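(* Let $d\in\{2,3\}$, $\Omega=\mathbb T^d$, $T>0$, and let $(\varrho,\mathbf u)$ be a weak solution of (gcNS) on $\mathbb T^d\times(0,T)$ with initial data $(\varrho_0,\varrho_0\mathbf u_0)$. Assume that there are constants $0<c_1\le c_2<\infty$ with $$c_1\le \varrho(x,t)\le c_2 \ \text{ a.e.},\qquad \mathbf u\in L^\infty(0,T;L^2(\mathbb T^d))\cap L^2(0,T;H^1(\mathbb T^d)).$$ If $d=2$, assume in addition that for some $\varepsilon>0$ $$\sup_{t\in(0,T)}\ \sup_{0<|h|<\varepsilon}|h|^{-1/2}\,\|\varrho(\cdot+h,t)-\varrho(\cdot,t)\|_{L^2(\mathbb T^2)}<\infty;$$ if $d=3$, assume in addition that $\mathbf u\in L^4(\mathbb T^3\times(0,T))$ and, for some $\varepsilon>0$, $$\sup_{t\in(0,T)}\ \sup_{0<|h|<\varepsilon}|h|^{-1/2}\,\|\varrho(\cdot+h,t)-\varrho(\cdot,t)\|_{L^{12/5}(\mathbb T^3)}<\infty.$$ Then for every $t\in(0,T)$, $$\int_{\mathbb T^d}\Big(\tfrac12\varrho|\mathbf u|^2+\mathcal P(\varrho)\Big)(x,t)\,dx+\int_0^t\!\!\int_{\mathbb T^d}\nu(\varrho)|\mathbb D\mathbf u|^2\,dx\,ds+\int_0^t\!\!\int_{\mathbb T^d}\mu(\varrho)|\nabla\cdot\mathbf u|^2\,dx\,ds=\int_{\mathbb T^d}\Big(\tfrac12\varrho_0|\mathbf u_0|^2+\mathcal P(\varrho_0)\Big)dx,$$ where $\mathcal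 P(\varrho)=\varrho\int_1^{\varrho}\frac{p(z)}{z^2}\,dz$.
   Context: Standing assumptions: $\nu,\mu:(0,\infty)\to[0,\infty)$ are continuous and $p\in C^2(0,\infty)$. $\mathbb D\mathbf u=\frac12(\nabla\mathbf u+\nabla^\top\mathbf u)$; for matrices $A:B=\sum_{i,j}A_{ij}B_{ij}$, $(\nabla\psi)_{ij}=\partial_j\psi_i$, $|\mathbb D\mathbf u|^2=\mathbb D\mathbf u:\mathbb D\mathbf u$. The system (gcNS) is $\partial_t\varrho+\nabla\cdot(\varrho\mathbf u)=0$, $\partial_t(\varrho\mathbf u)+\nabla\cdot(\varrho\mathbf u\otimes\mathbf u)+\nabla p(\varrho)-\nabla\cdot(\nu(\varrho)\mathbb D\mathbf u)-\nabla(\mu(\varrho)\nabla\cdot\mathbf u)=0$ in $\Omega\times(0,T)$. A weak solution with initial data $(\varrho_0,\varrho_0\mathbf u_0)$ is a pair of measurable functions $\varrho:\Omega\times(0,T)\to\mathbb R$, $\mathbf u:\Omega\times(0,T)\to\mathbb R^d$ such that $\varrho,\varrho\mathbf u,\varrho\mathbf u\otimes\mathbf u,p(\varrho),\nu(\varrho)\mathbb D\mathbf u,\mu(\varrho)\nabla\cdot\mathbf u\in L^1_{loc}(\Omega\times(0,T))$ and: (i) $\int_0^T\!\int_\Omega(\varrho\partial_t\varphi+\varrho\mathbf u\cdot\nabla\varphi)\,dx\,dt=0$ for all $\varphi\in C_c^\infty(\Omega\times(0,T))$; (ii) $\int_0^T\!\int_\Omega(\varrho\mathbf u\cdot\partial_t\psi+\varrho\mathbf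 u\otimes\mathbf u:\nabla\psi+p(\varrho)\nabla\cdot\psi-\nu(\varrho)\mathbb D\mathbf u:\nabla\psi-\mu(\varrho)(\nabla\cdot\mathbf u)(\nabla\cdot\psi))\,dx\,dt=0$ for all $\psi\in C_c^\infty(\Omega\times(0,T))^d$; (iii) $\lim_{t\to0}\int_\Omega\varrho(x,t)\varphi(x)\,dx=\int_\Omega\varrho_0\varphi\,dx$ for all $\varphi\in C_c^\infty(\Omega)$; (iv) $\lim_{t\to0}\int_\Omega(\varrho\mathbf u)(x,t)\cdot\psi(x)\,dx=\int_\Omega\varrho_0\mathbf u_0\cdot\psi\,dx$ for all $\psi\in C_c^\infty(\Omega)^d$.
   Formalization: The energy equality is proved for almost every t in (0,T) rather than every t, because a weak solution is only a pair of measurable functions and changing u on a single time slice keeps all hypotheses but alters the energy at that time. *)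

theory Defs
  imports "HOL-Analysis.Analysis"
begin

coinductive smooth_fun :: "('a::euclidean_space \<Rightarrow> real) \<Rightarrow> bool" where
  "(\<And>x. (f has_derivative f' x) (at x)) \<Longrightarrow> (\<And>v. smooth_fun (\<lambda>x. f' x v))
     \<Longrightarrow> smooth_fun f"

text \<open>Functions on the torus are represented as Z^d-periodic functions on R^d.\<close>
definition int_vec :: "real^'n \<Rightarrow> bool" where
  "int_vec v \<longleftrightarrow> (\<forall>i. v $ i \<in> \<int>)"

definition cell :: "(real^'n) set" where
  "cell = cbox 0 One"

definition cyl :: "real \<Rightarrow> real \<Rightarrow> ((real^'n) \<times> real) set" where
  "cyl a b = cell \<times> {a<..<b}"

definition periodic_st :: "((real^'n) \<times> real \<Rightarrow> 'b) \<Rightarrow> bool" where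
  "periodic_st f \<longleftrightarrow> (\<forall>x t v. int_vec v \<longrightarrow> f (x + v, t) = f (x, t))"

definition periodic_sp :: "(real^'n \<Rightarrow> 'b) \<Rightarrow> bool" where
  "periodic_sp f \<longleftrightarrow> (\<forall>x v. int_vec v \<longrightarrow> f (x + v) = f x)"

definition test_fun :: "real \<Rightarrow> ((real^'n) \<times> real \<Rightarrow> real) \<Rightarrow> bool" where
  "test_fun T \<phi> \<longleftrightarrow> smooth_fun \<phi> \<and> periodic_st \<phi> \<and>
     (\<exists>a b. 0 < a \<and> a < b \<and> b < T \<and> (\<forall>x t. t \<notin> {a..b} \<longrightarrow> \<phi> (x, t) = 0))"

definition vtest_fun :: "real \<Rightarrow> ((real^'n) \<times> real \<Rightarrow> real^'n) \<Rightarrow> bool" where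
  "vtest_fun T \<psi> \<longleftrightarrow> (\<forall>i. test_fun T (\<lambda>z. \<psi> z $ i))"

definition sp_test_fun :: "(real^'n \<Rightarrow> real) \<Rightarrow> bool" where
  "sp_test_fun \<phi> \<longleftrightarrow> smooth_fun \<phi> \<and> periodic_sp \<phi>"

definition sp_vtest_fun :: "(real^'n \<Rightarrow> real^'n) \<Rightarrow> bool" where
  "sp_vtest_fun \<psi> \<longleftrightarrow> (\<forall>i. sp_test_fun (\<lambda>x. \<psi> x $ i))"

definition dt :: "((real^'n) \<times> real \<Rightarrow> real) \<Rightarrow> (real^'n) \<times> real \<Rightarrow> real" where
  "dt \<phi> z = deriv (\<lambda>s. \<phi> (fst z, s)) (snd z)"

definition dx :: "'n \<Rightarrow> ((real^'n) \<times> real \<Rightarrow> real) \<Rightarrow> (real^'n) \<times> real \<Rightarrow> real" where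
  "dx j \<phi> z = deriv (\<lambda>r. \<phi> (fst z + r *\<^sub>R axis j 1, snd z)) 0"

definition grad :: "((real^'n) \<times> real \<Rightarrow> real) \<Rightarrow> (real^'n) \<times> real \<Rightarrow> real^'n" where
  "grad \<phi> z = (\<chi> j. dx j \<phi> z)"

definition jac :: "((real^'n) \<times> real \<Rightarrow> real^'n) \<Rightarrow> (real^'n) \<times> real \<Rightarrow> real^'n^'n" where
  "jac \<psi> z = (\<chi> i j. dx j (\<lambda>w. \<psi> w $ i) z)"

definition vdt :: "((real^'n) \<times> real \<Rightarrow> real^'n) \<Rightarrow> (real^'n) \<times> real \<Rightarrow> real^'n" where
  "vdt \<psi> z = (\<chi> i. dt (\<lambda>w. \<psi> w $ i) z)"

definition dvg :: "((real^'n) \<times> real \<Rightarrow> real^'n) \<Rightarrow> (real^'n) \<times> real \<Rightarrow> real" where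
  "dvg \<psi> z = (\<Sum>i\<in>UNIV. dx i (\<lambda>w. \<psi> w $ i) z)"

definition frob :: "real^'n^'n \<Rightarrow> real^'n^'n \<Rightarrow> real" where
  "frob A B = (\<Sum>i\<in>UNIV. \<Sum>j\<in>UNIV. A $ i $ j * B $ i $ j)"

definition trace_m :: "real^'n^'n \<Rightarrow> real" where
  "trace_m A = (\<Sum>i\<in>UNIV. A $ i $ i)"

definition sym_part :: "real^'n^'n \<Rightarrow> real^'n^'n" where
  "sym_part A = (1/2) *\<^sub>R (A + transpose A)"

definition tensor :: "real^'n \<Rightarrow> real^'n \<Rightarrow> real^'n^'n" where
  "tensor a b = (\<chi> i j. a $ i * b $ j)"

definition L1loc :: "real \<Rightarrow> ((real^'n) \<times> real \<Rightarrow> 'b::{banach,second_countable_topology}) \<Rightarrow> bool" where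
  "L1loc T f \<longleftrightarrow> (\<forall>a b. 0 < a \<longrightarrow> a < b \<longrightarrow> b < T \<longrightarrow>
      integrable (lebesgue_on (cell \<times> {a..b})) f)"

definition weak_grad :: "real \<Rightarrow> ((real^'n) \<times> real \<Rightarrow> real^'n) \<Rightarrow> ((real^'n) \<times> real \<Rightarrow> real^'n^'n) \<Rightarrow> bool" where
  "weak_grad T g Dg \<longleftrightarrow> L1loc T g \<and> L1loc T Dg \<and>
     (\<forall>\<phi> i j. test_fun T \<phi> \<longrightarrow>
        integral\<^sup>L (lebesgue_on (cyl 0 T)) (\<lambda>z. g z $ i * dx j \<phi> z)
        = - integral\<^sup>L (lebesgue_on (cyl 0 T)) (\<lambda>z. Dg z $ i $ j * \<phi> z))"

definition L2_st :: "real \<Rightarrow> ((real^'n) \<times> real \<Rightarrow> 'b::{banach,second_countable_topology}) \<Rightarrow> bool" where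
  "L2_st T f \<longleftrightarrow> f \<in> borel_measurable (lebesgue_on (cyl 0 T)) \<and>
     integrable (lebesgue_on (cyl 0 T)) (\<lambda>z. norm (f z) ^ 2)"

definition Linf_L2 :: "real \<Rightarrow> ((real^'n) \<times> real \<Rightarrow> real^'n) \<Rightarrow> bool" where
  "Linf_L2 T f \<longleftrightarrow> f \<in> borel_measurable (lebesgue_on (cyl 0 T)) \<and>
     (\<exists>C::real. AE t in lebesgue_on {0<..<T}.
        (\<integral>\<^sup>+x. ennreal (norm (f (x, t)) ^ 2) \<partial>lebesgue_on cell) \<le> ennreal C)"

definition half_holder :: "real \<Rightarrow> real \<Rightarrow> ((real^'n) \<times> real \<Rightarrow> real) \<Rightarrow> bool" where
  "half_holder q T r \<longleftrightarrow> (\<exists>\<epsilon>>0. \<exists>C::real. \<forall>t\<in>{0<..<T}. \<forall>h::real^'n.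
      0 < norm h \<and> norm h < \<epsilon> \<longrightarrow>
      (\<integral>\<^sup>+x. ennreal (\<bar>r (x + h, t) - r (x, t)\<bar> powr q) \<partial>lebesgue_on cell)
        \<le> ennreal (C * norm h powr (q / 2)))"

definition C2_on :: "real set \<Rightarrow> (real \<Rightarrow> real) \<Rightarrow> bool" where
  "C2_on S p \<longleftrightarrow> (\<exists>p1 p2. (\<forall>z\<in>S. (p has_real_derivative p1 z) (at z) \<and>
      (p1 has_real_derivative p2 z) (at z)) \<and> continuous_on S p2)"

definition Ppot :: "(real \<Rightarrow> real) \<Rightarrow> real \<Rightarrow> real" where
  "Ppot p r = r * (LBINT z=ereal 1..ereal r. p z / z^2)"

definition weak_solution ::
  "(real \<Rightarrow> real) \<Rightarrow> (real \<Rightarrow> real) \<Rightarrow> (real \<Rightarrow> real) \<Rightarrow> real \<Rightarrow>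
   (real^'n \<Rightarrow> real) \<Rightarrow> (real^'n \<Rightarrow> real^'n) \<Rightarrow>
   ((real^'n) \<times> real \<Rightarrow> real) \<Rightarrow> ((real^'n) \<times> real \<Rightarrow> real^'n) \<Rightarrow>
   ((real^'n) \<times> real \<Rightarrow> real^'n^'n) \<Rightarrow> bool" where
  "weak_solution p \<nu> \<mu> T \<rho>0 u0 \<rho> u Du \<longleftrightarrow>
     periodic_st \<rho> \<and> periodic_st u \<and> periodic_sp \<rho>0 \<and> periodic_sp u0 \<and>
     \<rho> \<in> borel_measurable (lebesgue_on (cyl 0 T)) \<and>
     u \<in> borel_measurable (lebesgue_on (cyl 0 T)) \<and>
     integrable (lebesgue_on cell) \<rho>0 \<and>
     integrable (lebesgue_on cell) (\<lambda>x. \<rho>0 x *\<^sub>R u0 x) \<and>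
     weak_grad T u Du \<and>
     L1loc T \<rho> \<and> L1loc T (\<lambda>z. \<rho> z *\<^sub>R u z) \<and> L1loc T (\<lambda>z. \<rho> z *\<^sub>R tensor (u z) (u z)) \<and>
     L1loc T (\<lambda>z. p (\<rho> z)) \<and> L1loc T (\<lambda>z. \<nu> (\<rho> z) *\<^sub>R sym_part (Du z)) \<and>
     L1loc T (\<lambda>z. \<mu> (\<rho> z) * trace_m (Du z)) \<and>
     (\<forall>\<phi>. test_fun T \<phi> \<longrightarrow>
        integral\<^sup>L (lebesgue_on (cyl 0 T))
          (\<lambda>z. \<rho> z * dt \<phi> z + \<rho> z * (u z \<bullet> grad \<phi> z)) = 0) \<and>
     (\<forall>\<psi>. vtest_fun T \<psi> \<longrightarrow>
        integral\<^sup>L (lebesgue_on (cyl 0 T))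
          (\<lambda>z. \<rho> z * (u z \<bullet> vdt \<psi> z) + \<rho> z * frob (tensor (u z) (u z)) (jac \<psi> z)
             + p (\<rho> z) * dvg \<psi> z - \<nu> (\<rho> z) * frob (sym_part (Du z)) (jac \<psi> z)
             - \<mu> (\<rho> z) * trace_m (Du z) * dvg \<psi> z) = 0) \<and>
     (\<forall>\<phi>. sp_test_fun \<phi> \<longrightarrow>
        ((\<lambda>t. integral\<^sup>L (lebesgue_on cell) (\<lambda>x. \<rho> (x, t) * \<phi> x))
          \<longlongrightarrow> integral\<^sup>L (lebesgue_on cell) (\<lambda>x. \<rho>0 x * \<phi> x)) (at_right 0)) \<and>
     (\<forall>\<psi>. sp_vtest_fun \<psi> \<longrightarrow>
        ((\<lambda>t. integral\<^sup>L (lebesgue_on cell) (\<lambda>x. \<rho> (x, t) * (u (x, t) \<bullet> \<psi> x)))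
          \<longlongrightarrow> integral\<^sup>L (lebesgue_on cell) (\<lambda>x. \<rho>0 x * (u0 x \<bullet> \<psi> x))) (at_right 0))"

end

theory Submission
  imports Defs
begin

text \<open>
  Mollify in space only, with a nonnegative trigonometric kernel: put \<open>R = S n \<rho>\<close>, \<open>M = S n (\<rho> u)\<close> and
  \<open>V = M / R\<close>. For every fixed \<open>x\<close> the equations turn \<open>R\<close> and \<open>M\<close> into absolutely continuous functions of time,
  so the chain rule applies to the convex energy \<open>|M|\<^sup>2 / (2 R) + P(R)\<close>; no commutator with the time derivative
  appears. After integration over \<open>x\<close> the remaining error is the flux defect \<open>S n (\<rho> u \<otimes> u) - M \<otimes> M / R\<close>
  tested against the gradient of \<open>V\<close>. The defect tends to zero in \<open>L\<^sup>2\<close> because \<open>u \<in> L\<^sup>4\<close> in space-time, which in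
  dimension two follows from Ladyzhenskaya's inequality. The gradient of \<open>V\<close> is bounded in \<open>L\<^sup>2\<close> uniformly
  in \<open>n\<close>, although the gradient of \<open>R\<close> is not: \<open>V(x)\<close> is the mean of \<open>u\<close> for the weight \<open>K(x - y) \<rho>(y)\<close>,
  so that \<open>R \<partial>\<^sub>jV (x)\<close> is the integral of \<open>\<partial>\<^sub>jK(x - y) \<rho>(y) (u(y) - V(x))\<close>, which the minimality of the mean
  and a Fisher-type bound on \<open>(\<partial>\<^sub>jK)\<^sup>2 / K\<close> control by the gradient of \<open>u\<close>.
\<close>

section \<open>The unit cell as a probability space\<close>

text \<open>Powers of cosines are chosen because integration by parts gives every moment that occurs
  in closed form. The second moment of \<open>ker n\<close>, measured by a squared sine, is
  \<open>1 / (2 n + 4)\<close>; the Fisher integral of \<open>dker n j\<close> is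
  \<open>(2 pi (n + 1))^2 / (2 n + 1)\<close>. One decays as fast as the other grows, and this
  cancellation is what makes the gradient bound for \<open>V\<close> uniform in \<open>n\<close>. In
  the limit of the energy flux two modes of convergence meet. The gradient of \<open>V\<close>
  converges only weakly in \<open>L2\<close>, so the flux has to converge strongly. Its defect is
  easily seen to vanish in \<open>L1\<close>; the pointwise majorant \<open>S n (r q)\<close> with
  \<open>q\<close> the squared speed, itself strongly convergent in \<open>L2\<close>, raises this
  to \<open>L2\<close>. The initial data are known only through limits against test functions and as
  integrable functions. Testing with the kernel identifies the initial value of each averaged curve;
  the bounds of the initial density and the square integrability of the initial momentum follow by
  letting \<open>t\<close> tend to 0 at fixed \<open>n\<close>, and then \<open>n\<close> to
  infinity.\<close>

definition torus :: "(real^'n) measure" where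
  "torus = density lborel (indicator cell)"

lemma sets_torus [measurable_cong, simp]: "sets torus = sets borel"
  by (simp add: torus_def)

lemma space_torus [simp]: "space torus = UNIV"
  by (simp add: torus_def)

lemma cell_borel [measurable, simp]: "cell \<in> sets borel"
  by (simp add: cell_def)

lemma One_nth [simp]: "(One :: real^'n) $ i = 1"
proof -
  have "(One :: real^'n) \<bullet> axis i 1 = 1"
    by (rule inner_sum_Basis) simp
  then show ?thesis by (simp add: cart_eq_inner_axis)
qed

lemma sum_Basis_nth [simp]: "(\<Sum>b\<in>(Basis :: (real^'n) set). b $ i) = 1"
  using One_nth[of i] by (simp del: One_nth)

lemma mem_cell: "x \<in> cell \<longleftrightarrow> (\<forall>i. 0 \<le> x $ i \<and> x $ i \<le> 1)" for x :: "real^'n"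
  by (simp add: cell_def mem_box_cart)

lemma nn_integral_torus: "f \<in> borel_measurable borel \<Longrightarrow>
  (\<integral>\<^sup>+x. f x \<partial>torus) = (\<integral>\<^sup>+x. indicator cell x * f x \<partial>lborel)"
  by (simp add: torus_def nn_integral_density)

lemma integral_torus: "f \<in> borel_measurable borel \<Longrightarrow>
  integral\<^sup>L torus f = (LINT x|lborel. indicat_real cell x * (f x :: real))"
  unfolding torus_def using integral_density[of f lborel "indicat_real cell"]
  by (simp add: ennreal_indicator)

lemma AE_torus: "(AE x in torus. P x) \<longleftrightarrow> (AE x in lborel. x \<in> cell \<longrightarrow> P x)"
  unfolding torus_def by (subst AE_density) (auto simp: indicator_def)

lemma prob_space_torus: "emeasure torus (UNIV :: (real^'n) set) = 1"
proof -
  have "emeasure torus (UNIV :: (real^'n) set) = emeasure lborel (cell :: (real^'n) set)"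
    by (simp add: torus_def emeasure_density)
  also have "\<dots> = 1"
    unfolding cell_def by (subst emeasure_lborel_cbox) auto
  finally show ?thesis .
qed

interpretation torus: finite_measure "torus :: (real^'n) measure"
  by standard (simp add: prob_space_torus)

text \<open>Half-open, so that the integer translates are disjoint and cover the whole space; the
  closed \<open>cell\<close> differs from it by a null set.\<close>

definition qcell :: "(real^'n) set" where
  "qcell = {x. \<forall>i. 0 \<le> x $ i \<and> x $ i < 1}"

lemma qcell_borel [measurable, simp]: "qcell \<in> sets (borel :: (real^'n) measure)"
proof -
  have "qcell = {x \<in> space (borel :: (real^'n) measure). \<forall>i. 0 \<le> x $ i \<and> x $ i < 1}"
    by (simp add: qcell_def)
  also have "\<dots> \<in> sets borel" by measurable
  finally show ?thesis .
qed

lemma AE_cell_qcell: "AE x in (lborel :: (real^'n) measure). x \<in> cell \<longleftrightarrow> x \<in> qcell"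
proof -
  have "negligible ((cbox 0 One :: (real^'n) set) - box 0 One)"
    using negligible_frontier_interval .
  then have "AE x in lebesgue. x \<notin> (cbox 0 One :: (real^'n) set) - box 0 One"
    unfolding negligible_iff_null_sets by (rule AE_not_in)
  then have *: "AE x in lborel. x \<notin> (cbox 0 One :: (real^'n) set) - box 0 One"
    by (simp add: AE_completion_iff)
  show ?thesis
    using * by eventually_elim
      (simp add: qcell_def cell_def mem_box_cart, meson less_imp_le)
qed

lemma countable_int_vec: "countable {k :: real^'n. int_vec k}"
proof -
  have "{k :: real^'n. int_vec k} \<subseteq> (\<lambda>f. \<chi> i. of_int (f i)) ` (Pi\<^sub>E UNIV (\<lambda>_. UNIV :: int set))"
  proof
    fix k :: "real^'n" assume "k \<in> {k. int_vec k}"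
    then have "\<forall>i. \<exists>z::int. k $ i = of_int z" by (auto simp: int_vec_def Ints_def)
    then obtain f where "\<forall>i. k $ i = of_int (f i :: int)" by metis
    then have "k = (\<chi> i. of_int (f i))" by (simp add: vec_eq_iff)
    then show "k \<in> (\<lambda>f. \<chi> i. of_int (f i)) ` (Pi\<^sub>E UNIV (\<lambda>_. UNIV :: int set))" by auto
  qed
  moreover have "countable (Pi\<^sub>E (UNIV::'n set) (\<lambda>_. UNIV :: int set))"
    by (rule countable_PiE) auto
  ultimately show ?thesis by (meson countable_image countable_subset)
qed

text \<open>Needed for \<open>ivec\<close>: \<open>from_nat_into\<close> is a bijection from the
  naturals only onto an infinite countable set.\<close>

lemma infinite_int_vec: "infinite {k :: real^'n. int_vec k}"
proof -
  have "inj (\<lambda>m::nat. (\<chi> i. real m) :: real^'n)"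
    by (auto simp: inj_on_def vec_eq_iff)
  moreover have "range (\<lambda>m::nat. (\<chi> i. real m) :: real^'n) \<subseteq> {k. int_vec k}"
    by (auto simp: int_vec_def)
  ultimately show ?thesis
    by (meson finite_subset infinite_UNIV_char_0 range_inj_infinite)
qed

definition ivec :: "nat \<Rightarrow> real^'n" where
  "ivec = from_nat_into {k. int_vec k}"

lemma bij_ivec: "bij_betw ivec UNIV {k :: real^'n. int_vec k}"
  unfolding ivec_def by (intro bij_betw_from_nat_into countable_int_vec infinite_int_vec)

lemma int_vec_ivec: "int_vec (ivec m)"
  using bij_ivec by (auto simp: bij_betw_def)

text \<open>The floor vector of \<open>x\<close> names the one tile that contains \<open>x\<close>.
  The enumeration \<open>e\<close> is left arbitrary because the unfolding argument sums over the
  lattice and also over its reflection.\<close>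

lemma suminf_indicator_tiles:
  fixes e :: "nat \<Rightarrow> real^'n"
  assumes bij: "bij_betw e UNIV {k. int_vec k}"
  shows "(\<Sum>m. indicator qcell (x - e m) :: ennreal) = 1"
proof -
  have iv: "int_vec (e m)" for m using bij by (auto simp: bij_betw_def)
  define A where "A = (\<lambda>m. {y :: real^'n. y - e m \<in> qcell})"
  have "disjoint_family A"
    unfolding disjoint_family_on_def
  proof (intro ballI impI)
    fix m m' :: nat assume "m \<noteq> m'"
    then have ne: "e m \<noteq> e m'"
      using bij unfolding bij_betw_def inj_on_def by blast
    show "A m \<inter> A m' = {}"
    proof (rule ccontr)
      assume "A m \<inter> A m' \<noteq> {}"
      then obtain y where y: "y - e m \<in> qcell" "y - e m' \<in> qcell" by (auto simp: A_def)
      have "e m $ i = e m' $ i" for i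
      proof -
        obtain a b :: int where ab: "e m $ i = of_int a" "e m' $ i = of_int b"
          using iv[of m] iv[of m'] unfolding int_vec_def by (metis Ints_cases)
        have "0 \<le> y $ i - a" "y $ i - a < 1" "0 \<le> y $ i - b" "y $ i - b < 1"
          using y ab unfolding qcell_def by (smt (verit, best) mem_Collect_eq vector_minus_component)+
        then have "a = b" by linarith
        then show ?thesis using ab by simp
      qed
      with ne show False by (simp add: vec_eq_iff)
    qed
  qed
  moreover have "x \<in> (\<Union>m. A m)"
  proof -
    define k where "k = (\<chi> i. of_int \<lfloor>x $ i\<rfloor> :: real^'n)"
    have "int_vec k" by (simp add: k_def int_vec_def)
    then obtain m where "e m = k" using bij unfolding bij_betw_def by (metis mem_Collect_eq rangeE)
    then have "x \<in> A m" by (simp add: A_def k_def qcell_def) linarith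
    then show ?thesis by blast
  qed
  ultimately have "(\<Sum>m. indicator (A m) x :: ennreal) = 1"
    by (subst suminf_indicator) auto
  moreover have "indicator (A m) x = (indicator qcell (x - e m) :: ennreal)" for m
    by (auto simp: A_def indicator_def)
  ultimately show ?thesis by simp
qed

lemma tiles:
  fixes x :: "real^'n"
  shows "(\<Sum>m. indicator qcell (x - ivec m) :: ennreal) = 1"
    and "(\<Sum>m. indicator qcell (x + ivec m) :: ennreal) = 1"
proof -
  show "(\<Sum>m. indicator qcell (x - ivec m) :: ennreal) = 1"
    by (rule suminf_indicator_tiles[OF bij_ivec])
  have "bij_betw uminus {k :: real^'n. int_vec k} {k. int_vec k}"
    by (rule bij_betwI[where g = uminus]) (auto simp: int_vec_def)
  from bij_betw_trans[OF bij_ivec this]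
  have "bij_betw (\<lambda>m. - ivec m) UNIV {k :: real^'n. int_vec k}"
    by (simp add: o_def)
  from suminf_indicator_tiles[OF this]
  show "(\<Sum>m. indicator qcell (x + ivec m) :: ennreal) = 1" by simp
qed

lemma nn_integral_lborel_shift:
  fixes a :: "'a::euclidean_space"
  assumes [measurable]: "f \<in> borel_measurable borel"
  shows "(\<integral>\<^sup>+x. f (x + a) \<partial>lborel) = (\<integral>\<^sup>+x. f x \<partial>lborel)"
proof -
  have "(\<integral>\<^sup>+x. f x \<partial>lborel) = (\<integral>\<^sup>+x. f x \<partial>distr lborel borel ((+) a))"
    by (simp add: lborel_distr_plus)
  also have "\<dots> = (\<integral>\<^sup>+x. f (x + a) \<partial>lborel)"
    by (subst nn_integral_distr) (auto simp: add.commute)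
  finally show ?thesis by simp
qed

lemma periodic_sp_minus: "periodic_sp f \<Longrightarrow> int_vec k \<Longrightarrow> f (x - k) = f x"
  unfolding periodic_sp_def by (metis add.commute diff_add_cancel)

text \<open>Unfolding: the shifted cell is cut along the integer lattice, each piece is carried back
  into \<open>qcell\<close> by periodicity, and the pieces reassemble there. Nonnegative integrands
  make every exchange of sum and integral legitimate.\<close>

lemma nn_integral_torus_shift:
  fixes f :: "real^'n \<Rightarrow> ennreal"
  assumes [measurable]: "f \<in> borel_measurable borel" and per: "periodic_sp f"
  shows "(\<integral>\<^sup>+x. f (x + a) \<partial>torus) = (\<integral>\<^sup>+x. f x \<partial>torus)"
proof -
  have q: "(\<integral>\<^sup>+x. g x \<partial>torus) = (\<integral>\<^sup>+x. indicator qcell x * g x \<partial>lborel)"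
    if [measurable]: "g \<in> borel_measurable borel" for g :: "real^'n \<Rightarrow> ennreal"
    unfolding nn_integral_torus[OF that]
    by (rule nn_integral_cong_AE) (use AE_cell_qcell in eventually_elim, auto simp: indicator_def)
  have "(\<integral>\<^sup>+x. f (x + a) \<partial>torus) = (\<integral>\<^sup>+x. indicator qcell x * f (x + a) \<partial>lborel)"
    by (rule q) measurable
  also have "\<dots> = (\<integral>\<^sup>+x. indicator qcell ((x + a) - a) * f (x + a) \<partial>lborel)" by simp
  also have "\<dots> = (\<integral>\<^sup>+x. indicator qcell (x - a) * f x \<partial>lborel)"
    by (rule nn_integral_lborel_shift[where f = "\<lambda>x. indicator qcell (x - a) * f x"]) measurable
  also have "\<dots> = (\<integral>\<^sup>+x. (\<Sum>m. indicator qcell (x - ivec m) * (indicator qcell (x - a) * f x)) \<partial>lborel)"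
    by (simp only: ennreal_suminf_multc tiles(1) mult_1)
  also have "\<dots> = (\<Sum>m. \<integral>\<^sup>+x. indicator qcell (x - ivec m) * (indicator qcell (x - a) * f x) \<partial>lborel)"
    by (rule nn_integral_suminf) measurable
  also have "\<dots> = (\<Sum>m. \<integral>\<^sup>+x. indicator qcell x * (indicator qcell ((x - a) + ivec m) * f x) \<partial>lborel)"
  proof (rule suminf_cong)
    fix m
    have "(\<integral>\<^sup>+x. indicator qcell (x - ivec m) * (indicator qcell (x - a) * f x) \<partial>lborel)
       = (\<integral>\<^sup>+x. indicator qcell ((x + ivec m) - ivec m) * (indicator qcell ((x + ivec m) - a) * f (x + ivec m)) \<partial>lborel)"
      by (rule nn_integral_lborel_shift[symmetric]) measurable
    also have "\<dots> = (\<integral>\<^sup>+x. indicator qcell x * (indicator qcell ((x - a) + ivec m) * f x) \<partial>lborel)"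
    proof (rule nn_integral_cong)
      fix x :: "real^'n"
      have 1: "f (x + ivec m) = f x" using per int_vec_ivec[of m] unfolding periodic_sp_def by blast
      have 2: "x + ivec m - ivec m = x" "x + ivec m - a = x - a + ivec m" by simp_all
      show "indicator qcell ((x + ivec m) - ivec m) * (indicator qcell ((x + ivec m) - a) * f (x + ivec m))
        = indicator qcell x * (indicator qcell ((x - a) + ivec m) * f x)"
        by (simp only: 1 2)
    qed
    finally show "(\<integral>\<^sup>+x. indicator qcell (x - ivec m) * (indicator qcell (x - a) * f x) \<partial>lborel) = \<dots>" .
  qed
  also have "\<dots> = (\<integral>\<^sup>+x. (\<Sum>m. indicator qcell x * (indicator qcell ((x - a) + ivec m) * f x)) \<partial>lborel)"
    by (rule nn_integral_suminf[symmetric]) measurable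
  also have "\<dots> = (\<integral>\<^sup>+x. indicator qcell x * f x \<partial>lborel)"
  proof (rule nn_integral_cong)
    fix x :: "real^'n"
    show "(\<Sum>m. indicator qcell x * (indicator qcell ((x - a) + ivec m) * f x)) = indicator qcell x * f x"
      by (simp only: ennreal_suminf_multc ennreal_suminf_cmult tiles(2) mult_1)
  qed
  also have "\<dots> = (\<integral>\<^sup>+x. f x \<partial>torus)" by (rule q[symmetric]) measurable
  finally show ?thesis .
qed

section \<open>Convolution and a trigonometric kernel\<close>

lemma periodic_bounded:
  fixes f :: "real^'n \<Rightarrow> real"
  assumes "continuous_on UNIV f" "periodic_sp f"
  obtains B where "0 \<le> B" "\<And>x. \<bar>f x\<bar> \<le> B"
proof -
  have "compact (f ` cell)"
    unfolding cell_def using assms(1) by (intro compact_continuous_image) (auto intro: continuous_on_subset)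
  then have "bounded (f ` cell)" by (rule compact_imp_bounded)
  then obtain B where B: "\<And>x. x \<in> cell \<Longrightarrow> \<bar>f x\<bar> \<le> B"
    by (auto simp: bounded_iff)
  have "\<bar>f x\<bar> \<le> B" for x
  proof -
    define k where "k = (\<chi> i. of_int \<lfloor>x $ i\<rfloor> :: real^'n)"
    have k: "int_vec k" by (simp add: k_def int_vec_def)
    have "x - k \<in> cell" unfolding mem_cell k_def by (simp; linarith)
    then show ?thesis using B[of "x - k"] periodic_sp_minus[OF assms(2) k] by simp
  qed
  then have "\<bar>f x\<bar> \<le> max B 0" for x by (simp add: le_max_iff_disj)
  then show ?thesis using that[of "max B 0"] by simp
qed

lemma borel_cont: "continuous_on UNIV f \<Longrightarrow> f \<in> borel_measurable borel"
  by (rule borel_measurable_continuous_onI)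

lemma integrable_torus_bounded:
  fixes f :: "real^'n \<Rightarrow> real"
  assumes "f \<in> borel_measurable borel" "\<And>x. \<bar>f x\<bar> \<le> B"
  shows "integrable torus f"
  by (rule torus.integrable_const_bound[where B = B]) (use assms in auto)

lemma integrable_torus_periodic:
  fixes f :: "real^'n \<Rightarrow> real"
  assumes "continuous_on UNIV f" "periodic_sp f"
  shows "integrable torus f"
  by (rule periodic_bounded[OF assms]) (auto intro: integrable_torus_bounded borel_cont assms)

lemma periodic_sp_shift: "periodic_sp f \<Longrightarrow> periodic_sp (\<lambda>x. f (x + a))"
  unfolding periodic_sp_def by (metis add.assoc add.commute)

lemma integral_torus_shift:
  fixes f :: "real^'n \<Rightarrow> real"
  assumes c: "continuous_on UNIV f" and p: "periodic_sp f"
  shows "(LINT x|torus. f (x + a)) = integral\<^sup>L torus f"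
proof -
  have [measurable]: "f \<in> borel_measurable borel" using borel_cont[OF c] .
  have c': "continuous_on UNIV (\<lambda>x. f (x + a))"
    by (intro continuous_on_compose2[OF c] continuous_intros) auto
  have i: "integrable torus f" "integrable torus (\<lambda>x. f (x + a))"
    using integrable_torus_periodic[OF c p] integrable_torus_periodic[OF c' periodic_sp_shift[OF p]] by auto
  have "(\<integral>\<^sup>+x. ennreal (f (x + a)) \<partial>torus) = (\<integral>\<^sup>+x. ennreal (f x) \<partial>torus)"
    "(\<integral>\<^sup>+x. ennreal (- f (x + a)) \<partial>torus) = (\<integral>\<^sup>+x. ennreal (- f x) \<partial>torus)"
    using p by (intro nn_integral_torus_shift[where f = "\<lambda>x. ennreal (f x)"]
        nn_integral_torus_shift[where f = "\<lambda>x. ennreal (- f x)"]; simp add: periodic_sp_def)+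
  then show ?thesis
    by (simp add: real_lebesgue_integral_def[OF i(1)] real_lebesgue_integral_def[OF i(2)])
qed

section \<open>Partial derivatives of periodic functions\<close>

definition pd :: "'n \<Rightarrow> (real^'n \<Rightarrow> real) \<Rightarrow> (real^'n \<Rightarrow> real) \<Rightarrow> bool" where
  "pd j F F' \<longleftrightarrow> periodic_sp F \<and> continuous_on UNIV F \<and> continuous_on UNIV F' \<and>
     (\<forall>x. ((\<lambda>s. F (x + s *\<^sub>R axis j 1)) has_real_derivative F' x) (at 0))"

lemma pd_cont: "pd j F F' \<Longrightarrow> continuous_on UNIV F" "pd j F F' \<Longrightarrow> continuous_on UNIV F'"
  and pd_periodic: "pd j F F' \<Longrightarrow> periodic_sp F"
  by (auto simp: pd_def)

text \<open>Uniqueness of the derivative: \<open>F\<close> has the same restriction to the axis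
  through \<open>x\<close> and to the axis through \<open>x + v\<close>. This is why
  \<open>pd\<close> asks for periodicity of \<open>F\<close> alone.\<close>

lemma pd_periodic': "pd (j::'n::finite) F F' \<Longrightarrow> periodic_sp F'"
  unfolding periodic_sp_def
proof (intro allI impI)
  fix x v :: "real^'n" assume pd: "pd j F F'" and v: "int_vec v"
  have "((\<lambda>s. F (x + v + s *\<^sub>R axis j 1)) has_real_derivative F' (x + v)) (at 0)"
    using pd by (auto simp: pd_def)
  also have "(\<lambda>s. F (x + v + s *\<^sub>R axis j 1)) = (\<lambda>s. F (x + s *\<^sub>R axis j 1))"
  proof (rule ext)
    fix s
    have "F ((x + s *\<^sub>R axis j 1) + v) = F (x + s *\<^sub>R axis j 1)"
      using pd_periodic[OF pd] v unfolding periodic_sp_def by blast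
    then show "F (x + v + s *\<^sub>R axis j 1) = F (x + s *\<^sub>R axis j 1)" by (simp add: ac_simps)
  qed
  finally show "F' (x + v) = F' x"
    using pd DERIV_unique unfolding pd_def by blast
qed

lemma pd_deriv:
  assumes "pd j F F'"
  shows "((\<lambda>s. F (x + s *\<^sub>R axis j 1)) has_real_derivative F' (x + t *\<^sub>R axis j 1)) (at t)"
proof -
  have "((\<lambda>s. F ((x + t *\<^sub>R axis j 1) + s *\<^sub>R axis j 1)) has_real_derivative F' (x + t *\<^sub>R axis j 1)) (at 0)"
    using assms unfolding pd_def by blast
  then have "((\<lambda>s. F (x + (s + t) *\<^sub>R axis j 1)) has_real_derivative F' (x + t *\<^sub>R axis j 1)) (at 0)"
    by (simp add: algebra_simps)
  then show ?thesis
    using DERIV_shift[of "\<lambda>s. F (x + s *\<^sub>R axis j 1)" _ 0 t] by simp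
qed

lemma pd_Lipschitz:
  assumes pd: "pd j F F'" and B: "\<And>x. \<bar>F' x\<bar> \<le> B"
  shows "\<bar>F (x + h *\<^sub>R axis j 1) - F x\<bar> \<le> B * \<bar>h\<bar>"
proof -
  have "norm (F (x + h *\<^sub>R axis j 1) - F (x + 0 *\<^sub>R axis j 1)) \<le> B * norm (h - 0)"
    by (rule field_differentiable_bound[where S = UNIV and f = "\<lambda>s. F (x + s *\<^sub>R axis j 1)"
          and f' = "\<lambda>s. F' (x + s *\<^sub>R axis j 1)"])
       (use pd_deriv[OF pd] B in auto)
  then show ?thesis by simp
qed

lemma pd_diff_quot:
  assumes pd: "pd j F F'"
  shows "(\<lambda>m. (F (x + (1 / real (Suc m)) *\<^sub>R axis j 1) - F x) / (1 / real (Suc m))) \<longlonglongrightarrow> F' x"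
proof -
  have "((\<lambda>h. (F (x + (0 + h) *\<^sub>R axis j 1) - F (x + 0 *\<^sub>R axis j 1)) / h) \<longlongrightarrow> F' x) (at 0)"
    using pd unfolding pd_def DERIV_def by blast
  then have *: "((\<lambda>h. (F (x + h *\<^sub>R axis j 1) - F x) / h) \<longlongrightarrow> F' x) (at 0)" by simp
  have "filterlim (\<lambda>m. 1 / real (Suc m)) (at 0) sequentially"
    unfolding filterlim_at using LIMSEQ_Suc[OF lim_1_over_n] by (auto simp: eventually_sequentially)
  from filterlim_compose[OF * this] show ?thesis .
qed

text \<open>Difference quotients have integral zero by translation invariance, and the Lipschitz
  bound dominates them in the limit. All integration by parts in space rests on this: the torus has
  no boundary.\<close>

lemma pd_integral_zero:
  assumes pd: "pd j F F'"
  shows "integral\<^sup>L torus F' = 0"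
proof -
  note c = pd_cont[OF pd]
  obtain B where B: "0 \<le> B" "\<And>x. \<bar>F' x\<bar> \<le> B"
    using periodic_bounded[OF c(2) pd_periodic'[OF pd]] by blast
  have [measurable]: "F \<in> borel_measurable borel" "F' \<in> borel_measurable borel"
    using c by (auto intro: borel_cont)
  define Q where "Q m x = (F (x + (1 / real (Suc m)) *\<^sub>R axis j 1) - F x) / (1 / real (Suc m))" for m x
  have [measurable]: "Q m \<in> borel_measurable borel" for m unfolding Q_def by measurable
  have "(\<lambda>m. integral\<^sup>L torus (Q m)) \<longlonglongrightarrow> integral\<^sup>L torus F'"
  proof (rule integral_dominated_convergence[where w = "\<lambda>_. B"])
    show "AE x in torus. (\<lambda>m. Q m x) \<longlonglongrightarrow> F' x"
      unfolding Q_def using pd_diff_quot[OF pd] by auto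
    show "AE x in torus. norm (Q m x) \<le> B" for m
    proof (rule AE_I2)
      fix x
      have "\<bar>F (x + (1 / real (Suc m)) *\<^sub>R axis j 1) - F x\<bar> \<le> B * \<bar>1 / real (Suc m)\<bar>"
        by (rule pd_Lipschitz[OF pd B(2)])
      then show "norm (Q m x) \<le> B" unfolding Q_def real_norm_def abs_divide
        by (subst pos_divide_le_eq) auto
    qed
  qed (auto simp: )
  moreover have "integral\<^sup>L torus (Q m) = 0" for m
  proof -
    have c': "continuous_on UNIV (\<lambda>x. F (x + (1 / real (Suc m)) *\<^sub>R axis j 1))"
      by (intro continuous_on_compose2[OF c(1)] continuous_intros) auto
    have i: "integrable torus F" "integrable torus (\<lambda>x. F (x + (1 / real (Suc m)) *\<^sub>R axis j 1))"
      using integrable_torus_periodic c c' pd_periodic[OF pd] periodic_sp_shift by blast+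
    show ?thesis unfolding Q_def
      using integral_torus_shift[OF c(1) pd_periodic[OF pd]] i by simp
  qed
  ultimately show ?thesis by (simp add: LIMSEQ_const_iff)
qed

lemma pd_const: "pd j (\<lambda>x. c) (\<lambda>x. 0)"
  by (auto simp: pd_def periodic_sp_def)

lemma pd_mult: "pd j F F' \<Longrightarrow> pd j G G' \<Longrightarrow> pd j (\<lambda>x. F x * G x) (\<lambda>x. F' x * G x + F x * G' x)"
  unfolding pd_def periodic_sp_def
  apply safe
     apply (simp; fail)
    apply (intro continuous_intros; assumption)
   apply (intro continuous_intros; assumption)
  apply (rule DERIV_mult[THEN DERIV_cong], blast, blast, simp)
  done

lemma pd_cmult: "pd j F F' \<Longrightarrow> pd j (\<lambda>x. c * F x) (\<lambda>x. c * F' x)"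
  using pd_mult[OF pd_const, of j F F' c] by simp

lemma pd_divide:
  assumes "pd j F F'" "pd j G G'" "\<And>x. G x \<noteq> 0"
  shows "pd j (\<lambda>x. F x / G x) (\<lambda>x. (F' x * G x - F x * G' x) / (G x * G x))"
  using assms unfolding pd_def periodic_sp_def
  apply safe
     apply (simp; fail)
    apply (intro continuous_intros; simp)
   apply (intro continuous_intros; simp)
  apply (rule DERIV_divide[THEN DERIV_cong], blast, blast, simp, simp)
  done

lemma pd_compose:
  assumes F: "pd j F F'" and g: "\<And>x. (g has_real_derivative g' (F x)) (at (F x))"
    and c: "continuous_on (range F) g'"
  shows "pd j (\<lambda>x. g (F x)) (\<lambda>x. g' (F x) * F' x)"
proof -
  have cg: "continuous_on (range F) g"
    using g by (auto intro!: continuous_at_imp_continuous_on DERIV_isCont)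
  have "continuous_on UNIV (\<lambda>x. g (F x))" "continuous_on UNIV (\<lambda>x. g' (F x))"
    using continuous_on_compose2[OF cg pd_cont(1)[OF F]] continuous_on_compose2[OF c pd_cont(1)[OF F]] by auto
  moreover have "((\<lambda>s. g (F (x + s *\<^sub>R axis j 1))) has_real_derivative g' (F x) * F' x) (at 0)" for x
    using DERIV_chain2[of g "g' (F x)" "\<lambda>s. F (x + s *\<^sub>R axis j 1)" 0 "F' x" UNIV] g F
    by (auto simp: pd_def)
  ultimately show ?thesis
    using F by (auto simp: pd_def periodic_sp_def intro!: continuous_intros)
qed

lemma pd_parts:
  assumes F: "pd j F F'" and G: "pd j G G'"
  shows "(LINT x|torus. F' x * G x) = - (LINT x|torus. F x * G' x)"
proof -
  have "integrable torus (\<lambda>x. F' x * G x)" "integrable torus (\<lambda>x. F x * G' x)"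
    using F G pd_periodic'[OF F] pd_periodic'[OF G]
    by (auto intro!: integrable_torus_periodic continuous_intros simp: pd_def periodic_sp_def)
  then show ?thesis
    using pd_integral_zero[OF pd_mult[OF F G]] by simp
qed

section \<open>Convolution against a periodic kernel\<close>

definition conv :: "(real^'n \<Rightarrow> real) \<Rightarrow> (real^'n \<Rightarrow> real) \<Rightarrow> real^'n \<Rightarrow> real" where
  "conv k f x = (LINT z|torus. k (x - z) * f z)"

lemma conv_integrable:
  fixes k :: "real^'n \<Rightarrow> real"
  assumes k: "continuous_on UNIV k" "periodic_sp k" and f: "integrable torus f"
  shows "integrable torus (\<lambda>z. k (x - z) * f z)"
proof -
  obtain B where B: "0 \<le> B" "\<And>x. \<bar>k x\<bar> \<le> B"
    using periodic_bounded[OF k] by blast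
  have [measurable]: "k \<in> borel_measurable borel" using k by (auto intro: borel_cont)
  have [measurable]: "f \<in> borel_measurable borel" using borel_measurable_integrable[OF f] by simp
  show ?thesis
    by (rule Bochner_Integration.integrable_bound[where f = "\<lambda>z. B * f z"])
       (use f B in \<open>auto simp: abs_mult intro!: mult_right_mono\<close>)
qed

text \<open>Dominated convergence for bounded kernels, used once for translates of \<open>k\<close>
  (continuity) and once for its difference quotients (differentiability).\<close>

lemma conv_tendsto:
  fixes g0 :: "real^'n \<Rightarrow> real"
  assumes k: "\<And>m. (\<lambda>z. g m z) \<in> borel_measurable borel" "\<And>z. (\<lambda>m. g m z) \<longlonglongrightarrow> g0 z"
      "\<And>m z. \<bar>g m z\<bar> \<le> B"
    and f: "integrable torus f"
  shows "(\<lambda>m. integral\<^sup>L torus (\<lambda>z::real^'n. g m z * f z)) \<longlonglongrightarrow> (LINT z|torus. g0 z * f z)"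
proof -
  have [measurable]: "f \<in> borel_measurable borel" using borel_measurable_integrable[OF f] by simp
  note k(1)[measurable]
  have [measurable]: "g0 \<in> borel_measurable borel"
    by (rule borel_measurable_LIMSEQ_real[where u = g]) (use k in auto)
  show ?thesis
    by (rule integral_dominated_convergence[where w = "\<lambda>z. B * \<bar>f z\<bar>"])
       (use f k in \<open>auto simp: abs_mult intro!: mult_right_mono tendsto_intros\<close>)
qed

lemma conv_cont:
  fixes k :: "real^'n \<Rightarrow> real"
  assumes k: "continuous_on UNIV k" "periodic_sp k" and f: "integrable torus f"
  shows "continuous_on UNIV (conv k f)"
proof -
  obtain B where B: "0 \<le> B" "\<And>x. \<bar>k x\<bar> \<le> B"
    using periodic_bounded[OF k] by blast
  have [measurable]: "k \<in> borel_measurable borel" using k by (auto intro: borel_cont)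
  have "continuous (at x) (conv k f)" for x
    unfolding continuous_at_sequentially
  proof (intro allI impI)
    fix X :: "nat \<Rightarrow> real^'n" assume X: "X \<longlonglongrightarrow> x"
    have "(\<lambda>m. (LINT z|torus. k (X m - z) * f z)) \<longlonglongrightarrow> (LINT z|torus. k (x - z) * f z)"
    proof (rule conv_tendsto[OF _ _ _ f])
      show "(\<lambda>m. k (X m - z)) \<longlonglongrightarrow> k (x - z)" for z
        by (rule continuous_on_tendsto_compose[OF k(1)]) (auto intro!: tendsto_intros X)
    qed (use B in auto)
    then show "(conv k f \<circ> X) \<longlonglongrightarrow> conv k f x" by (simp add: o_def conv_def)
  qed
  then show ?thesis by (simp add: continuous_at_imp_continuous_on)
qed

text \<open>The variable \<open>x\<close> sits only in the kernel, so the derivative falls there and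
  \<open>f\<close> enters through its values on the cell alone.\<close>

lemma pd_conv:
  fixes k :: "real^'n \<Rightarrow> real"
  assumes k: "pd j k k'" and f: "integrable torus f"
  shows "pd j (conv k f) (conv k' f)"
  unfolding pd_def
proof (intro conjI allI)
  note c = pd_cont[OF k] and p = pd_periodic[OF k] pd_periodic'[OF k]
  show "continuous_on UNIV (conv k f)" "continuous_on UNIV (conv k' f)"
    using c p f by (auto intro: conv_cont)
  show "periodic_sp (conv k f)"
    unfolding periodic_sp_def conv_def
    by (intro allI impI Bochner_Integration.integral_cong refl)
       (metis (no_types) add_diff_eq diff_add_eq p(1) periodic_sp_def)
  obtain B where B: "0 \<le> B" "\<And>x. \<bar>k' x\<bar> \<le> B"
    using periodic_bounded[OF c(2) p(2)] by blast
  have [measurable]: "k \<in> borel_measurable borel" using c by (auto intro: borel_cont)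
  fix x
  show "((\<lambda>s. conv k f (x + s *\<^sub>R axis j 1)) has_real_derivative conv k' f x) (at 0)"
    unfolding DERIV_def tendsto_at_iff_sequentially
  proof (intro allI impI)
    fix X :: "nat \<Rightarrow> real" assume X: "\<forall>i. X i \<in> UNIV - {0}" "X \<longlonglongrightarrow> 0"
    have "(\<lambda>m. (LINT z|torus. (k (x - z + X m *\<^sub>R axis j 1) - k (x - z)) / X m * f z))
        \<longlonglongrightarrow> (LINT z|torus. k' (x - z) * f z)"
    proof (rule conv_tendsto[OF _ _ _ f])
      fix z
      have "((\<lambda>h. (k (x - z + (0 + h) *\<^sub>R axis j 1) - k (x - z + 0 *\<^sub>R axis j 1)) / h) \<longlongrightarrow> k' (x - z)) (at 0)"
        using k unfolding pd_def DERIV_def by blast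
      then show "(\<lambda>m. (k (x - z + X m *\<^sub>R axis j 1) - k (x - z)) / X m) \<longlonglongrightarrow> k' (x - z)"
        unfolding tendsto_at_iff_sequentially using X by (auto simp: o_def)
    next
      fix m z
      have "\<bar>k (x - z + X m *\<^sub>R axis j 1) - k (x - z)\<bar> \<le> B * \<bar>X m\<bar>"
        by (rule pd_Lipschitz[OF k B(2)])
      then show "\<bar>(k (x - z + X m *\<^sub>R axis j 1) - k (x - z)) / X m\<bar> \<le> B"
        using X(1) by (simp add: abs_divide pos_divide_le_eq)
    qed measurable
    moreover have "(LINT z|torus. (k (x - z + X m *\<^sub>R axis j 1) - k (x - z)) / X m * f z)
        = (conv k f (x + X m *\<^sub>R axis j 1) - conv k f x) / X m" for m
    proof -
      have "(LINT z|torus. (k (x - z + X m *\<^sub>R axis j 1) - k (x - z)) / X m * f z)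
        = (LINT z|torus. (k ((x + X m *\<^sub>R axis j 1) - z) * f z - k (x - z) * f z) / X m)"
        by (intro Bochner_Integration.integral_cong) (auto simp: algebra_simps diff_divide_distrib)
      also have "\<dots> = (conv k f (x + X m *\<^sub>R axis j 1) - conv k f x) / X m"
        unfolding conv_def using conv_integrable[OF c(1) p(1) f] by simp
      finally show ?thesis .
    qed
    ultimately have "(\<lambda>m. (conv k f (x + X m *\<^sub>R axis j 1) - conv k f x) / X m) \<longlonglongrightarrow> conv k' f x"
      by (simp only: conv_def)
    then show "((\<lambda>h. (conv k f (x + (0 + h) *\<^sub>R axis j 1) - conv k f (x + 0 *\<^sub>R axis j 1)) / h) \<circ> X)
       \<longlonglongrightarrow> conv k' f x"
      by (simp add: o_def)
  qed
qed

section \<open>A kernel made of cosine powers, and its moments\<close>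

definition csq :: "real \<Rightarrow> real" where "csq s = (cos (pi * s))\<^sup>2"
definition scs :: "real \<Rightarrow> real" where "scs s = sin (pi * s) * cos (pi * s)"

lemma csq_bounds: "0 \<le> csq s" "csq s \<le> 1"
  by (auto simp: csq_def abs_square_le_1)

lemma one_minus_csq: "1 - csq s = (sin (pi * s))\<^sup>2"
  by (simp add: csq_def sin_squared_eq)

text \<open>The derivative of \<open>csq\<close> is a multiple of \<open>scs\<close>; this identity
  makes squared derivatives polynomial in \<open>csq\<close>, hence reducible to moments.\<close>

lemma scs_squared: "(scs s)\<^sup>2 = csq s * (1 - csq s)"
  by (simp add: scs_def one_minus_csq power_mult_distrib) (simp add: csq_def)

lemma csq_scs_periodic:
  assumes "m \<in> \<int>"
  shows "csq (s + m) = csq s" "scs (s + m) = scs s"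
proof -
  have s: "sin (pi * m) = 0" using assms sin_times_pi_eq_0[of m] by (simp add: mult.commute)
  then have c: "cos (pi * m) * cos (pi * m) = 1" using sin_cos_squared_add[of "pi * m"] by (simp add: power2_eq_square)
  show "csq (s + m) = csq s"
    by (simp add: csq_def distrib_left cos_add s power_mult_distrib) (simp add: power2_eq_square c)
  have "scs (s + m) = scs s * (cos (pi * m) * cos (pi * m))"
    by (simp add: scs_def distrib_left cos_add sin_add s)
  then show "scs (s + m) = scs s" by (simp add: c)
qed

lemma csq_deriv: "(csq has_real_derivative - (2 * pi * scs s)) (at s within A)"
  unfolding csq_def scs_def by (auto intro!: derivative_eq_intros)

lemma scs_deriv: "(scs has_real_derivative pi * (2 * csq s - 1)) (at s within A)"
  unfolding csq_def scs_def
  by (auto intro!: derivative_eq_intros simp: algebra_simps power2_eq_square[symmetric] sin_squared_eq)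

lemma csq_scs_cont [continuous_intros]:
  assumes "continuous_on A f"
  shows "continuous_on A (\<lambda>x. csq (f x))" "continuous_on A (\<lambda>x. scs (f x))"
proof -
  have "continuous_on UNIV csq" "continuous_on UNIV scs"
    using csq_deriv scs_deriv by (auto intro!: continuous_at_imp_continuous_on DERIV_isCont)
  then show "continuous_on A (\<lambda>x. csq (f x))" "continuous_on A (\<lambda>x. scs (f x))"
    using assms continuous_on_compose2 by blast+
qed

text \<open>The factor of the kernel that is constant along axis \<open>j\<close>; it stays frozen
  while one-variable calculus is done in \<open>y $ j\<close>.\<close>

definition kfac :: "nat \<Rightarrow> 'n \<Rightarrow> real^'n \<Rightarrow> real" where
  "kfac n j y = (\<Prod>i\<in>UNIV - {j}. csq (y $ i) ^ Suc n)"

text \<open>With exponent \<open>Suc n\<close> a derivative along an axis still carries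
  \<open>csq ^ n\<close>, so that its square divided by the kernel is again a polynomial in the
  cosines.\<close>

definition ker0 :: "nat \<Rightarrow> real^'n \<Rightarrow> real" where
  "ker0 n y = (\<Prod>i\<in>UNIV. csq (y $ i) ^ Suc n)"

lemma ker0_split: "ker0 n y = csq (y $ j) ^ Suc n * kfac n j y"
  by (simp add: ker0_def kfac_def prod.remove[of UNIV j])

lemma ker0_nonneg: "0 \<le> ker0 n y" and kfac_nonneg: "0 \<le> kfac n j y"
  by (auto simp: ker0_def kfac_def csq_bounds intro!: prod_nonneg)

lemma pd_coord:
  fixes j :: "'n::finite"
  assumes g: "\<And>s. (g has_real_derivative g' s) (at s)" and c: "continuous_on UNIV g'"
    and p: "\<And>s m. m \<in> \<int> \<Longrightarrow> g (s + m) = g s"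
  shows "pd j (\<lambda>y. g (y $ j) * kfac n j y) (\<lambda>y. g' (y $ j) * kfac n j y)"
  unfolding pd_def
proof (intro conjI allI)
  have cg: "continuous_on UNIV g" using g by (auto intro!: continuous_at_imp_continuous_on DERIV_isCont)
  have ck: "continuous_on UNIV (kfac n j)"
    unfolding kfac_def by (intro continuous_intros)
  show "continuous_on UNIV (\<lambda>y. g (y $ j) * kfac n j y)" "continuous_on UNIV (\<lambda>y. g' (y $ j) * kfac n j y)"
    by (intro continuous_intros ck continuous_on_compose2[OF cg] continuous_on_compose2[OF c]; simp)+
  show "periodic_sp (\<lambda>y. g (y $ j) * kfac n j y)"
    by (auto simp: periodic_sp_def int_vec_def p kfac_def csq_scs_periodic)
  fix x :: "real^'n"
  have 1: "kfac n j (x + s *\<^sub>R axis j 1) = kfac n j x" for s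
    unfolding kfac_def by (intro prod.cong) (auto simp: axis_def)
  have 2: "((\<lambda>s. g (x $ j + s)) has_real_derivative g' (x $ j)) (at 0)"
    using DERIV_shift[of g "g' (x $ j)" 0 "x $ j"] g by (simp add: add.commute)
  show "((\<lambda>s. g ((x + s *\<^sub>R axis j 1) $ j) * kfac n j (x + s *\<^sub>R axis j 1)) has_real_derivative
       g' (x $ j) * kfac n j x) (at 0)"
    using DERIV_cmult_right[OF 2, of "kfac n j x"] by (simp add: 1)
qed

text \<open>A Wallis recursion: the derivative of \<open>scs * csq ^ m\<close> is a combination of
  \<open>csq ^ m\<close> and \<open>csq ^ Suc m\<close>, and its integral over a period
  vanishes.\<close>

lemma moment_rec:
  fixes j :: "'n::finite"
  shows "(2 * real m + 1) * (LINT y|torus. csq (y $ j) ^ m * kfac n j y)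
     = (2 * real m + 2) * (LINT y|torus. csq (y $ j) ^ Suc m * kfac n j y)"
proof -
  define g where "g = (\<lambda>s. scs s * csq s ^ m)"
  define g' where "g' = (\<lambda>s. pi * ((2 * real m + 2) * csq s ^ Suc m - (2 * real m + 1) * csq s ^ m))"
  have d: "(g has_real_derivative g' s) (at s)" for s
  proof -
    have "(g has_real_derivative pi * (2 * csq s - 1) * csq s ^ m
        + (real m * csq s ^ (m - 1) * (- (2 * pi * scs s))) * scs s) (at s)"
      unfolding g_def by (rule DERIV_cong[OF DERIV_mult[OF scs_deriv DERIV_power[OF csq_deriv]]]) simp
    moreover have "pi * (2 * csq s - 1) * csq s ^ m
        + (real m * csq s ^ (m - 1) * (- (2 * pi * scs s))) * scs s = g' s"
    \<comment> \<open>At \<open>m = 0\<close> the truncated difference \<open>m - 1\<close> is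
      harmless because of the factor \<open>real m\<close>; otherwise \<open>scs_squared\<close>
      restores the missing power.\<close>
    proof (cases m)
      case (Suc k)
      have "pi * (2 * csq s - 1) * csq s ^ m
        + (real m * csq s ^ (m - 1) * (- (2 * pi * scs s))) * scs s
        = pi * ((2 * csq s - 1) * csq s ^ m - 2 * real m * csq s ^ (m - 1) * (scs s)\<^sup>2)"
        by (simp add: algebra_simps power2_eq_square)
      also have "\<dots> = g' s" unfolding scs_squared g'_def Suc by (simp add: algebra_simps)
      finally show ?thesis .
    qed (simp add: g'_def algebra_simps)
    ultimately show ?thesis by simp
  qed
  have "pd j (\<lambda>y. g (y $ j) * kfac n j y) (\<lambda>y. g' (y $ j) * kfac n j y)"
    by (rule pd_coord[OF d]) (auto simp: g_def g'_def csq_scs_periodic intro!: continuous_intros)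
  from pd_integral_zero[OF this]
  have z: "(LINT y|torus. g' (y $ j) * kfac n j y) = 0" .
  have i: "integrable torus (\<lambda>y. csq (y $ j) ^ k * kfac n j y)" for k
    unfolding kfac_def by (rule integrable_torus_periodic)
      (auto simp: periodic_sp_def int_vec_def csq_scs_periodic intro!: continuous_intros)
  have "(\<lambda>y. g' (y $ j) * kfac n j y) = (\<lambda>y. pi * ((2 * real m + 2) * (csq (y $ j) ^ Suc m * kfac n j y)
       - (2 * real m + 1) * (csq (y $ j) ^ m * kfac n j y)))"
    by (simp add: g'_def algebra_simps)
  then have "(LINT y|torus. g' (y $ j) * kfac n j y) = pi * ((2 * real m + 2) * (LINT y|torus. csq (y $ j) ^ Suc m * kfac n j y)
       - (2 * real m + 1) * (LINT y|torus. csq (y $ j) ^ m * kfac n j y))"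
    using i[of "Suc m"] i[of m] by (simp del: power_Suc)
  then show ?thesis using z by simp
qed

definition kmass :: "'n::finite itself \<Rightarrow> nat \<Rightarrow> real" where
  "kmass TYPE('n) n = integral\<^sup>L (torus :: (real^'n) measure) (ker0 n)"

lemma ker0_cont: "continuous_on UNIV (ker0 n :: real^'n \<Rightarrow> real)"
  unfolding ker0_def by (intro continuous_intros)

lemma ker0_periodic: "periodic_sp (ker0 n :: real^'n \<Rightarrow> real)"
  by (auto simp: periodic_sp_def int_vec_def ker0_def csq_scs_periodic)

lemma kmass_pos: "0 < kmass TYPE('n::finite) n"
proof -
  have i: "integrable torus (ker0 n :: real^'n \<Rightarrow> real)"
    by (rule integrable_torus_periodic[OF ker0_cont ker0_periodic])
  have "kmass TYPE('n) n \<noteq> 0"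
  proof
    assume "kmass TYPE('n) n = 0"
    then have "AE x in torus. ker0 n (x::real^'n) = 0"
      using integral_nonneg_eq_0_iff_AE[OF i] ker0_nonneg by (auto simp: kmass_def)
    then have ae: "AE x in lborel. x \<in> cell \<longrightarrow> ker0 n (x::real^'n) = 0"
      by (simp add: AE_torus)
    define U where "U = {x :: real^'n. x \<in> box 0 One \<and> 0 < ker0 n x}"
    have "AE x in lborel. x \<notin> U"
      using ae by eventually_elim (auto simp: U_def cell_def box_subset_cbox[THEN subsetD])
    then have "AE x in lebesgue. x \<notin> U" by (rule AE_completion)
    then have "negligible U"
      by (simp add: negligible_iff_null_sets AE_iff_null_sets[symmetric] U_def eventually_ae_filter)
         (smt (verit, best) completion.complete2 mem_Collect_eq subsetI)
    moreover have "open U"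
    proof -
      have "U = box 0 One \<inter> {x. 0 < ker0 n x}" by (auto simp: U_def)
      then show ?thesis using ker0_cont[of n] by (auto intro!: open_Int open_Collect_less continuous_intros)
    qed
    \<comment> \<open>The kernel peaks at the corners of the cell and vanishes where a coordinate is
      1/2. The point with all coordinates 1/4 is interior and has \<open>csq = 1/2\<close> in each
      of them.\<close>
    moreover have "(\<chi> i. 1/4) \<in> U"
    proof -
      have "0 < csq (1/4)" by (simp add: csq_def cos_45 mult.commute)
      then show ?thesis by (simp add: U_def mem_box_cart ker0_def prod_pos)
    qed
    ultimately show False using open_not_negligible by blast
  qed
  moreover have "0 \<le> kmass TYPE('n) n"
    unfolding kmass_def by (rule integral_nonneg_AE) (simp add: ker0_nonneg)
  ultimately show ?thesis by simp
qed

definition ker :: "nat \<Rightarrow> real^'n::finite \<Rightarrow> real" where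
  "ker n y = ker0 n y / kmass TYPE('n) n"

definition dker :: "nat \<Rightarrow> 'n::finite \<Rightarrow> real^'n \<Rightarrow> real" where
  "dker n j y = - (2 * pi * (real n + 1)) * (scs (y $ j) * csq (y $ j) ^ n * kfac n j y) / kmass TYPE('n) n"

text \<open>The Fisher quotient \<open>(dker n j y)\<^sup>2 / ker n y\<close> up to the constant in
  \<open>dker_squared\<close>, written as a polynomial so that it makes sense at the zeros of the
  kernel too.\<close>

definition fis :: "nat \<Rightarrow> 'n::finite \<Rightarrow> real^'n \<Rightarrow> real" where
  "fis n j y = csq (y $ j) ^ n * (1 - csq (y $ j)) * kfac n j y / kmass TYPE('n) n"

lemma ker_nonneg: "0 \<le> ker n y"
  unfolding ker_def by (intro divide_nonneg_nonneg ker0_nonneg less_imp_le[OF kmass_pos])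

lemma fis_nonneg: "0 \<le> fis n j y"
  unfolding fis_def
  by (intro divide_nonneg_nonneg mult_nonneg_nonneg kfac_nonneg less_imp_le[OF kmass_pos])
     (auto simp: csq_bounds)

lemma ker_cont: "continuous_on UNIV (ker n :: real^'n \<Rightarrow> real)"
  unfolding ker_def using kmass_pos[where 'n='n, of n] by (intro continuous_intros ker0_cont) auto

lemma ker_periodic: "periodic_sp (ker n :: real^'n \<Rightarrow> real)"
  unfolding ker_def periodic_sp_def using ker0_periodic[of n, unfolded periodic_sp_def] by metis

lemma fis_cont: "continuous_on UNIV (fis n j :: real^'n \<Rightarrow> real)"
  unfolding fis_def kfac_def using kmass_pos[where 'n='n, of n] by (intro continuous_intros) auto

lemma fis_periodic: "periodic_sp (fis n j :: real^'n \<Rightarrow> real)"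
  by (auto simp: fis_def kfac_def periodic_sp_def int_vec_def csq_scs_periodic)

lemma csq_minus: "csq (- s) = csq s"
  by (simp add: csq_def)

lemma ker_even: "ker n (- y) = ker n y" and fis_even: "fis n j (- y) = fis n j y"
  by (simp_all add: ker_def ker0_def fis_def kfac_def csq_minus)

lemma ker_integral: "integral\<^sup>L torus (ker n :: real^'n \<Rightarrow> real) = 1"
proof -
  have "integral\<^sup>L torus (ker n :: real^'n \<Rightarrow> real) = integral\<^sup>L torus (ker0 n :: real^'n \<Rightarrow> real) / kmass TYPE('n) n"
    unfolding ker_def by simp
  then show ?thesis using kmass_pos[where 'n='n, of n] unfolding kmass_def by simp
qed

lemma pd_ker: "pd j (ker n) (dker n j)"
proof -
  have "pd j (\<lambda>y. csq (y $ j) ^ Suc n * kfac n j y)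
      (\<lambda>y. (- (2 * pi * (real n + 1)) * (scs (y $ j) * csq (y $ j) ^ n)) * kfac n j y)"
    by (rule pd_coord) (auto intro!: derivative_eq_intros csq_deriv continuous_intros
        simp: csq_scs_periodic algebra_simps simp del: power_Suc)
  from pd_cmult[OF this, of "1 / kmass TYPE('a) n"] show ?thesis
    unfolding ker_def dker_def ker0_split[of n _ j] by (simp add: mult.assoc)
qed

lemma dker_squared: "(dker n j y)\<^sup>2 = (2 * pi * (real n + 1))\<^sup>2 * (ker n y * fis n j y)"
proof -
  have "(dker n j y)\<^sup>2 = (2 * pi * (real n + 1))\<^sup>2 * ((csq (y $ j) * (1 - csq (y $ j))) * (csq (y $ j) ^ n)\<^sup>2 * (kfac n j y)\<^sup>2)
      / (kmass TYPE('a) n)\<^sup>2"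
    unfolding dker_def scs_squared[symmetric] power_divide power_mult_distrib power2_minus by (simp only: mult.assoc)
  then show ?thesis
    unfolding ker_def fis_def ker0_split[of n y j] by (simp add: power2_eq_square mult.assoc mult.left_commute)
qed

text \<open>\<open>1 - csq\<close> is a squared sine, the periodic substitute for a squared
  distance. The value is one step of \<open>moment_rec\<close> at \<open>Suc n\<close>: the ratio of
  consecutive moments is \<open>(2 n + 3) / (2 n + 4)\<close>.\<close>

lemma ker_moment: "(LINT y|torus. ker n y * (1 - csq (y $ j))) = 1 / (2 * real n + 4)"
proof -
  let ?I = "\<lambda>m. (LINT y|torus. csq (y $ j) ^ m * kfac n j y)"
  have i: "integrable torus (\<lambda>y. csq (y $ j) ^ k * kfac n j y)" for k
    unfolding kfac_def by (rule integrable_torus_periodic)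
      (auto simp: periodic_sp_def int_vec_def csq_scs_periodic intro!: continuous_intros)
  have k: "?I (Suc n) = kmass TYPE('a) n"
    unfolding kmass_def ker0_split[of n _ j] ..
  have r: "(2 * real n + 3) * ?I (Suc n) = (2 * real n + 4) * ?I (Suc (Suc n))"
    using moment_rec[of "Suc n" j n] by (simp add: algebra_simps del: power_Suc)
  have "(\<lambda>y. ker n y * (1 - csq (y $ j))) =
      (\<lambda>y. (csq (y $ j) ^ Suc n * kfac n j y - csq (y $ j) ^ Suc (Suc n) * kfac n j y) / kmass TYPE('a) n)"
    by (simp add: ker_def ker0_split[of n _ j] algebra_simps diff_divide_distrib)
  then have "(LINT y|torus. ker n y * (1 - csq (y $ j))) = (?I (Suc n) - ?I (Suc (Suc n))) / kmass TYPE('a) n"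
    using i[of "Suc n"] i[of "Suc (Suc n)"] by (simp del: power_Suc)
  also have "?I (Suc n) = kmass TYPE('a) n" by (rule k)
  also have "?I (Suc (Suc n)) = (2 * real n + 3) / (2 * real n + 4) * kmass TYPE('a) n"
    using r k by (simp add: field_simps del: power_Suc)
  also have "(kmass TYPE('a) n - (2 * real n + 3) / (2 * real n + 4) * kmass TYPE('a) n) / kmass TYPE('a) n
      = 1 - (2 * real n + 3) / (2 * real n + 4)"
    using kmass_pos[where 'n='a, of n] by (simp add: diff_divide_distrib)
  also have "\<dots> = 1 / (2 * real n + 4)" by (simp add: field_simps)
  finally show ?thesis .
qed

text \<open>One step of \<open>moment_rec\<close> at \<open>n\<close>. Multiplied by the constant in
  \<open>dker_squared\<close> it grows like \<open>n\<close>, the counterweight to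
  \<open>ker_moment\<close>.\<close>

lemma fis_integral: "integral\<^sup>L torus (fis n j) = 1 / (2 * real n + 1)"
proof -
  let ?I = "\<lambda>m. (LINT y|torus. csq (y $ j) ^ m * kfac n j y)"
  have i: "integrable torus (\<lambda>y. csq (y $ j) ^ k * kfac n j y)" for k
    unfolding kfac_def by (rule integrable_torus_periodic)
      (auto simp: periodic_sp_def int_vec_def csq_scs_periodic intro!: continuous_intros)
  have k: "?I (Suc n) = kmass TYPE('a) n"
    unfolding kmass_def ker0_split[of n _ j] ..
  have r: "(2 * real n + 1) * ?I n = (2 * real n + 2) * ?I (Suc n)"
    using moment_rec[of n j n] .
  have "fis n j =
      (\<lambda>y. (csq (y $ j) ^ n * kfac n j y - csq (y $ j) ^ Suc n * kfac n j y) / kmass TYPE('a) n)"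
    by (simp add: fis_def fun_eq_iff algebra_simps diff_divide_distrib)
  then have "integral\<^sup>L torus (fis n j) = (?I n - ?I (Suc n)) / kmass TYPE('a) n"
    using i[of "Suc n"] i[of n] by (simp del: power_Suc)
  also have "?I (Suc n) = kmass TYPE('a) n" by (rule k)
  also have "?I n = (2 * real n + 2) / (2 * real n + 1) * kmass TYPE('a) n"
    using r k by (simp add: field_simps del: power_Suc)
  also have "((2 * real n + 2) / (2 * real n + 1) * kmass TYPE('a) n - kmass TYPE('a) n) / kmass TYPE('a) n
      = (2 * real n + 2) / (2 * real n + 1) - 1"
    using kmass_pos[where 'n='a, of n] by (simp add: diff_divide_distrib)
  also have "\<dots> = 1 / (2 * real n + 1)" by (simp add: field_simps)
  finally show ?thesis .
qed

section \<open>Mean-square convergence of mollifications\<close>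

lemma Cauchy_Schwarz_integral:
  fixes f g :: "'a \<Rightarrow> real"
  assumes [measurable]: "f \<in> borel_measurable M" "g \<in> borel_measurable M"
    and f: "integrable M (\<lambda>x. (f x)\<^sup>2)" and g: "integrable M (\<lambda>x. (g x)\<^sup>2)"
  shows "integrable M (\<lambda>x. f x * g x)"
    and "(integral\<^sup>L M (\<lambda>x. f x * g x))\<^sup>2 \<le> integral\<^sup>L M (\<lambda>x. (f x)\<^sup>2) * integral\<^sup>L M (\<lambda>x. (g x)\<^sup>2)"
proof -
  show i: "integrable M (\<lambda>x. f x * g x)"
  proof (rule Bochner_Integration.integrable_bound[where f = "\<lambda>x. (f x)\<^sup>2 + (g x)\<^sup>2"])
    show "AE x in M. norm (f x * g x) \<le> norm ((f x)\<^sup>2 + (g x)\<^sup>2)"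
    proof (rule AE_I2)
      fix x
      have "2 * (\<bar>f x\<bar> * \<bar>g x\<bar>) \<le> (f x)\<^sup>2 + (g x)\<^sup>2"
        using sum_squares_bound[of "\<bar>f x\<bar>" "\<bar>g x\<bar>"] by simp
      moreover have "0 \<le> \<bar>f x\<bar> * \<bar>g x\<bar>" by simp
      ultimately have "\<bar>f x\<bar> * \<bar>g x\<bar> \<le> (f x)\<^sup>2 + (g x)\<^sup>2" by linarith
      then show "norm (f x * g x) \<le> norm ((f x)\<^sup>2 + (g x)\<^sup>2)" by (simp add: abs_mult)
    qed
  qed (use f g in auto)
  define a b c where "a = integral\<^sup>L M (\<lambda>x. (f x)\<^sup>2)" and "b = integral\<^sup>L M (\<lambda>x. f x * g x)"
    and "c = integral\<^sup>L M (\<lambda>x. (g x)\<^sup>2)"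
  have q: "0 \<le> a - 2 * s * b + s\<^sup>2 * c" for s
  proof -
    have "integral\<^sup>L M (\<lambda>x. (f x - s * g x)\<^sup>2) = integral\<^sup>L M (\<lambda>x. (f x)\<^sup>2 - 2 * s * (f x * g x) + s\<^sup>2 * (g x)\<^sup>2)"
      by (intro Bochner_Integration.integral_cong) (auto simp: power2_eq_square algebra_simps)
    also have "\<dots> = a - 2 * s * b + s\<^sup>2 * c"
      using f g i by (simp add: a_def b_def c_def)
    finally show ?thesis using integral_nonneg_AE[of "\<lambda>x. (f x - s * g x)\<^sup>2" M] by simp
  qed
  have "b\<^sup>2 \<le> a * c"
  proof (cases "c = 0")
    case True
    have "b = 0"
    proof (rule ccontr)
      assume "b \<noteq> 0"
      \<comment> \<open>When \<open>c = 0\<close> the quadratic is affine in \<open>s\<close>; this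
        choice of \<open>s\<close> gives it the value -1.\<close>
      then show False using q[of "(a + 1) / (2 * b)"] True by simp
    qed
    then show ?thesis using True by simp
  next
    case False
    have "0 \<le> c" unfolding c_def by simp
    with False have "0 < c" by simp
    then have "0 \<le> c * (a - 2 * (b / c) * b + (b / c)\<^sup>2 * c)" using q[of "b / c"] by simp
    also have "\<dots> = a * c - b\<^sup>2" using \<open>0 < c\<close> by (simp add: field_simps power2_eq_square)
    finally show ?thesis by simp
  qed
  then show "b\<^sup>2 \<le> a * c" .
qed

section \<open>Square-integrable functions on the cell\<close>

definition L2 :: "(real^'n \<Rightarrow> real) \<Rightarrow> bool" where
  "L2 f \<longleftrightarrow> f \<in> borel_measurable borel \<and> integrable torus (\<lambda>x. (f x)\<^sup>2)"

definition l2 :: "(real^'n \<Rightarrow> real) \<Rightarrow> real" where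
  "l2 f = sqrt (LINT x|torus. (f x)\<^sup>2)"

lemma L2_measurable [measurable_dest]: "L2 f \<Longrightarrow> f \<in> borel_measurable borel"
  by (simp add: L2_def)

lemma L2_sq: "L2 f \<Longrightarrow> integrable torus (\<lambda>x. (f x)\<^sup>2)"
  by (simp add: L2_def)

lemma l2_nonneg: "0 \<le> l2 f"
  by (simp add: l2_def)

lemma l2_sq: "(l2 f)\<^sup>2 = (LINT x|torus. (f x)\<^sup>2)"
  by (simp add: l2_def)

lemma L2_mult:
  assumes "L2 f" "L2 g"
  shows "integrable torus (\<lambda>x. f x * g x)" "\<bar>(LINT x|torus. f x * g x)\<bar> \<le> l2 f * l2 g"
proof -
  have [measurable]: "f \<in> borel_measurable torus" "g \<in> borel_measurable torus"
    using assms by (auto simp: L2_def)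
  note cs = Cauchy_Schwarz_integral[of f torus g, OF _ _ L2_sq[OF assms(1)] L2_sq[OF assms(2)]]
  show "integrable torus (\<lambda>x. f x * g x)" by (rule cs(1)) measurable
  have "(LINT x|torus. f x * g x)\<^sup>2 \<le> (l2 f * l2 g)\<^sup>2"
    using cs(2) by (simp add: power_mult_distrib l2_sq)
  then show "\<bar>(LINT x|torus. f x * g x)\<bar> \<le> l2 f * l2 g"
    using abs_le_square_iff[of "(LINT x|torus. f x * g x)" "l2 f * l2 g"] by (simp add: l2_nonneg)
qed

lemma L2_bounded:
  fixes f :: "real^'n \<Rightarrow> real"
  assumes [measurable]: "f \<in> borel_measurable borel" and b: "\<And>x. \<bar>f x\<bar> \<le> B"
  shows "L2 f"
  unfolding L2_def
proof
  show "integrable torus (\<lambda>x. (f x)\<^sup>2)"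
  proof (rule integrable_torus_bounded[where B = "B\<^sup>2"])
    fix x
    have "\<bar>f x\<bar>\<^sup>2 \<le> B\<^sup>2" using b[of x] by (intro power_mono) auto
    then show "\<bar>(f x)\<^sup>2\<bar> \<le> B\<^sup>2" by simp
  qed measurable
qed fact

lemma L2_const: "L2 (\<lambda>x. c)"
  by (rule L2_bounded[where B = "\<bar>c\<bar>"]) auto

lemma L2_periodic: "continuous_on UNIV f \<Longrightarrow> periodic_sp f \<Longrightarrow> L2 f"
  using periodic_bounded[of f] L2_bounded[of f] borel_cont[of f] by metis

lemma L2_integrable: "L2 f \<Longrightarrow> integrable torus f"
  using L2_mult(1)[OF _ L2_const, of f 1] by simp

lemma L2_dominated:
  assumes "L2 g" "f \<in> borel_measurable borel" "\<And>x. \<bar>f x\<bar> \<le> \<bar>g x\<bar>"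
  shows "L2 f" "l2 f \<le> l2 g"
proof -
  have [measurable]: "f \<in> borel_measurable borel" by fact
  have le: "(f x)\<^sup>2 \<le> (g x)\<^sup>2" for x using assms(3)[of x] by (simp add: abs_le_square_iff)
  have i: "integrable torus (\<lambda>x. (f x)\<^sup>2)"
    by (rule Bochner_Integration.integrable_bound[OF L2_sq[OF assms(1)]]) (use le in auto)
  then show "L2 f" by (simp add: L2_def)
  show "l2 f \<le> l2 g" unfolding l2_def
    by (intro real_sqrt_le_mono integral_mono i L2_sq[OF assms(1)]) (use le in auto)
qed

lemma L2_cmult: "L2 f \<Longrightarrow> L2 (\<lambda>x. c * f x)" and l2_cmult: "l2 (\<lambda>x. c * f x) = \<bar>c\<bar> * l2 f"
  by (auto simp: L2_def l2_def power_mult_distrib real_sqrt_mult)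

lemma L2_add: assumes "L2 f" "L2 g" shows "L2 (\<lambda>x. f x + g x)" and l2_triangle: "l2 (\<lambda>x. f x + g x) \<le> l2 f + l2 g"
proof -
  have [measurable]: "f \<in> borel_measurable borel" "g \<in> borel_measurable borel"
    using assms by (auto simp: L2_def)
  have eq: "(\<lambda>x. (f x + g x)\<^sup>2) = (\<lambda>x. (f x)\<^sup>2 + 2 * (f x * g x) + (g x)\<^sup>2)"
    by (auto simp: power2_eq_square algebra_simps)
  note i = L2_sq[OF assms(1)] L2_sq[OF assms(2)] L2_mult(1)[OF assms]
  show "L2 (\<lambda>x. f x + g x)" unfolding L2_def eq using i by simp
  have "(LINT x|torus. (f x + g x)\<^sup>2) = (l2 f)\<^sup>2 + 2 * (LINT x|torus. f x * g x) + (l2 g)\<^sup>2"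
    unfolding eq l2_sq using i by simp
  also have "\<dots> \<le> (l2 f + l2 g)\<^sup>2"
    using L2_mult(2)[OF assms] by (simp add: power2_eq_square algebra_simps abs_le_iff)
  finally show "l2 (\<lambda>x. f x + g x) \<le> l2 f + l2 g"
    unfolding l2_def[of "\<lambda>x. f x + g x"] by (intro real_le_lsqrt) (auto simp: l2_nonneg)
qed

lemma L2_diff: assumes "L2 f" "L2 g" shows "L2 (\<lambda>x. f x - g x)"
  using L2_add[OF assms(1) L2_cmult[OF assms(2), of "-1"]] by simp

lemma l2_commute: "l2 (\<lambda>x. f x - g x) = l2 (\<lambda>x. g x - f x)"
  unfolding l2_def by (simp add: power2_commute)

lemma l2_dist_triangle:
  assumes "L2 f" "L2 g" "L2 h"
  shows "l2 (\<lambda>x. f x - h x) \<le> l2 (\<lambda>x. f x - g x) + l2 (\<lambda>x. g x - h x)"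
  using l2_triangle[OF L2_diff[OF assms(1,2)] L2_diff[OF assms(2,3)]] by simp

lemma L2_mult_bounded:
  assumes "L2 f" and [measurable]: "b \<in> borel_measurable borel" and "\<And>x. \<bar>b x\<bar> \<le> B"
  shows "L2 (\<lambda>x. b x * f x)" "l2 (\<lambda>x. b x * f x) \<le> B * l2 f"
proof -
  have [measurable]: "f \<in> borel_measurable borel" using assms by (auto simp: L2_def)
  have B: "0 \<le> B" using assms(3)[of undefined] by linarith
  have *: "\<bar>b x * f x\<bar> \<le> \<bar>B * f x\<bar>" for x
    using assms(3)[of x] B by (simp add: abs_mult mult_right_mono)
  note d = L2_dominated[OF L2_cmult[OF assms(1), of B] _ *]
  show "L2 (\<lambda>x. b x * f x)" by (rule d) measurable
  have "l2 (\<lambda>x. b x * f x) \<le> l2 (\<lambda>x. B * f x)" by (rule d) measurable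
  then show "l2 (\<lambda>x. b x * f x) \<le> B * l2 f" using B by (simp add: l2_cmult)
qed

section \<open>The averaging operators \<open>S n\<close>\<close>

abbreviation "S n \<equiv> conv (ker n)"

lemma even_kernel_integral:
  fixes k :: "real^'n \<Rightarrow> real"
  assumes k: "continuous_on UNIV k" "periodic_sp k" and e: "\<And>y. k (- y) = k y"
  shows "(LINT z|torus. k (x - z)) = integral\<^sup>L torus k"
proof -
  have "k (x - z) = k (z + (- x))" for z using e[of "z - x"] by simp
  then show ?thesis using integral_torus_shift[OF k, of "- x"] by simp
qed

lemma ker_integral_shift: "(LINT z|torus. ker n (x - z)) = 1"
  "(LINT z|torus. ker n (z - x)) = 1"
  using even_kernel_integral[OF ker_cont ker_periodic ker_even] integral_torus_shift[OF ker_cont ker_periodic, of n "- x"]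
  by (simp_all add: ker_integral)

lemma shift_kernel:
  fixes k :: "real^'n \<Rightarrow> real"
  assumes k: "continuous_on UNIV k" "periodic_sp k"
  shows "continuous_on UNIV (\<lambda>z. k (x - z))" "periodic_sp (\<lambda>z. k (x - z))"
proof -
  show "continuous_on UNIV (\<lambda>z. k (x - z))"
    by (intro continuous_on_compose2[OF k(1)] continuous_intros) auto
  show "periodic_sp (\<lambda>z. k (x - z))"
    unfolding periodic_sp_def by (metis diff_diff_eq k(2) periodic_sp_minus)
qed

lemma sqrt_kernel_L2:
  fixes k :: "real^'n \<Rightarrow> real"
  assumes k: "continuous_on UNIV k" "periodic_sp k" "\<And>y. 0 \<le> k y" and f: "L2 f"
  shows "L2 (\<lambda>z. sqrt (k (x - z)) * f z)"
    and "(l2 (\<lambda>z. sqrt (k (x - z)) * f z))\<^sup>2 = conv k (\<lambda>z. (f z)\<^sup>2) x"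
proof -
  have [measurable]: "f \<in> borel_measurable borel" using f by (auto simp: L2_def)
  have [measurable]: "k \<in> borel_measurable borel" using k by (auto intro: borel_cont)
  have eq: "(sqrt (k (x - z)) * f z)\<^sup>2 = k (x - z) * (f z)\<^sup>2" for z
    using k(3) by (simp add: power_mult_distrib)
  show "L2 (\<lambda>z. sqrt (k (x - z)) * f z)"
    unfolding L2_def eq using conv_integrable[OF k(1,2) L2_sq[OF f]] by simp
  show "(l2 (\<lambda>z. sqrt (k (x - z)) * f z))\<^sup>2 = conv k (\<lambda>z. (f z)\<^sup>2) x"
    unfolding l2_sq eq conv_def ..
qed

text \<open>Cauchy-Schwarz after splitting the kernel into two square roots; the factor without
  \<open>f\<close> is the total mass 1.\<close>

lemma conv_Jensen:
  assumes f: "L2 f"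
  shows "(S n f x)\<^sup>2 \<le> S n (\<lambda>z. (f z)\<^sup>2) x"
proof -
  note s1 = sqrt_kernel_L2[OF ker_cont ker_periodic ker_nonneg L2_const[of 1], of n x]
  note s2 = sqrt_kernel_L2[OF ker_cont ker_periodic ker_nonneg f, of n x]
  have "S n f x = (LINT z|torus. (sqrt (ker n (x - z)) * 1) * (sqrt (ker n (x - z)) * f z))"
    unfolding conv_def by (intro Bochner_Integration.integral_cong)
      (auto simp: ker_nonneg mult.assoc[symmetric])
  then have "\<bar>S n f x\<bar> \<le> l2 (\<lambda>z. sqrt (ker n (x - z)) * 1) * l2 (\<lambda>z. sqrt (ker n (x - z)) * f z)"
    using L2_mult(2)[OF s1(1) s2(1)] by simp
  then have "\<bar>S n f x\<bar>\<^sup>2 \<le> (l2 (\<lambda>z. sqrt (ker n (x - z)) * 1))\<^sup>2 * (l2 (\<lambda>z. sqrt (ker n (x - z)) * f z))\<^sup>2"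
    by (subst power_mult_distrib[symmetric]) (intro power_mono; simp)
  then show ?thesis unfolding s1(2) s2(2) by (simp add: conv_def ker_integral_shift)
qed

lemma conv_measurable:
  fixes k :: "real^'n \<Rightarrow> real"
  assumes "continuous_on UNIV k" "periodic_sp k" "integrable torus f"
  shows "conv k f \<in> borel_measurable borel"
  by (intro borel_cont conv_cont assms)

lemma pair_torus: "pair_sigma_finite (torus :: (real^'n) measure) (torus :: (real^'m) measure)"
  by (simp add: pair_sigma_finite_def torus.sigma_finite_measure_axioms)

text \<open>Fubini, legitimate since \<open>k\<close> is bounded. The reflected kernel is kept
  because both parities occur later: \<open>ker\<close> is even and \<open>dker\<close> is
  odd.\<close>

lemma conv_swap:
  fixes k :: "real^'n \<Rightarrow> real"
  assumes k: "continuous_on UNIV k" "periodic_sp k" and f: "integrable torus f" and g: "integrable torus g"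
  shows "(LINT x|torus. conv k f x * g x) = (LINT z|torus. f z * conv (\<lambda>y. k (- y)) g z)"
    and "integrable torus (\<lambda>x. conv k f x * g x)"
proof -
  interpret P: pair_sigma_finite "torus :: (real^'n) measure" "torus :: (real^'n) measure" by (rule pair_torus)
  obtain B where B: "0 \<le> B" "\<And>x. \<bar>k x\<bar> \<le> B"
    using periodic_bounded[OF k] by blast
  have [measurable]: "f \<in> borel_measurable borel" "g \<in> borel_measurable borel"
    using borel_measurable_integrable[OF f] borel_measurable_integrable[OF g] by simp_all
  have [measurable]: "k \<in> borel_measurable borel" using k by (auto intro: borel_cont)
  let ?F = "\<lambda>(x, z). (k (x - z) * f z) * g x"
  have ci: "integrable torus (\<lambda>z. k (x - z) * f z)" for x by (rule conv_integrable[OF k f])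
  have [measurable]: "?F \<in> borel_measurable (torus \<Otimes>\<^sub>M torus)" by measurable
  have I: "integrable (torus \<Otimes>\<^sub>M torus) ?F"
  proof (rule P.Fubini_integrable)
    show "integrable torus (\<lambda>x. (LINT y|torus. norm (?F (x, y))))"
    proof (rule Bochner_Integration.integrable_bound[where f = "\<lambda>x. (B * (LINT z|torus. \<bar>f z\<bar>)) * \<bar>g x\<bar>"])
      show "AE x in torus. norm (LINT y|torus. norm (?F (x, y))) \<le> norm ((B * (LINT z|torus. \<bar>f z\<bar>)) * \<bar>g x\<bar>)"
      proof (rule AE_I2)
        fix x
        have "(LINT y|torus. norm (?F (x, y))) = (LINT z|torus. \<bar>k (x - z) * f z\<bar>) * \<bar>g x\<bar>"
          by (simp add: abs_mult)
        also have "\<dots> \<le> (LINT z|torus. B * \<bar>f z\<bar>) * \<bar>g x\<bar>"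
          using integrable_abs[OF ci[of x]] f B
          by (intro mult_right_mono integral_mono) (auto simp: abs_mult mult_right_mono)
        finally have le: "(LINT y|torus. norm (?F (x, y))) \<le> (LINT z|torus. B * \<bar>f z\<bar>) * \<bar>g x\<bar>" .
        have "0 \<le> (LINT y|torus. norm (?F (x, y)))" by (rule integral_nonneg_AE) simp
        then have "norm (LINT y|torus. norm (?F (x, y))) = (LINT y|torus. norm (?F (x, y)))"
          by (simp only: real_norm_def abs_of_nonneg)
        also note le
        also have "(LINT z|torus. B * \<bar>f z\<bar>) * \<bar>g x\<bar> \<le> norm ((B * (LINT z|torus. \<bar>f z\<bar>)) * \<bar>g x\<bar>)"
          by simp
        finally show "norm (LINT y|torus. norm (?F (x, y))) \<le> norm ((B * (LINT z|torus. \<bar>f z\<bar>)) * \<bar>g x\<bar>)" .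
      qed
    qed (use g in auto)
    show "AE x in torus. integrable torus (\<lambda>y. ?F (x, y))" using ci by auto
  qed fact
  have "(LINT x|torus. conv k f x * g x) = (LINT x|torus. (LINT z|torus. ?F (x, z)))"
    using ci by (simp add: conv_def)
  also have "\<dots> = (LINT z|torus. (LINT x|torus. ?F (x, z)))"
    using P.Fubini_integral[of "\<lambda>x z. ?F (x, z)"] I by (simp add: case_prod_beta')
  also have "\<dots> = (LINT z|torus. f z * conv (\<lambda>y. k (- y)) g z)"
    by (simp add: conv_def mult.assoc mult.left_commute)
  finally show "(LINT x|torus. conv k f x * g x) = (LINT z|torus. f z * conv (\<lambda>y. k (- y)) g z)" .
  have "integrable torus (\<lambda>x. (LINT z|torus. ?F (x, z)))"
    by (rule P.integrable_fst'[OF I])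
  then show "integrable torus (\<lambda>x. conv k f x * g x)" using ci by (simp add: conv_def)
qed

lemma S_self_adjoint:
  assumes f: "integrable torus f" and g: "integrable torus g"
  shows "(LINT x|torus. S n f x * g x) = (LINT z|torus. f z * S n g z)"
  using conv_swap(1)[OF ker_cont ker_periodic f g, of n] by (simp add: ker_even)

lemma S_one: "S n (\<lambda>x. c) = (\<lambda>x. c)"
  by (simp add: conv_def ker_integral_shift fun_eq_iff)

lemma S_integral:
  assumes f: "integrable torus f"
  shows "integral\<^sup>L torus (S n f) = integral\<^sup>L torus f" "integrable torus (S n f)"
proof -
  have c: "integrable torus (\<lambda>x::real^'a. 1::real)" by simp
  show "integral\<^sup>L torus (S n f) = integral\<^sup>L torus f"
    using S_self_adjoint[OF f c, of n] by (simp add: S_one)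
  show "integrable torus (S n f)"
    using conv_swap(2)[OF ker_cont ker_periodic f c, of n] by simp
qed

text \<open>Jensen at each point, then conservation of the integral of the squared function.\<close>

lemma S_L2:
  assumes f: "L2 f"
  shows "L2 (S n f)" "l2 (S n f) \<le> l2 f"
proof -
  note i = S_integral[OF L2_sq[OF f], of n]
  have [measurable]: "S n f \<in> borel_measurable borel"
    by (intro conv_measurable ker_cont ker_periodic L2_integrable f)
  have j: "integrable torus (\<lambda>x. (S n f x)\<^sup>2)"
    by (rule Bochner_Integration.integrable_bound[OF i(2)]) (auto intro!: AE_I2 order_trans[OF conv_Jensen[OF f, of n] abs_ge_self])
  then show "L2 (S n f)" by (simp add: L2_def)
  have "(LINT x|torus. (S n f x)\<^sup>2) \<le> integral\<^sup>L torus (S n (\<lambda>z. (f z)\<^sup>2))"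
    by (intro integral_mono i j conv_Jensen[OF f])
  then show "l2 (S n f) \<le> l2 f" unfolding l2_def i by simp
qed

lemma conv_diff:
  fixes k :: "real^'n \<Rightarrow> real"
  assumes "continuous_on UNIV k" "periodic_sp k" "integrable torus f" "integrable torus g"
  shows "conv k (\<lambda>x. f x - g x) x = conv k f x - conv k g x"
    and "conv k (\<lambda>x. f x + g x) x = conv k f x + conv k g x"
  unfolding conv_def
  using conv_integrable[OF assms(1,2,3), of x] conv_integrable[OF assms(1,2,4), of x]
  by (simp_all add: algebra_simps)

lemma conv_cmult: "conv k (\<lambda>x. c * f x) x = c * conv k f x"
  unfolding conv_def by (simp add: mult.left_commute)

lemma conv_mono:
  fixes k :: "real^'n \<Rightarrow> real"
  assumes "continuous_on UNIV k" "periodic_sp k" "\<And>y. 0 \<le> k y" "integrable torus f" "integrable torus g"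
    "\<And>x. f x \<le> g x"
  shows "conv k f x \<le> conv k g x"
  unfolding conv_def
  by (intro integral_mono conv_integrable mult_left_mono assms)

section \<open>Convergence of the averages\<close>

lemma sin_ge_third: "0 \<le> x \<Longrightarrow> x \<le> 2 \<Longrightarrow> x / 3 \<le> sin (x::real)"
proof -
  assume x: "0 \<le> x" "x \<le> 2"
  \<comment> \<open>Third-order Taylor: \<open>x - sin x\<close> is at most
    \<open>x ^ 3 / 6\<close>, and \<open>x ^ 3 \<le> 4 * x\<close> on the interval leaves
    \<open>x / 3\<close>.\<close>
  have "\<bar>sin x - (\<Sum>m<3. sin_coeff m * x ^ m)\<bar> \<le> inverse (fact 3) * \<bar>x\<bar> ^ 3"
    by (rule Maclaurin_sin_bound)
  moreover have "(\<Sum>m<3. sin_coeff m * x ^ m) = x"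
    by (simp add: numeral_eq_Suc sin_coeff_def)
  moreover have "x ^ 3 \<le> 4 * x"
  proof -
    have "x * x \<le> 2 * 2" using x by (intro mult_mono) auto
    then have "x * x * x \<le> 4 * x" using x by (intro mult_right_mono) auto
    then show ?thesis by (simp add: power3_eq_cube)
  qed
  ultimately have 1: "\<bar>sin x - x\<bar> * 6 \<le> x ^ 3" and 3: "x ^ 3 \<le> 4 * x"
    using x by (simp_all add: fact_numeral)
  have "(x - sin x) * 6 \<le> \<bar>sin x - x\<bar> * 6" by (rule mult_right_mono) (simp_all add: abs_if)
  also note 1
  also note 3
  finally show "x / 3 \<le> sin x" by (simp add: field_simps)
qed

text \<open>The crude bound of \<open>sin_ge_third\<close> is enough: \<open>pi > 3\<close> makes up
  for the factor 1/3, and \<open>pi < 4\<close> keeps the argument of the sine below 2.\<close>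

lemma square_le_one_minus_csq: "\<bar>s\<bar> \<le> 1/2 \<Longrightarrow> s\<^sup>2 \<le> 1 - csq s"
proof -
  assume s: "\<bar>s\<bar> \<le> 1/2"
  have "pi * \<bar>s\<bar> \<le> 4 * (1/2)" using s pi_less_4 by (intro mult_mono) auto
  then have "pi * \<bar>s\<bar> / 3 \<le> sin (pi * \<bar>s\<bar>)" by (intro sin_ge_third) auto
  moreover have "3 * \<bar>s\<bar> \<le> pi * \<bar>s\<bar>" using pi_gt3 by (intro mult_right_mono) auto
  ultimately have "\<bar>s\<bar> \<le> sin (pi * \<bar>s\<bar>)" by simp
  then have "\<bar>s\<bar>\<^sup>2 \<le> (sin (pi * \<bar>s\<bar>))\<^sup>2" by (intro power_mono) auto
  also have "\<dots> = 1 - csq \<bar>s\<bar>" by (simp add: one_minus_csq)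
  also have "csq \<bar>s\<bar> = csq s" by (simp add: abs_if csq_minus)
  finally show ?thesis by simp
qed

text \<open>What counts is the distance from the integers. Past 1/2 the period moves
  \<open>\<bar>t\<bar>\<close> to \<open>\<bar>t\<bar> - 1\<close>, which is still at least
  \<open>d\<close> away from 0.\<close>

lemma one_minus_csq_lower:
  assumes "0 < d" "d \<le> 1/2" "d \<le> \<bar>t\<bar>" "\<bar>t\<bar> \<le> 1 - d"
  shows "d\<^sup>2 \<le> 1 - csq t"
proof (cases "\<bar>t\<bar> \<le> 1/2")
  case True
  have "d\<^sup>2 \<le> \<bar>t\<bar>\<^sup>2" using assms by (intro power_mono) auto
  then show ?thesis using square_le_one_minus_csq[OF True] by simp
next
  case False
  have "csq t = csq \<bar>t\<bar>" by (simp add: abs_if csq_minus)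
  also have "\<dots> = csq (\<bar>t\<bar> + (-1))" by (rule csq_scs_periodic(1)[symmetric]) simp
  finally have c: "csq t = csq (\<bar>t\<bar> - 1)" by simp
  have "\<bar>\<bar>t\<bar> - 1\<bar> \<le> 1/2" using False assms by linarith
  from square_le_one_minus_csq[OF this] have "(\<bar>t\<bar> - 1)\<^sup>2 \<le> 1 - csq t" by (simp add: c)
  moreover have "d\<^sup>2 \<le> \<bar>\<bar>t\<bar> - 1\<bar>\<^sup>2" using assms by (intro power_mono) auto
  ultimately show ?thesis by simp
qed

lemma ker_moment_shift: "(LINT z|torus. ker n (x - z) * (1 - csq ((x - z) $ j))) = 1 / (2 * real n + 4)"
proof -
  have "(LINT z|torus. (\<lambda>y. ker n y * (1 - csq (y $ j))) (x - z)) = (LINT y|torus. ker n y * (1 - csq (y $ j)))"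
  proof (rule even_kernel_integral)
    show "continuous_on UNIV (\<lambda>y. ker n y * (1 - csq (y $ j)))"
      by (intro continuous_intros ker_cont)
    show "periodic_sp (\<lambda>y. ker n y * (1 - csq (y $ j)))"
      using ker_periodic[of n] by (auto simp: periodic_sp_def int_vec_def csq_scs_periodic)
  qed (simp add: ker_even csq_minus)
  then show ?thesis by (simp add: ker_moment)
qed

text \<open>A Chebyshev argument: continuity controls the points near \<open>x\<close>, and the
  moment \<open>1 / (2 n + 4)\<close> controls the kernel elsewhere. Interior points are singled out
  because the kernel wraps around the cell while \<open>g\<close> is an arbitrary bounded continuous
  function.\<close>

lemma S_tendsto_continuous:
  fixes g :: "real^'n \<Rightarrow> real"
  assumes c: "continuous_on UNIV g" and b: "\<And>x. \<bar>g x\<bar> \<le> B" and x: "x \<in> box 0 One"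
  shows "(\<lambda>n. S n g x) \<longlonglongrightarrow> g x"
proof (rule LIMSEQ_I)
  fix e :: real assume e: "0 < e"
  have B: "0 \<le> B" using b[of x] by linarith
  have [measurable]: "g \<in> borel_measurable borel" using c by (rule borel_cont)
  have "continuous (at x) g" using c by (simp add: continuous_on_eq_continuous_at)
  then obtain d where d: "0 < d" "\<And>z. dist z x < d \<Longrightarrow> \<bar>g z - g x\<bar> < e / 2"
    using e unfolding continuous_at_eps_delta dist_real_def by (metis half_gt_zero)
  have x01: "0 < x $ i" "x $ i < 1" for i using x by (auto simp: mem_box_cart)
  define d0 where "d0 = Min (range (\<lambda>i. min (x $ i) (1 - x $ i)))"
  have d0: "0 < d0"
    unfolding d0_def by (subst Min_gr_iff) (use x01 in \<open>auto simp: less_diff_eq\<close>)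
  have d0': "d0 \<le> x $ i" "d0 \<le> 1 - x $ i" for i
  proof -
    have "d0 \<le> min (x $ i) (1 - x $ i)" unfolding d0_def by (rule Min_le) auto
    then show "d0 \<le> x $ i" "d0 \<le> 1 - x $ i" by linarith+
  qed
  \<comment> \<open>The bound by \<open>d0\<close> keeps every coordinate of \<open>x - z\<close>,
    for \<open>z\<close> in the cell, at distance \<open>d1\<close> from 1 and -1, so no wrapped
    copy of \<open>x\<close> interferes. The dimension in the denominator serves the passage from
    coordinates to the norm, and 1/2 is demanded by \<open>one_minus_csq_lower\<close>.\<close>
  define d1 where "d1 = min (1/2) (min (d / (2 * real CARD('n))) d0)"
  have d1: "0 < d1" "d1 \<le> 1/2" "d1 \<le> d / (2 * real CARD('n))" "\<And>i. d1 \<le> x $ i" "\<And>i. d1 \<le> 1 - x $ i"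
  proof -
    show "0 < d1" unfolding d1_def using d(1) d0 by simp
    show "d1 \<le> 1/2" "d1 \<le> d / (2 * real CARD('n))" unfolding d1_def by linarith+
    have "d1 \<le> d0" unfolding d1_def by linarith
    then show "d1 \<le> x $ i" "d1 \<le> 1 - x $ i" for i using d0'[of i] by linarith+
  qed
  have pw: "\<bar>g z - g x\<bar> \<le> e / 2 + (2 * B / d1\<^sup>2) * (\<Sum>j\<in>UNIV. 1 - csq ((x - z) $ j))" if z: "z \<in> cell" for z
  proof (cases "\<forall>j. \<bar>(x - z) $ j\<bar> < d1")
    case True
    have "dist z x \<le> (\<Sum>j\<in>UNIV. \<bar>(z - x) $ j\<bar>)" unfolding dist_norm by (rule norm_le_l1_cart)
    also have "\<dots> \<le> (\<Sum>j\<in>(UNIV::'n set). d1)"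
      using True by (intro sum_mono) (auto simp: abs_minus_commute less_imp_le)
    also have "\<dots> \<le> d / 2" using d1(3) by (simp add: field_simps)
    finally have "dist z x < d" using d by simp
    then have "\<bar>g z - g x\<bar> \<le> e / 2" using d(2) less_imp_le by blast
    moreover have "0 \<le> (2 * B / d1\<^sup>2) * (\<Sum>j\<in>UNIV. 1 - csq ((x - z) $ j))"
      using B by (intro mult_nonneg_nonneg sum_nonneg) (auto simp: csq_bounds)
    ultimately show ?thesis by linarith
  next
    case False
    then obtain j where j: "d1 \<le> \<bar>(x - z) $ j\<bar>" by (auto simp: not_less)
    have "\<bar>(x - z) $ j\<bar> \<le> 1 - d1"
    proof -
      have "0 \<le> z $ j" "z $ j \<le> 1" using z unfolding mem_cell by auto
      then show ?thesis unfolding vector_minus_component abs_le_iff using d1(4)[of j] d1(5)[of j] by linarith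
    qed
    then have "d1\<^sup>2 \<le> 1 - csq ((x - z) $ j)" using one_minus_csq_lower d1 j by blast
    also have "\<dots> \<le> (\<Sum>j\<in>UNIV. 1 - csq ((x - z) $ j))"
      by (rule member_le_sum) (auto simp: csq_bounds)
    finally have "(2 * B / d1\<^sup>2) * d1\<^sup>2 \<le> (2 * B / d1\<^sup>2) * (\<Sum>j\<in>UNIV. 1 - csq ((x - z) $ j))"
      using B by (intro mult_left_mono) auto
    moreover have "(2 * B / d1\<^sup>2) * d1\<^sup>2 = 2 * B" using d1 by simp
    moreover have "\<bar>g z - g x\<bar> \<le> 2 * B" using b[of z] b[of x] by linarith
    ultimately show ?thesis using e by linarith
  qed
  define C where "C = (2 * B / d1\<^sup>2) * real CARD('n)"
  have est: "\<bar>S n g x - g x\<bar> \<le> e / 2 + C / (2 * real n + 4)" for n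
  proof -
    have ik: "integrable torus (\<lambda>z. ker n (x - z))"
      using integrable_torus_periodic[OF shift_kernel[OF ker_cont ker_periodic]] .
    have ig: "integrable torus g" by (rule integrable_torus_bounded[OF _ b]) measurable
    have im: "integrable torus (\<lambda>z. ker n (x - z) * (1 - csq ((x - z) $ j)))" for j
      by (rule conv_integrable[OF ker_cont ker_periodic])
         (auto intro!: integrable_torus_bounded[where B = 1] borel_cont continuous_intros simp: csq_bounds)
    have "S n g x - g x = (LINT z|torus. ker n (x - z) * g z) - (LINT z|torus. ker n (x - z) * g x)"
      using ker_integral_shift(1)[of n x] by (simp add: conv_def)
    also have "\<dots> = (LINT z|torus. ker n (x - z) * (g z - g x))"
      using conv_integrable[OF ker_cont ker_periodic ig, of n x] ik by (simp add: right_diff_distrib)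
    finally have "\<bar>S n g x - g x\<bar> \<le> (LINT z|torus. \<bar>ker n (x - z) * (g z - g x)\<bar>)"
      using integral_abs_bound by simp
    also have "\<dots> \<le> (LINT z|torus. (e / 2) * ker n (x - z) + (2 * B / d1\<^sup>2) * (\<Sum>j\<in>UNIV. ker n (x - z) * (1 - csq ((x - z) $ j))))"
    proof (rule integral_mono_AE)
      show "integrable torus (\<lambda>z. \<bar>ker n (x - z) * (g z - g x)\<bar>)"
        using conv_integrable[OF ker_cont ker_periodic ig, of n x] ik by (simp add: right_diff_distrib)
      show "AE z in torus. \<bar>ker n (x - z) * (g z - g x)\<bar> \<le> (e / 2) * ker n (x - z) + (2 * B / d1\<^sup>2) * (\<Sum>j\<in>UNIV. ker n (x - z) * (1 - csq ((x - z) $ j)))"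
        unfolding AE_torus
      proof (rule AE_I2, rule impI)
        fix z :: "real^'n" assume "z \<in> cell"
        from pw[OF this] have "ker n (x - z) * \<bar>g z - g x\<bar> \<le> ker n (x - z) * (e / 2 + (2 * B / d1\<^sup>2) * (\<Sum>j\<in>UNIV. 1 - csq ((x - z) $ j)))"
          by (intro mult_left_mono ker_nonneg)
        also have "\<dots> = (e / 2) * ker n (x - z) + (2 * B / d1\<^sup>2) * (\<Sum>j\<in>UNIV. ker n (x - z) * (1 - csq ((x - z) $ j)))"
          by (simp only: distrib_left sum_distrib_left[symmetric] mult_ac)
        finally show "\<bar>ker n (x - z) * (g z - g x)\<bar> \<le> \<dots>" by (simp add: abs_mult ker_nonneg)
      qed
    qed (intro Bochner_Integration.integrable_add integrable_mult_right Bochner_Integration.integrable_sum ik im)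
    also have "\<dots> = e / 2 + (2 * B / d1\<^sup>2) * (\<Sum>j\<in>(UNIV::'n set). 1 / (2 * real n + 4))"
      by (subst Bochner_Integration.integral_add)
         (auto simp: ik im ker_integral_shift ker_moment_shift simp del: vector_minus_component)
    finally show ?thesis by (simp add: C_def)
  qed
  have "(\<lambda>n. C / (2 * real n + 4)) \<longlonglongrightarrow> 0"
  proof (rule Lim_null_comparison)
    show "\<forall>\<^sub>F n in sequentially. norm (C / (2 * real n + 4)) \<le> \<bar>C\<bar> * inverse (real (Suc n))"
      by (rule always_eventually) (auto simp: field_simps intro!: mult_left_mono add_mono)
    show "(\<lambda>n. \<bar>C\<bar> * inverse (real (Suc n))) \<longlonglongrightarrow> 0"
      by (intro tendsto_mult_right_zero LIMSEQ_inverse_real_of_nat)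
  qed
  then have "eventually (\<lambda>n. C / (2 * real n + 4) < e / 2) sequentially"
    using e by (intro order_tendstoD) auto
  then show "\<exists>no. \<forall>n\<ge>no. norm (S n g x - g x) < e"
    unfolding eventually_sequentially
  proof (elim exE, intro exI allI impI)
    fix no n assume "\<forall>n\<ge>no. C / (2 * real n + 4) < e / 2" "no \<le> n"
    then have "C / (2 * real n + 4) < e / 2" by blast
    then show "norm (S n g x - g x) < e" using est[of n] unfolding real_norm_def by linarith
  qed
qed

lemma AE_torus_interior: "AE x in torus. x \<in> box 0 (One :: real^'n)"
proof -
  have "negligible ((cbox 0 One :: (real^'n) set) - box 0 One)"
    using negligible_frontier_interval .
  then have "AE x in lebesgue. x \<notin> (cbox 0 One :: (real^'n) set) - box 0 One"
    unfolding negligible_iff_null_sets by (rule AE_not_in)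
  then have "AE x in lborel. x \<notin> (cbox 0 One :: (real^'n) set) - box 0 One"
    by (simp add: AE_completion_iff)
  then show ?thesis
    unfolding AE_torus by eventually_elim (auto simp: cell_def)
qed

lemma l2_tendsto_dominated:
  fixes w :: "real^'n \<Rightarrow> real"
  assumes [measurable]: "\<And>k. h k \<in> borel_measurable borel" and "AE x in torus. (\<lambda>k. h k x) \<longlonglongrightarrow> 0"
    and L: "L2 w" and le: "\<And>k x. \<bar>h k x\<bar> \<le> \<bar>w x\<bar>"
  shows "(\<lambda>k. l2 (h k)) \<longlonglongrightarrow> 0"
proof -
  have "(\<lambda>k. (LINT x|torus. (h k x)\<^sup>2)) \<longlonglongrightarrow> integral\<^sup>L torus (\<lambda>x::real^'n. 0)"
  proof (rule integral_dominated_convergence[where w = "\<lambda>x. (w x)\<^sup>2"])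
    show "AE x in torus. (\<lambda>k. (h k x)\<^sup>2) \<longlonglongrightarrow> 0"
      using assms(2) by eventually_elim (auto intro!: tendsto_eq_intros)
    show "AE x in torus. norm ((h k x)\<^sup>2) \<le> (w x)\<^sup>2" for k
      using le by (auto simp: abs_le_square_iff)
  qed (use L2_sq[OF L] in auto)
  then have "(\<lambda>k. sqrt (LINT x|torus. (h k x)\<^sup>2)) \<longlonglongrightarrow> sqrt 0"
    by (intro tendsto_real_sqrt) simp
  then show ?thesis by (simp add: l2_def)
qed

text \<open>Three-epsilon argument: \<open>S n\<close> is a contraction, so convergence at
  \<open>g\<close> passes to every \<open>f\<close> that such \<open>g\<close> approximate.\<close>

lemma S_approx_closed:
  assumes f: "L2 f" and g: "\<And>e. 0 < e \<Longrightarrow> \<exists>g. L2 g \<and> (\<lambda>n. l2 (\<lambda>x. S n g x - g x)) \<longlonglongrightarrow> 0 \<and> l2 (\<lambda>x. f x - g x) < e"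
  shows "(\<lambda>n. l2 (\<lambda>x. S n f x - f x)) \<longlonglongrightarrow> 0"
proof (rule LIMSEQ_I)
  fix e :: real assume "0 < e"
  then obtain g where g: "L2 g" "(\<lambda>n. l2 (\<lambda>x. S n g x - g x)) \<longlonglongrightarrow> 0" "l2 (\<lambda>x. f x - g x) < e / 3"
    using assms(2)[of "e/3"] by auto
  have "eventually (\<lambda>n. l2 (\<lambda>x. S n g x - g x) < e / 3) sequentially"
    using g(2) \<open>0 < e\<close> by (intro order_tendstoD) auto
  then obtain N where N: "\<And>n. n \<ge> N \<Longrightarrow> l2 (\<lambda>x. S n g x - g x) < e / 3"
    by (auto simp: eventually_sequentially)
  have "l2 (\<lambda>x. S n f x - f x) < e" if "n \<ge> N" for n
  proof -
    have "(\<lambda>x. S n f x - S n g x) = S n (\<lambda>x. f x - g x)"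
      using conv_diff(1)[OF ker_cont ker_periodic L2_integrable[OF f] L2_integrable[OF g(1)], of n] by auto
    then have 1: "l2 (\<lambda>x. S n f x - S n g x) \<le> l2 (\<lambda>x. f x - g x)"
      using S_L2(2)[OF L2_diff[OF f g(1)], of n] by simp
    have "l2 (\<lambda>x. S n f x - f x) \<le> l2 (\<lambda>x. S n f x - S n g x) + l2 (\<lambda>x. S n g x - f x)"
      by (rule l2_dist_triangle[OF S_L2(1)[OF f] S_L2(1)[OF g(1)] f])
    also have "l2 (\<lambda>x. S n g x - f x) \<le> l2 (\<lambda>x. S n g x - g x) + l2 (\<lambda>x. g x - f x)"
      by (rule l2_dist_triangle[OF S_L2(1)[OF g(1)] g(1) f])
    also have "l2 (\<lambda>x. g x - f x) = l2 (\<lambda>x. f x - g x)" by (rule l2_commute)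
    finally show ?thesis using 1 N[OF that] g(3) by linarith
  qed
  then show "\<exists>no. \<forall>n\<ge>no. norm (l2 (\<lambda>x. S n f x - f x) - 0) < e"
    by (auto simp: l2_nonneg)
qed

text \<open>The class of good functions grows in three stages: bounded continuous functions, bounded
  measurable ones as almost everywhere limits of clamped continuous functions, and all of
  \<open>L2\<close> by truncation.\<close>

theorem S_tendsto_L2:
  assumes f: "L2 (f :: real^'n \<Rightarrow> real)"
  shows "(\<lambda>n. l2 (\<lambda>x. S n f x - f x)) \<longlonglongrightarrow> 0"
proof -
  have cont: "(\<lambda>n. l2 (\<lambda>x. S n g x - g x)) \<longlonglongrightarrow> 0" if c: "continuous_on UNIV g" and b: "\<And>x. \<bar>g x\<bar> \<le> B" for g :: "real^'n \<Rightarrow> real" and B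
  proof -
    have [measurable]: "g \<in> borel_measurable borel" using c by (rule borel_cont)
    have i: "integrable torus g" by (rule integrable_torus_bounded[OF _ b]) measurable
    have Sb: "\<bar>S n g x\<bar> \<le> B" for n x
    proof -
      have "S n g x \<le> S n (\<lambda>_. B) x" "S n (\<lambda>_. - B) x \<le> S n g x"
        using b i by (auto intro!: conv_mono ker_cont ker_periodic ker_nonneg simp: abs_le_iff minus_le_iff)
      then show ?thesis by (simp add: S_one abs_le_iff)
    qed
    show ?thesis
    proof (rule l2_tendsto_dominated[where w = "\<lambda>_. 2 * B"])
      have [measurable]: "S n g \<in> borel_measurable borel" for n
        by (intro conv_measurable ker_cont ker_periodic i)
      show "(\<lambda>x. S n g x - g x) \<in> borel_measurable borel" for n by measurable
      show "AE x in torus. (\<lambda>n. S n g x - g x) \<longlonglongrightarrow> 0"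
        using AE_torus_interior
        by eventually_elim (use S_tendsto_continuous[OF c b] in \<open>auto simp: LIM_zero\<close>)
      show "\<bar>S n g x - g x\<bar> \<le> \<bar>2 * B\<bar>" for n x
        using Sb[of n x] b[of x] by linarith
    qed (rule L2_const)
  qed
  have bdd: "(\<lambda>n. l2 (\<lambda>x. S n g x - g x)) \<longlonglongrightarrow> 0" if [measurable]: "g \<in> borel_measurable borel" and b: "\<And>x. \<bar>g x\<bar> \<le> B" for g :: "real^'n \<Rightarrow> real" and B
  proof (rule S_approx_closed)
    show "L2 g" by (rule L2_bounded[OF that])
    fix e :: real assume e: "0 < e"
    have "g \<in> borel_measurable lebesgue" using measurable_completion[of g lborel borel] by simp
    then have "g measurable_on UNIV" by (rule lebesgue_measurable_imp_measurable_on) simp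
    then obtain N h where N: "negligible N" and h: "\<And>n. continuous_on UNIV (h n)"
      "\<And>x. x \<notin> N \<Longrightarrow> (\<lambda>n. h n x) \<longlonglongrightarrow> g x"
      unfolding measurable_on_def by auto
    \<comment> \<open>Clamping to \<open>[-B, B]\<close> provides a constant majorant and leaves the
      limit unchanged, because \<open>g\<close> takes its values there.\<close>
    define h' where "h' n x = max (- B) (min B (h n x))" for n x
    have ch: "continuous_on UNIV (h' n)" for n unfolding h'_def by (intro continuous_intros h)
    have [measurable]: "h' n \<in> borel_measurable borel" for n using ch by (rule borel_cont)
    have B: "0 \<le> B" using b[of undefined] by linarith
    have bh: "\<bar>h' n x\<bar> \<le> B" for n x using B by (auto simp: h'_def)
    have "(\<lambda>n. l2 (\<lambda>x. g x - h' n x)) \<longlonglongrightarrow> 0"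
    proof (rule l2_tendsto_dominated[where w = "\<lambda>_. 2 * B"])
      have "AE x in lebesgue. x \<notin> N" using N by (simp add: negligible_iff_null_sets AE_not_in)
      then have "AE x in lebesgue. (\<lambda>n. g x - h' n x) \<longlonglongrightarrow> 0"
      proof eventually_elim
        case (elim x)
        have "(\<lambda>n. h' n x) \<longlonglongrightarrow> max (- B) (min B (g x))"
          unfolding h'_def by (intro tendsto_intros h elim)
        moreover have "max (- B) (min B (g x)) = g x" using b[of x] by auto
        ultimately have "(\<lambda>n. g x - h' n x) \<longlonglongrightarrow> g x - g x" by (intro tendsto_intros) simp
        then show ?case by simp
      qed
      then have "AE x in lborel. (\<lambda>n. g x - h' n x) \<longlonglongrightarrow> 0" by (simp add: AE_completion_iff)
      then show "AE x in torus. (\<lambda>n. g x - h' n x) \<longlonglongrightarrow> 0" unfolding AE_torus by eventually_elim auto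
      show "\<bar>g x - h' n x\<bar> \<le> \<bar>2 * B\<bar>" for n x using bh[of n x] b[of x] by linarith
    qed (auto intro: L2_const)
    then have "eventually (\<lambda>n. l2 (\<lambda>x. g x - h' n x) < e) sequentially"
      using e by (intro order_tendstoD) auto
    then obtain n where "l2 (\<lambda>x. g x - h' n x) < e" by (auto simp: eventually_sequentially)
    then show "\<exists>h. L2 h \<and> (\<lambda>n. l2 (\<lambda>x. S n h x - h x)) \<longlonglongrightarrow> 0 \<and> l2 (\<lambda>x. g x - h x) < e"
    proof (intro exI conjI)
      show "L2 (h' n)" by (rule L2_bounded[OF _ bh]) measurable
      show "(\<lambda>k. l2 (\<lambda>x. S k (h' n) x - h' n x)) \<longlonglongrightarrow> 0" by (rule cont[OF ch bh])
    qed
  qed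
  have [measurable]: "f \<in> borel_measurable borel" using f by (simp add: L2_def)
  show ?thesis
  proof (rule S_approx_closed[OF f])
    fix e :: real assume e: "0 < e"
    define h where "h n x = max (- real n) (min (real n) (f x))" for n x
    have [measurable]: "h n \<in> borel_measurable borel" for n unfolding h_def by measurable
    have bh: "\<bar>h n x\<bar> \<le> real n" for n x by (auto simp: h_def)
    have "(\<lambda>n. l2 (\<lambda>x. f x - h n x)) \<longlonglongrightarrow> 0"
    proof (rule l2_tendsto_dominated[OF _ _ f])
      show "AE x in torus. (\<lambda>n. f x - h n x) \<longlonglongrightarrow> 0"
      proof (rule AE_I2)
        fix x
        have "eventually (\<lambda>n. f x - h n x = 0) sequentially"
          using eventually_ge_at_top[of "nat \<lceil>\<bar>f x\<bar>\<rceil>"]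
          by eventually_elim (auto simp: h_def abs_le_iff ceiling_le_iff nat_le_iff)
        then show "(\<lambda>n. f x - h n x) \<longlonglongrightarrow> 0" by (rule tendsto_eventually)
      qed
      show "\<bar>f x - h n x\<bar> \<le> \<bar>f x\<bar>" for n x by (auto simp: h_def)
    qed measurable
    then have "eventually (\<lambda>n. l2 (\<lambda>x. f x - h n x) < e) sequentially"
      using e by (intro order_tendstoD) auto
    then obtain n where "l2 (\<lambda>x. f x - h n x) < e" by (auto simp: eventually_sequentially)
    then show "\<exists>h. L2 h \<and> (\<lambda>n. l2 (\<lambda>x. S n h x - h x)) \<longlonglongrightarrow> 0 \<and> l2 (\<lambda>x. f x - h x) < e"
    proof (intro exI conjI)
      show "L2 (h n)" by (rule L2_bounded[OF _ bh]) measurable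
      show "(\<lambda>k. l2 (\<lambda>x. S k (h n) x - h n x)) \<longlonglongrightarrow> 0" by (rule bdd[OF _ bh]) measurable
    qed
  qed
qed

section \<open>The mollified velocity\<close>

lemma l2_shift:
  assumes "continuous_on UNIV f" "periodic_sp f"
  shows "l2 (\<lambda>x. f (x + a)) = l2 f"
proof -
  have c: "continuous_on UNIV (\<lambda>x. (f x)\<^sup>2)" by (intro continuous_intros assms)
  have p: "periodic_sp (\<lambda>x. (f x)\<^sup>2)"
    using assms(2) by (simp add: periodic_sp_def)
  show ?thesis unfolding l2_def using integral_torus_shift[OF c p, of a] by (rule arg_cong)
qed

lemma cont_shift:
  fixes f :: "real^'n \<Rightarrow> real"
  assumes "continuous_on UNIV f"
  shows "continuous_on UNIV (\<lambda>x. f (x + a))"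
  by (rule continuous_on_compose2[OF assms]) (auto intro: continuous_intros)

lemma L2_shift: "continuous_on UNIV f \<Longrightarrow> periodic_sp f \<Longrightarrow> L2 (\<lambda>x. f (x + a))"
  by (intro L2_periodic cont_shift periodic_sp_shift)

lemma l2_multi_shift:
  fixes v :: "real^'n \<Rightarrow> real"
  assumes c: "continuous_on UNIV v" "periodic_sp v"
  shows "l2 (\<lambda>x. v (x + real k *\<^sub>R a) - v x) \<le> real k * l2 (\<lambda>x. v (x + a) - v x)"
proof (induction k)
  case 0
  then show ?case by (simp add: l2_def)
next
  case (Suc k)
  have "l2 (\<lambda>x. v (x + real (Suc k) *\<^sub>R a) - v x)
      \<le> l2 (\<lambda>x. v (x + real (Suc k) *\<^sub>R a) - v (x + a)) + l2 (\<lambda>x. v (x + a) - v x)"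
    by (intro l2_dist_triangle L2_shift L2_periodic c)
  also have "(\<lambda>x. v (x + real (Suc k) *\<^sub>R a) - v (x + a)) = (\<lambda>x. (\<lambda>y. v (y + real k *\<^sub>R a) - v y) (x + a))"
    by (auto simp: algebra_simps)
  also have "l2 (\<lambda>x. (\<lambda>y. v (y + real k *\<^sub>R a) - v y) (x + a)) = l2 (\<lambda>y. v (y + real k *\<^sub>R a) - v y)"
  proof (rule l2_shift)
    show "continuous_on UNIV (\<lambda>y. v (y + real k *\<^sub>R a) - v y)"
      by (intro continuous_intros cont_shift c)
    show "periodic_sp (\<lambda>y. v (y + real k *\<^sub>R a) - v y)"
      using periodic_sp_shift[OF c(2), of "real k *\<^sub>R a"] c(2) by (simp add: periodic_sp_def)
  qed
  also note Suc
  finally show ?case by (simp add: algebra_simps)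
qed

text \<open>The shift is divided into \<open>Suc m\<close> equal steps. Each is \<open>s m\<close>
  times a difference quotient, whose norm tends to that of \<open>v'\<close>, and the steps add up
  by the triangle inequality and translation invariance.\<close>

lemma l2_shift_coord:
  assumes pd: "pd j v v'"
  shows "l2 (\<lambda>x. v (x + h *\<^sub>R axis j 1) - v x) \<le> \<bar>h\<bar> * l2 v'"
proof (cases "h = 0")
  case True
  then show ?thesis by (simp add: l2_def)
next
  case False
  note c = pd_cont[OF pd] and p = pd_periodic[OF pd] pd_periodic'[OF pd]
  obtain B where B: "0 \<le> B" "\<And>x. \<bar>v' x\<bar> \<le> B"
    using periodic_bounded[OF c(2) p(2)] by blast
  have [measurable]: "v \<in> borel_measurable borel" "v' \<in> borel_measurable borel"
    using c by (auto intro: borel_cont)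
  define s where "s m = h / real (Suc m)" for m
  have s0: "s m \<noteq> 0" for m using False by (simp add: s_def)
  define Q where "Q m x = (v (x + s m *\<^sub>R axis j 1) - v x) / s m" for m x
  have QB: "\<bar>Q m x\<bar> \<le> B" for m x
    using pd_Lipschitz[OF pd B(2), of x "s m"] s0[of m] by (simp add: Q_def abs_divide pos_divide_le_eq)
  have [measurable]: "Q m \<in> borel_measurable borel" for m unfolding Q_def by measurable
  have LQ: "L2 (Q m)" for m by (rule L2_bounded[OF _ QB]) measurable
  have Lv: "L2 v'" by (rule L2_periodic[OF c(2) p(2)])
  have "(\<lambda>m. l2 (\<lambda>x. Q m x - v' x)) \<longlonglongrightarrow> 0"
  proof (rule l2_tendsto_dominated[where w = "\<lambda>_. 2 * B"])
    show "AE x in torus. (\<lambda>m. Q m x - v' x) \<longlonglongrightarrow> 0"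
    proof (rule AE_I2)
      fix x
      have "((\<lambda>h. (v (x + (0 + h) *\<^sub>R axis j 1) - v (x + 0 *\<^sub>R axis j 1)) / h) \<longlongrightarrow> v' x) (at 0)"
        using pd unfolding pd_def DERIV_def by blast
      moreover have "s \<longlonglongrightarrow> 0" unfolding s_def
        using tendsto_mult_right_zero[OF LIMSEQ_inverse_real_of_nat, of h] by (simp add: divide_inverse)
      ultimately have "(\<lambda>m. Q m x) \<longlonglongrightarrow> v' x"
        unfolding tendsto_at_iff_sequentially Q_def using s0 by (auto simp: o_def)
      then show "(\<lambda>m. Q m x - v' x) \<longlonglongrightarrow> 0" by (rule LIM_zero)
    qed
    show "\<bar>Q m x - v' x\<bar> \<le> \<bar>2 * B\<bar>" for m x using QB[of m x] B(2)[of x] by linarith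
  qed (auto intro: L2_const)
  then have lim: "(\<lambda>m. \<bar>h\<bar> * (l2 (\<lambda>x. Q m x - v' x) + l2 v')) \<longlonglongrightarrow> \<bar>h\<bar> * (0 + l2 v')"
    by (intro tendsto_intros)
  have "l2 (\<lambda>x. v (x + h *\<^sub>R axis j 1) - v x) \<le> \<bar>h\<bar> * (l2 (\<lambda>x. Q m x - v' x) + l2 v')" for m
  proof -
    have h: "h = real (Suc m) * s m" by (simp add: s_def del: of_nat_Suc)
    have "l2 (\<lambda>x. v (x + h *\<^sub>R axis j 1) - v x) \<le> real (Suc m) * l2 (\<lambda>x. v (x + s m *\<^sub>R axis j 1) - v x)"
      using l2_multi_shift[OF c(1) p(1), of "Suc m" "s m *\<^sub>R axis j 1"] h by simp
    also have "(\<lambda>x. v (x + s m *\<^sub>R axis j 1) - v x) = (\<lambda>x. s m * Q m x)"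
      using s0 by (simp add: Q_def)
    also have "real (Suc m) * l2 (\<lambda>x. s m * Q m x) = \<bar>h\<bar> * l2 (Q m)"
      by (simp add: l2_cmult h abs_mult del: of_nat_Suc)
    also have "l2 (Q m) \<le> l2 (\<lambda>x. Q m x - v' x) + l2 v'"
      using l2_triangle[OF L2_diff[OF LQ[of m] Lv] Lv] by simp
    finally show ?thesis by (simp add: mult_left_mono)
  qed
  from LIMSEQ_le_const[OF lim] this show ?thesis by auto
qed

lemma l2_shift_vec:
  fixes v :: "real^'n \<Rightarrow> real"
  assumes pd: "\<And>j. pd j v (v' j)"
  shows "l2 (\<lambda>x. v (x + a) - v x) \<le> (\<Sum>j\<in>UNIV. \<bar>a $ j\<bar> * l2 (v' j))"
proof -
  have cp: "continuous_on UNIV v" "periodic_sp v"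
    using pd_cont(1)[OF pd] pd_periodic[OF pd] by auto
  have "l2 (\<lambda>x. v (x + (\<Sum>j\<in>J. a $ j *\<^sub>R axis j 1)) - v x) \<le> (\<Sum>j\<in>J. \<bar>a $ j\<bar> * l2 (v' j))"
    if "finite J" for J
    using that
  proof induction
    case empty
    then show ?case by (simp add: l2_def)
  next
    case (insert i J)
    let ?b = "\<Sum>j\<in>J. a $ j *\<^sub>R axis j 1 :: real^'n"
    have "l2 (\<lambda>x. v (x + (a $ i *\<^sub>R axis i 1 + ?b)) - v x)
        \<le> l2 (\<lambda>x. v (x + (a $ i *\<^sub>R axis i 1 + ?b)) - v (x + ?b)) + l2 (\<lambda>x. v (x + ?b) - v x)"
      by (intro l2_dist_triangle L2_shift L2_periodic cp)
    also have "(\<lambda>x. v (x + (a $ i *\<^sub>R axis i 1 + ?b)) - v (x + ?b)) = (\<lambda>x. (\<lambda>y. v (y + a $ i *\<^sub>R axis i 1) - v y) (x + ?b))"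
      by (auto simp: algebra_simps)
    also have "l2 (\<lambda>x. (\<lambda>y. v (y + a $ i *\<^sub>R axis i 1) - v y) (x + ?b)) = l2 (\<lambda>y. v (y + a $ i *\<^sub>R axis i 1) - v y)"
    proof (rule l2_shift)
      show "continuous_on UNIV (\<lambda>y. v (y + a $ i *\<^sub>R axis i 1) - v y)"
        by (intro continuous_intros cont_shift cp)
      show "periodic_sp (\<lambda>y. v (y + a $ i *\<^sub>R axis i 1) - v y)"
        using periodic_sp_shift[OF cp(2), of "a $ i *\<^sub>R axis i 1"] cp(2) by (simp add: periodic_sp_def)
    qed
    also have "\<dots> \<le> \<bar>a $ i\<bar> * l2 (v' i)" by (rule l2_shift_coord[OF pd])
    finally show ?case using insert by simp
  qed
  from this[of UNIV] have "l2 (\<lambda>x. v (x + (\<Sum>j\<in>UNIV. a $ j *\<^sub>R axis j 1)) - v x) \<le> (\<Sum>j\<in>UNIV. \<bar>a $ j\<bar> * l2 (v' j))"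
    by simp
  moreover have "(\<Sum>j\<in>UNIV. a $ j *\<^sub>R axis j 1) = a"
    by (simp add: vec_eq_iff axis_def if_distrib sum.delta cong: if_cong)
  ultimately show ?thesis by simp
qed

text \<open>Rounding \<open>a\<close> to the nearest integer vector leaves coordinates of size at
  most 1/2, where the squared displacement lies below \<open>1 - csq\<close>. In this form the bound
  can be integrated against \<open>ker\<close> by \<open>ker_moment\<close>; the dimension comes
  from squaring a sum over coordinates.\<close>

lemma l2_shift_periodic:
  fixes v :: "real^'n \<Rightarrow> real"
  assumes pd: "\<And>j. pd j v (v' j)"
  shows "(l2 (\<lambda>x. v (x + a) - v x))\<^sup>2 \<le> real CARD('n) * (\<Sum>j\<in>UNIV. (1 - csq (a $ j)) * (l2 (v' j))\<^sup>2)"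
proof -
  define k :: "real^'n" where "k = (\<chi> j. of_int (round (a $ j)))"
  have k: "int_vec k" by (simp add: k_def int_vec_def)
  have "v (x + a) = v (x + (a - k))" for x
    using periodic_sp_minus[OF pd_periodic[OF pd] k, of "x + a"] by (simp add: algebra_simps)
  then have "l2 (\<lambda>x. v (x + a) - v x) \<le> (\<Sum>j\<in>UNIV. \<bar>(a - k) $ j\<bar> * l2 (v' j))"
    using l2_shift_vec[OF pd, of "a - k"] by simp
  then have "(l2 (\<lambda>x. v (x + a) - v x))\<^sup>2 \<le> (\<Sum>j\<in>UNIV. \<bar>(a - k) $ j\<bar> * l2 (v' j))\<^sup>2"
    by (intro power_mono l2_nonneg)
  also have "\<dots> \<le> (\<Sum>j\<in>UNIV. (\<bar>(a - k) $ j\<bar> * l2 (v' j))\<^sup>2) * real CARD('n)"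
    using sum_squared_le_sum_of_squares[of "\<lambda>j. \<bar>(a - k) $ j\<bar> * l2 (v' j)" "UNIV :: 'n set"] by simp
  also have "\<dots> \<le> (\<Sum>j\<in>UNIV. (1 - csq (a $ j)) * (l2 (v' j))\<^sup>2) * real CARD('n)"
  proof (intro mult_right_mono sum_mono)
    fix j
    have "\<bar>(a - k) $ j\<bar> \<le> 1/2" using of_int_round_abs_le[of "a $ j"] by (simp add: k_def abs_minus_commute)
    then have "((a - k) $ j)\<^sup>2 \<le> 1 - csq ((a - k) $ j)" by (rule square_le_one_minus_csq)
    also have "csq ((a - k) $ j) = csq (a $ j)"
      using csq_scs_periodic(1)[of "- k $ j" "a $ j"] by (simp add: k_def)
    finally show "(\<bar>(a - k) $ j\<bar> * l2 (v' j))\<^sup>2 \<le> (1 - csq (a $ j)) * (l2 (v' j))\<^sup>2"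
      by (simp add: power_mult_distrib mult_right_mono del: vector_minus_component)
  qed simp
  finally show ?thesis by (simp add: mult.commute)
qed

text \<open>The nonlocal Dirichlet form of the kernel. By \<open>Dn_expand\<close> it is twice the
  quadratic form of the identity minus \<open>S n\<close>, which makes it continuous in
  \<open>L2\<close>.\<close>

definition Dn :: "nat \<Rightarrow> (real^'n::finite \<Rightarrow> real) \<Rightarrow> real" where
  "Dn n u = (LINT x|torus. conv (ker n) (\<lambda>z. (u z - u x)\<^sup>2) x)"

lemma S_square_expand:
  assumes u: "L2 u"
  shows "conv (ker n) (\<lambda>z. (u z - c)\<^sup>2) x = S n (\<lambda>z. (u z)\<^sup>2) x - 2 * (c * S n u x) + c\<^sup>2"
proof -
  note i = conv_integrable[OF ker_cont ker_periodic L2_sq[OF u], of n x]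
    conv_integrable[OF ker_cont ker_periodic L2_integrable[OF u], of n x]
    integrable_torus_periodic[OF shift_kernel[OF ker_cont ker_periodic], of n x]
  have "conv (ker n) (\<lambda>z. (u z - c)\<^sup>2) x = (LINT z|torus. ker n (x - z) * (u z)\<^sup>2 - (2 * c) * (ker n (x - z) * u z) + c\<^sup>2 * ker n (x - z))"
    unfolding conv_def by (intro Bochner_Integration.integral_cong) (auto simp: power2_eq_square algebra_simps)
  then show ?thesis using i by (simp add: conv_def ker_integral_shift)
qed

lemma Dn_expand:
  assumes u: "L2 u"
  shows "Dn n u = 2 * ((l2 u)\<^sup>2 - (LINT x|torus. u x * S n u x))"
    and "integrable torus (\<lambda>x. conv (ker n) (\<lambda>z. (u z - u x)\<^sup>2) x)"
proof -
  note S_square_expand[OF u, simp]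
  note i = S_integral(2)[OF L2_sq[OF u], of n] L2_mult(1)[OF u S_L2(1)[OF u], of n] L2_sq[OF u]
  show "integrable torus (\<lambda>x. conv (ker n) (\<lambda>z. (u z - u x)\<^sup>2) x)" using i by simp
  show "Dn n u = 2 * ((l2 u)\<^sup>2 - (LINT x|torus. u x * S n u x))"
    unfolding Dn_def l2_sq using i by (simp add: S_integral(1)[OF L2_sq[OF u]])
qed

text \<open>The substitution \<open>z = x + a\<close> makes the kernel depend on \<open>a\<close>
  only; after exchanging the integrals the inner one is a squared translation norm.\<close>

lemma Dn_bound_smooth:
  fixes v :: "real^'n \<Rightarrow> real"
  assumes pd: "\<And>j. pd j v (v' j)"
  shows "Dn n v \<le> real CARD('n) / (2 * real n + 4) * (\<Sum>j\<in>UNIV. (l2 (v' j))\<^sup>2)"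
proof -
  interpret P: pair_sigma_finite "torus :: (real^'n) measure" "torus :: (real^'n) measure" by (rule pair_torus)
  have c: "continuous_on UNIV v" and p: "periodic_sp v"
    using pd_cont(1)[OF pd] pd_periodic[OF pd] by auto
  obtain B where B: "0 \<le> B" "\<And>x. \<bar>v x\<bar> \<le> B" using periodic_bounded[OF c p] by blast
  obtain BK where BK: "0 \<le> BK" "\<And>x::real^'n. \<bar>ker n x\<bar> \<le> BK"
    using periodic_bounded[OF ker_cont ker_periodic] by blast
  have [measurable]: "v \<in> borel_measurable borel" "(ker n :: real^'n \<Rightarrow> real) \<in> borel_measurable borel"
    using c ker_cont by (auto intro: borel_cont)
  have inner: "conv (ker n) (\<lambda>z. (v z - v x)\<^sup>2) x = (LINT a|torus. ker n a * (v (x + a) - v x)\<^sup>2)" for x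
  proof -
    let ?G = "\<lambda>z. ker n (x - z) * (v z - v x)\<^sup>2"
    have "continuous_on UNIV ?G" by (intro continuous_intros shift_kernel ker_cont ker_periodic c)
    moreover have "periodic_sp ?G"
      using shift_kernel(2)[OF ker_cont ker_periodic, of n x] p by (auto simp: periodic_sp_def)
    ultimately have "(LINT a|torus. ?G (a + x)) = integral\<^sup>L torus ?G"
      by (rule integral_torus_shift)
    moreover have "ker n (x - (a + x)) = ker n a" for a using ker_even[of n a] by simp
    ultimately show ?thesis by (simp add: conv_def add.commute)
  qed
  let ?F = "\<lambda>(x, a). ker n a * (v (x + a) - v x)\<^sup>2"
  have I: "integrable (torus \<Otimes>\<^sub>M torus) ?F"
  proof (rule finite_measure.integrable_const_bound[where B = "BK * (2 * B)\<^sup>2"])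
    show "finite_measure (torus \<Otimes>\<^sub>M torus :: ((real^'n) \<times> (real^'n)) measure)"
      by (rule finite_measure_pair_measure) unfold_locales
    show "AE z in torus \<Otimes>\<^sub>M torus. norm (?F z) \<le> BK * (2 * B)\<^sup>2"
    proof (rule AE_I2, clarify)
      fix x a
      have "\<bar>v (x + a) - v x\<bar> \<le> 2 * B" using B(2)[of "x + a"] B(2)[of x] by linarith
      then have "\<bar>v (x + a) - v x\<bar>\<^sup>2 \<le> (2 * B)\<^sup>2" by (intro power_mono) auto
      then show "norm (ker n a * (v (x + a) - v x)\<^sup>2) \<le> BK * (2 * B)\<^sup>2"
        unfolding norm_mult using BK by (intro mult_mono) auto
    qed
    show "?F \<in> borel_measurable (torus \<Otimes>\<^sub>M torus)" by measurable
  qed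
  have "Dn n v = (LINT x|torus. (LINT a|torus. ?F (x, a)))"
    by (simp add: Dn_def inner)
  also have "\<dots> = (LINT a|torus. (LINT x|torus. ?F (x, a)))"
    using P.Fubini_integral[of "\<lambda>x z. ?F (x, z)"] I by (simp add: case_prod_beta')
  also have "\<dots> = (LINT a|torus. ker n a * (l2 (\<lambda>x. v (x + a) - v x))\<^sup>2)"
    by (simp add: l2_sq)
  also have "\<dots> \<le> (LINT a|torus. real CARD('n) * (\<Sum>j\<in>UNIV. (l2 (v' j))\<^sup>2 * (ker n a * (1 - csq (a $ j)))))"
  proof (rule integral_mono)
    have "integrable torus (\<lambda>a. (LINT x|torus. ?F (x, a)))"
      using P.integrable_snd[of "\<lambda>x a. ?F (x, a)"] I by (simp add: case_prod_beta')
    then show "integrable torus (\<lambda>a. ker n a * (l2 (\<lambda>x. v (x + a) - v x))\<^sup>2)" by (simp add: l2_sq)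
    show "integrable torus (\<lambda>a. real CARD('n) * (\<Sum>j\<in>UNIV. (l2 (v' j))\<^sup>2 * (ker n a * (1 - csq (a $ j)))))"
    proof (intro integrable_mult_right Bochner_Integration.integrable_sum integrable_torus_periodic)
      fix j
      show "continuous_on UNIV (\<lambda>a. (ker n a * (1 - csq (a $ j))))" by (intro continuous_intros ker_cont)
      show "periodic_sp (\<lambda>a. (ker n a * (1 - csq (a $ j))))"
        using ker_periodic[of n] by (auto simp: periodic_sp_def int_vec_def csq_scs_periodic)
    qed
    fix a :: "real^'n"
    have "ker n a * (l2 (\<lambda>x. v (x + a) - v x))\<^sup>2 \<le> ker n a * (real CARD('n) * (\<Sum>j\<in>UNIV. (1 - csq (a $ j)) * (l2 (v' j))\<^sup>2))"
      by (intro mult_left_mono l2_shift_periodic pd ker_nonneg)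
    also have "\<dots> = real CARD('n) * (\<Sum>j\<in>UNIV. (l2 (v' j))\<^sup>2 * (ker n a * (1 - csq (a $ j))))"
      by (simp add: sum_distrib_left mult_ac)
    finally show "ker n a * (l2 (\<lambda>x. v (x + a) - v x))\<^sup>2 \<le> real CARD('n) * (\<Sum>j\<in>UNIV. (l2 (v' j))\<^sup>2 * (ker n a * (1 - csq (a $ j))))" .
  qed
  also have "\<dots> = real CARD('n) * (\<Sum>j\<in>UNIV. (l2 (v' j))\<^sup>2 * (1 / (2 * real n + 4)))"
  proof -
    have i: "integrable torus (\<lambda>a. (ker n a * (1 - csq (a $ j))))" for j :: 'n
    proof (rule integrable_torus_periodic)
      show "continuous_on UNIV (\<lambda>a. (ker n a * (1 - csq (a $ j))))" by (intro continuous_intros ker_cont)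
      show "periodic_sp (\<lambda>a. (ker n a * (1 - csq (a $ j))))"
        using ker_periodic[of n] by (auto simp: periodic_sp_def int_vec_def csq_scs_periodic)
    qed
    show ?thesis
      by (subst integral_mult_right_zero, subst Bochner_Integration.integral_sum)
         (intro integrable_mult_right i, simp add: ker_moment)
  qed
  also have "\<dots> = real CARD('n) / (2 * real n + 4) * (\<Sum>j\<in>UNIV. (l2 (v' j))\<^sup>2)"
    by (simp add: sum_divide_distrib[symmetric])
  finally show ?thesis .
qed

lemma l2_lipschitz: "L2 f \<Longrightarrow> L2 g \<Longrightarrow> \<bar>l2 f - l2 g\<bar> \<le> l2 (\<lambda>x. f x - g x)"
  using l2_triangle[OF L2_diff[of f g], of g] l2_triangle[OF L2_diff[of g f], of f] l2_commute[of f g]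
  by auto

lemma l2_tendsto:
  assumes "L2 f" "\<And>m. L2 (F m)" "((\<lambda>m. l2 (\<lambda>x. F m x - f x)) \<longlongrightarrow> 0) sequentially"
  shows "((\<lambda>m. l2 (F m)) \<longlonglongrightarrow> l2 f)"
  by (rule LIM_zero_cancel, rule Lim_null_comparison[OF always_eventually assms(3)])
     (use l2_lipschitz[OF assms(2,1)] in auto)

lemma L2_inner_tendsto:
  assumes f: "L2 f" "\<And>m. L2 (F m)" "(\<lambda>m. l2 (\<lambda>x. F m x - f x)) \<longlonglongrightarrow> 0"
    and g: "L2 g" "\<And>m. L2 (G m)" "(\<lambda>m. l2 (\<lambda>x. G m x - g x)) \<longlonglongrightarrow> 0"
  shows "(\<lambda>m. (LINT x|torus. F m x * G m x)) \<longlonglongrightarrow> (LINT x|torus. f x * g x)"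
proof (rule LIM_zero_cancel, rule Lim_null_comparison)
  have d: "L2 (\<lambda>x. F m x - f x)" "L2 (\<lambda>x. G m x - g x)" for m
    using L2_diff f g by blast+
  show "\<forall>\<^sub>F m in sequentially. norm ((LINT x|torus. F m x * G m x) - (LINT x|torus. f x * g x))
     \<le> l2 (\<lambda>x. F m x - f x) * l2 (G m) + l2 f * l2 (\<lambda>x. G m x - g x)"
  proof (rule always_eventually, rule allI)
    fix m
    have "(LINT x|torus. F m x * G m x) - (LINT x|torus. f x * g x)
      = (LINT x|torus. (F m x - f x) * G m x) + (LINT x|torus. f x * (G m x - g x))"
      using L2_mult(1)[OF f(2)[of m] g(2)[of m]] L2_mult(1)[OF f(1) g(2)[of m]] L2_mult(1)[OF f(1) g(1)]
      by (simp add: left_diff_distrib right_diff_distrib)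
    then show "norm ((LINT x|torus. F m x * G m x) - (LINT x|torus. f x * g x))
     \<le> l2 (\<lambda>x. F m x - f x) * l2 (G m) + l2 f * l2 (\<lambda>x. G m x - g x)"
      using L2_mult(2)[OF d(1) g(2), of m m] L2_mult(2)[OF f(1) d(2), of m] by simp
  qed
  have "(\<lambda>m. l2 (\<lambda>x. F m x - f x) * l2 (G m) + l2 f * l2 (\<lambda>x. G m x - g x)) \<longlonglongrightarrow> 0 * l2 g + l2 f * 0"
    by (intro tendsto_intros f g l2_tendsto)
  then show "(\<lambda>m. l2 (\<lambda>x. F m x - f x) * l2 (G m) + l2 f * l2 (\<lambda>x. G m x - g x)) \<longlonglongrightarrow> 0" by simp
qed

text \<open>The hypothesis \<open>pd\<close> is the working form of \<open>g\<close> being the weak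
  gradient of \<open>u\<close>: it speaks of the averages at every scale. The smooth estimate for
  \<open>S m u\<close> has a bound independent of \<open>m\<close>, and \<open>Dn_expand\<close>
  lets \<open>m\<close> tend to infinity.\<close>

lemma Dn_bound:
  fixes u :: "real^'n \<Rightarrow> real"
  assumes u: "L2 u" and g: "\<And>j. L2 (g j)" and pd: "\<And>m j. pd j (S m u) (S m (g j))"
  shows "Dn n u \<le> real CARD('n) / (2 * real n + 4) * (\<Sum>j\<in>UNIV. (l2 (g j))\<^sup>2)"
proof -
  have conv0: "(\<lambda>m. l2 (\<lambda>x. S m u x - u x)) \<longlonglongrightarrow> 0" by (rule S_tendsto_L2[OF u])
  have "(\<lambda>m. l2 (\<lambda>x. S n (S m u) x - S n u x)) \<longlonglongrightarrow> 0"
  proof (rule Lim_null_comparison[OF always_eventually conv0], rule allI)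
    fix m
    have "(\<lambda>x. S n (S m u) x - S n u x) = S n (\<lambda>x. S m u x - u x)"
      using conv_diff(1)[OF ker_cont ker_periodic L2_integrable[OF S_L2(1)[OF u, of m]] L2_integrable[OF u], of n] by auto
    then show "norm (l2 (\<lambda>x. S n (S m u) x - S n u x)) \<le> l2 (\<lambda>x. S m u x - u x)"
      using S_L2(2)[OF L2_diff[OF S_L2(1)[OF u] u], of n m] by (simp add: l2_nonneg)
  qed
  then have "(\<lambda>m. 2 * ((l2 (S m u))\<^sup>2 - (LINT x|torus. S m u x * S n (S m u) x)))
      \<longlonglongrightarrow> 2 * ((l2 u)\<^sup>2 - (LINT x|torus. u x * S n u x))"
    by (intro tendsto_intros l2_tendsto L2_inner_tendsto u S_L2 conv0)
  then have "(\<lambda>m. Dn n (S m u)) \<longlonglongrightarrow> Dn n u"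
    using u by (simp add: Dn_expand S_L2)
  moreover have "Dn n (S m u) \<le> real CARD('n) / (2 * real n + 4) * (\<Sum>j\<in>UNIV. (l2 (g j))\<^sup>2)" for m
  proof -
    have "Dn n (S m u) \<le> real CARD('n) / (2 * real n + 4) * (\<Sum>j\<in>UNIV. (l2 (S m (g j)))\<^sup>2)"
      by (rule Dn_bound_smooth[OF pd])
    also have "\<dots> \<le> real CARD('n) / (2 * real n + 4) * (\<Sum>j\<in>UNIV. (l2 (g j))\<^sup>2)"
      by (intro mult_left_mono sum_mono power_mono S_L2 g l2_nonneg) auto
    finally show ?thesis .
  qed
  ultimately show ?thesis by (intro LIMSEQ_le_const2) auto
qed

text \<open>Weighted Cauchy-Schwarz: the modulus of \<open>dker\<close> is a constant times the
  product of the roots of \<open>fis\<close> and \<open>ker\<close>. The first root contributes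
  \<open>fis_integral\<close>, the second carries \<open>h\<close>.\<close>

lemma dker_bound:
  fixes h :: "real^'n \<Rightarrow> real"
  assumes h: "L2 h"
  shows "(conv (dker n j) h x)\<^sup>2 \<le> (2 * pi * (real n + 1))\<^sup>2 / (2 * real n + 1) * conv (ker n) (\<lambda>z. (h z)\<^sup>2) x"
proof -
  define c where "c = 2 * pi * (real n + 1)"
  have c: "0 \<le> c" by (simp add: c_def)
  note s1 = sqrt_kernel_L2[OF fis_cont fis_periodic fis_nonneg L2_const[of 1], of n j x]
  note s2 = sqrt_kernel_L2[OF ker_cont ker_periodic ker_nonneg h, of n x]
  have ab: "\<bar>dker n j y\<bar> = c * (sqrt (fis n j y) * sqrt (ker n y))" for y :: "real^'n"
  proof -
    have "\<bar>dker n j y\<bar> = sqrt ((dker n j y)\<^sup>2)" by simp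
    also have "\<dots> = c * (sqrt (fis n j y) * sqrt (ker n y))"
      unfolding dker_squared c_def[symmetric] using c by (simp add: real_sqrt_mult mult.commute)
    finally show ?thesis .
  qed
  have "\<bar>conv (dker n j) h x\<bar> \<le> (LINT z|torus. \<bar>dker n j (x - z) * h z\<bar>)"
    unfolding conv_def by (rule integral_abs_bound)
  also have "\<dots> = (LINT z|torus. c * ((sqrt (fis n j (x - z)) * 1) * \<bar>sqrt (ker n (x - z)) * h z\<bar>))"
    by (intro Bochner_Integration.integral_cong) (auto simp: abs_mult ab ker_nonneg)
  also have "\<dots> = c * (LINT z|torus. (sqrt (fis n j (x - z)) * 1) * \<bar>sqrt (ker n (x - z)) * h z\<bar>)" by simp
  also have "\<dots> \<le> c * (l2 (\<lambda>z. sqrt (fis n j (x - z)) * 1) * l2 (\<lambda>z. sqrt (ker n (x - z)) * h z))"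
  proof (rule mult_left_mono[OF _ c])
    have "L2 (\<lambda>z. \<bar>sqrt (ker n (x - z)) * h z\<bar>)" using s2(1) unfolding L2_def by (simp add: borel_measurable_abs)
    from L2_mult(2)[OF s1(1) this] show "(LINT z|torus. (sqrt (fis n j (x - z)) * 1) * \<bar>sqrt (ker n (x - z)) * h z\<bar>)
       \<le> l2 (\<lambda>z. sqrt (fis n j (x - z)) * 1) * l2 (\<lambda>z. sqrt (ker n (x - z)) * h z)"
      by (simp add: l2_def)
  qed
  finally have "\<bar>conv (dker n j) h x\<bar>\<^sup>2 \<le> (c * (l2 (\<lambda>z. sqrt (fis n j (x - z)) * 1) * l2 (\<lambda>z. sqrt (ker n (x - z)) * h z)))\<^sup>2"
    by (intro power_mono) auto
  also have "\<dots> = c\<^sup>2 * (conv (fis n j) (\<lambda>z. 1\<^sup>2) x * conv (ker n) (\<lambda>z. (h z)\<^sup>2) x)"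
    by (simp only: power_mult_distrib s1(2) s2(2))
  also have "conv (fis n j) (\<lambda>z. 1\<^sup>2) x = 1 / (2 * real n + 1)"
    using even_kernel_integral[OF fis_cont fis_periodic fis_even, of n j x] by (simp add: conv_def fis_integral)
  finally show ?thesis by (simp add: c_def)
qed

text \<open>Convergence in \<open>L1\<close> is pointwise only along subsequences. If the claim
  failed, it would fail along a subsequence; a further one converges almost everywhere and is
  dominated by \<open>g * W\<close>, a contradiction.\<close>

lemma weighted_L1_tendsto:
  fixes g :: "real^'n \<Rightarrow> real"
  assumes [measurable]: "g \<in> borel_measurable borel" "\<And>n. f n \<in> borel_measurable borel"
    and g: "\<And>x. 0 \<le> g x" and f: "\<And>n x. 0 \<le> f n x" "\<And>n x. f n x \<le> W x"
    and gW: "integrable torus (\<lambda>x. g x * W x)" and fi: "\<And>n. integrable torus (f n)"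
    and lim: "(\<lambda>n. integral\<^sup>L torus (f n)) \<longlonglongrightarrow> 0"
  shows "(\<lambda>n. (LINT x|torus. g x * f n x)) \<longlonglongrightarrow> 0"
proof (rule ccontr)
  let ?a = "\<lambda>n. (LINT x|torus. g x * f n x)"
  assume "\<not> ?a \<longlonglongrightarrow> 0"
  then obtain e where e: "0 < e" "\<not> eventually (\<lambda>n. dist (?a n) 0 < e) sequentially"
    unfolding tendsto_iff by auto
  from e(2) have "\<exists>\<^sub>F n in sequentially. e \<le> dist (?a n) 0"
    unfolding not_eventually not_less .
  then have inf: "infinite {n. e \<le> dist (?a n) 0}"
    by (simp add: cofinite_eq_sequentially[symmetric] frequently_cofinite)
  define r where "r = enumerate {n. e \<le> dist (?a n) 0}"
  have r: "strict_mono r" "\<And>n. e \<le> dist (?a (r n)) 0"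
    unfolding r_def using inf strict_mono_enumerate enumerate_in_set by auto
  have "(\<lambda>n. (LINT x|torus. norm (f (r n) x))) \<longlonglongrightarrow> 0"
    using LIMSEQ_subseq_LIMSEQ[OF lim r(1)] f(1) by (simp add: o_def)
  from tendsto_L1_AE_subseq[OF fi this]
  obtain q where q: "strict_mono q" "AE x in torus. (\<lambda>n. f (r (q n)) x) \<longlonglongrightarrow> 0" by auto
  have "(\<lambda>n. ?a (r (q n))) \<longlonglongrightarrow> integral\<^sup>L torus (\<lambda>x::real^'n. 0)"
  proof (rule integral_dominated_convergence[OF _ _ gW])
    show "AE x in torus. (\<lambda>n. g x * f (r (q n)) x) \<longlonglongrightarrow> 0"
      using q(2) by eventually_elim (rule tendsto_mult_right_zero)
    show "AE x in torus. norm (g x * f (r (q n)) x) \<le> g x * W x" for n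
      using f g by (auto intro!: AE_I2 mult_left_mono simp: abs_mult)
  qed auto
  then have "(\<lambda>n. ?a (r (q n))) \<longlonglongrightarrow> 0" by simp
  then have "eventually (\<lambda>n. dist (?a (r (q n))) 0 < e) sequentially" using e(1) by (rule tendstoD)
  then obtain n where "dist (?a (r (q n))) 0 < e" by (auto simp: eventually_sequentially)
  with r(2)[of "q n"] show False by simp
qed

text \<open>The bounds hold at every point; representatives of the density are clamped to secure
  this, so that division by \<open>S n r\<close> is always safe.\<close>

locale mass_density =
  fixes r :: "real^'n::finite \<Rightarrow> real" and c1 c2 :: real
  assumes r_meas [measurable]: "r \<in> borel_measurable borel"
    and c1_pos: "0 < c1" and r_lower: "\<And>x. c1 \<le> r x" and r_upper: "\<And>x. r x \<le> c2"
begin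

lemma c12: "c1 \<le> c2" "0 < c2"
  using r_lower[of undefined] r_upper[of undefined] c1_pos by linarith+

lemma r_abs: "\<bar>r x\<bar> \<le> c2" "0 < r x"
  using r_lower[of x] r_upper[of x] c1_pos by linarith+

lemma r_L2: "L2 r" by (rule L2_bounded[OF r_meas r_abs(1)])

lemma r_int: "integrable torus r" by (rule L2_integrable[OF r_L2])

lemma rw_L2: "L2 w \<Longrightarrow> L2 (\<lambda>x. r x * w x)"
  by (rule L2_mult_bounded(1)[OF _ r_meas r_abs(1)])

lemma R_bounds: "c1 \<le> S n r x" "S n r x \<le> c2"
proof -
  have "S n (\<lambda>_. c1) x \<le> S n r x" "S n r x \<le> S n (\<lambda>_. c2) x"
    by (intro conv_mono ker_cont ker_periodic ker_nonneg r_int; simp add: r_lower r_upper)+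
  then show "c1 \<le> S n r x" "S n r x \<le> c2" by (simp_all add: S_one)
qed

lemma R_pos: "0 < S n r x" "S n r x \<noteq> 0"
  using R_bounds(1)[of n x] c1_pos by linarith+

definition V :: "nat \<Rightarrow> (real^'n \<Rightarrow> real) \<Rightarrow> real^'n \<Rightarrow> real" where
  "V n w x = S n (\<lambda>x. r x * w x) x / S n r x"

definition DV :: "nat \<Rightarrow> 'n \<Rightarrow> (real^'n \<Rightarrow> real) \<Rightarrow> real^'n \<Rightarrow> real" where
  "DV n j w x = (conv (dker n j) (\<lambda>x. r x * w x) x * S n r x
      - S n (\<lambda>x. r x * w x) x * conv (dker n j) r x) / (S n r x * S n r x)"

lemma pd_S: "integrable torus f \<Longrightarrow> pd j (S n f) (conv (dker n j) f)"
  by (rule pd_conv[OF pd_ker])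

lemma pd_V: "L2 w \<Longrightarrow> pd j (V n w) (DV n j w)"
  unfolding V_def[abs_def] DV_def[abs_def]
  by (intro pd_divide pd_S L2_integrable rw_L2 r_L2 R_pos)

lemma M_eq: "S n (\<lambda>x. r x * w x) x = S n r x * V n w x"
  using R_pos[of n x] by (simp add: V_def)

lemma weighted_square_expand:
  assumes w: "L2 w"
  shows "conv (ker n) (\<lambda>z. r z * (w z - a)\<^sup>2) x
      = conv (ker n) (\<lambda>z. r z * (w z)\<^sup>2) x - 2 * (a * S n (\<lambda>x. r x * w x) x) + a\<^sup>2 * S n r x"
proof -
  have "integrable torus (\<lambda>z. (w z) * (r z * w z))"
    by (rule L2_mult(1)[OF w rw_L2[OF w]])
  then have "integrable torus (\<lambda>z. r z * (w z)\<^sup>2)" by (simp add: power2_eq_square mult_ac)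
  note i = conv_integrable[OF ker_cont ker_periodic this, of n x]
    conv_integrable[OF ker_cont ker_periodic L2_integrable[OF rw_L2[OF w]], of n x]
    conv_integrable[OF ker_cont ker_periodic r_int, of n x]
  have "conv (ker n) (\<lambda>z. r z * (w z - a)\<^sup>2) x
      = (LINT z|torus. ker n (x - z) * (r z * (w z)\<^sup>2) - (2 * a) * (ker n (x - z) * (r z * w z)) + a\<^sup>2 * (ker n (x - z) * r z))"
    unfolding conv_def by (intro Bochner_Integration.integral_cong) (auto simp: power2_eq_square algebra_simps)
  then show ?thesis using i by (simp add: conv_def)
qed

text \<open>The two sides differ by \<open>S n r x\<close> times the square of
  \<open>V n w x - c\<close>. It is applied with \<open>c = w x\<close>, a centre that no longer
  depends on \<open>n\<close>.\<close>

lemma V_minimal: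
  assumes w: "L2 w"
  shows "conv (ker n) (\<lambda>z. r z * (w z - V n w x)\<^sup>2) x \<le> conv (ker n) (\<lambda>z. r z * (w z - c)\<^sup>2) x"
proof -
  note expand = weighted_square_expand[OF w]
  have "conv (ker n) (\<lambda>z. r z * (w z - c)\<^sup>2) x - conv (ker n) (\<lambda>z. r z * (w z - V n w x)\<^sup>2) x
      = S n r x * (V n w x - c)\<^sup>2"
    unfolding expand M_eq[of n w x] by (simp only: power2_eq_square) algebra
  then show ?thesis using R_pos(1)[of n x] by (smt (verit) mult_nonneg_nonneg zero_le_power2)
qed

text \<open>Under the convolution \<open>V n w x\<close> is a constant, and by the quotient rule
  \<open>R\<close> times the derivative of \<open>V\<close> is the derivative of \<open>M\<close>
  minus \<open>V\<close> times that of \<open>R\<close>.\<close>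

lemma DV_eq:
  assumes w: "L2 w"
  shows "DV n j w x = conv (dker n j) (\<lambda>z. r z * (w z - V n w x)) x / S n r x"
proof -
  note pk = pd_ker[of j n]
  note dk = pd_cont(2)[OF pk] pd_periodic'[OF pk]
  have "conv (dker n j) (\<lambda>z. r z * (w z - V n w x)) x
      = conv (dker n j) (\<lambda>z. r z * w z - V n w x * r z) x"
    by (simp add: algebra_simps)
  also have "\<dots> = conv (dker n j) (\<lambda>z. r z * w z) x - conv (dker n j) (\<lambda>z. V n w x * r z) x"
    by (rule conv_diff(1)[OF dk]) (use L2_integrable[OF rw_L2[OF w]] r_int in auto)
  finally have "conv (dker n j) (\<lambda>z. r z * (w z - V n w x)) x
     = conv (dker n j) (\<lambda>z. r z * w z) x - V n w x * conv (dker n j) r x" by (simp add: conv_cmult)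
  moreover have "DV n j w x = (conv (dker n j) (\<lambda>z. r z * w z) x - V n w x * conv (dker n j) r x) / S n r x"
    unfolding DV_def M_eq using R_pos(2)[of n x] by (simp add: field_simps)
  ultimately show ?thesis by simp
qed

lemma DV_pointwise:
  assumes w: "L2 w"
  shows "(DV n j w x)\<^sup>2 \<le> (c2 / c1)\<^sup>2 * ((2 * pi * (real n + 1))\<^sup>2 / (2 * real n + 1)) * conv (ker n) (\<lambda>z. (w z - w x)\<^sup>2) x"
proof -
  let ?C = "(2 * pi * (real n + 1))\<^sup>2 / (2 * real n + 1)"
  have C: "0 \<le> ?C" by simp
  have Lw: "L2 (\<lambda>z. w z - a)" for a by (rule L2_diff[OF w L2_const])
  have Lh: "L2 (\<lambda>z. r z * (w z - a))" for a by (rule rw_L2[OF Lw])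
  have i1: "integrable torus (\<lambda>z. r z * (w z - a)\<^sup>2)" for a
    using L2_mult(1)[OF Lw[of a] Lh[of a]] by (simp add: power2_eq_square mult_ac)
  have i0: "integrable torus (\<lambda>z. (w z - a)\<^sup>2)" for a by (rule L2_sq[OF Lw])
  have i2: "integrable torus (\<lambda>z. (r z * (w z - a))\<^sup>2)" for a by (rule L2_sq[OF Lh])
  \<comment> \<open>Only one of the two factors \<open>r\<close> is estimated here:
    \<open>V n w x\<close> is the mean for the weight \<open>r\<close>, so the other factor has to
    stay until minimality has been used.\<close>
  have "conv (ker n) (\<lambda>z. (r z * (w z - V n w x))\<^sup>2) x \<le> conv (ker n) (\<lambda>z. c2 * (r z * (w z - V n w x)\<^sup>2)) x"
  proof (rule conv_mono[OF ker_cont ker_periodic ker_nonneg])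
    fix z
    have "r z * (r z * (w z - V n w x)\<^sup>2) \<le> c2 * (r z * (w z - V n w x)\<^sup>2)"
      using r_upper[of z] r_abs(2)[of z] by (intro mult_right_mono) auto
    then show "(r z * (w z - V n w x))\<^sup>2 \<le> c2 * (r z * (w z - V n w x)\<^sup>2)"
      by (simp add: power2_eq_square mult_ac)
  qed (use i1 i2 in auto)
  also have "\<dots> = c2 * conv (ker n) (\<lambda>z. r z * (w z - V n w x)\<^sup>2) x" by (rule conv_cmult)
  also have "\<dots> \<le> c2 * conv (ker n) (\<lambda>z. r z * (w z - w x)\<^sup>2) x"
    using c12 by (intro mult_left_mono V_minimal w) auto
  also have "\<dots> \<le> c2 * conv (ker n) (\<lambda>z. c2 * (w z - w x)\<^sup>2) x"
    using c12 by (intro mult_left_mono conv_mono ker_cont ker_periodic ker_nonneg i1 integrable_mult_right i0 mult_right_mono r_upper) auto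
  also have "\<dots> = c2\<^sup>2 * conv (ker n) (\<lambda>z. (w z - w x)\<^sup>2) x" by (simp add: conv_cmult power2_eq_square)
  finally have b: "conv (ker n) (\<lambda>z. (r z * (w z - V n w x))\<^sup>2) x \<le> c2\<^sup>2 * conv (ker n) (\<lambda>z. (w z - w x)\<^sup>2) x" .
  have "(conv (dker n j) (\<lambda>z. r z * (w z - V n w x)) x)\<^sup>2 \<le> ?C * conv (ker n) (\<lambda>z. (r z * (w z - V n w x))\<^sup>2) x"
    by (rule dker_bound[OF Lh])
  also have "\<dots> \<le> ?C * (c2\<^sup>2 * conv (ker n) (\<lambda>z. (w z - w x)\<^sup>2) x)"
    by (rule mult_left_mono[OF b C])
  finally have d: "(conv (dker n j) (\<lambda>z. r z * (w z - V n w x)) x)\<^sup>2 \<le> ?C * (c2\<^sup>2 * conv (ker n) (\<lambda>z. (w z - w x)\<^sup>2) x)" .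
  have "c1\<^sup>2 \<le> (S n r x)\<^sup>2" using R_bounds(1)[of n x] c1_pos by (intro power_mono) auto
  then have "(conv (dker n j) (\<lambda>z. r z * (w z - V n w x)) x)\<^sup>2 / (S n r x)\<^sup>2
      \<le> (?C * (c2\<^sup>2 * conv (ker n) (\<lambda>z. (w z - w x)\<^sup>2) x)) / c1\<^sup>2"
    using d c1_pos order_trans[OF zero_le_power2 d] by (intro frac_le) (simp_all only: zero_less_power)
  then show ?thesis unfolding DV_eq[OF w] power_divide by (simp add: mult_ac)
qed

text \<open>The density costs \<open>(c2 / c1)\<^sup>2\<close>. The rest bounds, for all
  \<open>n\<close> at once, the product of the Fisher constant of \<open>dker_bound\<close> with the
  factor \<open>CARD('n) / (2 n + 4)\<close> of \<open>Dn_bound\<close>.\<close>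

definition CB :: real where "CB = (c2 / c1)\<^sup>2 * (pi\<^sup>2 * real CARD('n))"

lemma CB_nonneg: "0 \<le> CB" by (simp add: CB_def)

lemma DV_L2:
  assumes w: "L2 w" and g: "\<And>j. L2 (g j)" and pd: "\<And>m j. pd j (S m w) (S m (g j))"
  shows "L2 (DV n j w)" "(l2 (DV n j w))\<^sup>2 \<le> CB * (\<Sum>j\<in>UNIV. (l2 (g j))\<^sup>2)"
proof -
  show L: "L2 (DV n j w)"
    using pd_V[OF w, of j n] by (intro L2_periodic pd_cont(2) pd_periodic')
  let ?C = "(c2 / c1)\<^sup>2 * ((2 * pi * (real n + 1))\<^sup>2 / (2 * real n + 1))"
  have "(l2 (DV n j w))\<^sup>2 \<le> (LINT x|torus. ?C * conv (ker n) (\<lambda>z. (w z - w x)\<^sup>2) x)"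
    unfolding l2_sq by (intro integral_mono L2_sq[OF L] integrable_mult_right Dn_expand(2) w DV_pointwise)
  also have "\<dots> = ?C * Dn n w" by (simp add: Dn_def)
  also have "\<dots> \<le> ?C * (real CARD('n) / (2 * real n + 4) * (\<Sum>j\<in>UNIV. (l2 (g j))\<^sup>2))"
    by (intro mult_left_mono Dn_bound[OF w g pd]) auto
  also have "\<dots> = ((c2 / c1)\<^sup>2 * real CARD('n) * (\<Sum>j\<in>UNIV. (l2 (g j))\<^sup>2) * pi\<^sup>2) * ((2 * (real n + 1))\<^sup>2 / ((2 * real n + 1) * (2 * real n + 4)))"
  proof -
    have *: "(2 * pi * (real n + 1))\<^sup>2 = pi\<^sup>2 * (2 * (real n + 1))\<^sup>2" by algebra
    show ?thesis unfolding * times_divide_eq_left times_divide_eq_right divide_divide_eq_left by (simp only: mult_ac)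
  qed
  also have "\<dots> \<le> ((c2 / c1)\<^sup>2 * real CARD('n) * (\<Sum>j\<in>UNIV. (l2 (g j))\<^sup>2) * pi\<^sup>2) * 1"
  proof (rule mult_left_mono)
    \<comment> \<open>The powers of \<open>n\<close> cancel here: the comparison is
      \<open>4 n\<^sup>2 + 8 n + 4\<close> against \<open>4 n\<^sup>2 + 10 n + 4\<close>.\<close>
    show "(2 * (real n + 1))\<^sup>2 / ((2 * real n + 1) * (2 * real n + 4)) \<le> 1"
    proof -
      have "0 < (2 * real n + 1) * (2 * real n + 4)" by (intro mult_pos_pos) auto
      then show ?thesis by (subst divide_le_eq_1_pos) (simp_all add: power2_eq_square algebra_simps)
    qed
    show "0 \<le> (c2 / c1)\<^sup>2 * real CARD('n) * (\<Sum>j\<in>UNIV. (l2 (g j))\<^sup>2) * pi\<^sup>2"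
      by (intro mult_nonneg_nonneg sum_nonneg) auto
  qed
  finally show "(l2 (DV n j w))\<^sup>2 \<le> CB * (\<Sum>j\<in>UNIV. (l2 (g j))\<^sup>2)"
    by (simp add: CB_def mult_ac)
qed

end

section \<open>The balance law on a time slice\<close>

lemma L1_le_l2: "L2 f \<Longrightarrow> (LINT x|torus. \<bar>f x\<bar>) \<le> l2 f"
proof -
  assume f: "L2 f"
  have a: "L2 (\<lambda>x. \<bar>f x\<bar>)" using f by (simp add: L2_def borel_measurable_abs)
  have "(LINT x|torus. \<bar>f x\<bar> * 1) \<le> l2 (\<lambda>x. \<bar>f x\<bar>) * l2 (\<lambda>x::real^'a. 1)"
    using L2_mult(2)[OF a L2_const[of 1]] by (simp add: abs_le_iff)
  moreover have "l2 (\<lambda>x::real^'a. 1) = 1"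
    by (simp add: l2_def measure_def prob_space_torus)
  ultimately show ?thesis by (simp add: l2_def)
qed

lemma L2_abs: "L2 f \<Longrightarrow> L2 (\<lambda>x. \<bar>f x\<bar>)" by (simp add: L2_def borel_measurable_abs)

lemma l2_abs: "l2 (\<lambda>x. \<bar>f x\<bar>) = l2 f" by (simp add: l2_def)

lemma L2_product_L1_tendsto:
  assumes f: "L2 f" "\<And>m. L2 (F m)" "(\<lambda>m. l2 (\<lambda>x. F m x - f x)) \<longlonglongrightarrow> 0"
    and g: "L2 g" "\<And>m. L2 (G m)" "(\<lambda>m. l2 (\<lambda>x. G m x - g x)) \<longlonglongrightarrow> 0"
  shows "(\<lambda>m. (LINT x|torus. \<bar>F m x * G m x - f x * g x\<bar>)) \<longlonglongrightarrow> 0"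
proof (rule Lim_null_comparison)
  have d: "L2 (\<lambda>x. F m x - f x)" "L2 (\<lambda>x. G m x - g x)" for m
    using L2_diff f g by blast+
  show "\<forall>\<^sub>F m in sequentially. norm (LINT x|torus. \<bar>F m x * G m x - f x * g x\<bar>)
     \<le> l2 (\<lambda>x. F m x - f x) * l2 (G m) + l2 f * l2 (\<lambda>x. G m x - g x)"
  proof (rule always_eventually, rule allI)
    fix m
    note i1 = L2_mult(1)[OF L2_abs[OF d(1)[of m]] L2_abs[OF g(2)[of m]]]
    note i2 = L2_mult(1)[OF L2_abs[OF f(1)] L2_abs[OF d(2)[of m]]]
    have "(LINT x|torus. \<bar>F m x * G m x - f x * g x\<bar>)
      \<le> (LINT x|torus. \<bar>F m x - f x\<bar> * \<bar>G m x\<bar> + \<bar>f x\<bar> * \<bar>G m x - g x\<bar>)"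
    proof (rule integral_mono)
      show "integrable torus (\<lambda>x. \<bar>F m x * G m x - f x * g x\<bar>)"
        using L2_mult(1)[OF f(2)[of m] g(2)[of m]] L2_mult(1)[OF f(1) g(1)] by simp
      show "integrable torus (\<lambda>x. \<bar>F m x - f x\<bar> * \<bar>G m x\<bar> + \<bar>f x\<bar> * \<bar>G m x - g x\<bar>)"
        using i1 i2 by simp
      fix x
      have "F m x * G m x - f x * g x = (F m x - f x) * G m x + f x * (G m x - g x)"
        by (simp add: algebra_simps)
      then show "\<bar>F m x * G m x - f x * g x\<bar> \<le> \<bar>F m x - f x\<bar> * \<bar>G m x\<bar> + \<bar>f x\<bar> * \<bar>G m x - g x\<bar>"
        using abs_triangle_ineq[of "(F m x - f x) * G m x" "f x * (G m x - g x)"] by (simp add: abs_mult)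
    qed
    also have "\<dots> = (LINT x|torus. \<bar>F m x - f x\<bar> * \<bar>G m x\<bar>) + (LINT x|torus. \<bar>f x\<bar> * \<bar>G m x - g x\<bar>)"
      using i1 i2 by simp
    also have "\<dots> \<le> l2 (\<lambda>x. F m x - f x) * l2 (G m) + l2 f * l2 (\<lambda>x. G m x - g x)"
      using L2_mult(2)[OF L2_abs[OF d(1)[of m]] L2_abs[OF g(2)[of m]]] L2_mult(2)[OF L2_abs[OF f(1)] L2_abs[OF d(2)[of m]]]
      by (simp add: l2_abs abs_le_iff)
    finally show "norm (LINT x|torus. \<bar>F m x * G m x - f x * g x\<bar>)
      \<le> l2 (\<lambda>x. F m x - f x) * l2 (G m) + l2 f * l2 (\<lambda>x. G m x - g x)" by simp
  qed
  have "(\<lambda>m. l2 (\<lambda>x. F m x - f x) * l2 (G m) + l2 f * l2 (\<lambda>x. G m x - g x)) \<longlonglongrightarrow> 0 * l2 g + l2 f * 0"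
    by (intro tendsto_intros f g l2_tendsto)
  then show "(\<lambda>m. l2 (\<lambda>x. F m x - f x) * l2 (G m) + l2 f * l2 (\<lambda>x. G m x - g x)) \<longlonglongrightarrow> 0" by simp
qed

text \<open>The uniform bound on \<open>D n\<close> pays for replacing \<open>F n\<close> by its
  limit; one fixed test function is then left for the weak convergence.\<close>

lemma weak_strong_tendsto:
  assumes D: "\<And>n. L2 (D n)" "\<And>n. l2 (D n) \<le> C" "\<And>F. L2 F \<Longrightarrow> (\<lambda>n. (LINT x|torus. F x * D n x)) \<longlonglongrightarrow> (LINT x|torus. F x * d x)"
    and F: "L2 f" "\<And>m. L2 (F m)" "(\<lambda>m. l2 (\<lambda>x. F m x - f x)) \<longlonglongrightarrow> 0"
  shows "(\<lambda>n. (LINT x|torus. F n x * D n x)) \<longlonglongrightarrow> (LINT x|torus. f x * d x)"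
proof -
  have dF: "L2 (\<lambda>x. F m x - f x)" for m by (intro L2_diff F)
  have "(\<lambda>n. (LINT x|torus. (F n x - f x) * D n x)) \<longlonglongrightarrow> 0"
  proof (rule Lim_null_comparison)
    show "\<forall>\<^sub>F n in sequentially. norm (LINT x|torus. (F n x - f x) * D n x) \<le> l2 (\<lambda>x. F n x - f x) * C"
      using order_trans[OF L2_mult(2)[OF dF D(1)] mult_left_mono[OF D(2) l2_nonneg]] by (auto intro: always_eventually)
    show "(\<lambda>n. l2 (\<lambda>x. F n x - f x) * C) \<longlonglongrightarrow> 0" by (rule tendsto_mult_left_zero[OF F(3)])
  qed
  from tendsto_add[OF this D(3)[OF F(1)]]
  have "(\<lambda>n. (LINT x|torus. (F n x - f x) * D n x) + (LINT x|torus. f x * D n x)) \<longlonglongrightarrow> (LINT x|torus. f x * d x)"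
    by simp
  moreover have "(LINT x|torus. (F n x - f x) * D n x) + (LINT x|torus. f x * D n x) = (LINT x|torus. F n x * D n x)" for n
    using L2_mult(1)[OF F(2)[of n] D(1)[of n]] L2_mult(1)[OF F(1) D(1)[of n]] by (simp add: left_diff_distrib)
  ultimately show ?thesis by simp
qed

section \<open>Strong and weak limits of the averaged velocity\<close>

context mass_density
begin

lemma R_meas [measurable]: "S n r \<in> borel_measurable borel"
  by (intro conv_measurable ker_cont ker_periodic r_int)

lemma R_L2: "L2 (S n r)" by (rule S_L2[OF r_L2])

lemma inv_R_bound: "\<bar>1 / S n r x\<bar> \<le> 1 / c1"
  using R_bounds(1)[of n x] c1_pos by (simp add: frac_le)

lemma V_L2:
  assumes w: "L2 w"
  shows "L2 (V n w)"
proof -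
  have "L2 (\<lambda>x. (1 / S n r x) * S n (\<lambda>x. r x * w x) x)"
    by (rule L2_mult_bounded(1)[OF S_L2(1)[OF rw_L2[OF w]] _ inv_R_bound]) measurable
  then show ?thesis by (simp add: V_def[abs_def])
qed

text \<open>\<open>V - w\<close> is \<open>1 / S n r\<close> times the sum of the averaging error of
  \<open>r w\<close> and the product \<open>(r - S n r) w\<close>. In the product the first factor
  is bounded and small in \<open>L2\<close> while \<open>w\<close> is merely in \<open>L2\<close>;
  \<open>weighted_L1_tendsto\<close> with weight \<open>w\<^sup>2\<close> covers this.\<close>

lemma V_tendsto:
  assumes w: "L2 w"
  shows "(\<lambda>n. l2 (\<lambda>x. V n w x - w x)) \<longlonglongrightarrow> 0"
proof -
  have [measurable]: "w \<in> borel_measurable borel" using w by (simp add: L2_def)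
  let ?M = "\<lambda>n. S n (\<lambda>x. r x * w x)"
  have LM: "L2 (?M n)" for n by (rule S_L2[OF rw_L2[OF w]])
  have lM: "(\<lambda>n. l2 (\<lambda>x. ?M n x - r x * w x)) \<longlonglongrightarrow> 0" by (rule S_tendsto_L2[OF rw_L2[OF w]])
  have LA: "L2 (\<lambda>x. ?M n x - r x * w x)" for n by (intro L2_diff LM rw_L2 w)
  have rR: "\<bar>r x - S n r x\<bar> \<le> c2" for n x using R_bounds[of n x] r_upper[of x] r_lower[of x] c1_pos by linarith
  have LB: "L2 (\<lambda>x. (r x - S n r x) * w x)" for n
    by (rule L2_mult_bounded(1)[OF w _ rR]) measurable
  have "(\<lambda>n. (LINT x|torus. (w x)\<^sup>2 * (S n r x - r x)\<^sup>2)) \<longlonglongrightarrow> 0"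
  proof (rule weighted_L1_tendsto[where W = "\<lambda>_. c2\<^sup>2"])
    show "(S n r x - r x)\<^sup>2 \<le> c2\<^sup>2" for n x
      using power_mono[OF rR[of x n], of 2] by (simp add: power2_commute)
    show "integrable torus (\<lambda>x. (S n r x - r x)\<^sup>2)" for n
      by (rule L2_sq[OF L2_diff[OF R_L2 r_L2]])
    have "(\<lambda>n. (l2 (\<lambda>x. S n r x - r x))\<^sup>2) \<longlonglongrightarrow> 0\<^sup>2" by (intro tendsto_intros S_tendsto_L2 r_L2)
    then show "(\<lambda>n. (LINT x|torus. (S n r x - r x)\<^sup>2)) \<longlonglongrightarrow> 0" by (simp add: l2_sq)
  qed (use L2_sq[OF w] in auto)
  then have "(\<lambda>n. (l2 (\<lambda>x. (r x - S n r x) * w x))\<^sup>2) \<longlonglongrightarrow> 0"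
    by (simp add: l2_sq power_mult_distrib power2_commute mult.commute)
  then have "(\<lambda>n. sqrt ((l2 (\<lambda>x. (r x - S n r x) * w x))\<^sup>2)) \<longlonglongrightarrow> sqrt 0" by (rule tendsto_real_sqrt)
  then have lB: "(\<lambda>n. l2 (\<lambda>x. (r x - S n r x) * w x)) \<longlonglongrightarrow> 0" by (simp add: l2_nonneg)
  show ?thesis
  proof (rule Lim_null_comparison)
    show "\<forall>\<^sub>F n in sequentially. norm (l2 (\<lambda>x. V n w x - w x)) \<le> (1 / c1) * (l2 (\<lambda>x. ?M n x - r x * w x) + l2 (\<lambda>x. (r x - S n r x) * w x))"
    proof (rule always_eventually, rule allI)
      fix n
      have eq: "(\<lambda>x. V n w x - w x) = (\<lambda>x. (1 / S n r x) * ((?M n x - r x * w x) + (r x - S n r x) * w x))"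
        using R_pos(2)[of n] by (auto simp: V_def field_simps)
      have "l2 (\<lambda>x. V n w x - w x) \<le> (1 / c1) * l2 (\<lambda>x. (?M n x - r x * w x) + (r x - S n r x) * w x)"
        unfolding eq by (rule L2_mult_bounded(2)[OF L2_add(1)[OF LA LB] _ inv_R_bound]) measurable
      also have "\<dots> \<le> (1 / c1) * (l2 (\<lambda>x. ?M n x - r x * w x) + l2 (\<lambda>x. (r x - S n r x) * w x))"
        using c1_pos by (intro mult_left_mono l2_triangle LA LB) auto
      finally show "norm (l2 (\<lambda>x. V n w x - w x)) \<le> (1 / c1) * (l2 (\<lambda>x. ?M n x - r x * w x) + l2 (\<lambda>x. (r x - S n r x) * w x))"
        by (simp add: l2_nonneg)
    qed
    have "(\<lambda>n. (1 / c1) * (l2 (\<lambda>x. ?M n x - r x * w x) + l2 (\<lambda>x. (r x - S n r x) * w x))) \<longlonglongrightarrow> (1 / c1) * (0 + 0)"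
      by (intro tendsto_intros lM lB)
    then show "(\<lambda>n. (1 / c1) * (l2 (\<lambda>x. ?M n x - r x * w x) + l2 (\<lambda>x. (r x - S n r x) * w x))) \<longlonglongrightarrow> 0" by simp
  qed
qed

text \<open>For a test function of the form \<open>S m F\<close> the derivative moves onto the
  kernel, where the strong convergence of \<open>V\<close> suffices. The bound in
  \<open>DV_L2\<close> makes the passage from \<open>S m F\<close> to \<open>F\<close> uniform in
  \<open>n\<close>.\<close>

lemma DV_weak:
  assumes w: "L2 w" and g: "\<And>j. L2 (g j)" and pd: "\<And>m j. pd j (S m w) (S m (g j))" and F: "L2 F"
  shows "(\<lambda>n. (LINT x|torus. F x * DV n j w x)) \<longlonglongrightarrow> (LINT x|torus. F x * g j x)"
proof (rule LIMSEQ_I)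
  fix e :: real assume e: "0 < e"
  define C where "C = sqrt (CB * (\<Sum>j\<in>UNIV. (l2 (g j))\<^sup>2))"
  have C: "l2 (DV n j w) \<le> C" for n
    unfolding C_def using DV_L2(2)[OF w g pd, of n j] by (intro real_le_rsqrt)
  have C0: "0 \<le> C" using order_trans[OF l2_nonneg C] .
  have LD: "L2 (DV n j w)" for n j by (rule DV_L2(1)[OF w g pd])
  \<comment> \<open>One third of \<open>e\<close> is spent on each of the two exchanges of
    \<open>F\<close> for \<open>S m F\<close> and one on the limit; the summand 1 keeps the
    denominator positive.\<close>
  have "eventually (\<lambda>m. l2 (\<lambda>x. S m F x - F x) < e / (3 * (C + l2 (g j) + 1))) sequentially"
    using S_tendsto_L2[OF F] e C0 l2_nonneg[of "g j"] by (intro order_tendstoD) auto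
  then obtain m where m: "l2 (\<lambda>x. S m F x - F x) < e / (3 * (C + l2 (g j) + 1))"
    by (auto simp: eventually_sequentially)
  have LFm: "L2 (\<lambda>x. F x - S m F x)" by (rule L2_diff[OF F S_L2(1)[OF F]])
  have m': "l2 (\<lambda>x. F x - S m F x) * (C + l2 (g j) + 1) < e / 3"
    using m C0 l2_nonneg[of "g j"] l2_commute[of F "S m F"] by (simp add: field_simps)
  have small: "l2 (\<lambda>x. F x - S m F x) * C \<le> e / 3" "l2 (\<lambda>x. F x - S m F x) * l2 (g j) \<le> e / 3"
  proof -
    have "l2 (\<lambda>x. F x - S m F x) * C \<le> l2 (\<lambda>x. F x - S m F x) * (C + l2 (g j) + 1)"
      by (intro mult_left_mono l2_nonneg) (simp add: l2_nonneg)
    moreover have "l2 (\<lambda>x. F x - S m F x) * l2 (g j) \<le> l2 (\<lambda>x. F x - S m F x) * (C + l2 (g j) + 1)"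
      using C0 by (intro mult_left_mono l2_nonneg) simp
    ultimately show "l2 (\<lambda>x. F x - S m F x) * C \<le> e / 3" "l2 (\<lambda>x. F x - S m F x) * l2 (g j) \<le> e / 3"
      using m' by linarith+
  qed
  let ?K = "conv (dker m j) F"
  have LK: "L2 ?K" using pd_S[OF L2_integrable[OF F], where j = j and n = m] by (intro L2_periodic pd_cont(2) pd_periodic')
  have "pd j (S m w) (conv (dker m j) w)" by (rule pd_S[OF L2_integrable[OF w]])
  then have gw: "conv (dker m j) w = S m (g j)"
    using pd[of j m] DERIV_unique unfolding pd_def by blast
  have odd: "dker m j (- y) = - dker m j y" for y :: "real^'n"
    by (simp add: dker_def kfac_def csq_minus) (simp add: scs_def)
  have step1: "(LINT x|torus. S m F x * DV n j w x) = - (LINT x|torus. ?K x * V n w x)" for n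
    using pd_parts[OF pd_S[OF L2_integrable[OF F], where j = j and n = m] pd_V[OF w, where j = j and n = n]] by simp
  have step2: "(LINT x|torus. ?K x * w x) = - (LINT x|torus. S m F x * g j x)"
  proof -
    note pk = pd_ker[of j m]
    have "(LINT x|torus. ?K x * w x) = (LINT z|torus. F z * conv (\<lambda>y. dker m j (- y)) w z)"
      by (rule conv_swap(1)[OF pd_cont(2)[OF pk] pd_periodic'[OF pk] L2_integrable[OF F] L2_integrable[OF w]])
    also have "conv (\<lambda>y. dker m j (- y)) w = (\<lambda>z. - S m (g j) z)"
      unfolding odd gw[symmetric] by (auto simp: conv_def)
    also have "(LINT z|torus. F z * - S m (g j) z) = - (LINT z|torus. F z * S m (g j) z)" by simp
    also have "(LINT z|torus. F z * S m (g j) z) = (LINT x|torus. S m F x * g j x)"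
      by (rule S_self_adjoint[OF L2_integrable[OF F] L2_integrable[OF g], symmetric])
    finally show ?thesis .
  qed
  have "(\<lambda>n. (LINT x|torus. ?K x * V n w x)) \<longlonglongrightarrow> (LINT x|torus. ?K x * w x)"
    by (rule L2_inner_tendsto[OF LK LK _ w V_L2[OF w] V_tendsto[OF w]]) (simp add: l2_def)
  then have "(\<lambda>n. (LINT x|torus. S m F x * DV n j w x)) \<longlonglongrightarrow> (LINT x|torus. S m F x * g j x)"
    using tendsto_minus[of "\<lambda>n. (LINT x|torus. ?K x * V n w x)"] unfolding step1 step2 by fastforce
  from LIMSEQ_D[OF this, of "e / 3"] e
  obtain no where no: "\<And>n. n \<ge> no \<Longrightarrow> norm ((LINT x|torus. S m F x * DV n j w x) - (LINT x|torus. S m F x * g j x)) < e / 3"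
    unfolding zero_less_divide_iff by (auto simp del: real_norm_def)
  show "\<exists>no. \<forall>n\<ge>no. norm ((LINT x|torus. F x * DV n j w x) - (LINT x|torus. F x * g j x)) < e"
  proof (intro exI allI impI)
    fix n assume "no \<le> n"
    have a: "(LINT x|torus. F x * DV n j w x) - (LINT x|torus. S m F x * DV n j w x) = (LINT x|torus. (F x - S m F x) * DV n j w x)"
      using L2_mult(1)[OF F LD[of n j]] L2_mult(1)[OF S_L2(1)[OF F, of m] LD[of n j]] by (simp add: left_diff_distrib)
    have b: "(LINT x|torus. F x * g j x) - (LINT x|torus. S m F x * g j x) = (LINT x|torus. (F x - S m F x) * g j x)"
      using L2_mult(1)[OF F g[of j]] L2_mult(1)[OF S_L2(1)[OF F, of m] g[of j]] by (simp add: left_diff_distrib)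
    have "\<bar>(LINT x|torus. (F x - S m F x) * DV n j w x)\<bar> \<le> e / 3"
      using L2_mult(2)[OF LFm LD[of n j]] mult_left_mono[OF C l2_nonneg] small(1) by (meson order_trans)
    moreover have "\<bar>(LINT x|torus. (F x - S m F x) * g j x)\<bar> \<le> e / 3"
      using L2_mult(2)[OF LFm g[of j]] small(2) by (meson order_trans)
    ultimately show "norm ((LINT x|torus. F x * DV n j w x) - (LINT x|torus. F x * g j x)) < e"
      using no[OF \<open>no \<le> n\<close>, unfolded real_norm_def] a b unfolding real_norm_def by linarith
  qed
qed

text \<open>The variance of \<open>w\<close> for the weight \<open>ker n (x - z) * r z\<close> is
  nonnegative.\<close>

lemma M_squared_le:
  assumes w: "L2 w"
  shows "(S n (\<lambda>x. r x * w x) x)\<^sup>2 \<le> S n r x * S n (\<lambda>x. r x * (w x)\<^sup>2) x"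
proof -
  have "conv (ker n) (\<lambda>z. r z * (w z - V n w x)\<^sup>2) x
      = conv (ker n) (\<lambda>z. r z * (w z)\<^sup>2) x - 2 * (V n w x * S n (\<lambda>x. r x * w x) x) + (V n w x)\<^sup>2 * S n r x"
    by (rule weighted_square_expand[OF w])
  moreover have "0 \<le> conv (ker n) (\<lambda>z. r z * (w z - V n w x)\<^sup>2) x"
    unfolding conv_def using r_abs(2) by (intro integral_nonneg_AE AE_I2 mult_nonneg_nonneg ker_nonneg) (auto intro: less_imp_le)
  ultimately have "0 \<le> S n (\<lambda>z. r z * (w z)\<^sup>2) x - S n r x * (V n w x)\<^sup>2"
    unfolding M_eq[of n w x] by (simp add: power2_eq_square algebra_simps)
  then have "0 \<le> S n r x * (S n (\<lambda>z. r z * (w z)\<^sup>2) x - S n r x * (V n w x)\<^sup>2)"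
    using R_pos(1)[of n x] by (intro mult_nonneg_nonneg) auto
  then show ?thesis unfolding M_eq[of n w x] by (simp add: power2_eq_square algebra_simps)
qed

end

text \<open>Dominated convergence with majorants that move with \<open>n\<close>: since
  \<open>2 * G n\<close> converges strongly, \<open>b n\<close> can be compared with the fixed
  majorant \<open>2 * \<bar>g\<bar>\<close>, up to errors carried by \<open>G n - g\<close>. The
  flux defect is dominated in just this way.\<close>

lemma l2_tendsto_generalized_dominated:
  assumes b: "\<And>n. b n \<in> borel_measurable borel" and le: "\<And>n x. \<bar>b n x\<bar> \<le> 2 * G n x"
    and G: "\<And>n. L2 (G n)" "L2 g" "(\<lambda>n. l2 (\<lambda>x. G n x - g x)) \<longlonglongrightarrow> 0"
    and lim: "(\<lambda>n. (LINT x|torus. \<bar>b n x\<bar>)) \<longlonglongrightarrow> 0"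
  shows "(\<lambda>n. l2 (b n)) \<longlonglongrightarrow> 0" "L2 (b n)"
proof -
  note b[measurable]
  have [measurable]: "G n \<in> borel_measurable borel" "g \<in> borel_measurable borel" for n using G by (simp_all add: L2_def)
  have Lb: "L2 (b n)" and lb: "l2 (b n) \<le> 2 * l2 (G n)" for n
  proof -
    have *: "\<bar>b n x\<bar> \<le> \<bar>2 * G n x\<bar>" for x using le[of n x] by linarith
    show "L2 (b n)" by (rule L2_dominated(1)[OF L2_cmult[OF G(1)[of n]] b *])
    show "l2 (b n) \<le> 2 * l2 (G n)" using L2_dominated(2)[OF L2_cmult[OF G(1)[of n]] b *] by (simp add: l2_cmult)
  qed
  show "L2 (b n)" by (rule Lb)
  have Lab: "L2 (\<lambda>x. \<bar>b n x\<bar>)" for n by (rule L2_abs[OF Lb])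
  have Lg: "L2 (\<lambda>x. \<bar>g x\<bar>)" by (rule L2_abs[OF G(2)])
  have LGg: "L2 (\<lambda>x. \<bar>G n x - g x\<bar>)" for n by (intro L2_abs L2_diff G)
  \<comment> \<open>The part of \<open>b n\<close> below the limiting majorant. It inherits
    convergence to 0 in \<open>L1\<close>, and the excess of \<open>b n\<close> over it is at most
    \<open>2 * \<bar>G n x - g x\<bar>\<close>.\<close>
  define f where "f n x = min \<bar>b n x\<bar> (2 * \<bar>g x\<bar>)" for n x
  have [measurable]: "f n \<in> borel_measurable borel" for n unfolding f_def by measurable
  have Lf: "L2 (f n)" for n
    by (rule L2_dominated(1)[OF Lab[of n]]) (auto simp: f_def)
  have f0: "(\<lambda>n. integral\<^sup>L torus (f n)) \<longlonglongrightarrow> 0"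
  proof (rule Lim_null_comparison[OF always_eventually lim], rule allI)
    fix n
    have "0 \<le> integral\<^sup>L torus (f n)" by (rule integral_nonneg_AE) (auto simp: f_def)
    moreover have "integral\<^sup>L torus (f n) \<le> (LINT x|torus. \<bar>b n x\<bar>)"
      by (intro integral_mono L2_integrable Lf Lab) (auto simp: f_def)
    ultimately show "norm (integral\<^sup>L torus (f n)) \<le> (LINT x|torus. \<bar>b n x\<bar>)" by simp
  qed
  have w0: "(\<lambda>n. (LINT x|torus. \<bar>g x\<bar> * f n x)) \<longlonglongrightarrow> 0"
  proof (rule weighted_L1_tendsto[where W = "\<lambda>x. 2 * \<bar>g x\<bar>", OF _ _ _ _ _ _ _ f0])
    show "integrable torus (\<lambda>x. \<bar>g x\<bar> * (2 * \<bar>g x\<bar>))"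
      using L2_mult(1)[OF Lg L2_cmult[OF Lg, of 2]] by simp
    show "integrable torus (f n)" for n by (rule L2_integrable[OF Lf])
  qed (auto simp: f_def)
  have est: "(l2 (b n))\<^sup>2 \<le> 2 * (l2 (\<lambda>x. G n x - g x) * l2 (b n)) + 2 * (LINT x|torus. \<bar>g x\<bar> * f n x) + 4 * (l2 g * l2 (\<lambda>x. G n x - g x))" for n
  proof -
    note i1 = L2_mult[OF LGg[of n] Lab[of n]] and i2 = L2_mult[OF Lg Lf[of n]] and i3 = L2_mult[OF Lg LGg[of n]]
    have "(l2 (b n))\<^sup>2 \<le> (LINT x|torus. 2 * (\<bar>G n x - g x\<bar> * \<bar>b n x\<bar>) + 2 * (\<bar>g x\<bar> * f n x) + 4 * (\<bar>g x\<bar> * \<bar>G n x - g x\<bar>))"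
      unfolding l2_sq
    proof (rule integral_mono)
      fix x
      have G0: "0 \<le> G n x" using le[of n x] by linarith
      have 1: "(b n x)\<^sup>2 \<le> 2 * G n x * \<bar>b n x\<bar>"
        using mult_right_mono[OF le[of n x], of "\<bar>b n x\<bar>"] by (simp add: power2_eq_square abs_mult[symmetric])
      have 2: "G n x \<le> \<bar>G n x - g x\<bar> + \<bar>g x\<bar>" by linarith
      have 3: "\<bar>b n x\<bar> \<le> f n x + 2 * \<bar>G n x - g x\<bar>"
        using le[of n x] 2 unfolding f_def by (cases "\<bar>b n x\<bar> \<le> 2 * \<bar>g x\<bar>") (simp_all add: min_def)
      have "2 * G n x * \<bar>b n x\<bar> \<le> 2 * (\<bar>G n x - g x\<bar> + \<bar>g x\<bar>) * \<bar>b n x\<bar>"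
        using 2 by (intro mult_right_mono) auto
      also have "\<dots> = 2 * (\<bar>G n x - g x\<bar> * \<bar>b n x\<bar>) + 2 * (\<bar>g x\<bar> * \<bar>b n x\<bar>)" by (simp add: algebra_simps)
      also have "\<bar>g x\<bar> * \<bar>b n x\<bar> \<le> \<bar>g x\<bar> * (f n x + 2 * \<bar>G n x - g x\<bar>)"
        using 3 by (intro mult_left_mono) auto
      finally show "(b n x)\<^sup>2 \<le> 2 * (\<bar>G n x - g x\<bar> * \<bar>b n x\<bar>) + 2 * (\<bar>g x\<bar> * f n x) + 4 * (\<bar>g x\<bar> * \<bar>G n x - g x\<bar>)"
        using 1 by (simp add: distrib_left)
    qed (use i1(1) i2(1) i3(1) L2_sq[OF Lb] in auto)
    also have "\<dots> = 2 * (LINT x|torus. \<bar>G n x - g x\<bar> * \<bar>b n x\<bar>) + 2 * (LINT x|torus. \<bar>g x\<bar> * f n x) + 4 * (LINT x|torus. \<bar>g x\<bar> * \<bar>G n x - g x\<bar>)"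
      using i1(1) i2(1) i3(1) by simp
    finally show ?thesis using i1(2) i3(2) by (simp add: l2_abs abs_le_iff)
  qed
  have "(\<lambda>n. (l2 (b n))\<^sup>2) \<longlonglongrightarrow> 0"
  proof (rule Lim_null_comparison)
    show "\<forall>\<^sub>F n in sequentially. norm ((l2 (b n))\<^sup>2) \<le> 2 * (l2 (\<lambda>x. G n x - g x) * (2 * l2 (G n))) + 2 * (LINT x|torus. \<bar>g x\<bar> * f n x) + 4 * (l2 g * l2 (\<lambda>x. G n x - g x))"
    proof (rule always_eventually, rule allI)
      fix n
      have "l2 (\<lambda>x. G n x - g x) * l2 (b n) \<le> l2 (\<lambda>x. G n x - g x) * (2 * l2 (G n))"
        by (intro mult_left_mono lb l2_nonneg)
      then show "norm ((l2 (b n))\<^sup>2) \<le> 2 * (l2 (\<lambda>x. G n x - g x) * (2 * l2 (G n))) + 2 * (LINT x|torus. \<bar>g x\<bar> * f n x) + 4 * (l2 g * l2 (\<lambda>x. G n x - g x))"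
        using est[of n] by simp
    qed
    have "(\<lambda>n. 2 * (l2 (\<lambda>x. G n x - g x) * (2 * l2 (G n))) + 2 * (LINT x|torus. \<bar>g x\<bar> * f n x) + 4 * (l2 g * l2 (\<lambda>x. G n x - g x)))
      \<longlonglongrightarrow> 2 * (0 * (2 * l2 g)) + 2 * 0 + 4 * (l2 g * 0)"
      by (intro tendsto_intros G(3) w0 l2_tendsto G)
    then show "(\<lambda>n. 2 * (l2 (\<lambda>x. G n x - g x) * (2 * l2 (G n))) + 2 * (LINT x|torus. \<bar>g x\<bar> * f n x) + 4 * (l2 g * l2 (\<lambda>x. G n x - g x))) \<longlonglongrightarrow> 0" by simp
  qed
  then have "(\<lambda>n. sqrt ((l2 (b n))\<^sup>2)) \<longlonglongrightarrow> sqrt 0" by (rule tendsto_real_sqrt)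
  then show "(\<lambda>n. l2 (b n)) \<longlonglongrightarrow> 0" by (simp add: l2_nonneg)
qed

lemma Lipschitz_cont:
  fixes p :: "real \<Rightarrow> real"
  assumes "\<And>a b. \<bar>p a - p b\<bar> \<le> L * \<bar>a - b\<bar>"
  shows "continuous_on UNIV p"
proof -
  have "0 \<le> L" using order_trans[OF abs_ge_zero assms[of 1 0]] by simp
  then have "L-lipschitz_on UNIV p" using assms by (intro lipschitz_onI) (auto simp: dist_real_def)
  then show ?thesis by (rule lipschitz_on_continuous_on)
qed

context mass_density
begin

lemma compose_R:
  assumes p: "\<And>a b. \<bar>p a - p b\<bar> \<le> L * \<bar>a - b\<bar>"
  shows "L2 (\<lambda>x. p (S n r x))" "L2 (\<lambda>x. p (r x))" "(\<lambda>n. l2 (\<lambda>x. p (S n r x) - p (r x))) \<longlonglongrightarrow> 0"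
proof -
  have cp: "continuous_on UNIV p" by (rule Lipschitz_cont[OF p])
  have [measurable]: "p \<in> borel_measurable borel" using cp by (rule borel_measurable_continuous_onI)
  have b: "\<bar>p y\<bar> \<le> \<bar>p 0\<bar> + L * c2" if "0 < y" "y \<le> c2" for y
  proof -
    have L: "0 \<le> L" using order_trans[OF abs_ge_zero p[of 1 0]] by simp
    have "\<bar>p y\<bar> \<le> \<bar>p 0\<bar> + \<bar>p y - p 0\<bar>" by linarith
    also have "\<bar>p y - p 0\<bar> \<le> L * \<bar>y - 0\<bar>" by (rule p)
    also have "L * \<bar>y - 0\<bar> \<le> L * c2" using that L by (intro mult_left_mono) auto
    finally show ?thesis by simp
  qed
  show 1: "L2 (\<lambda>x. p (S n r x))" for n
    by (rule L2_bounded[OF _ b]) (use R_pos R_bounds in \<open>auto\<close>)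
  show 2: "L2 (\<lambda>x. p (r x))"
    by (rule L2_bounded[OF _ b]) (use r_abs(2) r_upper in \<open>auto\<close>)
  have le: "l2 (\<lambda>x. p (S n r x) - p (r x)) \<le> L * l2 (\<lambda>x. S n r x - r x)" for n
  proof -
    have L: "0 \<le> L" using order_trans[OF abs_ge_zero p[of 1 0]] by simp
    have "\<bar>p (S n r x) - p (r x)\<bar> \<le> \<bar>L * (S n r x - r x)\<bar>" for x
      using p[of "S n r x" "r x"] L by (simp add: abs_mult)
    from L2_dominated(2)[OF L2_cmult[OF L2_diff[OF R_L2 r_L2]] _ this] show ?thesis using L by (simp add: l2_cmult)
  qed
  show "(\<lambda>n. l2 (\<lambda>x. p (S n r x) - p (r x))) \<longlonglongrightarrow> 0"
  proof (rule Lim_null_comparison)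
    show "\<forall>\<^sub>F n in sequentially. norm (l2 (\<lambda>x. p (S n r x) - p (r x))) \<le> L * l2 (\<lambda>x. S n r x - r x)"
      using le by (intro always_eventually) (simp add: l2_nonneg)
    show "(\<lambda>n. L * l2 (\<lambda>x. S n r x - r x)) \<longlonglongrightarrow> 0" by (intro tendsto_mult_right_zero S_tendsto_L2 r_L2)
  qed
qed

text \<open>The kinetic part is written as \<open>V\<close> times the averaged momentum, a product
  of two strongly convergent sequences, instead of a square over the density.\<close>

lemma energy_tendsto:
  fixes u :: "'n \<Rightarrow> real^'n \<Rightarrow> real"
  assumes u: "\<And>i. L2 (u i)" and P: "\<And>a b. \<bar>P a - P b\<bar> \<le> L * \<bar>a - b\<bar>"
  shows "(\<lambda>n. (LINT x|torus. (\<Sum>i\<in>UNIV. V n (u i) x * S n (\<lambda>x. r x * u i x) x) / 2 + P (S n r x)))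
      \<longlonglongrightarrow> (LINT x|torus. (\<Sum>i\<in>UNIV. u i x * (r x * u i x)) / 2 + P (r x))"
proof -
  note c = compose_R[OF P]
  have 1: "(\<lambda>n. (LINT x|torus. V n (u i) x * S n (\<lambda>x. r x * u i x) x)) \<longlonglongrightarrow> (LINT x|torus. u i x * (r x * u i x))" for i
    by (intro L2_inner_tendsto u V_L2 V_tendsto rw_L2 S_L2 S_tendsto_L2)
  have 2: "(\<lambda>n. (LINT x|torus. P (S n r x))) \<longlonglongrightarrow> (LINT x|torus. P (r x))"
    using L2_inner_tendsto[OF c(2) c(1) c(3) L2_const[of 1] L2_const[of 1]] by (simp add: l2_def)
  have i1: "integrable torus (\<lambda>x. V n (u i) x * S n (\<lambda>x. r x * u i x) x)" for n i
    by (rule L2_mult(1)[OF V_L2[OF u] S_L2(1)[OF rw_L2[OF u]]])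
  have i2: "integrable torus (\<lambda>x. u i x * (r x * u i x))" for i
    by (rule L2_mult(1)[OF u rw_L2[OF u]])
  have eq1: "(LINT x|torus. (\<Sum>i\<in>UNIV. V n (u i) x * S n (\<lambda>x. r x * u i x) x) / 2 + P (S n r x))
     = (\<Sum>i\<in>UNIV. (LINT x|torus. V n (u i) x * S n (\<lambda>x. r x * u i x) x)) / 2 + (LINT x|torus. P (S n r x))" for n
    using i1 L2_integrable[OF c(1)] by simp
  have eq2: "(LINT x|torus. (\<Sum>i\<in>UNIV. u i x * (r x * u i x)) / 2 + P (r x))
     = (\<Sum>i\<in>UNIV. (LINT x|torus. u i x * (r x * u i x))) / 2 + (LINT x|torus. P (r x))"
    using i2 L2_integrable[OF c(2)] by simp
  show ?thesis unfolding eq1 eq2 by (intro tendsto_intros 1 2) auto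
qed

end

text \<open>One time slice. \<open>g\<close> is the gradient of \<open>u\<close>, certified through
  averages as in \<open>Dn_bound\<close>, and \<open>sg\<close> an arbitrary stress. The pressure is
  globally Lipschitz and bounded because it will be instantiated by the clamped
  \<open>pc\<close>.\<close>

locale flow_slice = mass_density r c1 c2 for r :: "real^'n::finite \<Rightarrow> real" and c1 c2 +
  fixes u :: "'n \<Rightarrow> real^'n \<Rightarrow> real" and g sg :: "'n \<Rightarrow> 'n \<Rightarrow> real^'n \<Rightarrow> real"
    and p :: "real \<Rightarrow> real" and Lp Pm :: real
  assumes u_L2: "\<And>i. L2 (u i)" and g_L2: "\<And>i j. L2 (g i j)" and sg_L2: "\<And>i j. L2 (sg i j)"
    and u_pd: "\<And>m i j. pd j (S m (u i)) (S m (g i j))"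
    and u_sq_L2: "L2 (\<lambda>x. \<Sum>i\<in>UNIV. (u i x)\<^sup>2)"
    and p_lip: "\<And>a b. \<bar>p a - p b\<bar> \<le> Lp * \<bar>a - b\<bar>" and p_bound: "\<And>a. \<bar>p a\<bar> \<le> Pm"
begin

definition q :: "real^'n \<Rightarrow> real" where "q x = (\<Sum>i\<in>UNIV. (u i x)\<^sup>2)"

text \<open>The first two terms are the averaged momentum flux with its sign reversed; the last is
  what the mass equation contributes once the rate of kinetic energy has been integrated by
  parts.\<close>

definition flux :: "nat \<Rightarrow> 'n \<Rightarrow> 'n \<Rightarrow> real^'n \<Rightarrow> real" where
  "flux n i j x = S n (sg i j) x - S n (\<lambda>x. r x * (u i x * u j x)) x + V n (u i) x * S n (\<lambda>x. r x * u j x) x"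

text \<open>The energy rate of the averaged flow with all derivatives moved onto \<open>V\<close>;
  \<open>balance_identity\<close> derives it from the rates of density and momentum.\<close>

definition balance :: "nat \<Rightarrow> real" where
  "balance n = - (\<Sum>i\<in>UNIV. \<Sum>j\<in>UNIV. (LINT x|torus. flux n i j x * DV n j (u i) x))
     - (\<Sum>i\<in>UNIV. (LINT x|torus. p (S n r x) * DV n i (u i) x))"

lemma q_L2: "L2 q" using u_sq_L2 by (simp add: q_def[abs_def])

lemma u_meas [measurable]: "u i \<in> borel_measurable borel" using u_L2[of i] by (simp add: L2_def)

lemma q_ge: "(u i x)\<^sup>2 \<le> q x" unfolding q_def by (rule member_le_sum) auto

lemma q_nonneg: "0 \<le> q x" unfolding q_def by (rule sum_nonneg) auto

lemma prod_le_q: "\<bar>u i x * u j x\<bar> \<le> q x"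
proof -
  have "2 * \<bar>u i x * u j x\<bar> \<le> (u i x)\<^sup>2 + (u j x)\<^sup>2"
    using sum_squares_bound[of "\<bar>u i x\<bar>" "\<bar>u j x\<bar>"] by (simp add: abs_mult)
  then show ?thesis using q_ge[of i x] q_ge[of j x] by linarith
qed

lemma uu_L2: "L2 (\<lambda>x. u i x * u j x)"
  by (rule L2_dominated(1)[OF q_L2]) (auto simp: prod_le_q q_nonneg)

lemma rq_L2: "L2 (\<lambda>x. r x * q x)" "l2 (\<lambda>x. r x * q x) \<le> c2 * l2 q"
  by (rule L2_mult_bounded[OF q_L2 r_meas r_abs(1)])+

text \<open>A common majorant for the two halves of the defect; for the product it comes from
  \<open>M_squared_le\<close> applied to each component. It is chosen because the averages of
  \<open>r q\<close> converge strongly in \<open>L2\<close>.\<close>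

lemma bracket_bounds: "\<bar>V n (u i) x * S n (\<lambda>x. r x * u j x) x\<bar> \<le> S n (\<lambda>x. r x * q x) x"
  "\<bar>S n (\<lambda>x. r x * (u i x * u j x)) x\<bar> \<le> S n (\<lambda>x. r x * q x) x"
proof -
  have iq: "integrable torus (\<lambda>x. r x * q x)" by (rule L2_integrable[OF rq_L2(1)])
  have isq: "integrable torus (\<lambda>x. r x * (u i x)\<^sup>2)" for i
    using L2_mult(1)[OF u_L2[of i] rw_L2[OF u_L2[of i]]] by (simp add: power2_eq_square mult_ac)
  have M: "(S n (\<lambda>x. r x * u i x) x)\<^sup>2 \<le> S n r x * S n (\<lambda>x. r x * q x) x" for i
  proof -
    have "(S n (\<lambda>x. r x * u i x) x)\<^sup>2 \<le> S n r x * S n (\<lambda>x. r x * (u i x)\<^sup>2) x" by (rule M_squared_le[OF u_L2])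
    also have "\<dots> \<le> S n r x * S n (\<lambda>x. r x * q x) x"
      using R_pos(1)[of n x] r_abs(2) q_ge
      by (intro mult_left_mono conv_mono ker_cont ker_periodic ker_nonneg isq iq) (auto intro: less_imp_le)
    finally show ?thesis .
  qed
  let ?a = "S n (\<lambda>x. r x * u i x) x" and ?b = "S n (\<lambda>x. r x * u j x) x"
  have "2 * \<bar>?a * ?b\<bar> \<le> ?a\<^sup>2 + ?b\<^sup>2"
    using sum_squares_bound[of "\<bar>?a\<bar>" "\<bar>?b\<bar>"] by (simp add: abs_mult)
  then have ab: "\<bar>?a * ?b\<bar> \<le> S n r x * S n (\<lambda>x. r x * q x) x" using M[of i] M[of j] by linarith
  have "\<bar>V n (u i) x * ?b\<bar> = \<bar>?a * ?b\<bar> / S n r x"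
    using R_pos(1)[of n x] by (simp add: V_def abs_mult)
  also have "\<dots> \<le> S n (\<lambda>x. r x * q x) x"
    using ab R_pos(1)[of n x] by (simp add: pos_divide_le_eq mult.commute)
  finally show "\<bar>V n (u i) x * ?b\<bar> \<le> S n (\<lambda>x. r x * q x) x" .
  have le: "\<bar>r x * (u i x * u j x)\<bar> \<le> r x * q x" for x
    using mult_left_mono[OF prod_le_q[of i x j], of "r x"] r_abs(2)[of x] by (simp add: abs_mult)
  have iu: "integrable torus (\<lambda>x. r x * (u i x * u j x))" by (rule L2_integrable[OF rw_L2[OF uu_L2]])
  have "S n (\<lambda>x. r x * (u i x * u j x)) x \<le> S n (\<lambda>x. r x * q x) x"
    using le by (intro conv_mono ker_cont ker_periodic ker_nonneg iq iu) (auto simp: abs_le_iff)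
  moreover have "S n (\<lambda>x. (-1) * (r x * (u i x * u j x))) x \<le> S n (\<lambda>x. r x * q x) x"
    using le by (intro conv_mono ker_cont ker_periodic ker_nonneg iq integrable_mult_right iu) (auto simp: abs_le_iff)
  then have "- S n (\<lambda>x. r x * (u i x * u j x)) x \<le> S n (\<lambda>x. r x * q x) x"
    unfolding conv_cmult by simp
  ultimately show "\<bar>S n (\<lambda>x. r x * (u i x * u j x)) x\<bar> \<le> S n (\<lambda>x. r x * q x) x" by linarith
qed

text \<open>Both terms tend to \<open>r u_i u_j\<close> in \<open>L1\<close>, the product because
  its factors converge in \<open>L2\<close>. The majorant of \<open>bracket_bounds\<close> raises
  this to \<open>L2\<close>; here the square integrability of \<open>q\<close> enters.\<close>

lemma bracket_tendsto:
  "(\<lambda>n. l2 (\<lambda>x. V n (u i) x * S n (\<lambda>x. r x * u j x) x - S n (\<lambda>x. r x * (u i x * u j x)) x)) \<longlonglongrightarrow> 0"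
  "L2 (\<lambda>x. V n (u i) x * S n (\<lambda>x. r x * u j x) x - S n (\<lambda>x. r x * (u i x * u j x)) x)"
proof -
  let ?b = "\<lambda>n x. V n (u i) x * S n (\<lambda>x. r x * u j x) x - S n (\<lambda>x. r x * (u i x * u j x)) x"
  have LV: "L2 (V n (u i))" and LM: "L2 (S n (\<lambda>x. r x * u j x))" and LS: "L2 (S n (\<lambda>x. r x * (u i x * u j x)))" for n
    by (intro V_L2 u_L2 S_L2(1) rw_L2 uu_L2)+
  have meas: "?b n \<in> borel_measurable borel" for n
    using L2_measurable[OF LV[of n]] L2_measurable[OF LM[of n]] L2_measurable[OF LS[of n]] by measurable
  have le: "\<bar>?b n x\<bar> \<le> 2 * S n (\<lambda>x. r x * q x) x" for n x
    using bracket_bounds(1)[of n i x j] bracket_bounds(2)[of n i j x] by linarith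
  have lim1: "(\<lambda>n. (LINT x|torus. \<bar>V n (u i) x * S n (\<lambda>x. r x * u j x) x - u i x * (r x * u j x)\<bar>)) \<longlonglongrightarrow> 0"
    by (rule L2_product_L1_tendsto[OF u_L2 LV V_tendsto[OF u_L2] rw_L2[OF u_L2] LM S_tendsto_L2[OF rw_L2[OF u_L2]]])
  have lim2: "(\<lambda>n. l2 (\<lambda>x. S n (\<lambda>x. r x * (u i x * u j x)) x - r x * (u i x * u j x))) \<longlonglongrightarrow> 0"
    by (rule S_tendsto_L2[OF rw_L2[OF uu_L2]])
  have "(\<lambda>n. (LINT x|torus. \<bar>?b n x\<bar>)) \<longlonglongrightarrow> 0"
  proof (rule Lim_null_comparison)
    show "\<forall>\<^sub>F n in sequentially. norm (LINT x|torus. \<bar>?b n x\<bar>)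
      \<le> (LINT x|torus. \<bar>V n (u i) x * S n (\<lambda>x. r x * u j x) x - u i x * (r x * u j x)\<bar>)
        + l2 (\<lambda>x. S n (\<lambda>x. r x * (u i x * u j x)) x - r x * (u i x * u j x))"
    proof (rule always_eventually, rule allI)
      fix n
      have i1: "integrable torus (\<lambda>x. \<bar>V n (u i) x * S n (\<lambda>x. r x * u j x) x - u i x * (r x * u j x)\<bar>)"
        using L2_mult(1)[OF LV[of n] LM[of n]] L2_mult(1)[OF u_L2[of i] rw_L2[OF u_L2[of j]]] by simp
      have L: "L2 (\<lambda>x. S n (\<lambda>x. r x * (u i x * u j x)) x - r x * (u i x * u j x))"
        by (rule L2_diff[OF LS rw_L2[OF uu_L2]])
      have i2: "integrable torus (\<lambda>x. \<bar>S n (\<lambda>x. r x * (u i x * u j x)) x - r x * (u i x * u j x)\<bar>)"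
        by (rule L2_integrable[OF L2_abs[OF L]])
      have "(LINT x|torus. \<bar>?b n x\<bar>) \<le> (LINT x|torus. \<bar>V n (u i) x * S n (\<lambda>x. r x * u j x) x - u i x * (r x * u j x)\<bar>
         + \<bar>S n (\<lambda>x. r x * (u i x * u j x)) x - r x * (u i x * u j x)\<bar>)"
      proof (rule integral_mono)
        show "integrable torus (\<lambda>x. \<bar>?b n x\<bar>)"
          using L2_mult(1)[OF LV[of n] LM[of n]] L2_integrable[OF LS[of n]] by simp
        show "integrable torus (\<lambda>x. \<bar>V n (u i) x * S n (\<lambda>x. r x * u j x) x - u i x * (r x * u j x)\<bar>
         + \<bar>S n (\<lambda>x. r x * (u i x * u j x)) x - r x * (u i x * u j x)\<bar>)" using i1 i2 by simp
        fix x
        have "r x * (u i x * u j x) = u i x * (r x * u j x)" by simp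
        then show "\<bar>?b n x\<bar> \<le> \<bar>V n (u i) x * S n (\<lambda>x. r x * u j x) x - u i x * (r x * u j x)\<bar>
         + \<bar>S n (\<lambda>x. r x * (u i x * u j x)) x - r x * (u i x * u j x)\<bar>" by linarith
      qed
      then show "norm (LINT x|torus. \<bar>?b n x\<bar>)
        \<le> (LINT x|torus. \<bar>V n (u i) x * S n (\<lambda>x. r x * u j x) x - u i x * (r x * u j x)\<bar>)
        + l2 (\<lambda>x. S n (\<lambda>x. r x * (u i x * u j x)) x - r x * (u i x * u j x))"
        using L1_le_l2[OF L] Bochner_Integration.integral_add[OF i1 i2] by simp
    qed
  qed (use tendsto_add[OF lim1 lim2] in simp)
  note gd = l2_tendsto_generalized_dominated[where b = "?b", OF meas le S_L2(1)[OF rq_L2(1)] rq_L2(1) S_tendsto_L2[OF rq_L2(1)] this]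
  show "(\<lambda>n. l2 (?b n)) \<longlonglongrightarrow> 0" by (rule gd(1))
  show "L2 (?b n)" by (rule gd(2))
qed

lemma flux_L2: "L2 (flux n i j)" and flux_tendsto: "(\<lambda>n. l2 (\<lambda>x. flux n i j x - sg i j x)) \<longlonglongrightarrow> 0"
  and flux_bound: "l2 (flux n i j) \<le> l2 (sg i j) + 2 * c2 * l2 q"
proof -
  let ?b = "\<lambda>n x. V n (u i) x * S n (\<lambda>x. r x * u j x) x - S n (\<lambda>x. r x * (u i x * u j x)) x"
  have eq: "flux n i j = (\<lambda>x. S n (sg i j) x + ?b n x)" for n by (auto simp: flux_def)
  have LS: "L2 (S n (sg i j))" for n by (rule S_L2(1)[OF sg_L2])
  note Lb = bracket_tendsto(2)[where i = i and j = j]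
  show "L2 (flux n i j)" unfolding eq by (rule L2_add(1)[OF LS Lb])
  show "(\<lambda>n. l2 (\<lambda>x. flux n i j x - sg i j x)) \<longlonglongrightarrow> 0"
  proof (rule Lim_null_comparison)
    show "\<forall>\<^sub>F n in sequentially. norm (l2 (\<lambda>x. flux n i j x - sg i j x)) \<le> l2 (\<lambda>x. S n (sg i j) x - sg i j x) + l2 (?b n)"
    proof (rule always_eventually, rule allI)
      fix n
      have "(\<lambda>x. flux n i j x - sg i j x) = (\<lambda>x. (S n (sg i j) x - sg i j x) + ?b n x)" unfolding eq by auto
      then show "norm (l2 (\<lambda>x. flux n i j x - sg i j x)) \<le> l2 (\<lambda>x. S n (sg i j) x - sg i j x) + l2 (?b n)"
        using l2_triangle[OF L2_diff[OF LS[of n] sg_L2[of i j]] Lb[of n]] by (simp add: l2_nonneg)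
    qed
    show "(\<lambda>n. l2 (\<lambda>x. S n (sg i j) x - sg i j x) + l2 (?b n)) \<longlonglongrightarrow> 0"
      using tendsto_add[OF S_tendsto_L2[OF sg_L2[of i j]] bracket_tendsto(1)[of i j]] by simp
  qed
  have Sq: "0 \<le> S n (\<lambda>x. r x * q x) x" for x
    using bracket_bounds(2)[of n i j x] by linarith
  have "\<bar>?b n x\<bar> \<le> \<bar>2 * S n (\<lambda>x. r x * q x) x\<bar>" for x
    using bracket_bounds(1)[of n i x j] bracket_bounds(2)[of n i j x] by linarith
  from L2_dominated(2)[OF L2_cmult[OF S_L2(1)[OF rq_L2(1)]] L2_measurable[OF Lb] this]
  have "l2 (?b n) \<le> 2 * l2 (S n (\<lambda>x. r x * q x))" by (simp add: l2_cmult)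
  also have "\<dots> \<le> 2 * (c2 * l2 q)" using S_L2(2)[OF rq_L2(1), of n] rq_L2(2) by simp
  finally have "l2 (?b n) \<le> 2 * c2 * l2 q" by simp
  then show "l2 (flux n i j) \<le> l2 (sg i j) + 2 * c2 * l2 q"
    unfolding eq using l2_triangle[OF LS[of n] Lb[of n]] S_L2(2)[OF sg_L2, of n i j] by linarith
qed

text \<open>\<open>flux\<close> and the pressure converge strongly, \<open>DV\<close> weakly, and
  every term of \<open>balance\<close> pairs one of each kind.\<close>

theorem balance_tendsto:
  "balance \<longlonglongrightarrow> - (\<Sum>i\<in>UNIV. \<Sum>j\<in>UNIV. (LINT x|torus. sg i j x * g i j x))
      - (\<Sum>i\<in>UNIV. (LINT x|torus. p (r x) * g i i x))"
proof -
  have l: "l2 (DV n j (u i)) \<le> sqrt (CB * (\<Sum>j\<in>UNIV. (l2 (g i j))\<^sup>2))" for n i j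
    using DV_L2(2)[OF u_L2 g_L2 u_pd, of n j i] by (intro real_le_rsqrt)
  note c = compose_R[OF p_lip]
  have 1: "(\<lambda>n. (LINT x|torus. flux n i j x * DV n j (u i) x)) \<longlonglongrightarrow> (LINT x|torus. sg i j x * g i j x)" for i j
    by (rule weak_strong_tendsto[OF DV_L2(1)[OF u_L2 g_L2 u_pd] l DV_weak[OF u_L2 g_L2 u_pd] sg_L2 flux_L2 flux_tendsto])
  have 2: "(\<lambda>n. (LINT x|torus. p (S n r x) * DV n i (u i) x)) \<longlonglongrightarrow> (LINT x|torus. p (r x) * g i i x)" for i
    by (rule weak_strong_tendsto[OF DV_L2(1)[OF u_L2 g_L2 u_pd] l DV_weak[OF u_L2 g_L2 u_pd] c(2) c(1) c(3)])
  show ?thesis unfolding balance_def[abs_def] by (intro tendsto_intros 1 2)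
qed

lemma Pm_nonneg: "0 \<le> Pm" using p_bound[of 0] by linarith

text \<open>Independent of \<open>n\<close> and built from squares of slice norms, so that it is
  integrable over the time interval and can serve as a majorant there.\<close>

theorem balance_bound:
  "\<bar>balance n\<bar> \<le> (\<Sum>i\<in>UNIV. \<Sum>j\<in>UNIV. (l2 (sg i j))\<^sup>2 + 4 * c2\<^sup>2 * (l2 q)\<^sup>2 + CB * (\<Sum>k\<in>UNIV. (l2 (g i k))\<^sup>2))
     + (\<Sum>i\<in>UNIV. Pm\<^sup>2 + CB * (\<Sum>k\<in>UNIV. (l2 (g i k))\<^sup>2))"
proof -
  note D = DV_L2[OF u_L2 g_L2 u_pd]
  have am: "x * y \<le> (x\<^sup>2 + y\<^sup>2) / 2" for x y :: real using sum_squares_bound[of x y] by simp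
  have G0: "0 \<le> CB * (\<Sum>k\<in>UNIV. (l2 (g i k))\<^sup>2)" for i by (intro mult_nonneg_nonneg sum_nonneg CB_nonneg) auto
  have 1: "\<bar>(LINT x|torus. flux n i j x * DV n j (u i) x)\<bar>
    \<le> (l2 (sg i j))\<^sup>2 + 4 * c2\<^sup>2 * (l2 q)\<^sup>2 + CB * (\<Sum>k\<in>UNIV. (l2 (g i k))\<^sup>2)" for i j
  proof -
    have "\<bar>(LINT x|torus. flux n i j x * DV n j (u i) x)\<bar> \<le> ((l2 (flux n i j))\<^sup>2 + (l2 (DV n j (u i)))\<^sup>2) / 2"
      using L2_mult(2)[OF flux_L2 D(1), of n i j n j i] am[of "l2 (flux n i j)" "l2 (DV n j (u i))"] by linarith
    moreover have "(l2 (flux n i j))\<^sup>2 \<le> (l2 (sg i j) + 2 * c2 * l2 q)\<^sup>2"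
      by (intro power_mono flux_bound l2_nonneg)
    moreover have "(l2 (sg i j) + 2 * c2 * l2 q)\<^sup>2 \<le> 2 * (l2 (sg i j))\<^sup>2 + 2 * (2 * c2 * l2 q)\<^sup>2"
      using sum_squares_bound[of "l2 (sg i j)" "2 * c2 * l2 q"] unfolding power2_sum by linarith
    moreover have "(2 * c2 * l2 q)\<^sup>2 = 4 * c2\<^sup>2 * (l2 q)\<^sup>2" by (simp add: power_mult_distrib)
    \<comment> \<open>Stated for plain real variables, to separate the arithmetic from the large
      norm expressions.\<close>
    moreover have "I \<le> (A + B) / 2 \<Longrightarrow> A \<le> A' \<Longrightarrow> A' \<le> 2 * s + 2 * t \<Longrightarrow> t = t' \<Longrightarrow> B \<le> C \<Longrightarrow> 0 \<le> C \<Longrightarrow> I \<le> s + t' + C"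
      for I A A' B C s t t' :: real by (simp add: field_simps)
    ultimately show ?thesis using D(2)[of n j i] G0[of i] by blast
  qed
  have lp: "l2 (\<lambda>x. p (S n r x)) \<le> Pm"
  proof -
    have "\<bar>p (S n r x)\<bar> \<le> \<bar>Pm\<bar>" for x using p_bound[of "S n r x"] by linarith
    from L2_dominated(2)[OF L2_const L2_measurable[OF compose_R(1)[OF p_lip]] this]
    have "l2 (\<lambda>x. p (S n r x)) \<le> l2 (\<lambda>x::real^'n. Pm)" .
    also have "l2 (\<lambda>x::real^'n. Pm) = Pm"
      using Pm_nonneg by (simp add: l2_def measure_def prob_space_torus)
    finally show ?thesis .
  qed
  have 2: "\<bar>(LINT x|torus. p (S n r x) * DV n i (u i) x)\<bar> \<le> Pm\<^sup>2 + CB * (\<Sum>k\<in>UNIV. (l2 (g i k))\<^sup>2)" for i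
  proof -
    have "\<bar>(LINT x|torus. p (S n r x) * DV n i (u i) x)\<bar> \<le> ((l2 (\<lambda>x. p (S n r x)))\<^sup>2 + (l2 (DV n i (u i)))\<^sup>2) / 2"
      using L2_mult(2)[OF compose_R(1)[OF p_lip] D(1), of n n i i] am[of "l2 (\<lambda>x. p (S n r x))" "l2 (DV n i (u i))"] by linarith
    moreover have "(l2 (\<lambda>x. p (S n r x)))\<^sup>2 \<le> Pm\<^sup>2" by (intro power_mono lp l2_nonneg)
    moreover have "I \<le> (A + B) / 2 \<Longrightarrow> A \<le> A' \<Longrightarrow> B \<le> C \<Longrightarrow> 0 \<le> C \<Longrightarrow> 0 \<le> A' \<Longrightarrow> I \<le> A' + C"
      for I A A' B C :: real by (simp add: field_simps)
    ultimately show ?thesis using D(2)[of n i i] G0[of i] zero_le_power2[of Pm] by blast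
  qed
  have "\<bar>balance n\<bar> \<le> \<bar>\<Sum>i\<in>UNIV. \<Sum>j\<in>UNIV. (LINT x|torus. flux n i j x * DV n j (u i) x)\<bar>
     + \<bar>\<Sum>i\<in>UNIV. (LINT x|torus. p (S n r x) * DV n i (u i) x)\<bar>" unfolding balance_def by linarith
  also have "\<dots> \<le> (\<Sum>i\<in>UNIV. \<Sum>j\<in>UNIV. \<bar>(LINT x|torus. flux n i j x * DV n j (u i) x)\<bar>)
     + (\<Sum>i\<in>UNIV. \<bar>(LINT x|torus. p (S n r x) * DV n i (u i) x)\<bar>)"
    by (intro add_mono sum_abs order_trans[OF sum_abs] sum_mono)
  also have "\<dots> \<le> (\<Sum>i\<in>UNIV. \<Sum>j\<in>UNIV. (l2 (sg i j))\<^sup>2 + 4 * c2\<^sup>2 * (l2 q)\<^sup>2 + CB * (\<Sum>k\<in>UNIV. (l2 (g i k))\<^sup>2))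
     + (\<Sum>i\<in>UNIV. Pm\<^sup>2 + CB * (\<Sum>k\<in>UNIV. (l2 (g i k))\<^sup>2))"
    by (intro add_mono sum_mono 1 2)
  finally show ?thesis .
qed

end

section \<open>Ladyzhenskaya's inequality\<close>

text \<open>A mean over one full period: it erases the dependence of a periodic function on
  coordinate \<open>j\<close> while preserving the total integral.\<close>

definition avg :: "'n \<Rightarrow> (real^'n::finite \<Rightarrow> real) \<Rightarrow> real^'n \<Rightarrow> real" where
  "avg j h x = integral {0..1} (\<lambda>s. h (x + s *\<^sub>R axis j 1))"

lemma line_cont:
  fixes h :: "real^'n::finite \<Rightarrow> real"
  assumes "continuous_on UNIV h"
  shows "continuous_on A (\<lambda>s. h (x + s *\<^sub>R axis j 1))"
  by (rule continuous_on_compose2[OF assms]) (auto intro!: continuous_intros)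

lemma avg_cont:
  assumes c: "continuous_on UNIV h"
  shows "continuous_on UNIV (avg j h)"
proof -
  have "continuous_on UNIV (\<lambda>x. integral (cbox 0 1) (\<lambda>s. h (x + s *\<^sub>R axis j 1)))"
    by (rule integral_continuous_on_param)
       (auto simp: case_prod_beta' intro!: continuous_on_compose2[OF c] continuous_intros)
  then show ?thesis by (simp add: avg_def[abs_def])
qed

lemma avg_periodic: "periodic_sp h \<Longrightarrow> periodic_sp (avg j h)"
  unfolding periodic_sp_def avg_def
proof (intro allI impI)
  fix x v :: "real^'a" assume p: "\<forall>x v. int_vec v \<longrightarrow> h (x + v) = h x" and v: "int_vec v"
  have "h (x + v + s *\<^sub>R axis j 1) = h (x + s *\<^sub>R axis j 1)" for s
    using p[rule_format, OF v, of "x + s *\<^sub>R axis j 1"] by (simp only: ac_simps)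
  then show "integral {0..1} (\<lambda>s. h (x + v + s *\<^sub>R axis j 1)) = integral {0..1} (\<lambda>s. h (x + s *\<^sub>R axis j 1))"
    by simp
qed

lemma int_vec_axis: "int_vec (axis j 1)"
  by (simp add: int_vec_def axis_def)

text \<open>The window \<open>[t, 1 + t]\<close> is split at 1 and its second piece moved back by
  one period.\<close>

lemma avg_invariant:
  assumes c: "continuous_on UNIV h" and p: "periodic_sp h" and t: "0 \<le> t" "t \<le> 1"
  shows "avg j h (x + t *\<^sub>R axis j 1) = avg j h x"
proof -
  define f where "f s = h (x + s *\<^sub>R axis j 1)" for s
  have cf: "continuous_on A f" for A unfolding f_def by (rule line_cont[OF c])
  have f1: "f (s + 1) = f s" for s
  proof -
    have "f (s + 1) = h ((x + s *\<^sub>R axis j 1) + axis j 1)" by (simp add: f_def algebra_simps)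
    also have "\<dots> = h (x + s *\<^sub>R axis j 1)"
      using p int_vec_axis unfolding periodic_sp_def by blast
    finally show ?thesis by (simp add: f_def)
  qed
  have "avg j h (x + t *\<^sub>R axis j 1) = integral {0..1} (f \<circ> (\<lambda>s. s + t))"
    by (simp add: avg_def f_def o_def algebra_simps)
  also have "\<dots> = integral {0 + t..1 + t} f"
    by (rule integral_shift) (rule cf)
  also have "\<dots> = integral {t..1} f + integral {1..1 + t} f"
    using t by (subst Henstock_Kurzweil_Integration.integral_combine) (auto intro!: integrable_continuous_interval cf)
  also have "integral {1..1 + t} f = integral {0 + 1..t + 1} f" by (simp add: add.commute)
  also have "\<dots> = integral {0..t} (f \<circ> (\<lambda>s. s + 1))"
    by (rule integral_shift[symmetric]) (rule cf)
  also have "f \<circ> (\<lambda>s. s + 1) = f" by (auto simp: f1)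
  also have "integral {t..1} f + integral {0..t} f = integral {0..1} f"
    using t Henstock_Kurzweil_Integration.integral_combine[of 0 t 1 f]
    by (simp add: integrable_continuous_interval cf)
  also have "f = (\<lambda>s. h (x + s *\<^sub>R axis j 1))" by (simp add: fun_eq_iff f_def)
  finally show ?thesis by (simp add: avg_def)
qed

lemma integral_torus_cell:
  assumes c: "continuous_on UNIV (h :: real^'n::finite \<Rightarrow> real)"
  shows "integral\<^sup>L torus h = integral cell h"
proof -
  have "set_integrable lborel cell h"
    unfolding cell_def set_integrable_def by (rule borel_integrable_compact) (auto intro: continuous_on_subset[OF c])
  from set_borel_integral_eq_integral(2)[OF this]
  show ?thesis using integral_torus[OF borel_cont[OF c]] by (simp add: set_lebesgue_integral_def)
qed

lemma avg_integral:
  assumes c: "continuous_on UNIV h" and p: "periodic_sp h"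
  shows "integral\<^sup>L torus (avg j h) = integral\<^sup>L torus h"
proof -
  have "integral\<^sup>L torus (avg j h) = integral (cbox 0 One) (\<lambda>x. integral (cbox 0 1) (\<lambda>s. h (x + s *\<^sub>R axis j 1)))"
    unfolding integral_torus_cell[OF avg_cont[OF c]] by (simp add: avg_def[abs_def] cell_def)
  also have "\<dots> = integral (cbox 0 1) (\<lambda>s. integral (cbox 0 One) (\<lambda>x. h (x + s *\<^sub>R axis j 1)))"
    by (rule integral_swap_continuous) (auto simp: case_prod_beta' intro!: continuous_on_compose2[OF c] continuous_intros)
  also have "(\<lambda>s. integral (cbox 0 One) (\<lambda>x. h (x + s *\<^sub>R axis j 1))) = (\<lambda>s::real. integral\<^sup>L torus h)"
  proof
    fix s :: real
    have "integral (cbox 0 One) (\<lambda>x. h (x + s *\<^sub>R axis j 1)) = (LINT x|torus. h (x + s *\<^sub>R axis j 1))"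
      using integral_torus_cell[OF cont_shift[OF c]] by (simp add: cell_def)
    then show "integral (cbox 0 One) (\<lambda>x. h (x + s *\<^sub>R axis j 1)) = integral\<^sup>L torus h"
      by (simp add: integral_torus_shift[OF c p])
  qed
  finally show ?thesis by simp
qed

text \<open>With only two axes, averaging along both leaves a constant, which must then be the total
  integral.\<close>

lemma avg_avg_const:
  fixes a b :: "'n::finite"
  assumes ab: "UNIV = {a, b}" "a \<noteq> b" and c: "continuous_on UNIV h" and p: "periodic_sp h"
  shows "avg a (avg b h) x = integral\<^sup>L torus h"
proof -
  let ?H = "avg a (avg b h)"
  note c1 = avg_cont[OF c, of b] and p1 = avg_periodic[OF p, of b]
  note c2 = avg_cont[OF c1, of a] and p2 = avg_periodic[OF p1, of a]
  have H: "?H y = ?H 0" for y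
  proof -
    define k :: "real^'n" where "k = (\<chi> i. of_int \<lfloor>y $ i\<rfloor>)"
    have k: "int_vec k" by (simp add: k_def int_vec_def)
    define z where "z = y - k"
    have z: "0 \<le> z $ i" "z $ i \<le> 1" for i unfolding z_def k_def by simp_all linarith
    have zz: "z = (0 + z $ a *\<^sub>R axis a 1) + z $ b *\<^sub>R axis b 1"
    proof (subst vec_eq_iff, rule allI)
      fix i have "i = a \<or> i = b" using ab(1) by auto
      then show "z $ i = ((0 + z $ a *\<^sub>R axis a 1) + z $ b *\<^sub>R axis b 1) $ i"
        using ab(2) by (auto simp: axis_def)
    qed
    have "?H y = ?H z" unfolding z_def by (rule periodic_sp_minus[OF p2 k, symmetric])
    also have "\<dots> = ?H ((0 + z $ a *\<^sub>R axis a 1) + z $ b *\<^sub>R axis b 1)" using zz by simp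
    also have "\<dots> = ?H (0 + z $ a *\<^sub>R axis a 1)"
    proof -
      have "avg b h (w + z $ b *\<^sub>R axis b 1 + s *\<^sub>R axis a 1) = avg b h (w + s *\<^sub>R axis a 1)" for w s
        using avg_invariant[OF c p z, of b "w + s *\<^sub>R axis a 1"] by (simp add: algebra_simps)
      then show ?thesis unfolding avg_def[of a "avg b h"] by simp
    qed
    also have "\<dots> = ?H 0" by (rule avg_invariant[OF c1 p1 z])
    finally show ?thesis .
  qed
  have "integral\<^sup>L torus h = integral\<^sup>L torus ?H" by (simp add: avg_integral c p c1 p1)
  also have "?H = (\<lambda>_. ?H 0)" using H by blast
  also have "integral\<^sup>L torus (\<lambda>_::real^'n. ?H 0) = ?H 0" by (simp add: measure_def prob_space_torus)
  finally show ?thesis using H[of x] by simp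
qed

text \<open>The value at \<open>x\<close> is compared with the values along one period by the
  fundamental theorem of calculus, and the comparison is averaged. A periodic function may have no
  zero, which is why the square itself appears beside the derivative term.\<close>

lemma square_le_avg:
  assumes pd: "pd j f f'"
  shows "(f x)\<^sup>2 \<le> avg j (\<lambda>x. (f x)\<^sup>2 + 2 * (\<bar>f x\<bar> * \<bar>f' x\<bar>)) x"
proof -
  note c = pd_cont[OF pd]
  define \<phi> where "\<phi> s = f (x + s *\<^sub>R axis j 1)" for s
  define \<psi> where "\<psi> s = f' (x + s *\<^sub>R axis j 1)" for s
  have c\<phi>: "continuous_on A \<phi>" and c\<psi>: "continuous_on A \<psi>" for A
    unfolding \<phi>_def \<psi>_def by (intro line_cont c)+
  have d: "(\<phi> has_real_derivative \<psi> s) (at s)" for s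
    unfolding \<phi>_def \<psi>_def by (rule pd_deriv[OF pd])
  define K where "K = integral {0..1} (\<lambda>s. 2 * (\<bar>\<phi> s\<bar> * \<bar>\<psi> s\<bar>))"
  have ca: "continuous_on A (\<lambda>s. 2 * (\<bar>\<phi> s\<bar> * \<bar>\<psi> s\<bar>))" for A by (intro continuous_intros c\<phi> c\<psi>)
  have le: "(\<phi> 0)\<^sup>2 \<le> (\<phi> s)\<^sup>2 + K" if s: "0 \<le> s" "s \<le> 1" for s
  proof -
    have "((\<lambda>s. 2 * (\<phi> s * \<psi> s)) has_integral (\<phi> s)\<^sup>2 - (\<phi> 0)\<^sup>2) {0..s}"
    proof (rule fundamental_theorem_of_calculus[OF s(1)])
      fix t assume "t \<in> {0..s}"
      have "((\<lambda>s. (\<phi> s)\<^sup>2) has_real_derivative 2 * (\<phi> t * \<psi> t)) (at t)"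
        using DERIV_power[OF d[of t], of 2] by (simp add: mult_ac)
      then show "((\<lambda>s. (\<phi> s)\<^sup>2) has_vector_derivative 2 * (\<phi> t * \<psi> t)) (at t within {0..s})"
        by (simp add: has_real_derivative_iff_has_vector_derivative has_vector_derivative_at_within)
    qed
    then have eq: "integral {0..s} (\<lambda>s. 2 * (\<phi> s * \<psi> s)) = (\<phi> s)\<^sup>2 - (\<phi> 0)\<^sup>2" by (rule integral_unique)
    have "norm (integral {0..s} (\<lambda>s. 2 * (\<phi> s * \<psi> s))) \<le> integral {0..s} (\<lambda>s. 2 * (\<bar>\<phi> s\<bar> * \<bar>\<psi> s\<bar>))"
      by (rule integral_norm_bound_integral)
         (auto intro!: integrable_continuous_interval continuous_intros c\<phi> c\<psi> simp: abs_mult)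
    also have "\<dots> \<le> K" unfolding K_def
      using s by (intro integral_subset_le integrable_continuous_interval ca) auto
    finally show ?thesis unfolding eq by (simp add: abs_le_iff)
  qed
  have "(f x)\<^sup>2 = integral {0..1} (\<lambda>s::real. (\<phi> 0)\<^sup>2)" by (simp add: \<phi>_def)
  also have "\<dots> \<le> integral {0..1} (\<lambda>s. (\<phi> s)\<^sup>2 + K)"
    by (intro integral_le integrable_continuous_interval continuous_intros c\<phi>) (use le in auto)
  also have "\<dots> = integral {0..1} (\<lambda>s. (\<phi> s)\<^sup>2) + K"
    by (subst Henstock_Kurzweil_Integration.integral_add)
       (auto intro!: integrable_continuous_interval continuous_intros c\<phi>)
  also have "\<dots> = integral {0..1} (\<lambda>s. (\<phi> s)\<^sup>2 + 2 * (\<bar>\<phi> s\<bar> * \<bar>\<psi> s\<bar>))"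
    unfolding K_def by (subst Henstock_Kurzweil_Integration.integral_add)
       (auto intro!: integrable_continuous_interval continuous_intros c\<phi> c\<psi>)
  finally show ?thesis by (simp add: avg_def \<phi>_def \<psi>_def)
qed

text \<open>Each factor \<open>(f x)\<^sup>2\<close> is bounded by an average along its own axis.
  The average along \<open>a\<close> is constant in direction \<open>a\<close>, so averaging the
  product once more along \<open>a\<close> splits it into a product of integrals.\<close>

lemma Ladyzhenskaya_smooth:
  fixes a b :: "'n::finite"
  assumes ab: "UNIV = {a, b}" "a \<noteq> b" and pa: "pd a f fa" and pb: "pd b f fb"
  shows "(LINT x|torus. (f x) ^ 4) \<le> ((l2 f)\<^sup>2 + 2 * (l2 f * l2 fa)) * ((l2 f)\<^sup>2 + 2 * (l2 f * l2 fb))"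
proof -
  let ?h = "\<lambda>f' x. (f x)\<^sup>2 + 2 * (\<bar>f x\<bar> * \<bar>f' x\<bar>)"
  note cf = pd_cont(1)[OF pa] and ca = pd_cont(2)[OF pa] and cb = pd_cont(2)[OF pb]
  note pf = pd_periodic[OF pa] and pa' = pd_periodic'[OF pa] and pb' = pd_periodic'[OF pb]
  have cA: "continuous_on UNIV (?h fa)" and cB: "continuous_on UNIV (?h fb)"
    by (intro continuous_intros cf ca cb)+
  have pA: "periodic_sp (?h fa)" and pB: "periodic_sp (?h fb)"
    using pf pa' pb' by (simp_all add: periodic_sp_def)
  let ?A = "avg a (?h fa)" and ?B = "avg b (?h fb)"
  note cA' = avg_cont[OF cA, of a] and cB' = avg_cont[OF cB, of b]
  note pA' = avg_periodic[OF pA, of a] and pB' = avg_periodic[OF pB, of b]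
  have cAB: "continuous_on UNIV (\<lambda>x. ?A x * ?B x)" by (intro continuous_intros cA' cB')
  have pAB: "periodic_sp (\<lambda>x. ?A x * ?B x)" using pA' pB' by (simp add: periodic_sp_def)
  have hb: "integral\<^sup>L torus (?h f') \<le> (l2 f)\<^sup>2 + 2 * (l2 f * l2 f')" if "continuous_on UNIV f'" "periodic_sp f'" for f'
  proof -
    have L: "L2 f" "L2 f'" using cf pf that by (auto intro: L2_periodic)
    note m = L2_mult[OF L2_abs[OF L(1)] L2_abs[OF L(2)]]
    have "integral\<^sup>L torus (?h f') = (l2 f)\<^sup>2 + 2 * (LINT x|torus. \<bar>f x\<bar> * \<bar>f' x\<bar>)"
      using m(1) L2_sq[OF L(1)] by (simp add: l2_sq)
    then show ?thesis using m(2) by (simp add: l2_abs abs_le_iff)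
  qed
  have h0: "0 \<le> integral\<^sup>L torus (?h f')" for f' by (rule integral_nonneg_AE) auto
  have "(LINT x|torus. (f x) ^ 4) \<le> (LINT x|torus. ?A x * ?B x)"
  proof (rule integral_mono)
    show "integrable torus (\<lambda>x. (f x) ^ 4)"
      using pf by (intro integrable_torus_periodic continuous_intros cf) (simp add: periodic_sp_def)
    show "integrable torus (\<lambda>x. ?A x * ?B x)" by (rule integrable_torus_periodic[OF cAB pAB])
    fix x
    have "(f x)\<^sup>2 * (f x)\<^sup>2 \<le> ?A x * ?B x"
      using square_le_avg[OF pa, of x] square_le_avg[OF pb, of x] order_trans[OF zero_le_power2 square_le_avg[OF pa, of x]]
      by (intro mult_mono) auto
    then show "(f x) ^ 4 \<le> ?A x * ?B x" by (simp add: power2_eq_square power4_eq_xxxx mult.assoc)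
  qed
  also have "\<dots> = integral\<^sup>L torus (avg a (\<lambda>x. ?A x * ?B x))" by (simp add: avg_integral[OF cAB pAB])
  also have "avg a (\<lambda>x. ?A x * ?B x) = (\<lambda>x. ?A x * integral\<^sup>L torus (?h fb))"
  proof
    fix x
    have "avg a (\<lambda>x. ?A x * ?B x) x = integral {0..1} (\<lambda>s. ?A x * ?B (x + s *\<^sub>R axis a 1))"
      unfolding avg_def[of a "\<lambda>x. ?A x * ?B x"]
      by (rule Henstock_Kurzweil_Integration.integral_cong) (simp add: avg_invariant[OF cA pA])
    also have "\<dots> = ?A x * avg a ?B x" by (simp add: avg_def[of a ?B])
    also have "avg a ?B x = integral\<^sup>L torus (?h fb)" by (rule avg_avg_const[OF ab cB pB])
    finally show "avg a (\<lambda>x. ?A x * ?B x) x = ?A x * integral\<^sup>L torus (?h fb)" .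
  qed
  also have "(LINT x|torus. ?A x * integral\<^sup>L torus (?h fb)) = integral\<^sup>L torus (?h fa) * integral\<^sup>L torus (?h fb)"
    by (simp add: avg_integral[OF cA pA])
  also have "\<dots> \<le> ((l2 f)\<^sup>2 + 2 * (l2 f * l2 fa)) * ((l2 f)\<^sup>2 + 2 * (l2 f * l2 fb))"
    by (rule mult_mono[OF hb[OF ca pa'] hb[OF cb pb'] order_trans[OF h0 hb[OF ca pa']] h0])
  finally show ?thesis .
qed

text \<open>Fatou along averages that converge almost everywhere; the smooth bound is monotone in
  the norms, which averaging does not increase.\<close>

theorem Ladyzhenskaya:
  fixes u :: "real^'n::finite \<Rightarrow> real"
  assumes card: "CARD('n) = 2" and u: "L2 u" and g: "\<And>j. L2 (g j)" and pd: "\<And>m j. pd j (S m u) (S m (g j))"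
  shows "(\<integral>\<^sup>+x. ennreal ((u x) ^ 4) \<partial>torus) \<le> ennreal (3 * (l2 u)\<^sup>2 * ((l2 u)\<^sup>2 + 2 * (\<Sum>j\<in>UNIV. (l2 (g j))\<^sup>2)))"
proof -
  obtain a b :: 'n where ab: "UNIV = {a, b}" "a \<noteq> b"
    using card by (metis card_2_iff)
  have [measurable]: "u \<in> borel_measurable borel" using u by (simp add: L2_def)
  let ?C = "3 * (l2 u)\<^sup>2 * ((l2 u)\<^sup>2 + 2 * (\<Sum>j\<in>UNIV. (l2 (g j))\<^sup>2))"
  have bound: "(LINT x|torus. (S m u x) ^ 4) \<le> ?C" for m
  proof -
    have l: "l2 (S m u) \<le> l2 u" "l2 (S m (g j)) \<le> l2 (g j)" for j by (intro S_L2 u g)+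
    have "(LINT x|torus. (S m u x) ^ 4)
        \<le> ((l2 (S m u))\<^sup>2 + 2 * (l2 (S m u) * l2 (S m (g a)))) * ((l2 (S m u))\<^sup>2 + 2 * (l2 (S m u) * l2 (S m (g b))))"
      by (rule Ladyzhenskaya_smooth[OF ab pd pd])
    also have "\<dots> \<le> ((l2 u)\<^sup>2 + 2 * (l2 u * l2 (g a))) * ((l2 u)\<^sup>2 + 2 * (l2 u * l2 (g b)))"
      using l by (intro mult_mono add_mono power_mono mult_left_mono order_refl mult_nonneg_nonneg add_nonneg_nonneg l2_nonneg) (auto simp: l2_nonneg)
    also have "\<dots> \<le> ?C"
    proof -
      let ?x = "l2 u" and ?y = "l2 (g a)" and ?z = "l2 (g b)"
      \<comment> \<open>The origin of the constant 3: with it, the difference of the two sides is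
        exactly this multiple of a sum of squares.\<close>
      have "0 \<le> ?x\<^sup>2 * ((?x - ?y)\<^sup>2 + (?x - ?z)\<^sup>2 + 2 * (?y - ?z)\<^sup>2 + 3 * ?y\<^sup>2 + 3 * ?z\<^sup>2)"
        by (intro mult_nonneg_nonneg add_nonneg_nonneg) auto
      then have n: "0 \<le> 3 * ?x\<^sup>2 * (?x\<^sup>2 + 2 * (?y\<^sup>2 + ?z\<^sup>2)) - (?x\<^sup>2 + 2 * (?x * ?y)) * (?x\<^sup>2 + 2 * (?x * ?z))"
        by (simp add: power2_eq_square algebra_simps)
      have s: "(\<Sum>j\<in>UNIV. (l2 (g j))\<^sup>2) = ?y\<^sup>2 + ?z\<^sup>2" unfolding ab(1) using ab(2) by simp
      show ?thesis unfolding s using n unfolding diff_ge_0_iff_ge .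
    qed
    finally show ?thesis .
  qed
  have Sm: "S m u \<in> borel_measurable borel" for m using S_L2(1)[OF u, of m] by (simp add: L2_def)
  note Sm[measurable]
  have "(\<lambda>m. (LINT x|torus. norm (S m u x - u x))) \<longlonglongrightarrow> 0"
  proof (rule Lim_null_comparison[OF _ S_tendsto_L2[OF u]], rule always_eventually, rule allI)
    fix m
    have "0 \<le> (LINT x|torus. norm (S m u x - u x))" by (rule integral_nonneg_AE) auto
    then show "norm (LINT x|torus. norm (S m u x - u x)) \<le> l2 (\<lambda>x. S m u x - u x)"
      using L1_le_l2[OF L2_diff[OF S_L2(1)[OF u, of m] u]] by simp
  qed
  from tendsto_L1_AE_subseq[OF L2_integrable[OF L2_diff[OF S_L2(1)[OF u] u]] this]
  obtain q where q: "strict_mono q" "AE x in torus. (\<lambda>n. S (q n) u x - u x) \<longlonglongrightarrow> 0" by auto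
  have "(\<integral>\<^sup>+x. ennreal ((u x) ^ 4) \<partial>torus) = (\<integral>\<^sup>+x. liminf (\<lambda>n. ennreal ((S (q n) u x) ^ 4)) \<partial>torus)"
  proof (rule nn_integral_cong_AE, use q(2) in eventually_elim)
    case (elim x)
    then have "(\<lambda>n. S (q n) u x) \<longlonglongrightarrow> u x" by (rule LIM_zero_cancel)
    then have "(\<lambda>n. ennreal ((S (q n) u x) ^ 4)) \<longlonglongrightarrow> ennreal ((u x) ^ 4)"
      by (intro tendsto_ennrealI tendsto_power)
    from lim_imp_Liminf[OF _ this] show ?case by simp
  qed
  also have "\<dots> \<le> liminf (\<lambda>n. \<integral>\<^sup>+x. ennreal ((S (q n) u x) ^ 4) \<partial>torus)"
    by (rule nn_integral_liminf) measurable
  also have "\<dots> \<le> ennreal ?C"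
  proof (rule Liminf_le[OF _ always_eventually])
    show "\<forall>n. (\<integral>\<^sup>+x. ennreal ((S (q n) u x) ^ 4) \<partial>torus) \<le> ennreal ?C"
    proof
      fix n
      have p: "pd a (S (q n) u) (S (q n) (g a))" by (rule pd)
      have "integrable torus (\<lambda>x. (S (q n) u x) ^ 4)"
        using pd_periodic[OF p] by (intro integrable_torus_periodic continuous_intros pd_cont(1)[OF p]) (simp add: periodic_sp_def)
      then have "(\<integral>\<^sup>+x. ennreal ((S (q n) u x) ^ 4) \<partial>torus) = ennreal (LINT x|torus. (S (q n) u x) ^ 4)"
        by (rule nn_integral_eq_integral) auto
      then show "(\<integral>\<^sup>+x. ennreal ((S (q n) u x) ^ 4) \<partial>torus) \<le> ennreal ?C"
        using bound[of "q n"] by (simp add: ennreal_leI)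
    qed
  qed simp
  finally show ?thesis .
qed

section \<open>Absolutely continuous curves and weak derivatives in time\<close>

text \<open>On a short interval the increment of \<open>\<Phi>\<close> is linearised at the left
  endpoint, with an error of \<open>e\<close> times the increment of \<open>K\<close>; freezing
  \<open>D\<close> in the integral costs as much again. Over a partition the errors add up to
  \<open>2 * e * K T\<close>, for every \<open>e > 0\<close>.\<close>

theorem AC_chain_rule:
  fixes f g :: "real \<Rightarrow> 'a::euclidean_space" and \<Phi> :: "'a \<Rightarrow> real" and D :: "'a \<Rightarrow> 'a"
  assumes T: "0 \<le> T" and g: "g absolutely_integrable_on {0..T}"
    and f: "\<And>t. t \<in> {0..T} \<Longrightarrow> f t = f0 + integral {0..t} g"
    and U: "convex U" "\<And>t. t \<in> {0..T} \<Longrightarrow> f t \<in> U"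
    and \<Phi>: "\<And>z. z \<in> U \<Longrightarrow> (\<Phi> has_derivative (\<lambda>h. D z \<bullet> h)) (at z)" and cD: "continuous_on U D"
  shows "(\<lambda>s. D (f s) \<bullet> g s) absolutely_integrable_on {0..T}"
    and "\<Phi> (f T) = \<Phi> f0 + integral {0..T} (\<lambda>s. D (f s) \<bullet> g s)"
proof -
  have gi: "g integrable_on {a..b}" if "0 \<le> a" "b \<le> T" for a b
    using that set_lebesgue_integral_eq_integral(1)[OF g] by (rule_tac integrable_on_subinterval) auto
  have ni: "(\<lambda>s. norm (g s)) integrable_on {a..b}" if "0 \<le> a" "b \<le> T" for a b
    using that g unfolding absolutely_integrable_on_def by (rule_tac integrable_on_subinterval) auto
  have cf: "continuous_on {0..T} f"
  proof (rule continuous_on_eq)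
    show "continuous_on {0..T} (\<lambda>t. f0 + integral {0..t} g)"
      by (intro continuous_intros indefinite_integral_continuous_1 gi) auto
  qed (use f in simp)
  \<comment> \<open>The mean value estimate runs along segments between values of \<open>f\<close>.
    The convex hull contains these segments and stays inside \<open>U\<close>; it is compact, so
    \<open>D\<close> is uniformly continuous on it.\<close>
  define C where "C = convex hull (f ` {0..T})"
  have C: "compact C" "convex C" "C \<subseteq> U" "\<And>t. t \<in> {0..T} \<Longrightarrow> f t \<in> C"
  proof -
    show "compact C" unfolding C_def by (intro compact_convex_hull compact_continuous_image cf) auto
    show "convex C" unfolding C_def by simp
    show "C \<subseteq> U" unfolding C_def using U by (intro hull_minimal) auto
    show "f t \<in> C" if "t \<in> {0..T}" for t unfolding C_def using that by (intro hull_inc) auto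
  qed
  have cDf: "continuous_on {0..T} (\<lambda>s. D (f s))"
    by (rule continuous_on_compose2[OF cD cf]) (use U in auto)
  show ai: "(\<lambda>s. D (f s) \<bullet> g s) absolutely_integrable_on {0..T}"
  proof (rule absolutely_integrable_bounded_measurable_product[where h = "(\<bullet>)", OF _ _ _ _ g])
    show "bilinear (inner :: 'a \<Rightarrow> 'a \<Rightarrow> real)" unfolding bilinear_conv_bounded_bilinear by (rule bounded_bilinear_inner)
    show "(\<lambda>s. D (f s)) \<in> borel_measurable (lebesgue_on {0..T})"
      by (rule continuous_imp_measurable_on_sets_lebesgue[OF cDf]) auto
    show "bounded ((\<lambda>s. D (f s)) ` {0..T})"
      by (intro compact_imp_bounded compact_continuous_image cDf) auto
  qed auto
  have di: "(\<lambda>s. D (f s) \<bullet> g s) integrable_on {a..b}" if "0 \<le> a" "b \<le> T" for a b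
    using that set_lebesgue_integral_eq_integral(1)[OF ai] by (rule_tac integrable_on_subinterval) auto
  define E where "E t = \<Phi> (f t) - \<Phi> (f 0) - integral {0..t} (\<lambda>s. D (f s) \<bullet> g s)" for t
  define K where "K t = integral {0..t} (\<lambda>s. norm (g s))" for t
  have f0: "f 0 = f0" using f[of 0] T by simp
  have diff: "integral {0..t} h - integral {0..s} h = integral {s..t} h"
    if "0 \<le> s" "s \<le> t" "t \<le> T" "h integrable_on {0..t}" for s t and h :: "real \<Rightarrow> 'b::banach"
    using Henstock_Kurzweil_Integration.integral_combine[OF that(1,2,4)] by (simp add: algebra_simps)
  have main: "\<bar>E T\<bar> \<le> 2 * e * K T" if e: "0 < e" for e
  proof -
    have "uniformly_continuous_on C D"
      using C cD by (intro compact_uniformly_continuous) (auto intro: continuous_on_subset)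
    then obtain d1 where d1: "0 < d1" "\<And>z w. z \<in> C \<Longrightarrow> w \<in> C \<Longrightarrow> dist w z < d1 \<Longrightarrow> dist (D w) (D z) < e"
      using e unfolding uniformly_continuous_on_def by metis
    have "uniformly_continuous_on {0..T} f" using cf by (intro compact_uniformly_continuous) auto
    then obtain d where d: "0 < d" "\<And>s t. s \<in> {0..T} \<Longrightarrow> t \<in> {0..T} \<Longrightarrow> dist t s < d \<Longrightarrow> dist (f t) (f s) < d1"
      using d1(1) unfolding uniformly_continuous_on_def by metis
    have local: "\<bar>E t - E s\<bar> \<le> 2 * e * (K t - K s)" if st: "0 \<le> s" "s \<le> t" "t \<le> T" "t - s < d" for s t
    proof -
      have fst: "f t - f s = integral {s..t} g" and Kst: "K t - K s = integral {s..t} (\<lambda>s. norm (g s))"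
        and Dst: "E t - E s = \<Phi> (f t) - \<Phi> (f s) - integral {s..t} (\<lambda>s. D (f s) \<bullet> g s)"
        using f[of s] f[of t] st diff[OF st(1-3) gi] diff[OF st(1-3) ni] diff[OF st(1-3) di]
        by (auto simp: K_def E_def)
      have near: "dist (f r) (f s) < d1" if "r \<in> {s..t}" for r
        using d(2)[of s r] st that by (auto simp: dist_real_def)
      have nf: "norm (f t - f s) \<le> K t - K s"
        unfolding fst Kst using st by (intro integral_norm_bound_integral gi ni) auto
      have seg: "closed_segment (f s) (f t) \<subseteq> C" using C st by (intro closed_segment_subset) auto
      have "norm (\<Phi> (f t) - \<Phi> (f s) - D (f s) \<bullet> (f t - f s)) \<le> norm (f t - f s) * e"
      proof (rule differentiable_bound_linearization[where S = "closed_segment (f s) (f t)" and f' = "\<lambda>z h. D z \<bullet> h" and f = \<Phi>])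
        show "f s + r *\<^sub>R (f t - f s) \<in> closed_segment (f s) (f t)" if "r \<in> {0..1}" for r
          using that unfolding closed_segment_def by (auto intro!: exI[of _ r] simp: algebra_simps)
        show "(\<Phi> has_derivative (\<lambda>h. D z \<bullet> h)) (at z within closed_segment (f s) (f t))"
          if "z \<in> closed_segment (f s) (f t)" for z
          using \<Phi>[of z] that seg C(3) by (blast intro: has_derivative_at_withinI)
        show "onorm ((\<lambda>h. D z \<bullet> h) - (\<lambda>h. D (f s) \<bullet> h)) \<le> e" if z: "z \<in> closed_segment (f s) (f t)" for z
        proof -
          have "dist z (f s) \<le> dist (f t) (f s)"
            using z by (metis dist_commute segment_bound(1) dist_norm norm_minus_commute)
          then have "dist (D z) (D (f s)) < e"
            using d1(2)[of "f s" z] near[of t] st z seg C(4)[of s] by force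
          then have "norm (D z - D (f s)) \<le> e" by (simp add: dist_norm)
          moreover have "onorm (\<lambda>h. (D z - D (f s)) \<bullet> h) \<le> norm (D z - D (f s))"
            by (rule onorm_le) (use Cauchy_Schwarz_ineq2[of "D z - D (f s)"] in \<open>auto\<close>)
          moreover have "((\<lambda>h. D z \<bullet> h) - (\<lambda>h. D (f s) \<bullet> h)) = (\<lambda>h. (D z - D (f s)) \<bullet> h)"
            by (auto simp: inner_diff_left)
          ultimately show ?thesis by simp
        qed
      qed auto
      then have 1: "\<bar>\<Phi> (f t) - \<Phi> (f s) - D (f s) \<bullet> (f t - f s)\<bar> \<le> e * (K t - K s)"
        using order_trans[OF _ mult_right_mono[OF nf less_imp_le[OF e]]] by (simp add: mult.commute)
      have "D (f s) \<bullet> (f t - f s) = integral {s..t} (\<lambda>r. D (f s) \<bullet> g r)"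
        unfolding fst using integral_linear[OF gi bounded_linear_inner_right, of s t "D (f s)"] st by (simp add: o_def)
      then have "D (f s) \<bullet> (f t - f s) - integral {s..t} (\<lambda>s. D (f s) \<bullet> g s)
          = integral {s..t} (\<lambda>r. D (f s) \<bullet> g r - D (f r) \<bullet> g r)"
        using st integrable_linear[OF gi bounded_linear_inner_right, of s t "D (f s)"]
        by (subst Henstock_Kurzweil_Integration.integral_diff) (auto intro!: di simp: o_def)
      also have "norm \<dots> \<le> integral {s..t} (\<lambda>r. e * norm (g r))"
      proof (rule integral_norm_bound_integral)
        show "(\<lambda>r. D (f s) \<bullet> g r - D (f r) \<bullet> g r) integrable_on {s..t}"
          using st integrable_linear[OF gi bounded_linear_inner_right, of s t "D (f s)"]
          by (intro Henstock_Kurzweil_Integration.integrable_diff di) (auto simp: o_def)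
        show "(\<lambda>r. e * norm (g r)) integrable_on {s..t}" using ni[of s t] st by (intro integrable_on_mult_right) auto
        fix r assume r: "r \<in> {s..t}"
        have "dist (D (f r)) (D (f s)) < e" using d1(2)[OF _ _ near[OF r]] C(4) r st by auto
        then have "norm (D (f s) - D (f r)) \<le> e" by (simp add: dist_norm norm_minus_commute)
        then show "norm (D (f s) \<bullet> g r - D (f r) \<bullet> g r) \<le> e * norm (g r)"
          using Cauchy_Schwarz_ineq2[of "D (f s) - D (f r)" "g r"] mult_right_mono[of "norm (D (f s) - D (f r))" e "norm (g r)"]
          by (simp add: inner_diff_left)
      qed
      also have "\<dots> = e * (K t - K s)" unfolding Kst by simp
      finally have 2: "\<bar>D (f s) \<bullet> (f t - f s) - integral {s..t} (\<lambda>s. D (f s) \<bullet> g s)\<bar> \<le> e * (K t - K s)" by simp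
      have "\<bar>A - B\<bar> \<le> c \<Longrightarrow> \<bar>B - C\<bar> \<le> c \<Longrightarrow> \<bar>A - C\<bar> \<le> 2 * c" for A B C c :: real by linarith
      from this[OF 1 2] show ?thesis unfolding Dst by (simp add: mult.assoc)
    qed
    obtain N :: nat where N: "T / d < real N" using reals_Archimedean2 by blast
    then have N0: "0 < N" using T d(1) by (cases N) (auto simp: divide_less_0_iff)
    have step: "T / N < d" using N N0 d(1) by (simp add: field_simps)
    have "\<bar>E (real k * (T / N))\<bar> \<le> 2 * e * K (real k * (T / N))" if "k \<le> N" for k
      using that
    proof (induction k)
      case 0
      then show ?case by (simp add: E_def K_def)
    next
      case (Suc k)
      have a: "0 \<le> real k * (T / N)" "real k * (T / N) \<le> real (Suc k) * (T / N)"
        using T by (intro mult_nonneg_nonneg mult_right_mono; simp)+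
      have b: "real (Suc k) * (T / N) \<le> T"
        using mult_right_mono[of "real (Suc k)" "real N" "T / N"] Suc.prems T N0 by simp
      have c: "real (Suc k) * (T / N) - real k * (T / N) < d"
      proof -
        have "real (Suc k) * X - real k * X = X" for X :: real by (simp add: algebra_simps)
        then show ?thesis using step by (simp only:)
      qed
      from local[OF a b c] Suc show ?case by (simp add: right_diff_distrib)
    qed
    from this[of N] show ?thesis using N0 by simp
  qed
  have "E T = 0"
  proof (rule ccontr)
    assume nz: "E T \<noteq> 0"
    have K0: "0 \<le> K T" unfolding K_def by (rule Henstock_Kurzweil_Integration.integral_nonneg) (use ni[of 0 T] in auto)
    \<comment> \<open>This choice of \<open>e\<close> bounds \<open>\<bar>E T\<bar>\<close> by half
      of itself; the summand 1 keeps the denominator positive.\<close>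
    have "\<bar>E T\<bar> \<le> 2 * (\<bar>E T\<bar> / (4 * (K T + 1))) * K T" using nz K0 by (intro main) auto
    also have "\<dots> = \<bar>E T\<bar> / 2 * (K T / (K T + 1))"
    proof -
      have "2 * (a / (4 * b)) * c = a / 2 * (c / b)" for a b c :: real by simp
      then show ?thesis by (simp only:)
    qed
    also have "\<dots> \<le> \<bar>E T\<bar> / 2 * 1" using K0 by (intro mult_left_mono) auto
    finally show False using nz by simp
  qed
  then show "\<Phi> (f T) = \<Phi> f0 + integral {0..T} (\<lambda>s. D (f s) \<bullet> g s)" by (simp add: E_def f0)
qed

text \<open>A graded counterpart of the coinductive \<open>smooth_fun\<close>: closure under sums,
  products and compositions is shown by induction on the order, and coinduction is used only once,
  in \<open>smooth_fun_smooth\<close>.\<close>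

primrec Ck :: "nat \<Rightarrow> ('a::euclidean_space \<Rightarrow> real) \<Rightarrow> bool" where
  "Ck 0 f = True"
| "Ck (Suc n) f = (\<exists>f'. (\<forall>x. (f has_derivative f' x) (at x)) \<and> (\<forall>v. Ck n (\<lambda>x. f' x v)))"

definition smooth :: "('a::euclidean_space \<Rightarrow> real) \<Rightarrow> bool" where
  "smooth f \<longleftrightarrow> (\<forall>n. Ck n f)"

text \<open>Each order \<open>n\<close> supplies its own derivative; uniqueness of derivatives
  identifies them all with a single \<open>f'\<close>.\<close>

lemma smooth_fun_smooth: "smooth f \<Longrightarrow> smooth_fun f"
proof (coinduction arbitrary: f rule: smooth_fun.coinduct)
  case smooth_fun
  then have *: "Ck (Suc n) f" for n unfolding smooth_def by blast
  obtain f' where f': "\<And>x. (f has_derivative f' x) (at x)" using *[of 0] by auto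
  have "Ck n (\<lambda>x. f' x v)" for n v
  proof -
    obtain f'' where f'': "\<And>x. (f has_derivative f'' x) (at x)" "\<And>v. Ck n (\<lambda>x. f'' x v)" using *[of n] by auto
    have "f'' x = f' x" for x using has_derivative_unique[OF f''(1) f'] .
    then show ?thesis using f''(2)[of v] by simp
  qed
  then show ?case using f' unfolding smooth_def by blast
qed

lemma Ck_mono: "Ck (Suc n) f \<Longrightarrow> Ck n f"
proof (induction n arbitrary: f)
  case (Suc n)
  then obtain f' where "\<forall>x. (f has_derivative f' x) (at x)" "\<forall>v. Ck (Suc n) (\<lambda>x. f' x v)"
    by (auto simp only: Ck.simps(2)[of "Suc n"])
  then show ?case using Suc.IH by auto
qed simp

lemma Ck_const: "Ck n (\<lambda>x. c)"
  by (induction n arbitrary: c) (auto intro!: exI[of _ "\<lambda>x v. 0"])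

lemma Ck_add: "Ck n f \<Longrightarrow> Ck n g \<Longrightarrow> Ck n (\<lambda>x. f x + g x)"
proof (induction n arbitrary: f g)
  case (Suc n)
  obtain f' where f': "\<And>x. (f has_derivative f' x) (at x)" "\<And>v. Ck n (\<lambda>x. f' x v)" using Suc.prems(1) by auto
  obtain g' where g': "\<And>x. (g has_derivative g' x) (at x)" "\<And>v. Ck n (\<lambda>x. g' x v)" using Suc.prems(2) by auto
  show ?case unfolding Ck.simps
    by (intro exI[of _ "\<lambda>x v. f' x v + g' x v"] conjI allI has_derivative_add f' g' Suc.IH)
qed simp

lemma Ck_mult: "Ck n f \<Longrightarrow> Ck n g \<Longrightarrow> Ck n (\<lambda>x. f x * g x)"
proof (induction n arbitrary: f g)
  case (Suc n)
  obtain f' where f': "\<And>x. (f has_derivative f' x) (at x)" "\<And>v. Ck n (\<lambda>x. f' x v)" using Suc.prems(1) by auto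
  obtain g' where g': "\<And>x. (g has_derivative g' x) (at x)" "\<And>v. Ck n (\<lambda>x. g' x v)" using Suc.prems(2) by auto
  have "Ck n (\<lambda>x. f x * g' x v + f' x v * g x)" for v
    by (rule Ck_add[OF Suc.IH[OF Ck_mono[OF Suc.prems(1)] g'(2)] Suc.IH[OF f'(2) Ck_mono[OF Suc.prems(2)]]])
  then show ?case unfolding Ck.simps
    by (intro exI[of _ "\<lambda>x v. f x * g' x v + f' x v * g x"] conjI allI has_derivative_mult f' g')
qed simp

lemma Ck_linear_compose:
  fixes l :: "'a::euclidean_space \<Rightarrow> real"
  assumes l: "bounded_linear l"
  shows "Ck n f \<Longrightarrow> Ck n (\<lambda>x. f (l x + c))"
proof (induction n arbitrary: f)
  case (Suc n)
  obtain f' where f': "\<And>x. (f has_derivative f' x) (at x)" "\<And>v. Ck n (\<lambda>x. f' x v)" using Suc.prems by auto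
  have "((\<lambda>x. f (l x + c)) has_derivative (\<lambda>v. f' (l x + c) (l v))) (at x)" for x
    by (rule has_derivative_compose[OF _ f'(1)])
       (auto intro!: derivative_eq_intros bounded_linear_imp_has_derivative l)
  moreover have "f' (l x + c) (l v) = l v * f' (l x + c) 1" for x v
    using has_derivative_linear[OF f'(1), of "l x + c"] linear_scale[of "f' (l x + c)" "l v" 1] by simp
  then have "Ck n (\<lambda>x. f' (l x + c) (l v))" for v
    by (simp only:) (intro Ck_mult Ck_const Suc.IH[OF f'(2)])
  ultimately show ?case unfolding Ck.simps by (intro exI[of _ "\<lambda>x v. f' (l x + c) (l v)"]) auto
qed simp

lemma Ck_real: "(\<And>x. (f has_real_derivative f' x) (at x)) \<Longrightarrow> Ck n f' \<Longrightarrow> Ck (Suc n) f"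
  unfolding Ck.simps has_field_derivative_def
  by (intro exI[of _ "\<lambda>x v. f' x * v"]) (auto intro: Ck_mult Ck_const)

lemma smooth_intros:
  "smooth (\<lambda>x. c)" "smooth f \<Longrightarrow> smooth g \<Longrightarrow> smooth (\<lambda>x. f x + g x)"
  "smooth f \<Longrightarrow> smooth g \<Longrightarrow> smooth (\<lambda>x. f x * g x)"
  "(\<And>x. (F has_real_derivative f' x) (at x)) \<Longrightarrow> smooth f' \<Longrightarrow> smooth F"
  by (auto simp: smooth_def intro: Ck_const Ck_add Ck_mult Ck_mono[OF Ck_real] simp del: Ck.simps)

lemma smooth_compose:
  fixes f :: "real \<Rightarrow> real"
  shows "smooth f \<Longrightarrow> bounded_linear l \<Longrightarrow> smooth (\<lambda>x. f (l x + c))"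
  unfolding smooth_def using Ck_linear_compose[where l = l and f = f and c = c] by blast

lemma smooth_power: "smooth f \<Longrightarrow> smooth (\<lambda>x. f x ^ n)"
  by (induction n) (auto intro: smooth_intros(1,3))

lemma smooth_prod: "(\<And>i. i \<in> A \<Longrightarrow> smooth (f i)) \<Longrightarrow> smooth (\<lambda>x. \<Prod>i\<in>A. f i x)"
  by (induction A rule: infinite_finite_induct) (auto intro: smooth_intros(1,3))

lemma smooth_cont: "smooth f \<Longrightarrow> continuous_on A f"
proof -
  assume "smooth f"
  then have "Ck (Suc 0) f" unfolding smooth_def by blast
  then obtain f' where "\<And>x. (f has_derivative f' x) (at x)" by auto
  then show "continuous_on A f"
    by (intro continuous_at_imp_continuous_on ballI has_derivative_continuous)
qed

lemma Ck_sin_cos: "Ck n (\<lambda>x::real. sin (pi * x)) \<and> Ck n (\<lambda>x::real. cos (pi * x))"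
proof (induction n)
  case (Suc n)
  have "((\<lambda>x. sin (pi * x)) has_real_derivative pi * cos (pi * x)) (at x)"
    "((\<lambda>x. cos (pi * x)) has_real_derivative (- pi) * sin (pi * x)) (at x)" for x
    by (auto intro!: derivative_eq_intros)
  then show ?case using Ck_real[OF _ Ck_mult[OF Ck_const[of n pi] conjunct2[OF Suc]]]
      Ck_real[OF _ Ck_mult[OF Ck_const[of n "- pi"] conjunct1[OF Suc]]] by blast
qed simp

lemma smooth_csq: "smooth csq" and smooth_scs: "smooth scs"
  unfolding csq_def[abs_def] scs_def[abs_def] power2_eq_square
  using Ck_sin_cos by (auto simp: smooth_def intro!: Ck_mult)

text \<open>The linear span of this family is closed under differentiation, so smoothness follows by
  induction on the order with \<open>k\<close> arbitrary.\<close>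

definition flatk :: "nat \<Rightarrow> real \<Rightarrow> real" where
  "flatk k s = (if 0 < s then inverse s ^ k * exp (- inverse s) else 0)"

lemma flatk_tendsto: "(flatk k \<longlongrightarrow> 0) (at 0)"
proof (rule filterlim_split_at)
  have "((\<lambda>s::real. inverse s ^ k / exp (inverse s)) \<longlongrightarrow> 0) (at_right 0)"
    by (rule filterlim_compose[OF tendsto_power_div_exp_0 filterlim_inverse_at_top_right])
  moreover have "\<forall>\<^sub>F s in at_right 0. inverse s ^ k / exp (inverse s) = flatk k s"
    using eventually_at_right_less[of 0] by eventually_elim (simp add: flatk_def exp_minus divide_inverse)
  ultimately show "(flatk k \<longlongrightarrow> 0) (at_right 0)" by (rule Lim_transform_eventually)
  have "\<forall>\<^sub>F s in at_left (0::real). 0 = flatk k s"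
    unfolding eventually_at_left_field by (auto simp: flatk_def intro!: exI[of _ "-1"])
  then show "(flatk k \<longlongrightarrow> 0) (at_left 0)" by (rule Lim_transform_eventually[OF tendsto_const])
qed

lemma flatk_deriv: "(flatk k has_real_derivative (- real k) * flatk (Suc k) s + flatk (Suc (Suc k)) s) (at s)"
proof -
  consider "0 < s" | "s < 0" | "s = 0" by linarith
  then show ?thesis
  proof cases
    case 1
    have "((\<lambda>s. inverse s ^ k * exp (- inverse s)) has_real_derivative
       (- real k) * (inverse s ^ Suc k * exp (- inverse s)) + inverse s ^ Suc (Suc k) * exp (- inverse s)) (at s)"
    proof -
      have i: "(inverse has_real_derivative - (inverse s * inverse s)) (at s)"
        using DERIV_inverse[of s] 1 by (simp add: power2_eq_square numeral_2_eq_2)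
      have p: "((\<lambda>s. inverse s ^ k) has_real_derivative - real k * inverse s ^ Suc k) (at s)"
        by (rule DERIV_cong[OF DERIV_power[OF i]]) (cases k; simp add: algebra_simps)
      have e: "((\<lambda>s. exp (- inverse s)) has_real_derivative (inverse s * inverse s) * exp (- inverse s)) (at s)"
        by (rule DERIV_cong[OF DERIV_fun_exp[OF DERIV_minus[OF i]]]) simp
      show ?thesis by (rule DERIV_cong[OF DERIV_mult[OF p e]]) (simp add: algebra_simps)
    qed
    moreover have "\<forall>\<^sub>F t in nhds s. inverse t ^ k * exp (- inverse t) = flatk k t"
      using eventually_nhds_in_open[of "{0<..}" s] 1 by (auto elim!: eventually_mono simp: flatk_def)
    ultimately show ?thesis using 1 by (subst DERIV_cong_ev[OF refl _ refl, symmetric]) (auto simp: flatk_def)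
  next
    case 2
    have "((\<lambda>s::real. 0::real) has_real_derivative 0) (at s)" by simp
    moreover have "\<forall>\<^sub>F t in nhds s. 0 = flatk k t"
      using eventually_nhds_in_open[of "{..<0}" s] 2 by (auto elim!: eventually_mono simp: flatk_def)
    ultimately have "(flatk k has_real_derivative 0) (at s)"
      using DERIV_cong_ev[of s s "\<lambda>_. 0" "flatk k" 0 0] by simp
    then show ?thesis using 2 by (simp add: flatk_def)
  next
    case 3
    \<comment> \<open>At 0 the difference quotient of \<open>flatk k\<close> is
      \<open>flatk (Suc k)\<close>.\<close>
    have "((\<lambda>h. (flatk k (0 + h) - flatk k 0) / h) \<longlongrightarrow> 0) (at 0)"
      using flatk_tendsto[of "Suc k"] by (rule Lim_transform_eventually)
         (auto simp: eventually_at_filter flatk_def divide_inverse intro!: always_eventually)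
    then show ?thesis using 3 by (simp add: DERIV_def flatk_def)
  qed
qed

lemma Ck_flatk: "Ck n (flatk k)"
proof (induction n arbitrary: k)
  case (Suc n)
  show ?case by (rule Ck_real[OF flatk_deriv]) (intro Ck_add Ck_mult Ck_const Suc)
qed simp

text \<open>Two flat steps facing each other. A larger \<open>k\<close> makes both steeper without
  moving the support; as \<open>k\<close> grows the function tends to the indicator of the open
  interval.\<close>

definition bump :: "real \<Rightarrow> real \<Rightarrow> real \<Rightarrow> real \<Rightarrow> real" where
  "bump k a b t = flatk 0 (k * t + (- (k * a))) * flatk 0 ((- k) * t + k * b)"

lemma smooth_bump: "smooth (bump k a b)"
proof -
  have f: "smooth (flatk 0)" by (simp add: smooth_def Ck_flatk)
  show ?thesis unfolding bump_def[abs_def]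
    by (intro smooth_intros(3) smooth_compose[OF f] bounded_linear_mult_right)
qed

lemma bump_bounds: "0 \<le> bump k a b t" "bump k a b t \<le> 1"
proof -
  have "0 \<le> flatk 0 s" "flatk 0 s \<le> 1" for s by (auto simp: flatk_def)
  then show "0 \<le> bump k a b t" "bump k a b t \<le> 1" unfolding bump_def by (auto intro: mult_le_one)
qed

lemma bump_zero: "0 < k \<Longrightarrow> t \<notin> {a..b} \<Longrightarrow> bump k a b t = 0"
  by (auto simp: bump_def flatk_def mult_less_cancel_left_pos not_le) 

lemma bump_pos: "0 < k \<Longrightarrow> a < t \<Longrightarrow> t < b \<Longrightarrow> 0 < bump k a b t"
  by (auto simp: bump_def flatk_def)

section \<open>Integration and test functions on the time interval\<close>

definition tm :: "real \<Rightarrow> real measure" where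
  "tm T = density lborel (indicator {0<..<T})"

lemma sets_tm [measurable_cong, simp]: "sets (tm T) = sets borel"
  by (simp add: tm_def)

lemma space_tm [simp]: "space (tm T) = UNIV"
  by (simp add: tm_def)

lemma finite_measure_tm: "finite_measure (tm T)"
  by standard (cases "0 \<le> T", simp_all add: tm_def emeasure_density)

lemma integral_tm: "f \<in> borel_measurable borel \<Longrightarrow>
  integral\<^sup>L (tm T) f = (LINT x|lborel. indicat_real {0<..<T} x * (f x :: real))"
  unfolding tm_def using integral_density[of f lborel "indicat_real {0<..<T}"]
  by (simp add: ennreal_indicator)

lemma integrable_tm: "f \<in> borel_measurable borel \<Longrightarrow>
  integrable (tm T) f \<longleftrightarrow> integrable lborel (\<lambda>x. indicat_real {0<..<T} x * (f x :: real))"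
  unfolding tm_def using integrable_density[of f lborel "indicat_real {0<..<T}"]
  by (simp add: ennreal_indicator)

lemma AE_tm: "(AE x in tm T. P x) \<longleftrightarrow> (AE x in lborel. x \<in> {0<..<T} \<longrightarrow> P x)"
  unfolding tm_def by (subst AE_density) (auto simp: indicator_def)

definition tfun :: "real \<Rightarrow> (real \<Rightarrow> real) \<Rightarrow> bool" where
  "tfun T \<theta> \<longleftrightarrow> smooth \<theta> \<and> (\<exists>a b. 0 < a \<and> a < b \<and> b < T \<and> (\<forall>t. t \<notin> {a..b} \<longrightarrow> \<theta> t = 0))"

lemma tfun_bump: "0 < k \<Longrightarrow> 0 < a \<Longrightarrow> a < b \<Longrightarrow> b < T \<Longrightarrow> tfun T (bump k a b)"
  unfolding tfun_def using smooth_bump bump_zero by blast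

lemma tfun_bounded:
  assumes "tfun T \<theta>"
  obtains B where "0 \<le> B" "\<And>t. \<bar>\<theta> t\<bar> \<le> B"
proof -
  obtain a b where ab: "\<And>t. t \<notin> {a..b} \<Longrightarrow> \<theta> t = 0" using assms unfolding tfun_def by blast
  have "continuous_on {a..b} \<theta>" using assms smooth_cont unfolding tfun_def by blast
  then have "bounded (\<theta> ` {a..b})" by (intro compact_imp_bounded compact_continuous_image) auto
  then obtain B where "\<forall>x\<in>\<theta> ` {a..b}. norm x \<le> B" unfolding bounded_iff by blast
  then have B: "\<And>t. t \<in> {a..b} \<Longrightarrow> \<bar>\<theta> t\<bar> \<le> B" by auto
  have "\<bar>\<theta> t\<bar> \<le> max B 0" for t
    using ab[of t] B[of t] by (cases "t \<in> {a..b}") (auto simp: le_max_iff_disj)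
  then show ?thesis using that[of "max B 0"] by simp
qed

lemma tfun_measurable: "tfun T \<theta> \<Longrightarrow> \<theta> \<in> borel_measurable borel"
  unfolding tfun_def by (auto intro: borel_measurable_continuous_onI smooth_cont)

lemma tfun_integrable_mult:
  assumes h: "integrable (tm T) h" and \<theta>: "tfun T \<theta>"
  shows "integrable (tm T) (\<lambda>t. h t * \<theta> t)"
proof -
  obtain B where B: "0 \<le> B" "\<And>t. \<bar>\<theta> t\<bar> \<le> B" using tfun_bounded[OF \<theta>] by metis
  have [measurable]: "\<theta> \<in> borel_measurable borel" by (rule tfun_measurable[OF \<theta>])
  have [measurable]: "h \<in> borel_measurable borel" using borel_measurable_integrable[OF h] by simp
  show ?thesis
    by (rule Bochner_Integration.integrable_bound[where f = "\<lambda>t. B * h t"])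
       (use h B in \<open>auto simp: abs_mult mult.commute intro!: mult_right_mono\<close>)
qed

text \<open>Initial segments form an intersection-stable generator of the Borel sets, so the
  vanishing of the integrals extends to all Borel sets, in particular to those where
  \<open>h\<close> is positive or negative.\<close>

lemma AE_zero_of_initial_integrals:
  assumes h: "integrable (tm T) h" and z: "\<And>a. (LINT t|tm T. indicat_real {..a} t * h t) = 0"
  shows "AE t in tm T. h t = 0"
proof -
  have [measurable]: "h \<in> borel_measurable borel" using borel_measurable_integrable[OF h] by simp
  have ih: "integrable (tm T) (\<lambda>t. indicat_real A t * h t)" if "A \<in> sets borel" for A
    using integrable_mult_indicator[of A "tm T" h] h that by simp
  \<comment> \<open>The complement step of the induction needs the integral over the whole line; the
    segment up to \<open>T\<close> already carries all of \<open>tm T\<close>.\<close>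
  have tot: "integral\<^sup>L (tm T) h = 0"
  proof -
    have "AE t in tm T. indicat_real {..T} t * h t = h t"
      unfolding AE_tm by (rule AE_I2) (auto simp: indicator_def)
    then have "(LINT t|tm T. indicat_real {..T} t * h t) = integral\<^sup>L (tm T) h"
      by (intro integral_cong_AE) auto
    then show ?thesis using z by simp
  qed
  have all: "(LINT t|tm T. indicat_real A t * h t) = 0" if "A \<in> sets borel" for A
  proof -
    have A: "A \<in> sigma_sets UNIV (range (\<lambda>a::real. {..a}))"
      using that unfolding borel_eq_atMost by simp
    have st: "Int_stable (range (\<lambda>a::real. {..a}))"
      by (auto simp: Int_stable_def)
    have sb: "B \<in> sets borel" if "B \<in> sigma_sets UNIV (range (\<lambda>a::real. {..a}))" for B
      using that unfolding borel_eq_atMost by simp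
    have sp: "range (\<lambda>a::real. {..a}) \<subseteq> Pow UNIV" by auto
    show ?thesis using st sp A
    proof (induction rule: sigma_sets_induct_disjoint)
      case (basic A)
      then show ?case using z by auto
    next
      case empty
      then show ?case by simp
    next
      case (compl A)
      have "(LINT t|tm T. indicat_real (UNIV - A) t * h t) = (LINT t|tm T. h t - indicat_real A t * h t)"
        by (intro Bochner_Integration.integral_cong) (auto simp: indicator_def)
      then show ?case using compl h ih[OF sb[OF compl(1)]] tot by simp
    next
      case (union A)
      have "(\<lambda>n. (LINT t|tm T. indicat_real (\<Union>i<n. A i) t * h t)) \<longlonglongrightarrow> (LINT t|tm T. indicat_real (\<Union>i. A i) t * h t)"
      proof (rule integral_dominated_convergence[where w = "\<lambda>t. \<bar>h t\<bar>"])
        have Am[measurable]: "A i \<in> sets borel" for i using union(2) sb by blast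
        show "(\<lambda>t. indicat_real (\<Union>i. A i) t * h t) \<in> borel_measurable (tm T)"
          "(\<lambda>t. indicat_real (\<Union>i<n. A i) t * h t) \<in> borel_measurable (tm T)" for n by measurable
        show "AE t in tm T. (\<lambda>n. indicat_real (\<Union>i<n. A i) t * h t) \<longlonglongrightarrow> indicat_real (\<Union>i. A i) t * h t"
          by (intro AE_I2 tendsto_mult_right LIMSEQ_indicator_UN)
        show "AE t in tm T. norm (indicat_real (\<Union>i<n. A i) t * h t) \<le> \<bar>h t\<bar>" for n
          by (auto simp: indicator_def)
      qed (use h in auto)
      moreover have "(LINT t|tm T. indicat_real (\<Union>i<n. A i) t * h t) = 0" for n
      proof -
        have "indicat_real (\<Union>i<n. A i) t = (\<Sum>i<n. indicat_real (A i) t)" for t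
          using union(1) by (subst indicator_UN_disjoint) (auto simp: disjoint_family_on_def)
        then have "(LINT t|tm T. indicat_real (\<Union>i<n. A i) t * h t) = integral\<^sup>L (tm T) (\<lambda>t. \<Sum>i<n. indicat_real (A i) t * h t)"
          by (simp add: sum_distrib_right)
        also have "\<dots> = 0" using union(2,3) ih sb by (subst Bochner_Integration.integral_sum) auto
        finally show ?thesis .
      qed
      ultimately show ?case by (simp add: LIMSEQ_const_iff)
    qed
  qed
  have pos: "AE t in tm T. f t \<le> 0" if f: "integrable (tm T) f" and fz: "\<And>A. A \<in> sets borel \<Longrightarrow> (LINT t|tm T. indicat_real A t * f t) = 0" for f
  proof -
    have [measurable]: "f \<in> borel_measurable borel" using borel_measurable_integrable[OF f] by simp
    have A: "{t. 0 < f t} \<in> sets borel" by measurable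
    have i: "integrable (tm T) (\<lambda>t. indicat_real {t. 0 < f t} t * f t)"
      using integrable_mult_indicator[of "{t. 0 < f t}" "tm T" f] f A by simp
    have "AE t in tm T. indicat_real {t. 0 < f t} t * f t = 0"
      using integral_nonneg_eq_0_iff_AE[OF i] fz[OF A] by (auto simp: indicator_def)
    then show ?thesis by eventually_elim (auto simp: indicator_def split: if_splits)
  qed
  have "AE t in tm T. h t \<le> 0" by (rule pos[OF h all])
  moreover have "AE t in tm T. - h t \<le> 0" by (rule pos) (use h all in auto)
  ultimately show ?thesis by eventually_elim auto
qed

text \<open>Bumps that grow steeper while their supports exhaust \<open>(0, c)\<close> approximate
  the indicator of an initial segment.\<close>

lemma fundamental_lemma:
  assumes h: "integrable (tm T) h" and z: "\<And>\<theta>. tfun T \<theta> \<Longrightarrow> (LINT t|tm T. h t * \<theta> t) = 0"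
  shows "AE t in tm T. h t = 0"
proof (rule AE_zero_of_initial_integrals[OF h])
  fix a :: real
  have [measurable]: "h \<in> borel_measurable borel" using borel_measurable_integrable[OF h] by simp
  define c where "c = min a T"
  show "(LINT t|tm T. indicat_real {..a} t * h t) = 0"
  proof (cases "0 < c")
    case False
    have "AE t in tm T. indicat_real {..a} t * h t = 0"
      unfolding AE_tm by (rule AE_I2) (use False in \<open>auto simp: c_def indicator_def min_def split: if_splits\<close>)
    then show ?thesis by (simp add: integral_eq_zero_AE)
  next
    case True
    \<comment> \<open>The 3 guarantees \<open>2 * e n < c\<close> already at \<open>n = 0\<close>,
      so every bump has a nondegenerate support.\<close>
    define e where "e n = c / (real n + 3)" for n
    have e: "0 < e n" "e n < c - e n" for n
    proof -
      show "0 < e n" using True by (simp add: e_def)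
      have "e n * (real n + 3) = c" by (simp add: e_def)
      moreover have "0 < e n * (real n + 1)" using \<open>0 < e n\<close> by simp
      ultimately show "e n < c - e n" by (simp add: algebra_simps)
    qed
    define \<theta> where "\<theta> n = bump (real (Suc n)) (e n) (c - e n)" for n
    have tf: "tfun T (\<theta> n)" for n
      unfolding \<theta>_def using e[of n] by (intro tfun_bump) (auto simp: c_def min_def split: if_splits)
    have [measurable]: "\<theta> n \<in> borel_measurable borel" for n by (rule tfun_measurable[OF tf])
    have e0: "e \<longlonglongrightarrow> 0"
    proof (rule Lim_null_comparison)
      show "\<forall>\<^sub>F n in sequentially. norm (e n) \<le> c * inverse (real (Suc n))"
        by (rule always_eventually) (use True in \<open>auto simp: e_def divide_inverse intro!: mult_left_mono le_imp_inverse_le\<close>)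
      show "(\<lambda>n. c * inverse (real (Suc n))) \<longlonglongrightarrow> 0" by (intro tendsto_mult_right_zero LIMSEQ_inverse_real_of_nat)
    qed
    have flat1: "(\<lambda>n. flatk 0 (x n)) \<longlonglongrightarrow> 1" if "filterlim x at_top sequentially" for x
    proof -
      have "(\<lambda>n. exp (- inverse (x n))) \<longlonglongrightarrow> exp (- 0)"
        by (intro tendsto_intros tendsto_inverse_0_at_top that)
      moreover have "\<forall>\<^sub>F n in sequentially. exp (- inverse (x n)) = flatk 0 (x n)"
        using filterlim_at_top_dense[THEN iffD1, OF that, rule_format, of 0] by eventually_elim (simp add: flatk_def)
      ultimately show ?thesis by (simp add: Lim_transform_eventually)
    qed
    have lim: "(\<lambda>n. \<theta> n t) \<longlonglongrightarrow> indicat_real {0<..<c} t" for t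
    proof (cases "t \<in> {0<..<c}")
      case True
      have 1: "filterlim (\<lambda>n. (t - e n) * real (Suc n)) at_top sequentially"
      proof (rule filterlim_tendsto_pos_mult_at_top)
        show "(\<lambda>n. t - e n) \<longlonglongrightarrow> t - 0" by (intro tendsto_intros e0)
        show "filterlim (\<lambda>n. real (Suc n)) at_top sequentially"
          using filterlim_compose[OF filterlim_real_sequentially filterlim_Suc] .
      qed (use True in auto)
      have 2: "filterlim (\<lambda>n. (c - e n - t) * real (Suc n)) at_top sequentially"
      proof (rule filterlim_tendsto_pos_mult_at_top)
        show "(\<lambda>n. c - e n - t) \<longlonglongrightarrow> c - 0 - t" by (intro tendsto_intros e0)
        show "filterlim (\<lambda>n. real (Suc n)) at_top sequentially"
          using filterlim_compose[OF filterlim_real_sequentially filterlim_Suc] .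
      qed (use True in auto)
      have "(\<lambda>n. flatk 0 ((t - e n) * real (Suc n)) * flatk 0 ((c - e n - t) * real (Suc n))) \<longlonglongrightarrow> 1 * 1"
        by (intro tendsto_mult flat1 1 2)
      then show ?thesis using True by (simp add: \<theta>_def bump_def algebra_simps)
    next
      case False
      have "\<theta> n t = 0" for n unfolding \<theta>_def using False e[of n] by (intro bump_zero) auto
      then show ?thesis using False by simp
    qed
    have "(\<lambda>n. (LINT t|tm T. h t * \<theta> n t)) \<longlonglongrightarrow> (LINT t|tm T. h t * indicat_real {0<..<c} t)"
    proof (rule integral_dominated_convergence[where w = "\<lambda>t. \<bar>h t\<bar>"])
      show "AE t in tm T. (\<lambda>n. h t * \<theta> n t) \<longlonglongrightarrow> h t * indicat_real {0<..<c} t"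
        by (intro AE_I2 tendsto_mult_left lim)
      show "AE t in tm T. norm (h t * \<theta> n t) \<le> \<bar>h t\<bar>" for n
        using bump_bounds[of "real (Suc n)" "e n" "c - e n"]
        by (intro AE_I2) (auto simp: \<theta>_def abs_mult intro!: mult_left_le)
    qed (use h in auto)
    then have "(LINT t|tm T. h t * indicat_real {0<..<c} t) = 0"
      by (simp add: z[OF tf] LIMSEQ_const_iff)
    moreover have "AE t in tm T. indicat_real {..a} t * h t = h t * indicat_real {0<..<c} t"
    proof -
      have "AE t in lborel. t \<noteq> c" by (rule AE_lborel_singleton)
      then show ?thesis unfolding AE_tm
        by eventually_elim (auto simp: c_def indicator_def min_def split: if_splits)
    qed
    then have "(LINT t|tm T. indicat_real {..a} t * h t) = (LINT t|tm T. h t * indicat_real {0<..<c} t)"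
      by (intro integral_cong_AE) auto
    ultimately show ?thesis by simp
  qed
qed

text \<open>The bridge between the two integrals in use: \<open>tm\<close> for product measures and
  limits, \<open>absolutely_integrable_on\<close> for curves and the chain rule.\<close>

lemma tm_absolutely_integrable:
  fixes B :: "real \<Rightarrow> real"
  assumes B: "integrable (tm T) B" and t: "t \<le> T"
  shows "B absolutely_integrable_on {0..t}" "integral {0..t} B = integral\<^sup>L (tm t) B" "integrable (tm t) B"
proof -
  have [measurable]: "B \<in> borel_measurable borel" using borel_measurable_integrable[OF B] by simp
  have "integrable lborel (\<lambda>x. indicat_real {0<..<t} x * (indicat_real {0<..<T} x * B x))"
    using integrable_mult_indicator[of "{0<..<t}" lborel "\<lambda>x. indicat_real {0<..<T} x * B x"] B integrable_tm[of B T] by simp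
  moreover have "indicat_real {0<..<t} x * (indicat_real {0<..<T} x * B x) = indicat_real {0<..<t} x * B x" for x
    using t by (auto simp: indicator_def)
  ultimately have i: "integrable lborel (\<lambda>x. indicat_real {0<..<t} x * B x)" by simp
  then show "integrable (tm t) B" by (simp add: integrable_tm)
  have ae: "AE x in lborel. indicat_real {0<..<t} x * B x = indicat_real {0..t} x *\<^sub>R B x"
  proof -
    have "AE x in lborel. x \<noteq> 0" "AE x in lborel. x \<noteq> t" by (rule AE_lborel_singleton)+
    then show ?thesis by eventually_elim (auto simp: indicator_def)
  qed
  have s: "set_integrable lborel {0..t} B"
    unfolding set_integrable_def by (rule integrable_cong_AE_imp[OF i]) (use ae in auto)
  then show "B absolutely_integrable_on {0..t}"
    unfolding set_integrable_def by (rule integrable_completion[THEN iffD2, rotated]) measurable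
  show "integral {0..t} B = integral\<^sup>L (tm t) B"
    unfolding set_borel_integral_eq_integral(2)[OF s, symmetric] set_lebesgue_integral_def integral_tm[OF \<open>B \<in> borel_measurable borel\<close>]
    by (rule integral_cong_AE) (use ae in auto)
qed

lemma smooth_deriv:
  fixes f :: "real \<Rightarrow> real"
  assumes f: "smooth f" and d: "\<And>x. (f has_real_derivative f' x) (at x)"
  shows "smooth f'"
  unfolding smooth_def
proof
  fix n
  have "Ck (Suc n) f" using f unfolding smooth_def by blast
  then obtain g where g: "\<And>x. (f has_derivative g x) (at x)" "\<And>v. Ck n (\<lambda>x. g x v)" by auto
  have "g x = (*) (f' x)" for x
    using has_derivative_unique[OF g(1) d[unfolded has_field_derivative_def]] .
  then show "Ck n f'" using g(2)[of 1] by simp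
qed

lemma tfun_deriv:
  assumes \<theta>: "tfun T \<theta>" and d: "\<And>t. (\<theta> has_real_derivative \<theta>' t) (at t)"
  shows "tfun T \<theta>'"
proof -
  obtain a b where ab: "0 < a" "a < b" "b < T" "\<And>t. t \<notin> {a..b} \<Longrightarrow> \<theta> t = 0" and s: "smooth \<theta>"
    using \<theta> unfolding tfun_def by blast
  have "\<theta>' t = 0" if t: "t \<notin> {a..b}" for t
  proof -
    have "open (- {a..b})" by auto
    then have "\<forall>\<^sub>F u in nhds t. 0 = \<theta> u"
      using eventually_nhds_in_open[of "- {a..b}" t] t by (auto elim!: eventually_mono simp: ab(4))
    moreover have "((\<lambda>u::real. 0::real) has_real_derivative 0) (at t)" by simp
    ultimately have "(\<theta> has_real_derivative 0) (at t)"
      using DERIV_cong_ev[of t t "\<lambda>u. 0" \<theta> 0 0] by simp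
    then show ?thesis using d DERIV_unique by blast
  qed
  then show ?thesis unfolding tfun_def using smooth_deriv[OF s d] ab by blast
qed

text \<open>A primitive is constant on either side of the support; mean zero makes the two constants
  equal, and subtracting their common value gives compact support.\<close>

lemma antiderivative_tfun:
  assumes g: "tfun T g" and z: "integral\<^sup>L (tm T) g = 0"
  shows "\<exists>\<theta>. tfun T \<theta> \<and> (\<forall>t. (\<theta> has_real_derivative g t) (at t))"
proof -
  obtain a b where ab: "0 < a" "a < b" "b < T" "\<And>t. t \<notin> {a..b} \<Longrightarrow> g t = 0" and s: "smooth g"
    using g unfolding tfun_def by blast
  have cg: "continuous_on A g" for A by (rule smooth_cont[OF s])
  have "\<exists>F. \<forall>x::real. -\<infinity> < ereal x \<longrightarrow> ereal x < \<infinity> \<longrightarrow> (F has_vector_derivative g x) (at x)"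
    by (rule einterval_antiderivative) (use cg[of UNIV] in \<open>auto simp: continuous_on_eq_continuous_at\<close>)
  then obtain F where F: "\<And>x. (F has_real_derivative g x) (at x)"
    by (auto simp: has_real_derivative_iff_has_vector_derivative)
  have left: "F t = F a" if "t < a" for t
    using MVT2[of t a F g] that F ab(4) by fastforce
  have right: "F t = F b" if "b < t" for t
    using MVT2[of b t F g] that F ab(4) by fastforce
  have "integrable (tm T) (\<lambda>t. 1 * g t)"
    by (rule tfun_integrable_mult[OF _ g]) (simp add: finite_measure.integrable_const[OF finite_measure_tm])
  then have "integral {0..T} g = 0" using tm_absolutely_integrable(2)[of T g T] z by simp
  moreover have "(g has_integral F T - F 0) {0..T}"
    using ab F by (intro fundamental_theorem_of_calculus)
      (auto simp: has_real_derivative_iff_has_vector_derivative[symmetric] intro: has_field_derivative_at_within)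
  ultimately have ba: "F b = F a" using left[of 0] right[of T] ab integral_unique by force
  define \<theta> where "\<theta> t = F t - F a" for t
  have d: "(\<theta> has_real_derivative g t) (at t)" for t
    unfolding \<theta>_def using DERIV_diff[OF F[of t] DERIV_const[of "F a"]] by simp
  have "\<theta> t = 0" if "t \<notin> {a..b}" for t
    using that left[of t] right[of t] ba by (cases "t < a") (auto simp: \<theta>_def)
  then have "tfun T \<theta>" unfolding tfun_def using smooth_intros(4)[OF d s] ab by blast
  then show ?thesis using d by blast
qed

lemma tfun_integrable: "tfun T \<theta> \<Longrightarrow> integrable (tm T) \<theta>"
  using tfun_integrable_mult[of T "\<lambda>_. 1" \<theta>] by (simp add: finite_measure.integrable_const[OF finite_measure_tm])

lemma tfun_lincomb:
  assumes "tfun T f" "tfun T g"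
  shows "tfun T (\<lambda>t. f t + c * g t)"
proof -
  obtain a b where ab: "0 < a" "a < b" "b < T" "\<And>t. t \<notin> {a..b} \<Longrightarrow> f t = 0" and s: "smooth f"
    using assms(1) unfolding tfun_def by blast
  obtain a' b' where ab': "0 < a'" "a' < b'" "b' < T" "\<And>t. t \<notin> {a'..b'} \<Longrightarrow> g t = 0" and s': "smooth g"
    using assms(2) unfolding tfun_def by blast
  have "f t + c * g t = 0" if "t \<notin> {min a a'..max b b'}" for t
  proof -
    have "t \<notin> {a..b}" "t \<notin> {a'..b'}" using that by (auto simp: min_def max_def split: if_splits)
    then show ?thesis using ab(4) ab'(4) by simp
  qed
  moreover have "smooth (\<lambda>t. f t + c * g t)" by (intro smooth_intros(1-3) s s')
  moreover have "0 < min a a'" "min a a' < max b b'" "max b b' < T" using ab ab' by auto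
  ultimately show ?thesis unfolding tfun_def by blast
qed

text \<open>A test function of mean zero is the derivative of another one; subtracting a multiple of
  the fixed bump \<open>\<omega>\<close> brings any test function to mean zero. The constant is the
  \<open>\<omega>\<close>-weighted mean of \<open>D\<close>.\<close>

lemma zero_derivative_const:
  assumes T: "0 < T" and D: "integrable (tm T) D"
    and z: "\<And>\<theta> \<theta>'. tfun T \<theta> \<Longrightarrow> (\<And>t. (\<theta> has_real_derivative \<theta>' t) (at t)) \<Longrightarrow> (LINT t|tm T. D t * \<theta>' t) = 0"
  shows "\<exists>c. AE t in tm T. D t = c"
proof -
  define \<omega> where "\<omega> = bump 1 (T/4) (T/2)"
  have \<omega>: "tfun T \<omega>" unfolding \<omega>_def using T by (intro tfun_bump) auto
  define J where "J = integral\<^sup>L (tm T) \<omega>"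
  have [measurable]: "\<omega> \<in> borel_measurable borel" by (rule tfun_measurable[OF \<omega>])
  have \<omega>0: "0 \<le> \<omega> t" for t unfolding \<omega>_def by (rule bump_bounds)
  have J: "0 < J"
  proof -
    have "J \<noteq> 0"
    proof
      assume "J = 0"
      then have "AE t in tm T. \<omega> t = 0"
        using integral_nonneg_eq_0_iff_AE[OF tfun_integrable[OF \<omega>]] \<omega>0 by (auto simp: J_def)
      then have "AE t in lborel. t \<notin> {T/4<..<T/2}"
        unfolding AE_tm by eventually_elim (use bump_pos[of 1 "T/4" _ "T/2"] T in \<open>fastforce simp: \<omega>_def\<close>)
      then have "{T/4<..<T/2} \<in> null_sets lborel" by (subst AE_iff_null_sets) auto
      then show False using T by (auto simp: null_sets_def)
    qed
    moreover have "0 \<le> J" unfolding J_def using \<omega>0 by (intro integral_nonneg_AE) auto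
    ultimately show ?thesis by simp
  qed
  define c where "c = (LINT t|tm T. D t * \<omega> t) / J"
  have ic: "integrable (tm T) (\<lambda>t. c)" by (rule finite_measure.integrable_const[OF finite_measure_tm])
  have "AE t in tm T. D t - c = 0"
  proof (rule fundamental_lemma)
    show "integrable (tm T) (\<lambda>t. D t - c)" using D ic by simp
    fix \<eta> assume \<eta>: "tfun T \<eta>"
    define m where "m = integral\<^sup>L (tm T) \<eta> / J"
    define g where "g t = \<eta> t + (- m) * \<omega> t" for t
    have tg: "tfun T g" unfolding g_def by (rule tfun_lincomb[OF \<eta> \<omega>])
    have "integral\<^sup>L (tm T) g = integral\<^sup>L (tm T) \<eta> + (- m) * J"
      unfolding g_def J_def using tfun_integrable[OF \<eta>] tfun_integrable[OF \<omega>] by simp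
    also have "\<dots> = 0" using J by (simp add: m_def)
    finally obtain \<theta> where "tfun T \<theta>" "\<And>t. (\<theta> has_real_derivative g t) (at t)"
      using antiderivative_tfun[OF tg] by blast
    then have "(LINT t|tm T. D t * g t) = 0" by (rule z)
    moreover have "(LINT t|tm T. D t * g t) = (LINT t|tm T. D t * \<eta> t - m * (D t * \<omega> t))"
      by (intro Bochner_Integration.integral_cong) (auto simp: g_def algebra_simps)
    moreover have "(LINT t|tm T. D t * \<eta> t - m * (D t * \<omega> t)) = (LINT t|tm T. D t * \<eta> t) - m * (LINT t|tm T. D t * \<omega> t)"
      using tfun_integrable_mult[OF D \<eta>] tfun_integrable_mult[OF D \<omega>] by simp
    moreover have "m * (LINT t|tm T. D t * \<omega> t) = c * integral\<^sup>L (tm T) \<eta>"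
      by (simp add: m_def c_def)
    moreover have "(LINT t|tm T. (D t - c) * \<eta> t) = (LINT t|tm T. D t * \<eta> t) - c * integral\<^sup>L (tm T) \<eta>"
      using tfun_integrable_mult[OF D \<eta>] tfun_integrable[OF \<eta>] by (simp add: left_diff_distrib)
    ultimately show "(LINT t|tm T. (D t - c) * \<eta> t) = 0" by simp
  qed
  then show ?thesis by auto
qed

lemma absolutely_integrable_Pair:
  fixes f :: "real \<Rightarrow> 'a::euclidean_space" and g :: "real \<Rightarrow> 'b::euclidean_space"
  assumes f: "f absolutely_integrable_on {a..b}" and g: "g absolutely_integrable_on {a..b}"
  shows "(\<lambda>x. (f x, g x)) absolutely_integrable_on {a..b}"
    and "t \<le> b \<Longrightarrow> integral {a..t} (\<lambda>x. (f x, g x)) = (integral {a..t} f, integral {a..t} g)"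
proof -
  have l: "bounded_linear (\<lambda>x::'a. (x, 0::'b))" "bounded_linear (\<lambda>x::'b. (0::'a, x))"
    by (auto intro!: bounded_linear_Pair bounded_linear_ident bounded_linear_zero)
  have eq: "(\<lambda>x. (f x, g x)) = (\<lambda>x. ((\<lambda>x. (x, 0)) \<circ> f) x + ((\<lambda>x. (0, x)) \<circ> g) x)" by (simp add: o_def)
  show "(\<lambda>x. (f x, g x)) absolutely_integrable_on {a..b}"
    unfolding eq by (intro set_integral_add(1) absolutely_integrable_linear f g l)
  assume t: "t \<le> b"
  have fi: "f integrable_on {a..t}"
    by (rule integrable_on_subinterval[OF set_lebesgue_integral_eq_integral(1)[OF f]]) (use t in auto)
  have gi: "g integrable_on {a..t}"
    by (rule integrable_on_subinterval[OF set_lebesgue_integral_eq_integral(1)[OF g]]) (use t in auto)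
  show "integral {a..t} (\<lambda>x. (f x, g x)) = (integral {a..t} f, integral {a..t} g)"
    unfolding eq using integral_linear[OF fi l(1)] integral_linear[OF gi l(2)] integrable_linear[OF fi l(1)] integrable_linear[OF gi l(2)]
    by (subst Henstock_Kurzweil_Integration.integral_add) auto
qed

text \<open>Subtracting the primitive of \<open>B\<close> reduces the claim to a vanishing weak
  derivative. The integration by parts that this requires is \<open>AC_chain_rule\<close> for the
  product of two real curves, a function whose gradient is \<open>prod.swap\<close>.\<close>

theorem du_Bois_Reymond:
  assumes T: "0 < T" and A: "integrable (tm T) A" and B: "integrable (tm T) B"
    and z: "\<And>\<theta> \<theta>'. tfun T \<theta> \<Longrightarrow> (\<And>t. (\<theta> has_real_derivative \<theta>' t) (at t)) \<Longrightarrow>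
       (LINT t|tm T. A t * \<theta>' t + B t * \<theta> t) = 0"
  shows "\<exists>c. AE t in tm T. A t = c + integral {0..t} B"
proof -
  define Q where "Q t = integral {0..t} B" for t
  \<comment> \<open>The primitive continued by constants outside \<open>[0, T]\<close>, hence
    continuous and Borel on the whole line.\<close>
  define Qc where "Qc t = Q (max 0 (min T t))" for t
  note aB = tm_absolutely_integrable(1)[OF B order_refl]
  have iB: "B integrable_on {0..T}" by (rule set_lebesgue_integral_eq_integral(1)[OF aB])
  have cQ: "continuous_on {0..T} Q" unfolding Q_def by (rule indefinite_integral_continuous_1[OF iB])
  have cQc: "continuous_on UNIV Qc" unfolding Qc_def
    by (rule continuous_on_compose2[OF cQ]) (use T in \<open>auto intro!: continuous_intros\<close>)
  have [measurable]: "Qc \<in> borel_measurable borel" by (rule borel_measurable_continuous_onI[OF cQc])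
  have "compact (Q ` {0..T})" by (intro compact_continuous_image cQ) auto
  then obtain M where M: "\<And>t. t \<in> {0..T} \<Longrightarrow> norm (Q t) \<le> M"
    using compact_imp_bounded bounded_iff by (metis image_eqI)
  have Mc: "norm (Qc t) \<le> M" for t unfolding Qc_def using T by (intro M) auto
  have iQ: "integrable (tm T) Qc"
    by (rule finite_measure.integrable_const_bound[OF finite_measure_tm, where B = M]) (use Mc in auto)
  have "\<exists>c. AE t in tm T. A t - Qc t = c"
  proof (rule zero_derivative_const[OF T])
    show "integrable (tm T) (\<lambda>t. A t - Qc t)" using A iQ by simp
    fix \<theta> \<theta>' assume \<theta>: "tfun T \<theta>" and d: "\<And>t. (\<theta> has_real_derivative \<theta>' t) (at t)"
    have \<theta>': "tfun T \<theta>'" by (rule tfun_deriv[OF \<theta> d])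
    note i = tfun_integrable_mult[OF A \<theta>'] tfun_integrable_mult[OF B \<theta>] tfun_integrable_mult[OF iQ \<theta>']
    have ends: "\<theta> 0 = 0" "\<theta> T = 0" using \<theta> unfolding tfun_def by force+
    note a\<theta>' = tm_absolutely_integrable(1)[OF tfun_integrable[OF \<theta>'] order_refl]
    have ft: "integral {0..t} \<theta>' = \<theta> t" if "0 \<le> t" for t
    proof -
      have "(\<theta>' has_integral \<theta> t - \<theta> 0) {0..t}"
        using that d by (intro fundamental_theorem_of_calculus)
          (auto simp: has_real_derivative_iff_has_vector_derivative[symmetric] intro: has_field_derivative_at_within)
      then show ?thesis using ends integral_unique by force
    qed
    have cr: "(\<lambda>(x, y). x * y) (Q T, \<theta> T) = (\<lambda>(x, y). x * y) (0::real, 0::real) + integral {0..T} (\<lambda>s. prod.swap (Q s, \<theta> s) \<bullet> (B s, \<theta>' s))"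
      "(\<lambda>s. prod.swap (Q s, \<theta> s) \<bullet> (B s, \<theta>' s)) absolutely_integrable_on {0..T}"
    proof -
      have h: "((\<lambda>(x, y). x * y) has_derivative (\<lambda>h. prod.swap z \<bullet> h)) (at z)" for z :: "real \<times> real"
        unfolding case_prod_beta' by (rule derivative_eq_intros refl)+ (auto simp: inner_prod_def)
      have f: "(Q t, \<theta> t) = (0, 0) + integral {0..t} (\<lambda>s. (B s, \<theta>' s))" if "t \<in> {0..T}" for t
        using absolutely_integrable_Pair(2)[OF aB a\<theta>', of t] that ft by (simp add: Q_def)
      note c = AC_chain_rule[where f = "\<lambda>t. (Q t, \<theta> t)" and U = UNIV and D = prod.swap,
          OF less_imp_le[OF T] absolutely_integrable_Pair(1)[OF aB a\<theta>'] f convex_UNIV UNIV_I h]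
      show "(\<lambda>(x, y). x * y) (Q T, \<theta> T) = (\<lambda>(x, y). x * y) (0::real, 0::real) + integral {0..T} (\<lambda>s. prod.swap (Q s, \<theta> s) \<bullet> (B s, \<theta>' s))"
        by (rule c(2)) (auto intro!: continuous_intros simp: prod.swap_def)
      show "(\<lambda>s. prod.swap (Q s, \<theta> s) \<bullet> (B s, \<theta>' s)) absolutely_integrable_on {0..T}"
        by (rule c(1)) (auto intro!: continuous_intros simp: prod.swap_def)
    qed
    have "integral {0..T} (\<lambda>s. prod.swap (Q s, \<theta> s) \<bullet> (B s, \<theta>' s)) = integral {0..T} (\<lambda>s. B s * \<theta> s + Qc s * \<theta>' s)"
      by (rule Henstock_Kurzweil_Integration.integral_cong) (auto simp: inner_prod_def Qc_def mult.commute)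
    also have "\<dots> = (LINT s|tm T. B s * \<theta> s + Qc s * \<theta>' s)"
      by (rule tm_absolutely_integrable(2)) (use i in auto)
    also have "\<dots> = (LINT s|tm T. B s * \<theta> s) + (LINT s|tm T. Qc s * \<theta>' s)" using i by simp
    finally have "(LINT s|tm T. B s * \<theta> s) + (LINT s|tm T. Qc s * \<theta>' s) = 0"
      using cr(1) ends by simp
    moreover have "(LINT s|tm T. A s * \<theta>' s) + (LINT s|tm T. B s * \<theta> s) = 0"
      using z[OF \<theta> d] i by simp
    ultimately show "(LINT t|tm T. (A t - Qc t) * \<theta>' t) = 0"
      using i by (simp add: left_diff_distrib)
  qed
  then obtain c where "AE t in tm T. A t - Qc t = c" by blast
  then have "AE t in tm T. A t = c + integral {0..t} B"
    unfolding AE_tm by eventually_elim (auto simp: Qc_def Q_def)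
  then show ?thesis by blast
qed

text \<open>The representation holds for almost all times, whereas the limit speaks of all times. If
  the constants differed, every sufficiently small time would violate the representation, and these
  times fill an interval of positive length.\<close>

lemma initial_value:
  fixes A0 :: real
  assumes T: "0 < T" and B: "integrable (tm T) B" and A: "AE t in tm T. A t = c + integral {0..t} B"
    and lim: "(A \<longlongrightarrow> A0) (at_right 0)"
  shows "c = A0"
proof (rule ccontr)
  assume "c \<noteq> A0"
  define e where "e = \<bar>c - A0\<bar> / 2"
  have e: "0 < e" using \<open>c \<noteq> A0\<close> by (simp add: e_def)
  have iB: "B integrable_on {0..T}"
    by (rule set_lebesgue_integral_eq_integral(1)[OF tm_absolutely_integrable(1)[OF B order_refl]])
  have "continuous_on {0..T} (\<lambda>t. integral {0..t} B)" by (rule indefinite_integral_continuous_1[OF iB])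
  then have "((\<lambda>t. integral {0..t} B) \<longlongrightarrow> integral {0..0} B) (at 0 within {0..T})"
    by (rule continuous_on_def[THEN iffD1, rule_format]) (use T in auto)
  then obtain d1 where d1: "0 < d1" "\<And>t. t \<in> {0..T} \<Longrightarrow> 0 < dist t 0 \<Longrightarrow> dist t 0 < d1 \<Longrightarrow> dist (integral {0..t} B) 0 < e"
    using e unfolding Lim_within by auto
  from lim have "\<forall>\<^sub>F t in at_right 0. dist (A t) A0 < e" using e by (rule tendstoD)
  then obtain d2 where d2: "0 < d2" "\<And>t. 0 < t \<Longrightarrow> t < d2 \<Longrightarrow> dist (A t) A0 < e"
    unfolding eventually_at_right_field by auto
  define d where "d = min T (min d1 d2)"
  have "AE t in lborel. t \<notin> {0<..<d}"
    using A unfolding AE_tm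
  proof eventually_elim
    case (elim t)
    show ?case
    proof
      assume t: "t \<in> {0<..<d}"
      then have "A t = c + integral {0..t} B" using elim by (auto simp: d_def)
      moreover have "\<bar>A t - A0\<bar> < e" using d2(2)[of t] t by (auto simp: d_def dist_real_def)
      moreover have "\<bar>integral {0..t} B\<bar> < e" using d1(2)[of t] t by (auto simp: d_def dist_real_def)
      ultimately have "\<bar>c - A0\<bar> < 2 * e" by linarith
      then show False by (simp add: e_def)
    qed
  qed
  then have "{0<..<d} \<in> null_sets lborel" by (subst AE_iff_null_sets) auto
  moreover have "0 < d" using T d1 d2 by (simp add: d_def)
  ultimately show False by (auto simp: null_sets_def)
qed

section \<open>Functions of space and time\<close>

text \<open>Truncation reduces this to \<open>S_tendsto_L2\<close>, with the averages of the
  remainder controlled by conservation of the integral. The initial data are a priori only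
  integrable, hence the extension.\<close>

lemma S_tendsto_L1:
  fixes f :: "real^'n::finite \<Rightarrow> real"
  assumes f: "integrable torus f"
  shows "(\<lambda>n. (LINT x|torus. \<bar>S n f x - f x\<bar>)) \<longlonglongrightarrow> 0"
proof (rule LIMSEQ_I)
  fix e :: real assume e: "0 < e"
  have [measurable]: "f \<in> borel_measurable borel" using borel_measurable_integrable[OF f] by simp
  define h where "h k x = max (- real k) (min (real k) (f x))" for k x
  have [measurable]: "h k \<in> borel_measurable borel" for k unfolding h_def by measurable
  have hb: "\<bar>h k x\<bar> \<le> real k" for k x by (auto simp: h_def)
  have Lh: "L2 (h k)" for k by (rule L2_bounded[OF _ hb]) measurable
  have "(\<lambda>k. (LINT x|torus. \<bar>f x - h k x\<bar>)) \<longlonglongrightarrow> integral\<^sup>L torus (\<lambda>x::real^'n. 0)"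
  proof (rule integral_dominated_convergence[where w = "\<lambda>x. \<bar>f x\<bar>"])
    show "AE x in torus. (\<lambda>k. \<bar>f x - h k x\<bar>) \<longlonglongrightarrow> 0"
    proof (rule AE_I2)
      fix x
      have "eventually (\<lambda>k. \<bar>f x - h k x\<bar> = 0) sequentially"
        using eventually_ge_at_top[of "nat \<lceil>\<bar>f x\<bar>\<rceil>"]
        by eventually_elim (auto simp: h_def abs_le_iff ceiling_le_iff nat_le_iff)
      then show "(\<lambda>k. \<bar>f x - h k x\<bar>) \<longlonglongrightarrow> 0" by (rule tendsto_eventually)
    qed
    show "AE x in torus. norm \<bar>f x - h k x\<bar> \<le> \<bar>f x\<bar>" for k by (auto simp: h_def)
  qed (use f in auto)
  then have "eventually (\<lambda>k. (LINT x|torus. \<bar>f x - h k x\<bar>) < e / 3) sequentially"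
    using e by (intro order_tendstoD) auto
  then obtain k where k: "(LINT x|torus. \<bar>f x - h k x\<bar>) < e / 3" by (auto simp: eventually_sequentially)
  have ih: "integrable torus (h k)" by (rule L2_integrable[OF Lh])
  have id: "integrable torus (\<lambda>x. f x - h k x)" using f ih by simp
  have "eventually (\<lambda>n. l2 (\<lambda>x. S n (h k) x - h k x) < e / 3) sequentially"
    using S_tendsto_L2[OF Lh] e by (intro order_tendstoD) auto
  then obtain N where N: "\<And>n. N \<le> n \<Longrightarrow> l2 (\<lambda>x. S n (h k) x - h k x) < e / 3"
    by (auto simp: eventually_sequentially)
  show "\<exists>no. \<forall>n\<ge>no. norm ((LINT x|torus. \<bar>S n f x - f x\<bar>) - 0) < e"
  proof (intro exI allI impI)
    fix n assume n: "N \<le> n"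
    have Sab: "\<bar>S n (\<lambda>x. f x - h k x) x\<bar> \<le> S n (\<lambda>x. \<bar>f x - h k x\<bar>) x" for x
    proof -
      have "\<bar>S n (\<lambda>x. f x - h k x) x\<bar> \<le> (LINT z|torus. \<bar>ker n (x - z) * (f z - h k z)\<bar>)"
        unfolding conv_def by (rule integral_abs_bound)
      then show ?thesis by (simp add: conv_def abs_mult ker_nonneg)
    qed
    have ia: "integrable torus (\<lambda>x. \<bar>f x - h k x\<bar>)" using id by simp
    note iS = S_integral[OF ia, of n]
    have dec: "S n f x - f x = S n (\<lambda>x. f x - h k x) x + (S n (h k) x - h k x) - (f x - h k x)" for x
      using conv_diff(1)[OF ker_cont ker_periodic f ih, of n x] by simp
    have i2: "integrable torus (\<lambda>x. \<bar>S n (h k) x - h k x\<bar>)"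
      using S_integral(2)[OF ih, of n] ih by simp
    have "(LINT x|torus. \<bar>S n f x - f x\<bar>) \<le> (LINT x|torus. S n (\<lambda>x. \<bar>f x - h k x\<bar>) x + \<bar>S n (h k) x - h k x\<bar> + \<bar>f x - h k x\<bar>)"
    proof (rule integral_mono)
      show "integrable torus (\<lambda>x. \<bar>S n f x - f x\<bar>)" using S_integral(2)[OF f, of n] f by simp
      show "\<bar>S n f x - f x\<bar> \<le> S n (\<lambda>x. \<bar>f x - h k x\<bar>) x + \<bar>S n (h k) x - h k x\<bar> + \<bar>f x - h k x\<bar>" for x
        using Sab[of x] dec[of x] by linarith
    qed (use iS i2 ia in simp)
    also have "\<dots> = (LINT x|torus. \<bar>f x - h k x\<bar>) + (LINT x|torus. \<bar>S n (h k) x - h k x\<bar>) + (LINT x|torus. \<bar>f x - h k x\<bar>)"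
      using iS i2 ia by simp
    also have "(LINT x|torus. \<bar>S n (h k) x - h k x\<bar>) \<le> l2 (\<lambda>x. S n (h k) x - h k x)"
      by (rule L1_le_l2[OF L2_diff[OF S_L2(1)[OF Lh] Lh]])
    finally have "(LINT x|torus. \<bar>S n f x - f x\<bar>) < e" using k N[OF n] by simp
    moreover have "0 \<le> (LINT x|torus. \<bar>S n f x - f x\<bar>)" by (rule integral_nonneg_AE) auto
    ultimately show "norm ((LINT x|torus. \<bar>S n f x - f x\<bar>) - 0) < e" by simp
  qed
qed

lemma S_AE_subseq:
  fixes f :: "real^'n::finite \<Rightarrow> real"
  assumes f: "integrable torus f"
  obtains q where "strict_mono q" "AE x in torus. (\<lambda>n. S (q n) f x) \<longlonglongrightarrow> f x"
proof -
  have i: "integrable torus (\<lambda>x. S n f x - f x)" for n using S_integral(2)[OF f, of n] f by simp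
  have "(\<lambda>n. (LINT x|torus. norm (S n f x - f x))) \<longlonglongrightarrow> 0" using S_tendsto_L1[OF f] by simp
  from tendsto_L1_AE_subseq[OF i this] obtain q where
    "strict_mono q" "AE x in torus. (\<lambda>n. S (q n) f x - f x) \<longlonglongrightarrow> 0" by auto
  then show ?thesis by (intro that[of q]) (auto simp: LIM_zero_iff)
qed

lemma Lipschitz_clamp:
  fixes f :: "real \<Rightarrow> real"
  assumes c: "0 < c1" "c1 \<le> c2" and d: "\<And>z. 0 < z \<Longrightarrow> (f has_real_derivative f' z) (at z)" and cf: "continuous_on {0<..} f'"
  obtains L where "\<And>a b. \<bar>f (max c1 (min c2 a)) - f (max c1 (min c2 b))\<bar> \<le> L * \<bar>a - b\<bar>"
proof -
  have "continuous_on {c1..c2} f'" by (rule continuous_on_subset[OF cf]) (use c in auto)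
  then have "bounded (f' ` {c1..c2})" by (intro compact_imp_bounded compact_continuous_image) auto
  then obtain L where "\<forall>x\<in>f' ` {c1..c2}. norm x \<le> L" unfolding bounded_iff by blast
  then have L: "\<And>z. z \<in> {c1..c2} \<Longrightarrow> norm (f' z) \<le> L" by auto
  have L0: "0 \<le> L" using order_trans[OF norm_ge_zero L[of c1]] c by simp
  have "\<bar>f (max c1 (min c2 a)) - f (max c1 (min c2 b))\<bar> \<le> L * \<bar>a - b\<bar>" for a b
  proof -
    have "norm (f (max c1 (min c2 a)) - f (max c1 (min c2 b))) \<le> L * norm (max c1 (min c2 a) - max c1 (min c2 b))"
      by (rule field_differentiable_bound[where S = "{c1..c2}" and f' = f'])
         (use c d L in \<open>auto intro: has_field_derivative_at_within\<close>)
    also have "\<dots> \<le> L * \<bar>a - b\<bar>" using L0 by (intro mult_left_mono) auto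
    finally show ?thesis by simp
  qed
  then show ?thesis by (rule that)
qed

context flow_slice
begin

text \<open>The integrand is the gradient of kinetic energy plus \<open>P\<close>, as a function of
  density \<open>R\<close> and momentum \<open>M\<close>, applied to their rates: the partial
  derivatives are \<open>P'\<close> minus half the squared length of \<open>V\<close>, and
  \<open>V\<close> itself.\<close>

lemma balance_identity:
  assumes P: "\<And>z. 0 < z \<Longrightarrow> (P has_real_derivative P' z) (at z)" and cP: "continuous_on {0<..} P'"
    and Pp: "\<And>z. c1 \<le> z \<Longrightarrow> z \<le> c2 \<Longrightarrow> z * P' z - P z = p z"
  shows "(LINT x|torus. (P' (S n r x) - (\<Sum>i\<in>UNIV. (V n (u i) x)\<^sup>2) / 2) * (- (\<Sum>j\<in>UNIV. conv (dker n j) (\<lambda>z. r z * u j z) x))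
      + (\<Sum>i\<in>UNIV. V n (u i) x * (\<Sum>j\<in>UNIV. conv (dker n j) (\<lambda>z. sg i j z - r z * (u i z * u j z)) x))) = balance n"
proof -
  let ?R = "S n r" and ?V = "\<lambda>i. V n (u i)" and ?D = "\<lambda>i j. DV n j (u i)"
  let ?M = "\<lambda>j. S n (\<lambda>z. r z * u j z)" and ?dM = "\<lambda>j. conv (dker n j) (\<lambda>z. r z * u j z)"
  let ?t = "\<lambda>i j z. sg i j z - r z * (u i z * u j z)"
  have Lt: "L2 (?t i j)" for i j by (intro L2_diff sg_L2 rw_L2 uu_L2)
  have pV: "pd j (?V i) (?D i j)" for i j by (rule pd_V[OF u_L2])
  have pR: "pd j ?R (conv (dker n j) r)" for j by (rule pd_S[OF r_int])
  have pM: "pd j (?M j) (?dM j)" for j by (rule pd_S[OF L2_integrable[OF rw_L2[OF u_L2]]])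
  have pt: "pd j (S n (?t i j)) (conv (dker n j) (?t i j))" for i j by (rule pd_S[OF L2_integrable[OF Lt]])
  have rng: "range ?R \<subseteq> {0<..}" using R_pos by auto
  have pP: "pd j (\<lambda>x. P (?R x)) (\<lambda>x. P' (?R x) * conv (dker n j) r x)" for j
    by (rule pd_compose[OF pR P continuous_on_subset[OF cP rng]]) (rule R_pos)
  have cR: "continuous_on UNIV ?R" using pd_cont(1)[OF pR] .
  have cPR: "continuous_on UNIV (\<lambda>x. P' (?R x))"
    by (rule continuous_on_compose2[OF cP cR]) (use rng in auto)
  have perR: "periodic_sp ?R" by (rule pd_periodic[OF pR])
  note cc = pd_cont[OF pV] pd_cont[OF pR] pd_cont[OF pM] pd_cont[OF pt] pd_cont[OF pP] cPR
  note pp = pd_periodic[OF pV] pd_periodic'[OF pV] pd_periodic[OF pR] pd_periodic'[OF pR] pd_periodic[OF pM]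
    pd_periodic'[OF pM] pd_periodic[OF pt] pd_periodic'[OF pt]
  have int: "integrable torus f" if "continuous_on UNIV f" "periodic_sp f" for f :: "real^'n \<Rightarrow> real"
    using that by (rule integrable_torus_periodic)
  have i1: "integrable torus (\<lambda>x. ?V i x * conv (dker n j) (?t i j) x)" for i j
    by (rule int) (intro continuous_intros cc, use pp in \<open>simp add: periodic_sp_def\<close>)
  have e1: "(LINT x|torus. ?V i x * conv (dker n j) (?t i j) x) = - (LINT x|torus. S n (?t i j) x * ?D i j x)" for i j
    using pd_parts[OF pV pt, of j i i] by (simp add: mult.commute)
  have i2: "integrable torus (\<lambda>x. (?V i x)\<^sup>2 * ?dM j x)" for i j
    by (rule int) (intro continuous_intros cc, use pp in \<open>simp add: periodic_sp_def\<close>)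
  \<comment> \<open>The two equal terms of the product rule cancel the factor 1/2 of the kinetic
    energy and leave the product \<open>V_i M_j\<close> that appears in \<open>flux\<close>.\<close>
  have e2: "(LINT x|torus. (?V i x)\<^sup>2 * ?dM j x) = - (2 * (LINT x|torus. ?V i x * ?M j x * ?D i j x))" for i j
  proof -
    have "pd j (\<lambda>x. ?V i x * ?V i x) (\<lambda>x. ?D i j x * ?V i x + ?V i x * ?D i j x)" by (rule pd_mult[OF pV pV])
    from pd_parts[OF this pM]
    have "(LINT x|torus. (?D i j x * ?V i x + ?V i x * ?D i j x) * ?M j x) = - (LINT x|torus. ?V i x * ?V i x * ?dM j x)" .
    moreover have "(\<lambda>x. (?D i j x * ?V i x + ?V i x * ?D i j x) * ?M j x) = (\<lambda>x. 2 * (?V i x * ?M j x * ?D i j x))"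
      by (auto simp: algebra_simps)
    ultimately show ?thesis by (simp add: power2_eq_square)
  qed
  have i3: "integrable torus (\<lambda>x. P' (?R x) * ?dM j x)" for j
    by (rule int) (intro continuous_intros cc, use pp in \<open>simp add: periodic_sp_def\<close>)
  \<comment> \<open>The momentum is expanded as density times velocity; after one integration by
    parts the hypothesis \<open>Pp\<close> assembles \<open>P\<close> and \<open>P'\<close> into the
    pressure.\<close>
  have e3: "(LINT x|torus. P' (?R x) * ?dM j x) = (LINT x|torus. p (?R x) * ?D j j x)" for j
  proof -
    have Meq: "?M j = (\<lambda>x. ?R x * ?V j x)" using M_eq[of n "u j"] by blast
    have "pd j (\<lambda>x. ?R x * ?V j x) (\<lambda>x. conv (dker n j) r x * ?V j x + ?R x * ?D j j x)" by (rule pd_mult[OF pR pV])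
    then have dM: "?dM j x = conv (dker n j) r x * ?V j x + ?R x * ?D j j x" for x
      using pM[of j] DERIV_unique unfolding Meq pd_def by blast
    have j1: "integrable torus (\<lambda>x. P' (?R x) * conv (dker n j) r x * ?V j x)"
      by (rule int) (intro continuous_intros cc, use pp in \<open>simp add: periodic_sp_def\<close>)
    have j2: "integrable torus (\<lambda>x. P' (?R x) * ?R x * ?D j j x)"
      by (rule int) (intro continuous_intros cc, use pp in \<open>simp add: periodic_sp_def\<close>)
    have j3: "integrable torus (\<lambda>x. P (?R x) * ?D j j x)"
      by (rule int) (intro continuous_intros cc, use pp in \<open>simp add: periodic_sp_def\<close>)
    have "(LINT x|torus. P' (?R x) * ?dM j x) = (LINT x|torus. P' (?R x) * conv (dker n j) r x * ?V j x + P' (?R x) * ?R x * ?D j j x)"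
      by (intro Bochner_Integration.integral_cong) (auto simp: dM algebra_simps)
    also have "\<dots> = (LINT x|torus. P' (?R x) * conv (dker n j) r x * ?V j x) + (LINT x|torus. P' (?R x) * ?R x * ?D j j x)"
      using j1 j2 by simp
    also have "(LINT x|torus. P' (?R x) * conv (dker n j) r x * ?V j x) = - (LINT x|torus. P (?R x) * ?D j j x)"
      by (rule pd_parts[OF pP pV])
    also have "- (LINT x|torus. P (?R x) * ?D j j x) + (LINT x|torus. P' (?R x) * ?R x * ?D j j x)
      = (LINT x|torus. P' (?R x) * ?R x * ?D j j x - P (?R x) * ?D j j x)"
      using j2 j3 by simp
    also have "\<dots> = (LINT x|torus. p (?R x) * ?D j j x)"
    proof (rule Bochner_Integration.integral_cong[OF refl])
      fix x
      have "?R x * P' (?R x) - P (?R x) = p (?R x)" by (rule Pp[OF R_bounds])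
      from this[symmetric] show "P' (?R x) * ?R x * ?D j j x - P (?R x) * ?D j j x = p (?R x) * ?D j j x"
      proof -
        have "b * a * d - c * d = (a * b - c) * d" for a b c d :: real by (simp add: algebra_simps)
        then show ?thesis unfolding \<open>p (?R x) = ?R x * P' (?R x) - P (?R x)\<close> by blast
      qed
    qed
    finally show ?thesis .
  qed
  have i4: "integrable torus (\<lambda>x. S n (?t i j) x * ?D i j x)" for i j
    by (rule int) (intro continuous_intros cc, use pp in \<open>simp add: periodic_sp_def\<close>)
  have i5: "integrable torus (\<lambda>x. ?V i x * ?M j x * ?D i j x)" for i j
    by (rule int) (intro continuous_intros cc, use pp in \<open>simp add: periodic_sp_def\<close>)
  have flux: "flux n i j x = S n (?t i j) x + ?V i x * ?M j x" for i j x
    using conv_diff(1)[OF ker_cont ker_periodic L2_integrable[OF sg_L2] L2_integrable[OF rw_L2[OF uu_L2]], of n i j i j x]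
    by (simp add: flux_def)
  have "(LINT x|torus. (P' (?R x) - (\<Sum>i\<in>UNIV. (?V i x)\<^sup>2) / 2) * (- (\<Sum>j\<in>UNIV. ?dM j x))
      + (\<Sum>i\<in>UNIV. ?V i x * (\<Sum>j\<in>UNIV. conv (dker n j) (?t i j) x)))
    = (LINT x|torus. (\<Sum>i\<in>UNIV. \<Sum>j\<in>UNIV. (?V i x)\<^sup>2 * ?dM j x) / 2 - (\<Sum>j\<in>UNIV. P' (?R x) * ?dM j x)
      + (\<Sum>i\<in>UNIV. \<Sum>j\<in>UNIV. ?V i x * conv (dker n j) (?t i j) x))"
  proof (rule Bochner_Integration.integral_cong[OF refl])
    fix x
    have 1: "(\<Sum>i\<in>UNIV. \<Sum>j\<in>UNIV. (?V i x)\<^sup>2 * ?dM j x) = (\<Sum>i\<in>UNIV. (?V i x)\<^sup>2) * (\<Sum>j\<in>UNIV. ?dM j x)"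
      by (simp only: sum_product)
    have 2: "(\<Sum>j\<in>UNIV. P' (?R x) * ?dM j x) = P' (?R x) * (\<Sum>j\<in>UNIV. ?dM j x)"
      by (simp only: sum_distrib_left)
    have 3: "(\<Sum>i\<in>UNIV. \<Sum>j\<in>UNIV. ?V i x * conv (dker n j) (?t i j) x) = (\<Sum>i\<in>UNIV. ?V i x * (\<Sum>j\<in>UNIV. conv (dker n j) (?t i j) x))"
      by (simp only: sum_distrib_left)
    have 4: "(a - s / 2) * (- m) + y = s * m / 2 - a * m + y" for a s m y :: real by (simp add: field_simps)
    show "(P' (?R x) - (\<Sum>i\<in>UNIV. (?V i x)\<^sup>2) / 2) * (- (\<Sum>j\<in>UNIV. ?dM j x))
      + (\<Sum>i\<in>UNIV. ?V i x * (\<Sum>j\<in>UNIV. conv (dker n j) (?t i j) x))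
      = (\<Sum>i\<in>UNIV. \<Sum>j\<in>UNIV. (?V i x)\<^sup>2 * ?dM j x) / 2 - (\<Sum>j\<in>UNIV. P' (?R x) * ?dM j x)
      + (\<Sum>i\<in>UNIV. \<Sum>j\<in>UNIV. ?V i x * conv (dker n j) (?t i j) x)"
      unfolding 1 2 3 by (rule 4)
  qed
  also have "\<dots> = (\<Sum>i\<in>UNIV. \<Sum>j\<in>UNIV. (LINT x|torus. (?V i x)\<^sup>2 * ?dM j x)) / 2 - (\<Sum>j\<in>UNIV. (LINT x|torus. P' (?R x) * ?dM j x))
      + (\<Sum>i\<in>UNIV. \<Sum>j\<in>UNIV. (LINT x|torus. ?V i x * conv (dker n j) (?t i j) x))"
    using i1 i2 i3 by simp
  also have "\<dots> = - (\<Sum>i\<in>UNIV. \<Sum>j\<in>UNIV. (LINT x|torus. ?V i x * ?M j x * ?D i j x)) - (\<Sum>j\<in>UNIV. (LINT x|torus. p (?R x) * ?D j j x))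
      - (\<Sum>i\<in>UNIV. \<Sum>j\<in>UNIV. (LINT x|torus. S n (?t i j) x * ?D i j x))"
    unfolding e1 e2 e3 by (simp add: sum_negf sum_distrib_left[symmetric])
  also have "\<dots> = balance n"
    unfolding balance_def flux using i4 i5 by (simp add: distrib_right sum.distrib)
  finally show ?thesis .
qed

end

section \<open>The product measure on space-time\<close>

abbreviation "st T \<equiv> torus \<Otimes>\<^sub>M tm T"

lemma pair_st: "pair_sigma_finite (torus :: (real^'n::finite) measure) (tm T)"
  by (simp add: pair_sigma_finite_def torus.sigma_finite_measure_axioms finite_measure.axioms(1)[OF finite_measure_tm])

lemma sets_st [measurable_cong]: "sets (st T :: ((real^'n::finite) \<times> real) measure) = sets borel"
  unfolding sets_pair_measure_cong[OF sets_torus sets_tm] borel_prod ..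

lemma st_finite: "finite_measure (st T :: ((real^'n::finite) \<times> real) measure)"
  by (rule finite_measure_pair_measure) (rule finite_measure_tm, unfold_locales)

lemma slice_measurable:
  "h \<in> borel_measurable (borel :: ((real^'n::finite) \<times> real) measure) \<Longrightarrow> (\<lambda>x. h (x, t)) \<in> borel_measurable borel"
  using measurable_compose[of "\<lambda>x. (x, t)" borel "borel :: ((real^'n) \<times> real) measure" h borel] borel_measurable_Pair by simp

lemma st_slices:
  fixes h :: "(real^'n::finite) \<times> real \<Rightarrow> real"
  assumes h: "integrable (st T) h"
  shows "AE t in tm T. integrable torus (\<lambda>x. h (x, t))" "integrable (tm T) (\<lambda>t. (LINT x|torus. h (x, t)))"
    "integral\<^sup>L (st T) h = (LINT t|tm T. (LINT x|torus. h (x, t)))"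
proof -
  interpret P: pair_sigma_finite "torus :: (real^'n) measure" "tm T" by (rule pair_st)
  have h': "integrable (st T) (\<lambda>(x, t). h (x, t))" using h by simp
  show "AE t in tm T. integrable torus (\<lambda>x. h (x, t))" using P.AE_integrable_snd[OF h'] .
  show "integrable (tm T) (\<lambda>t. (LINT x|torus. h (x, t)))" using P.integrable_snd[OF h'] .
  show "integral\<^sup>L (st T) h = (LINT t|tm T. (LINT x|torus. h (x, t)))"
    using P.integral_snd[OF h'] by simp
qed

lemma st_mult_bounded:
  fixes h :: "(real^'n::finite) \<times> real \<Rightarrow> real"
  assumes h: "integrable (st T) h" and [measurable]: "b \<in> borel_measurable borel" and B: "\<And>z. \<bar>b z\<bar> \<le> B"
  shows "integrable (st T) (\<lambda>z. b z * h z)"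
proof -
  have B0: "0 \<le> B" using B[of undefined] by linarith
  have [measurable]: "h \<in> borel_measurable (st T)" using h by auto
  show ?thesis
    by (rule Bochner_Integration.integrable_bound[where f = "\<lambda>z. B * h z"])
       (use h B B0 in \<open>auto simp: abs_mult intro!: mult_right_mono\<close>)
qed

text \<open>The identities arise at each fixed \<open>x\<close> for almost all \<open>t\<close>,
  while integration over space wants the reverse order. Joint measurability of both sides allows the
  exchange of quantifiers.\<close>

lemma AE_st_swap:
  fixes F G :: "(real^'n::finite) \<times> real \<Rightarrow> real"
  assumes [measurable]: "F \<in> borel_measurable borel" "G \<in> borel_measurable borel"
    and ae: "\<And>x. AE t in tm T. F (x, t) = G (x, t)"
  shows "AE t in tm T. AE x in torus. F (x, t) = G (x, t)"
proof -
  interpret P: pair_sigma_finite "torus :: (real^'n) measure" "tm T" by (rule pair_st)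
  have m: "{z \<in> space (st T). F (fst z, snd z) = G (fst z, snd z)} \<in> sets (st T)"
  proof -
    have "{z \<in> space (borel :: ((real^'n) \<times> real) measure). F z = G z} \<in> sets borel" by measurable
    then show ?thesis unfolding sets_st by (simp add: space_pair_measure)
  qed
  have "AE x in torus. AE t in tm T. F (x, t) = G (x, t)" using ae by simp
  then show ?thesis using P.AE_commute[OF m[unfolded split_beta]] m by (subst (asm) P.AE_commute) auto
qed

text \<open>A violation would persist on an interval of positive length. The bounds thereby reach
  the endpoint \<open>t = 0\<close>, where they become bounds for the initial data.\<close>

lemma AE_ge_continuous:
  fixes f :: "real \<Rightarrow> real"
  assumes T: "0 < T" and c: "continuous_on {0..T} f" and ae: "AE t in tm T. a \<le> f t \<and> f t \<le> b" and t: "t \<in> {0..T}"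
  shows "a \<le> f t" "f t \<le> b"
proof -
  have *: "f t \<in> {a..b}"
  proof (rule ccontr)
    assume nt: "f t \<notin> {a..b}"
    have "open (- {a..b})" by auto
    then obtain d where d: "0 < d" "\<And>s. s \<in> {0..T} \<Longrightarrow> dist s t < d \<Longrightarrow> f s \<notin> {a..b}"
    proof -
      have "\<exists>e>0. ball (f t) e \<subseteq> - {a..b}" using \<open>open (- {a..b})\<close> nt by (simp add: open_contains_ball)
      then obtain e where e: "0 < e" "ball (f t) e \<subseteq> - {a..b}" by blast
      from c[unfolded continuous_on_iff, rule_format, OF t e(1)] obtain d where
        "0 < d" "\<forall>s\<in>{0..T}. dist s t < d \<longrightarrow> dist (f s) (f t) < e" by blast
      then show ?thesis
      proof (intro that[of d])
        fix s assume "s \<in> {0..T}" "dist s t < d"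
        then have "f s \<in> ball (f t) e" using \<open>\<forall>s\<in>{0..T}. dist s t < d \<longrightarrow> dist (f s) (f t) < e\<close> by (simp add: dist_commute)
        then show "f s \<notin> {a..b}" using e(2) by blast
      qed
    qed
    define s1 s2 where "s1 = max 0 (t - d)" and "s2 = min T (t + d)"
    have "s1 < s2" using t d(1) T by (auto simp: s1_def s2_def)
    have "AE s in lborel. s \<notin> {s1<..<s2}"
      using ae unfolding AE_tm
      by eventually_elim (use d(2) in \<open>force simp: s1_def s2_def dist_real_def\<close>)
    then have "{s1<..<s2} \<in> null_sets lborel" by (subst AE_iff_null_sets) auto
    with \<open>s1 < s2\<close> show False by (auto simp: null_sets_def)
  qed
  then show "a \<le> f t" "f t \<le> b" by auto
qed

section \<open>Energy of the mollified flow\<close>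

text \<open>Viscous stress minus pressure on the diagonal, combined so that viscosity and pressure
  enter the momentum equation as one tensor.\<close>

definition stress :: "(real \<Rightarrow> real) \<Rightarrow> (real \<Rightarrow> real) \<Rightarrow> (real \<Rightarrow> real) \<Rightarrow> (('a \<Rightarrow> real) \<Rightarrow> ('n::finite \<Rightarrow> 'n \<Rightarrow> 'a \<Rightarrow> real) \<Rightarrow> 'n \<Rightarrow> 'n \<Rightarrow> 'a \<Rightarrow> real)" where
  "stress \<nu> \<mu> p R D i j z = \<nu> (R z) * ((D i j z + D j i z) / 2)
     + (if i = j then \<mu> (R z) * (\<Sum>k\<in>UNIV. D k k z) - p (R z) else 0)"

lemma clamp_id: "c1 \<le> x \<Longrightarrow> x \<le> c2 \<Longrightarrow> max c1 (min c2 x) = (x::real)"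
  by simp

lemma continuous_clamp:
  fixes f :: "real \<Rightarrow> real"
  assumes "continuous_on {0<..} f" "0 < c1"
  shows "continuous_on UNIV (\<lambda>x. f (max c1 (min c2 x)))"
  by (rule continuous_on_compose2[OF assms(1)]) (use assms(2) in \<open>auto intro!: continuous_intros\<close>)

lemma bounded_clamp:
  fixes f :: "real \<Rightarrow> real"
  assumes "continuous_on {0<..} f" "0 < c1" "c1 \<le> c2"
  obtains B where "0 \<le> B" "\<And>x. \<bar>f (max c1 (min c2 x))\<bar> \<le> B"
proof -
  have "continuous_on {c1..c2} f" by (rule continuous_on_subset[OF assms(1)]) (use assms in auto)
  then have "bounded (f ` {c1..c2})" by (intro compact_imp_bounded compact_continuous_image) auto
  then obtain B where "\<forall>x\<in>f ` {c1..c2}. norm x \<le> B" unfolding bounded_iff by blast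
  then have "\<bar>f (max c1 (min c2 x))\<bar> \<le> max B 0" for x
    using assms(3) by (simp add: le_max_iff_disj)
  then show ?thesis using that[of "max B 0"] by simp
qed

lemma Ppot_deriv:
  assumes p: "continuous_on {0<..} p" and z: "0 < z"
  shows "(Ppot p has_real_derivative (LBINT w=ereal 1..ereal z. p w / w^2) + p z / z) (at z)"
proof -
  define a b where "a = min 1 z / 2" and "b = max 1 z + 1"
  have ab: "0 < a" "a \<le> 1" "1 \<le> b" "a < z" "z < b" using z by (auto simp: a_def b_def)
  have c: "continuous_on {a..b} (\<lambda>w. p w / w^2)"
    using ab by (intro continuous_intros continuous_on_subset[OF p]) auto
  have "((\<lambda>x. LBINT w=ereal 1..ereal x. p w / w^2) has_vector_derivative p z / z^2) (at z within {a..b})"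
    by (rule interval_integral_FTC2[OF _ _ c]) (use ab in auto)
  then have "((\<lambda>x. LBINT w=ereal 1..ereal x. p w / w^2) has_real_derivative p z / z^2) (at z within {a..b})"
    by (simp add: has_real_derivative_iff_has_vector_derivative)
  then have d: "((\<lambda>x. LBINT w=ereal 1..ereal x. p w / w^2) has_real_derivative p z / z^2) (at z)"
    using ab at_within_interior[of z "{a..b}"] by (simp add: interior_atLeastAtMost_real)
  show ?thesis unfolding Ppot_def[abs_def]
    by (rule DERIV_cong[OF DERIV_mult[OF DERIV_ident d]]) (use z in \<open>simp add: power2_eq_square\<close>)
qed

text \<open>Supplies the joint measurability in \<open>(x, t)\<close> on which the exchange of the
  quantifiers over \<open>x\<close> and \<open>t\<close> depends.\<close>

lemma conv_joint_measurable:
  fixes k :: "real^'n::finite \<Rightarrow> real" and h :: "(real^'n) \<times> real \<Rightarrow> real"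
  assumes [measurable]: "k \<in> borel_measurable borel" "h \<in> borel_measurable borel"
  shows "(\<lambda>z. conv k (\<lambda>y. h (y, snd z)) (fst z)) \<in> borel_measurable borel"
proof -
  have f: "(\<lambda>(z, y). k (fst z - y) * h (y, snd z)) \<in> borel_measurable ((borel :: ((real^'n) \<times> real) measure) \<Otimes>\<^sub>M torus)"
  proof -
    let ?M = "(borel :: ((real^'n) \<times> real) measure) \<Otimes>\<^sub>M (torus :: (real^'n) measure)"
    have "snd \<in> ?M \<rightarrow>\<^sub>M torus" by (rule measurable_snd)
    then have sn: "snd \<in> ?M \<rightarrow>\<^sub>M borel" unfolding measurable_cong_sets[OF refl sets_torus] .
    have fs: "fst \<in> borel_measurable (borel :: ((real^'n) \<times> real) measure)"
      "snd \<in> borel_measurable (borel :: ((real^'n) \<times> real) measure)"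
      by (intro borel_measurable_continuous_onI continuous_intros)+
    note f1 = measurable_compose[OF measurable_fst fs(1), of torus] and f2 = measurable_compose[OF measurable_fst fs(2), of torus]
    have m1: "(\<lambda>w. fst (fst w) - snd w) \<in> ?M \<rightarrow>\<^sub>M borel" by (intro borel_measurable_diff f1 sn)
    have m2: "(\<lambda>w. (snd w, snd (fst w))) \<in> ?M \<rightarrow>\<^sub>M borel" by (intro borel_measurable_Pair f2 sn)
    show ?thesis
      using measurable_compose[OF m1 assms(1)] measurable_compose[OF m2 assms(2)] by (simp add: split_beta')
  qed
  show ?thesis
    unfolding conv_def using torus.borel_measurable_lebesgue_integral[OF f] by simp
qed

lemma conv_slices:
  fixes k :: "real^'n::finite \<Rightarrow> real"
  assumes k: "continuous_on UNIV k" "periodic_sp k" and h: "integrable (st T) h"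
  shows "integrable (tm T) (\<lambda>s. conv k (\<lambda>y. h (y, s)) x)"
proof -
  obtain B where B: "0 \<le> B" "\<And>x. \<bar>k x\<bar> \<le> B" using periodic_bounded[OF k] by blast
  have [measurable]: "k \<in> borel_measurable borel" using k by (auto intro: borel_cont)
  have "(\<lambda>z. k (x - fst z)) \<in> borel_measurable (borel :: ((real^'n) \<times> real) measure)"
    unfolding borel_prod[symmetric] by measurable
  from st_mult_bounded[OF h this B(2)] have "integrable (st T) (\<lambda>z. k (x - fst z) * h z)" .
  from st_slices(2)[OF this] show ?thesis by (simp add: conv_def)
qed

lemma conv_abs_le:
  fixes k :: "real^'n::finite \<Rightarrow> real"
  assumes k: "continuous_on UNIV k" "periodic_sp k" and B: "\<And>x. \<bar>k x\<bar> \<le> B" and f: "integrable torus f"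
  shows "\<bar>conv k f x\<bar> \<le> B * (LINT y|torus. \<bar>f y\<bar>)"
proof -
  have "\<bar>conv k f x\<bar> \<le> (LINT z|torus. \<bar>k (x - z) * f z\<bar>)"
    unfolding conv_def by (rule integral_abs_bound)
  also have "\<dots> \<le> (LINT z|torus. B * \<bar>f z\<bar>)"
    using integrable_abs[OF conv_integrable[OF k f, of x]] f B by (intro integral_mono) (auto simp: abs_mult intro!: mult_right_mono)
  finally show ?thesis by simp
qed

lemma dker_facts: "continuous_on UNIV (dker n j :: real^'n \<Rightarrow> real)" "periodic_sp (dker n j :: real^'n \<Rightarrow> real)"
  using pd_cont(2)[OF pd_ker] pd_periodic'[OF pd_ker] by auto

text \<open>Borel representatives on space-time, with bounds for the density at every point.
  \<open>C0\<close> is the essential bound for the squared slice norms of the velocity.\<close>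

locale flow_data =
  fixes T c1 c2 C0 :: real and p p1 \<nu> \<mu> :: "real \<Rightarrow> real" and R :: "(real^'n::finite) \<times> real \<Rightarrow> real"
    and U :: "'n \<Rightarrow> (real^'n) \<times> real \<Rightarrow> real" and D :: "'n \<Rightarrow> 'n \<Rightarrow> (real^'n) \<times> real \<Rightarrow> real"
  assumes T_pos: "0 < T" and c1_pos: "0 < c1" and c12: "c1 \<le> c2"
    and p_deriv: "\<And>z. 0 < z \<Longrightarrow> (p has_real_derivative p1 z) (at z)" and p1_cont: "continuous_on {0<..} p1"
    and \<nu>_cont: "continuous_on {0<..} \<nu>" and \<mu>_cont: "continuous_on {0<..} \<mu>"
    and R_meas [measurable]: "R \<in> borel_measurable borel" and R_lower: "\<And>z. c1 \<le> R z" and R_upper: "\<And>z. R z \<le> c2"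
    and U_meas [measurable]: "\<And>i. U i \<in> borel_measurable borel" and D_meas [measurable]: "\<And>i j. D i j \<in> borel_measurable borel"
    and U_int: "\<And>i. integrable (st T) (\<lambda>z. (U i z)\<^sup>2)" and D_int: "\<And>i j. integrable (st T) (\<lambda>z. (D i j z)\<^sup>2)"
    and U_Linf: "AE t in tm T. integral\<^sup>L torus (\<lambda>x. \<Sum>i\<in>UNIV. (U i (x, t))\<^sup>2) \<le> C0"
begin

abbreviation "\<sigma> \<equiv> stress \<nu> \<mu> p R D"

text \<open>Equal to \<open>p\<close> on the range of the density, but globally Lipschitz and
  bounded, as \<open>flow_slice\<close> asks.\<close>

definition pc :: "real \<Rightarrow> real" where "pc x = p (max c1 (min c2 x))"

lemma p_cont: "continuous_on {0<..} p"
  using p_deriv by (auto intro!: continuous_at_imp_continuous_on DERIV_isCont)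

lemma R_abs: "\<bar>R z\<bar> \<le> c2" using R_lower[of z] R_upper[of z] c1_pos by linarith

text \<open>Off the positive axis \<open>f\<close> is unconstrained, so measurability is obtained
  through the clamped function, which is continuous everywhere and agrees with \<open>f\<close> on
  the range of \<open>R\<close>.\<close>

lemma coeff_R:
  fixes f :: "real \<Rightarrow> real"
  assumes f: "continuous_on {0<..} f"
  shows "(\<lambda>z. f (R z)) \<in> borel_measurable borel" "\<exists>B. \<forall>z. \<bar>f (R z)\<bar> \<le> B"
proof -
  have eq: "f (R z) = f (max c1 (min c2 (R z)))" for z using clamp_id[OF R_lower R_upper, of z] by simp
  have "(\<lambda>x. f (max c1 (min c2 x))) \<in> borel_measurable borel"
    by (rule borel_measurable_continuous_onI[OF continuous_clamp[OF f c1_pos]])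
  from measurable_compose[OF R_meas this] show "(\<lambda>z. f (R z)) \<in> borel_measurable borel" by (simp add: eq[symmetric])
  obtain B where "\<And>x. \<bar>f (max c1 (min c2 x))\<bar> \<le> B" using bounded_clamp[OF f c1_pos c12] by blast
  then have "\<bar>f (R z)\<bar> \<le> B" for z using eq[of z] by metis
  then show "\<exists>B. \<forall>z. \<bar>f (R z)\<bar> \<le> B" by blast
qed

lemma \<sigma>_meas [measurable]: "\<sigma> i j \<in> borel_measurable borel"
proof -
  note coeff_R(1)[OF \<nu>_cont, measurable] coeff_R(1)[OF \<mu>_cont, measurable] coeff_R(1)[OF p_cont, measurable]
  show ?thesis unfolding stress_def[abs_def] by measurable
qed

definition sqint :: "((real^'n) \<times> real \<Rightarrow> real) \<Rightarrow> bool" where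
  "sqint f \<longleftrightarrow> f \<in> borel_measurable borel \<and> integrable (st T) (\<lambda>z. (f z)\<^sup>2)"

lemma sqint_meas: "sqint f \<Longrightarrow> f \<in> borel_measurable borel" by (simp add: sqint_def)

lemma st_meas: "f \<in> borel_measurable borel \<Longrightarrow> f \<in> borel_measurable (st T)"
  by (simp add: measurable_cong_sets[OF sets_st refl])

lemma sqint_dom:
  assumes g: "integrable (st T) g" and f: "f \<in> borel_measurable borel" and le: "\<And>z. (f z)\<^sup>2 \<le> g z"
  shows "sqint f"
  unfolding sqint_def
proof
  have [measurable]: "f \<in> borel_measurable (st T)" by (rule st_meas[OF f])
  show "integrable (st T) (\<lambda>z. (f z)\<^sup>2)"
    by (rule Bochner_Integration.integrable_bound[OF g]) (auto intro!: AE_I2 order_trans[OF le abs_ge_self])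
qed fact

lemma sqint_add: "sqint f \<Longrightarrow> sqint g \<Longrightarrow> sqint (\<lambda>z. f z + g z)"
proof -
  assume f: "sqint f" and g: "sqint g"
  have [measurable]: "f \<in> borel_measurable borel" "g \<in> borel_measurable borel" using f g by (auto simp: sqint_def)
  show ?thesis
  proof (rule sqint_dom[where g = "\<lambda>z. 2 * (f z)\<^sup>2 + 2 * (g z)\<^sup>2"])
    show "(f z + g z)\<^sup>2 \<le> 2 * (f z)\<^sup>2 + 2 * (g z)\<^sup>2" for z
      using sum_squares_bound[of "f z" "g z"] unfolding power2_sum by linarith
  qed (use f g in \<open>auto simp: sqint_def\<close>)
qed

lemma sqint_bounded_mult:
  assumes f: "sqint f" and b: "b \<in> borel_measurable borel" "\<And>z. \<bar>b z\<bar> \<le> B"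
  shows "sqint (\<lambda>z. b z * f z)"
proof -
  have [measurable]: "f \<in> borel_measurable borel" "b \<in> borel_measurable borel" using f b by (auto simp: sqint_def)
  show ?thesis
  proof (rule sqint_dom[where g = "\<lambda>z. B\<^sup>2 * (f z)\<^sup>2"])
    show "(b z * f z)\<^sup>2 \<le> B\<^sup>2 * (f z)\<^sup>2" for z
      unfolding power_mult_distrib using power_mono[OF b(2)[of z], of 2] by (intro mult_right_mono) auto
  qed (use f in \<open>auto simp: sqint_def\<close>)
qed

lemma sqint_bounded:
  assumes b: "b \<in> borel_measurable borel" "\<And>z. \<bar>b z\<bar> \<le> B"
  shows "sqint b"
proof (rule sqint_dom[OF _ b(1), where g = "\<lambda>z. B\<^sup>2"])
  show "integrable (st T) (\<lambda>z::(real^'n) \<times> real. B\<^sup>2)" by (rule finite_measure.integrable_const[OF st_finite])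
  show "(b z)\<^sup>2 \<le> B\<^sup>2" for z using power_mono[OF b(2)[of z], of 2] by simp
qed

lemma sqint_sum: "finite A \<Longrightarrow> (\<And>i. i \<in> A \<Longrightarrow> sqint (f i)) \<Longrightarrow> sqint (\<lambda>z. \<Sum>i\<in>A. f i z)"
  by (induction A rule: finite_induct) (auto intro: sqint_add sqint_bounded[where B = 0])

lemma sqint_U: "sqint (U i)" and sqint_D: "sqint (D i j)"
  using U_int D_int by (auto simp: sqint_def)

lemma sqint_\<sigma>: "sqint (\<sigma> i j)"
proof -
  obtain B1 where B1: "\<And>z. \<bar>\<nu> (R z)\<bar> \<le> B1" using coeff_R(2)[OF \<nu>_cont] by blast
  obtain B2 where B2: "\<And>z. \<bar>\<mu> (R z)\<bar> \<le> B2" using coeff_R(2)[OF \<mu>_cont] by blast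
  obtain B3 where B3: "\<And>z. \<bar>p (R z)\<bar> \<le> B3" using coeff_R(2)[OF p_cont] by blast
  note m = coeff_R(1)[OF \<nu>_cont] coeff_R(1)[OF \<mu>_cont] coeff_R(1)[OF p_cont]
  have s: "sqint (\<lambda>z. (1/2) * (D i j z + D j i z))"
    by (rule sqint_bounded_mult[OF sqint_add[OF sqint_D sqint_D], where B = "1/2"]) auto
  have a: "sqint (\<lambda>z. \<nu> (R z) * ((1/2) * (D i j z + D j i z)))" by (rule sqint_bounded_mult[OF s m(1) B1])
  have b: "sqint (\<lambda>z. \<mu> (R z) * (\<Sum>k\<in>UNIV. D k k z))"
    by (rule sqint_bounded_mult[OF sqint_sum m(2) B2]) (auto intro: sqint_D)
  have c: "sqint (\<lambda>z. - p (R z))" by (rule sqint_bounded[where B = B3]) (use m(3) B3 in auto)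
  have "sqint (\<lambda>z. \<nu> (R z) * ((1/2) * (D i j z + D j i z)) + (if i = j then \<mu> (R z) * (\<Sum>k\<in>UNIV. D k k z) + - p (R z) else 0))"
    using sqint_add[OF a sqint_add[OF b c]] a by (cases "i = j") auto
  then show ?thesis by (rule back_subst[of sqint]) (auto simp: stress_def fun_eq_iff)
qed

abbreviation "\<tau> i j \<equiv> \<lambda>z. \<sigma> i j z - R z * (U i z * U j z)"

lemma sqint_RU: "sqint (\<lambda>z. R z * U i z)" by (rule sqint_bounded_mult[OF sqint_U R_meas R_abs])

lemma sqint_integrable: "sqint f \<Longrightarrow> integrable (st T) f"
proof -
  assume f: "sqint f"
  have [measurable]: "f \<in> borel_measurable (st T)" by (rule st_meas[OF sqint_meas[OF f]])
  have "integrable (st T) (\<lambda>z::(real^'n) \<times> real. (1::real)\<^sup>2)"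
    by (rule finite_measure.integrable_const[OF st_finite])
  then show ?thesis using Cauchy_Schwarz_integral(1)[of f "st T" "\<lambda>_. 1"] f by (simp add: sqint_def)
qed

lemma sqint_slice: "sqint f \<Longrightarrow> AE t in tm T. L2 (\<lambda>x. f (x, t))"
  using st_slices(1)[of T "\<lambda>z. (f z)\<^sup>2"] slice_measurable[of f] by (auto simp: sqint_def L2_def)

lemma pc_lip: "\<exists>L. \<forall>a b. \<bar>pc a - pc b\<bar> \<le> L * \<bar>a - b\<bar>"
  using Lipschitz_clamp[OF c1_pos c12 p_deriv p1_cont] unfolding pc_def by metis

text \<open>Fixed once by choice, so that all time slices share the same constant.\<close>

definition Lp :: real where "Lp = (SOME L. \<forall>a b. \<bar>pc a - pc b\<bar> \<le> L * \<bar>a - b\<bar>)"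

lemma Lp: "\<bar>pc a - pc b\<bar> \<le> Lp * \<bar>a - b\<bar>"
  using someI_ex[OF pc_lip] unfolding Lp_def by blast

definition Pm :: real where "Pm = (SOME B. \<forall>a. \<bar>pc a\<bar> \<le> B)"

lemma Pm: "\<bar>pc a\<bar> \<le> Pm"
proof -
  have "\<exists>B. \<forall>a. \<bar>pc a\<bar> \<le> B" using bounded_clamp[OF p_cont c1_pos c12] unfolding pc_def by metis
  from someI_ex[OF this] show ?thesis unfolding Pm_def by blast
qed

lemma sqint_mult: "sqint f \<Longrightarrow> sqint g \<Longrightarrow> integrable (st T) (\<lambda>z. f z * g z)"
  by (rule Cauchy_Schwarz_integral(1)) (auto simp: sqint_def intro: st_meas)

lemma sqint_p: "sqint (\<lambda>z. p (R z))"
  using coeff_R[OF p_cont] sqint_bounded by blast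

end

text \<open>The mass and momentum equations enter through the integrated form of their averages at
  each fixed \<open>n\<close> and \<open>x\<close>; \<open>r0\<close> and \<open>v0\<close> are the
  initial density and velocity.\<close>

locale flow = flow_data T c1 c2 C0 p p1 \<nu> \<mu> R U D
  for T c1 c2 C0 p p1 \<nu> \<mu> and R :: "(real^'n::finite) \<times> real \<Rightarrow> real" and U D +
  fixes r0 :: "real^'n \<Rightarrow> real" and v0 :: "'n \<Rightarrow> real^'n \<Rightarrow> real"
  assumes q_int: "integrable (st T) (\<lambda>z. (\<Sum>i\<in>UNIV. (U i z)\<^sup>2)\<^sup>2)"
    and r0_density: "mass_density r0 c1 c2" and v0_L2: "\<And>i. L2 (v0 i)"
    and pd_slices: "AE t in tm T. \<forall>m i j. pd j (S m (\<lambda>x. U i (x, t))) (S m (\<lambda>x. D i j (x, t)))"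
    and mass: "\<And>n x. AE t in tm T. S n (\<lambda>z. R (z, t)) x = S n r0 x
      + integral {0..t} (\<lambda>s. - (\<Sum>j\<in>UNIV. conv (dker n j) (\<lambda>z. R (z, s) * U j (z, s)) x))"
    and momentum: "\<And>n x i. AE t in tm T. S n (\<lambda>z. R (z, t) * U i (z, t)) x = S n (\<lambda>z. r0 z * v0 i z) x
      + integral {0..t} (\<lambda>s. \<Sum>j\<in>UNIV. conv (dker n j)
          (\<lambda>z. stress \<nu> \<mu> p R D i j (z, s) - R (z, s) * (U i (z, s) * U j (z, s))) x)"
begin

lemma sqint_UU: "sqint (\<lambda>z. U i z * U j z)"
proof (rule sqint_dom[OF q_int])
  fix z
  have "\<bar>U i z * U j z\<bar> \<le> (\<Sum>i\<in>UNIV. (U i z)\<^sup>2)"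
  proof -
    have "2 * \<bar>U i z * U j z\<bar> \<le> (U i z)\<^sup>2 + (U j z)\<^sup>2"
      using sum_squares_bound[of "\<bar>U i z\<bar>" "\<bar>U j z\<bar>"] by (simp add: abs_mult)
    moreover have "(U k z)\<^sup>2 \<le> (\<Sum>i\<in>UNIV. (U i z)\<^sup>2)" for k by (rule member_le_sum) auto
    from this[of i] this[of j] have "(U i z)\<^sup>2 + (U j z)\<^sup>2 \<le> 2 * (\<Sum>i\<in>UNIV. (U i z)\<^sup>2)" by simp
    ultimately show ?thesis by simp
  qed
  from power_mono[OF this, of 2] show "(U i z * U j z)\<^sup>2 \<le> (\<Sum>i\<in>UNIV. (U i z)\<^sup>2)\<^sup>2" by simp
qed measurable

lemma sqint_\<tau>: "sqint (\<tau> i j)"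
proof -
  have "sqint (\<lambda>z. (- R z) * (U i z * U j z))"
    by (rule sqint_bounded_mult[OF sqint_UU, where B = c2]) (use R_abs in auto)
  from sqint_add[OF sqint_\<sigma> this] show ?thesis by simp
qed

text \<open>Countably many almost everywhere statements are gathered into one null set of times, off
  which the slice satisfies the locale.\<close>

lemma AE_slices: "AE t in tm T. flow_slice (\<lambda>x. R (x, t)) c1 c2 (\<lambda>i x. U i (x, t)) (\<lambda>i j x. D i j (x, t)) (\<lambda>i j x. \<sigma> i j (x, t)) pc Lp Pm"
proof -
  have "AE t in tm T. \<forall>i\<in>UNIV. L2 (\<lambda>x. U i (x, t))"
    by (rule AE_finite_allI) (auto intro: sqint_slice sqint_U)
  moreover have "AE t in tm T. \<forall>i\<in>UNIV. \<forall>j\<in>UNIV. L2 (\<lambda>x. D i j (x, t))"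
    by (intro AE_finite_allI) (auto intro: sqint_slice sqint_D)
  moreover have "AE t in tm T. \<forall>i\<in>UNIV. \<forall>j\<in>UNIV. L2 (\<lambda>x. \<sigma> i j (x, t))"
    by (intro AE_finite_allI) (auto intro: sqint_slice sqint_\<sigma>)
  moreover have "AE t in tm T. L2 (\<lambda>x. \<Sum>i\<in>UNIV. (U i (x, t))\<^sup>2)"
    by (rule sqint_slice[of "\<lambda>z. \<Sum>i\<in>UNIV. (U i z)\<^sup>2"]) (use q_int in \<open>simp add: sqint_def\<close>)
  ultimately show ?thesis using pd_slices
  proof eventually_elim
    case (elim t)
    show ?case
      by unfold_locales (use elim slice_measurable[OF R_meas] R_lower R_upper c1_pos Lp Pm in auto)
  qed
qed

definition P' :: "real \<Rightarrow> real" where "P' z = (LBINT w=ereal 1..ereal z. p w / w^2) + p z / z"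

lemma Ppot_has_deriv: "0 < z \<Longrightarrow> (Ppot p has_real_derivative P' z) (at z)"
  unfolding P'_def by (rule Ppot_deriv[OF p_cont])

lemma P'_eq: "0 < z \<Longrightarrow> P' z = (Ppot p z + p z) / z"
  by (simp add: P'_def Ppot_def add_divide_distrib)

lemma P'_cont: "continuous_on {0<..} P'"
proof -
  have "continuous_on {0<..} (Ppot p)"
    using Ppot_has_deriv by (auto intro!: continuous_at_imp_continuous_on DERIV_isCont)
  then have "continuous_on {0<..} (\<lambda>z. (Ppot p z + p z) / z)" by (intro continuous_intros p_cont) auto
  then show ?thesis by (rule continuous_on_eq) (auto simp: P'_eq)
qed

text \<open>The relation between potential and pressure that \<open>balance_identity\<close> asks
  for.\<close>

lemma P_legendre: "0 < z \<Longrightarrow> z * P' z - Ppot p z = p z"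
  by (simp add: P'_eq)

section \<open>The averaged fields as curves in time\<close>

definition Rn :: "nat \<Rightarrow> (real^'n) \<times> real \<Rightarrow> real" where
  "Rn n z = S n (\<lambda>y. R (y, snd z)) (fst z)"
definition Mn :: "nat \<Rightarrow> 'n \<Rightarrow> (real^'n) \<times> real \<Rightarrow> real" where
  "Mn n i z = S n (\<lambda>y. R (y, snd z) * U i (y, snd z)) (fst z)"
definition dR :: "nat \<Rightarrow> (real^'n) \<times> real \<Rightarrow> real" where
  "dR n z = - (\<Sum>j\<in>UNIV. conv (dker n j) (\<lambda>y. R (y, snd z) * U j (y, snd z)) (fst z))"
definition dM :: "nat \<Rightarrow> 'n \<Rightarrow> (real^'n) \<times> real \<Rightarrow> real" where
  "dM n i z = (\<Sum>j\<in>UNIV. conv (dker n j) (\<lambda>y. \<tau> i j (y, snd z)) (fst z))"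

lemma RM_meas [measurable]: "Rn n \<in> borel_measurable borel" "Mn n i \<in> borel_measurable borel"
  "dR n \<in> borel_measurable borel" "dM n i \<in> borel_measurable borel"
proof -
  have k: "(ker n :: real^'n \<Rightarrow> real) \<in> borel_measurable borel" "(dker n j :: real^'n \<Rightarrow> real) \<in> borel_measurable borel" for j
    by (intro borel_cont ker_cont dker_facts)+
  have t: "\<tau> i j \<in> borel_measurable borel" "(\<lambda>z. R z * U j z) \<in> borel_measurable borel" for i j by measurable
  show "Rn n \<in> borel_measurable borel" unfolding Rn_def[abs_def] by (rule conv_joint_measurable[OF k(1) R_meas])
  show "Mn n i \<in> borel_measurable borel" unfolding Mn_def[abs_def] by (rule conv_joint_measurable[OF k(1) t(2)])
  show "dR n \<in> borel_measurable borel" unfolding dR_def[abs_def]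
    by (intro borel_measurable_uminus borel_measurable_sum conv_joint_measurable[OF k(2) t(2)])
  show "dM n i \<in> borel_measurable borel" unfolding dM_def[abs_def]
    by (intro borel_measurable_sum conv_joint_measurable[OF k(2) t(1)])
qed

lemma rate_slices: "integrable (tm T) (\<lambda>s. dR n (x, s))" "integrable (tm T) (\<lambda>s. dM n i (x, s))"
  unfolding dR_def dM_def
  by (auto intro!: conv_slices[OF dker_facts] sqint_integrable sqint_RU sqint_\<tau>)

lemma Rn_bounds: "c1 \<le> Rn n z" "Rn n z \<le> c2"
proof -
  interpret mass_density "\<lambda>y. R (y, snd z)" c1 c2
    by unfold_locales (use slice_measurable[OF R_meas] R_lower R_upper c1_pos in auto)
  show "c1 \<le> Rn n z" "Rn n z \<le> c2" unfolding Rn_def by (rule R_bounds)+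
qed

text \<open>An integrable function of time that, up to a constant, majorises the rates of the
  averaged fields uniformly in \<open>x\<close>.\<close>

definition H :: "real \<Rightarrow> real" where
  "H s = (\<Sum>j\<in>UNIV. (LINT x|torus. \<bar>R (x, s) * U j (x, s)\<bar>)) + (\<Sum>i\<in>UNIV. \<Sum>j\<in>UNIV. (LINT x|torus. \<bar>\<tau> i j (x, s)\<bar>))"

lemma H_int: "integrable (tm T) H"
proof -
  have "integrable (tm T) (\<lambda>s. (LINT x|torus. \<bar>R (x, s) * U j (x, s)\<bar>))" for j
    using st_slices(2)[of T "\<lambda>z. \<bar>R z * U j z\<bar>"] integrable_abs[OF sqint_integrable[OF sqint_RU]] by simp
  moreover have "integrable (tm T) (\<lambda>s. (LINT x|torus. \<bar>\<tau> i j (x, s)\<bar>))" for i j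
    using st_slices(2)[of T "\<lambda>z. \<bar>\<tau> i j z\<bar>"] integrable_abs[OF sqint_integrable[OF sqint_\<tau>]] by simp
  ultimately show ?thesis unfolding H_def[abs_def] by simp
qed

text \<open>The constant depends on \<open>n\<close>, since bounds for \<open>dker n\<close> enter;
  uniformity in \<open>n\<close> is gained only after integration over space, in
  \<open>rate_dominated\<close>.\<close>

lemma rate_bounds:
  "\<exists>K\<ge>0. AE s in tm T. \<forall>x. \<bar>dR n (x, s)\<bar> \<le> K * H s \<and> (\<forall>i. \<bar>dM n i (x, s)\<bar> \<le> K * H s) \<and> (\<forall>i. \<bar>Mn n i (x, s)\<bar> \<le> K)"
proof -
  have "\<exists>B. \<forall>y. \<bar>dker n j (y::real^'n)\<bar> \<le> B" for j using periodic_bounded[OF dker_facts] by metis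
  then obtain B where B: "\<And>j y. \<bar>dker n j (y::real^'n)\<bar> \<le> B j" by metis
  obtain BK where BK: "0 \<le> BK" "\<And>y::real^'n. \<bar>ker n y\<bar> \<le> BK" using periodic_bounded[OF ker_cont ker_periodic] by metis
  have B0: "0 \<le> B j" for j using B[of j 0] by linarith
  define K1 where "K1 = (\<Sum>j\<in>UNIV. B j)"
  have K1: "0 \<le> K1" "\<And>j. B j \<le> K1"
    unfolding K1_def by (auto intro: sum_nonneg member_le_sum simp: B0)
  define K where "K = K1 + BK * (c2 * (1 + \<bar>C0\<bar>))"
  have c20: "0 \<le> c2" using c1_pos c12 by linarith
  have K: "0 \<le> K" "K1 \<le> K" "BK * (c2 * (1 + \<bar>C0\<bar>)) \<le> K" unfolding K_def using K1 BK c20 by auto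
  have RU: "AE s in tm T. \<forall>j\<in>UNIV. L2 (\<lambda>x. R (x, s) * U j (x, s))"
    by (rule AE_finite_allI) (auto intro: sqint_slice[OF sqint_RU])
  have Us: "AE s in tm T. \<forall>j\<in>UNIV. L2 (\<lambda>x. U j (x, s))"
    by (rule AE_finite_allI) (auto intro: sqint_slice[OF sqint_U])
  have TT: "AE s in tm T. \<forall>i\<in>UNIV. \<forall>j\<in>UNIV. L2 (\<lambda>x. \<tau> i j (x, s))"
    by (intro AE_finite_allI) (auto intro: sqint_slice[OF sqint_\<tau>])
  have "AE s in tm T. \<forall>x. \<bar>dR n (x, s)\<bar> \<le> K * H s \<and> (\<forall>i. \<bar>dM n i (x, s)\<bar> \<le> K * H s) \<and> (\<forall>i. \<bar>Mn n i (x, s)\<bar> \<le> K)"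
    using RU Us TT U_Linf
  proof eventually_elim
    case (elim s)
    have n1: "0 \<le> (LINT x|torus. \<bar>R (x, s) * U j (x, s)\<bar>)" for j by (rule integral_nonneg_AE) auto
    have n2: "0 \<le> (LINT x|torus. \<bar>\<tau> i j (x, s)\<bar>)" for i j by (rule integral_nonneg_AE) auto
    have s1: "(\<Sum>j\<in>UNIV. (LINT x|torus. \<bar>R (x, s) * U j (x, s)\<bar>)) \<le> H s"
      unfolding H_def using n2 by (simp add: sum_nonneg)
    have s2: "(\<Sum>j\<in>UNIV. (LINT x|torus. \<bar>\<tau> i j (x, s)\<bar>)) \<le> H s" for i
    proof -
      have "(\<Sum>j\<in>UNIV. (LINT x|torus. \<bar>\<tau> i j (x, s)\<bar>)) \<le> (\<Sum>i\<in>UNIV. \<Sum>j\<in>UNIV. (LINT x|torus. \<bar>\<tau> i j (x, s)\<bar>))"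
        by (rule member_le_sum) (auto intro!: sum_nonneg n2)
      moreover have "0 \<le> (\<Sum>j\<in>UNIV. (LINT x|torus. \<bar>R (x, s) * U j (x, s)\<bar>))" by (intro sum_nonneg n1)
      ultimately show ?thesis unfolding H_def by linarith
    qed
    have H0: "0 \<le> H s" unfolding H_def by (intro add_nonneg_nonneg sum_nonneg n1 n2)
    have KH: "K1 * H s \<le> K * H s" using K(2) H0 by (rule mult_right_mono)
    show ?case
    proof (intro allI conjI)
      fix x
      have "\<bar>dR n (x, s)\<bar> \<le> (\<Sum>j\<in>UNIV. \<bar>conv (dker n j) (\<lambda>y. R (y, s) * U j (y, s)) x\<bar>)"
        unfolding dR_def by simp
      also have "\<dots> \<le> (\<Sum>j\<in>UNIV. K1 * (LINT x|torus. \<bar>R (x, s) * U j (x, s)\<bar>))"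
        by (intro sum_mono conv_abs_le dker_facts L2_integrable order_trans[OF B K1(2)]) (use elim in auto)
      also have "\<dots> \<le> K1 * H s" unfolding sum_distrib_left[symmetric] by (intro mult_left_mono s1 K1)
      finally show "\<bar>dR n (x, s)\<bar> \<le> K * H s" using KH by linarith
      fix i
      have "\<bar>dM n i (x, s)\<bar> \<le> (\<Sum>j\<in>UNIV. \<bar>conv (dker n j) (\<lambda>y. \<tau> i j (y, s)) x\<bar>)"
        unfolding dM_def by simp
      also have "\<dots> \<le> (\<Sum>j\<in>UNIV. K1 * (LINT x|torus. \<bar>\<tau> i j (x, s)\<bar>))"
        by (intro sum_mono conv_abs_le dker_facts L2_integrable order_trans[OF B K1(2)]) (use elim in auto)
      also have "\<dots> \<le> K1 * H s" unfolding sum_distrib_left[symmetric] by (intro mult_left_mono s2 K1)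
      finally show "\<bar>dM n i (x, s)\<bar> \<le> K * H s" using KH by linarith
      have "\<bar>Mn n i (x, s)\<bar> \<le> BK * (LINT y|torus. \<bar>R (y, s) * U i (y, s)\<bar>)"
        unfolding Mn_def using elim by (auto intro!: conv_abs_le ker_cont ker_periodic L2_integrable BK)
      also have "\<dots> \<le> BK * (c2 * (1 + \<bar>C0\<bar>))"
      proof (rule mult_left_mono[OF _ BK(1)])
        have iU: "integrable torus (\<lambda>x. (U j (x, s))\<^sup>2)" for j using elim(2) L2_sq by blast
        have "(LINT y|torus. \<bar>R (y, s) * U i (y, s)\<bar>) \<le> (LINT y|torus. c2 * (1 + (\<Sum>j\<in>UNIV. (U j (y, s))\<^sup>2)))"
        proof (rule integral_mono)
          show "integrable torus (\<lambda>y. \<bar>R (y, s) * U i (y, s)\<bar>)" using L2_integrable[OF bspec[OF elim(1) UNIV_I], of i] by (rule integrable_abs)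
          show "integrable torus (\<lambda>y. c2 * (1 + (\<Sum>j\<in>UNIV. (U j (y, s))\<^sup>2)))" using iU by simp
          fix y
          have "\<bar>U i (y, s)\<bar> \<le> 1 + (U i (y, s))\<^sup>2"
            using sum_squares_bound[of 1 "\<bar>U i (y, s)\<bar>"] by simp
          also have "(U i (y, s))\<^sup>2 \<le> (\<Sum>j\<in>UNIV. (U j (y, s))\<^sup>2)" by (rule member_le_sum) auto
          finally show "\<bar>R (y, s) * U i (y, s)\<bar> \<le> c2 * (1 + (\<Sum>j\<in>UNIV. (U j (y, s))\<^sup>2))"
            unfolding abs_mult using R_abs c20 by (intro mult_mono) auto
        qed
        also have "\<dots> = c2 * (1 + integral\<^sup>L torus (\<lambda>y. \<Sum>j\<in>UNIV. (U j (y, s))\<^sup>2))"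
          using iU by (simp add: measure_def prob_space_torus)
        also have "\<dots> \<le> c2 * (1 + \<bar>C0\<bar>)" using elim(4) c20 by (intro mult_left_mono) auto
        finally show "(LINT y|torus. \<bar>R (y, s) * U i (y, s)\<bar>) \<le> c2 * (1 + \<bar>C0\<bar>)" .
      qed
      finally show "\<bar>Mn n i (x, s)\<bar> \<le> K" using K(3) by linarith
    qed
  qed
  then show ?thesis using K(1) by blast
qed

text \<open>The gradient of the energy density in \<open>En\<close>, taken in the variables density
  and momentum, applied to the rates \<open>dR\<close> and \<open>dM\<close>.\<close>

definition W :: "nat \<Rightarrow> (real^'n) \<times> real \<Rightarrow> real" where
  "W n z = (P' (Rn n z) - (\<Sum>i\<in>UNIV. (Mn n i z)\<^sup>2) / (2 * (Rn n z)\<^sup>2)) * dR n z + (\<Sum>i\<in>UNIV. Mn n i z / Rn n z * dM n i z)"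

definition En :: "nat \<Rightarrow> (real^'n) \<times> real \<Rightarrow> real" where
  "En n z = (\<Sum>i\<in>UNIV. (Mn n i z)\<^sup>2) / (2 * Rn n z) + Ppot p (Rn n z)"

lemma comp_Rn: "continuous_on {0<..} f \<Longrightarrow> (\<lambda>z. f (Rn n z)) \<in> borel_measurable borel" for f :: "real \<Rightarrow> real"
proof -
  assume f: "continuous_on {0<..} f"
  have eq: "f (Rn n z) = f (max c1 (min c2 (Rn n z)))" for z using clamp_id[OF Rn_bounds, of n z] by simp
  have "(\<lambda>x. f (max c1 (min c2 x))) \<in> borel_measurable borel"
    by (rule borel_measurable_continuous_onI[OF continuous_clamp[OF f c1_pos]])
  from measurable_compose[OF RM_meas(1)[of n] this] show ?thesis by (simp add: eq[symmetric])
qed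

lemma Ppot_cont: "continuous_on {0<..} (Ppot p)"
  using Ppot_has_deriv by (auto intro!: continuous_at_imp_continuous_on DERIV_isCont)

lemma W_meas [measurable]: "W n \<in> borel_measurable borel" and En_meas [measurable]: "En n \<in> borel_measurable borel"
proof -
  note comp_Rn[OF P'_cont, measurable] comp_Rn[OF Ppot_cont, measurable]
  show "W n \<in> borel_measurable borel" unfolding W_def[abs_def] by measurable
  show "En n \<in> borel_measurable borel" unfolding En_def[abs_def] by measurable
qed

lemma W_bound: "\<exists>K. AE s in tm T. \<forall>x. \<bar>W n (x, s)\<bar> \<le> K * H s"
proof -
  obtain K where K: "0 \<le> K" and ae: "AE s in tm T. \<forall>x. \<bar>dR n (x, s)\<bar> \<le> K * H s \<and> (\<forall>i. \<bar>dM n i (x, s)\<bar> \<le> K * H s) \<and> (\<forall>i. \<bar>Mn n i (x, s)\<bar> \<le> K)"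
    using rate_bounds by blast
  obtain B where B: "0 \<le> B" "\<And>x. \<bar>P' (max c1 (min c2 x))\<bar> \<le> B" using bounded_clamp[OF P'_cont c1_pos c12] by blast
  have PB: "\<bar>P' (Rn n z)\<bar> \<le> B" for z using B(2)[of "Rn n z"] clamp_id[OF Rn_bounds, of n z] by simp
  define d where "d = real CARD('n)"
  define K2 where "K2 = (B + d * K\<^sup>2 / (2 * c1\<^sup>2)) * K + d * (K / c1 * K)"
  have "AE s in tm T. \<forall>x::real^'n. \<bar>W n (x, s)\<bar> \<le> K2 * H s"
    using ae
  proof eventually_elim
    case (elim s)
    show ?case
    proof
      fix x :: "real^'n"
      let ?z = "(x, s)"
      have r: "c1 \<le> Rn n ?z" by (rule Rn_bounds)
      have KH: "0 \<le> K * H s" using elim abs_ge_zero order_trans by blast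
      have M2: "(\<Sum>i\<in>UNIV. (Mn n i ?z)\<^sup>2) \<le> d * K\<^sup>2"
      proof -
        have "(Mn n i ?z)\<^sup>2 \<le> K\<^sup>2" for i using power_mono[of "\<bar>Mn n i ?z\<bar>" K 2] elim by simp
        then have "(\<Sum>i\<in>UNIV. (Mn n i ?z)\<^sup>2) \<le> (\<Sum>i\<in>(UNIV::'n set). K\<^sup>2)" by (intro sum_mono)
        then show ?thesis by (simp add: d_def)
      qed
      have 1: "(\<Sum>i\<in>UNIV. (Mn n i ?z)\<^sup>2) / (2 * (Rn n ?z)\<^sup>2) \<le> d * K\<^sup>2 / (2 * c1\<^sup>2)"
        using r c1_pos M2 by (intro frac_le mult_left_mono power_mono) (auto simp: d_def)
      have 0: "0 \<le> (\<Sum>i\<in>UNIV. (Mn n i ?z)\<^sup>2) / (2 * (Rn n ?z)\<^sup>2)" by (intro divide_nonneg_nonneg sum_nonneg) auto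
      have a: "\<bar>P' (Rn n ?z) - (\<Sum>i\<in>UNIV. (Mn n i ?z)\<^sup>2) / (2 * (Rn n ?z)\<^sup>2)\<bar> \<le> B + d * K\<^sup>2 / (2 * c1\<^sup>2)"
        using PB[of ?z] 0 1 by linarith
      have b: "\<bar>\<Sum>i\<in>UNIV. Mn n i ?z / Rn n ?z * dM n i ?z\<bar> \<le> d * (K / c1 * (K * H s))"
      proof -
        have "\<bar>Mn n i ?z / Rn n ?z * dM n i ?z\<bar> \<le> K / c1 * (K * H s)" for i
          unfolding abs_mult abs_divide using elim r c1_pos K by (intro mult_mono frac_le) auto
        then have "\<bar>\<Sum>i\<in>UNIV. Mn n i ?z / Rn n ?z * dM n i ?z\<bar> \<le> (\<Sum>i\<in>(UNIV::'n set). K / c1 * (K * H s))"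
          by (intro order_trans[OF sum_abs] sum_mono)
        then show ?thesis by (simp add: d_def)
      qed
      have "\<bar>W n ?z\<bar> \<le> \<bar>(P' (Rn n ?z) - (\<Sum>i\<in>UNIV. (Mn n i ?z)\<^sup>2) / (2 * (Rn n ?z)\<^sup>2)) * dR n ?z\<bar> + \<bar>\<Sum>i\<in>UNIV. Mn n i ?z / Rn n ?z * dM n i ?z\<bar>"
        unfolding W_def by (rule abs_triangle_ineq)
      also have "\<dots> \<le> (B + d * K\<^sup>2 / (2 * c1\<^sup>2)) * (K * H s) + d * (K / c1 * (K * H s))"
        unfolding abs_mult using a b elim by (intro add_mono mult_mono order_trans[OF abs_ge_zero a]) auto
      finally show "\<bar>W n ?z\<bar> \<le> K2 * H s" by (simp add: K2_def algebra_simps)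
    qed
  qed
  then show ?thesis by blast
qed

text \<open>The majorant of \<open>W_bound\<close> is independent of \<open>x\<close>, so the
  iterated integral of the norm is bounded and Fubini's criterion applies.\<close>

lemma W_int: "integrable (st T) (W n)" "integrable (tm T) (\<lambda>s. W n (x, s))"
proof -
  interpret Q: pair_sigma_finite "torus :: (real^'n) measure" "tm T" by (rule pair_st)
  obtain K where K: "AE s in tm T. \<forall>x. \<bar>W n (x, s)\<bar> \<le> K * H s" using W_bound by blast
  have m: "(\<lambda>s. W n (x, s)) \<in> borel_measurable (tm T)" for x
    using measurable_compose[OF _ W_meas, of "\<lambda>s. (x, s)" borel n] borel_measurable_Pair by simp
  show i: "integrable (tm T) (\<lambda>s. W n (x, s))" for x
  proof (rule Bochner_Integration.integrable_bound[OF _ m])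
    show "integrable (tm T) (\<lambda>s. K * H s)" using H_int by simp
    show "AE s in tm T. norm (W n (x, s)) \<le> norm (K * H s)" using K by eventually_elim (auto intro: order_trans[OF _ abs_ge_self])
  qed
  show "integrable (st T) (W n)"
  proof (rule Q.Fubini_integrable)
    show "W n \<in> borel_measurable (st T)" by (rule st_meas) measurable
    have "(\<lambda>x. (LINT s|tm T. norm (W n (x, s)))) \<in> borel_measurable torus"
    proof -
      have "(\<lambda>z. norm (W n z)) \<in> borel_measurable (st T)" by (intro st_meas) measurable
      then have "(\<lambda>(x, s). norm (W n (x, s))) \<in> borel_measurable (st T)" by (simp add: case_prod_beta')
      then show ?thesis
        by (rule sigma_finite_measure.borel_measurable_lebesgue_integral[OF finite_measure.axioms(1)[OF finite_measure_tm]])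
    qed
    then show "integrable torus (\<lambda>x. (LINT s|tm T. norm (W n (x, s))))"
    proof (rule torus.integrable_const_bound[rotated, where B = "(LINT s|tm T. K * H s)"])
      show "AE x in torus. norm (LINT s|tm T. norm (W n (x, s))) \<le> (LINT s|tm T. K * H s)"
      proof (rule AE_I2)
        fix x
        have "0 \<le> (LINT s|tm T. norm (W n (x, s)))" by (rule integral_nonneg_AE) auto
        moreover have "(LINT s|tm T. norm (W n (x, s))) \<le> (LINT s|tm T. K * H s)"
          by (rule integral_mono_AE) (use i H_int K in \<open>auto elim!: eventually_mono\<close>)
        ultimately show "norm (LINT s|tm T. norm (W n (x, s))) \<le> (LINT s|tm T. K * H s)" by simp
      qed
    qed
    show "AE x in torus. integrable (tm T) (\<lambda>s. W n (x, s))" using i by simp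
  qed
qed

lemma W_balance: "AE s in tm T. \<forall>n. (LINT x|torus. W n (x, s))
   = flow_slice.balance (\<lambda>x. R (x, s)) (\<lambda>i x. U i (x, s)) (\<lambda>i j x. \<sigma> i j (x, s)) pc n"
  using AE_slices
proof eventually_elim
  case (elim s)
  interpret F: flow_slice "\<lambda>x. R (x, s)" c1 c2 "\<lambda>i x. U i (x, s)" "\<lambda>i j x. D i j (x, s)" "\<lambda>i j x. \<sigma> i j (x, s)" pc Lp Pm
    by (rule elim)
  show ?case
  proof
    fix n
    have Pp: "z * P' z - Ppot p z = pc z" if "c1 \<le> z" "z \<le> c2" for z
      using that P_legendre[of z] c1_pos by (simp add: pc_def)
    show "(LINT x|torus. W n (x, s)) = F.balance n"
    proof (rule trans[OF _ F.balance_identity[OF Ppot_has_deriv P'_cont Pp]])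
      show "(LINT x|torus. W n (x, s)) = (LINT x|torus. (P' (S n (\<lambda>x. R (x, s)) x) - (\<Sum>i\<in>UNIV. (F.V n (\<lambda>x. U i (x, s)) x)\<^sup>2) / 2) *
        - (\<Sum>j\<in>UNIV. conv (dker n j) (\<lambda>z. R (z, s) * U j (z, s)) x) +
        (\<Sum>i\<in>UNIV. F.V n (\<lambda>x. U i (x, s)) x * (\<Sum>j\<in>UNIV. conv (dker n j) (\<lambda>z. \<sigma> i j (z, s) - R (z, s) * (U i (z, s) * U j (z, s))) x)))"
    proof (rule Bochner_Integration.integral_cong[OF refl])
      fix x
      have r: "Rn n (x, s) \<noteq> 0" using Rn_bounds(1)[of n "(x, s)"] c1_pos by linarith
      have V: "F.V n (\<lambda>x. U i (x, s)) x = Mn n i (x, s) / Rn n (x, s)" for i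
        by (simp add: F.V_def Mn_def Rn_def)
      show "W n (x, s) = (P' (S n (\<lambda>x. R (x, s)) x) - (\<Sum>i\<in>UNIV. (F.V n (\<lambda>x. U i (x, s)) x)\<^sup>2) / 2) *
        - (\<Sum>j\<in>UNIV. conv (dker n j) (\<lambda>z. R (z, s) * U j (z, s)) x) +
        (\<Sum>i\<in>UNIV. F.V n (\<lambda>x. U i (x, s)) x * (\<Sum>j\<in>UNIV. conv (dker n j) (\<lambda>z. \<sigma> i j (z, s) - R (z, s) * (U i (z, s) * U j (z, s))) x))"
        unfolding V by (simp add: W_def dR_def dM_def Rn_def power_divide sum_divide_distrib[symmetric])
    qed
    qed
  qed
qed

definition E0 :: "nat \<Rightarrow> real^'n \<Rightarrow> real" where
  "E0 n x = (\<Sum>i\<in>UNIV. (S n (\<lambda>z. r0 z * v0 i z) x)\<^sup>2) / (2 * S n r0 x) + Ppot p (S n r0 x)"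

text \<open>For fixed \<open>x\<close> the averaged density and momentum form an absolutely
  continuous curve in the half-space of positive density, where the energy density is
  differentiable, and \<open>AC_chain_rule\<close> applies.\<close>

lemma energy_curve:
  "AE t in tm T. En n (x, t) = E0 n x + (LINT s|tm t. W n (x, s))"
proof -
  define Rt where "Rt s = S n r0 x + integral {0..s} (\<lambda>s. dR n (x, s))" for s
  define Mt :: "real \<Rightarrow> real^'n" where "Mt s = (\<chi> i. S n (\<lambda>z. r0 z * v0 i z) x + integral {0..s} (\<lambda>s. dM n i (x, s)))" for s
  define f where "f s = (Rt s, Mt s)" for s
  define g :: "real \<Rightarrow> real \<times> (real^'n)" where "g s = (dR n (x, s), \<chi> i. dM n i (x, s))" for s
  define f0 :: "real \<times> (real^'n)" where "f0 = (S n r0 x, \<chi> i. S n (\<lambda>z. r0 z * v0 i z) x)"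
  define \<Phi> :: "real \<times> (real^'n) \<Rightarrow> real" where "\<Phi> z = (snd z \<bullet> snd z) / (2 * fst z) + Ppot p (fst z)" for z
  define G :: "real \<times> (real^'n) \<Rightarrow> real \<times> (real^'n)" where
    "G z = (P' (fst z) - (snd z \<bullet> snd z) / (2 * (fst z)\<^sup>2), (1 / fst z) *\<^sub>R snd z)" for z
  have aeR: "AE t in tm T. Rn n (x, t) = Rt t"
    using mass[of n x] unfolding Rt_def Rn_def dR_def by simp
  have "AE t in tm T. \<forall>i\<in>UNIV. Mn n i (x, t) = Mt t $ i"
    by (rule AE_finite_allI) (use momentum[of n _ x] in \<open>simp_all add: Mt_def Mn_def dM_def\<close>)
  then have aeM: "AE t in tm T. (\<chi> i. Mn n i (x, t)) = Mt t"
    by eventually_elim (simp add: vec_eq_iff)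
  have iR: "(\<lambda>s. dR n (x, s)) absolutely_integrable_on {0..t}" if "t \<le> T" for t
    using tm_absolutely_integrable(1)[OF rate_slices(1) that] .
  have iM: "(\<lambda>s. dM n i (x, s)) absolutely_integrable_on {0..t}" if "t \<le> T" for t i
    using tm_absolutely_integrable(1)[OF rate_slices(2) that] .
  have iMv: "(\<lambda>s. (\<chi> i. dM n i (x, s)) :: real^'n) absolutely_integrable_on {0..t}" if "t \<le> T" for t
  proof (rule absolutely_integrable_componentwise)
    fix b :: "real^'n" assume "b \<in> Basis"
    then obtain i where "b = axis i 1" by (auto simp: Basis_vec_def)
    then show "(\<lambda>s. (\<chi> i. dM n i (x, s)) \<bullet> b) absolutely_integrable_on {0..t}"
      using iM[OF that, of i] by (simp add: inner_axis)
  qed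
  have cR: "continuous_on {0..T} Rt"
    unfolding Rt_def
    by (intro continuous_intros indefinite_integral_continuous_1 set_lebesgue_integral_eq_integral(1)[OF iR]) simp
  \<comment> \<open>\<open>Rt\<close> agrees with \<open>Rn\<close> for almost all times only;
    continuity carries the lower bound to every time, as the chain rule requires.\<close>
  have Rpos: "0 < Rt t" if "t \<in> {0..T}" for t
  proof -
    have "AE t in tm T. c1 \<le> Rt t \<and> Rt t \<le> c2"
      using aeR by eventually_elim (metis Rn_bounds)
    from AE_ge_continuous(1)[OF T_pos cR this that] show ?thesis using c1_pos by linarith
  qed
  have id: "integral {0..t} (\<lambda>s. (\<chi> i. dM n i (x, s)) :: real^'n) = (\<chi> i. integral {0..t} (\<lambda>s. dM n i (x, s)))" if "t \<le> T" for t
  proof -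
    have "integral {0..t} (\<lambda>s. (\<chi> i. dM n i (x, s)) :: real^'n) $ i = integral {0..t} (\<lambda>s. dM n i (x, s))" for i
    proof -
      have "((\<lambda>s. (\<chi> i. dM n i (x, s)) $ i) has_integral (integral {0..t} (\<lambda>s. (\<chi> i. dM n i (x, s)) :: real^'n) $ i)) {0..t}"
        using has_integral_linear[OF integrable_integral[OF set_lebesgue_integral_eq_integral(1)[OF iMv[OF that]]] bounded_linear_vec_nth, of i]
        by (simp add: o_def)
      then show ?thesis by (simp add: integral_unique)
    qed
    then show ?thesis by (simp add: vec_eq_iff)
  qed
  have chain: "\<Phi> (f t) = \<Phi> f0 + integral {0..t} (\<lambda>s. G (f s) \<bullet> g s)" if t: "0 < t" "t < T" for t
  proof (rule AC_chain_rule(2)[where U = "{z :: real \<times> (real^'n). 0 < fst z}"])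
    show "g absolutely_integrable_on {0..t}"
      unfolding g_def[abs_def] using t by (intro absolutely_integrable_Pair(1) iR iMv) auto
    show "f s = f0 + integral {0..s} g" if "s \<in> {0..t}" for s
    proof -
      have sT: "s \<le> T" using that t by simp
      have "integral {0..s} g = (integral {0..s} (\<lambda>s. dR n (x, s)), integral {0..s} (\<lambda>s. \<chi> i. dM n i (x, s)))"
        unfolding g_def[abs_def] by (rule absolutely_integrable_Pair(2)[OF iR[OF sT] iMv[OF sT] order_refl])
      then show ?thesis by (simp add: f_def f0_def Rt_def Mt_def id[OF sT] plus_vec_def)
    qed
    show "convex {z :: real \<times> (real^'n). 0 < fst z}"
      using convex_Times[OF convex_real_interval(3)[of 0] convex_UNIV]
      by (rule back_subst[of convex]) (auto simp: mem_Times_iff)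
    show "f s \<in> {z. 0 < fst z}" if "s \<in> {0..t}" for s using Rpos[of s] that t by (simp add: f_def)
    show "(\<Phi> has_derivative (\<lambda>h. G z \<bullet> h)) (at z)" if "z \<in> {z. 0 < fst z}" for z
    proof -
      have z: "fst z \<noteq> 0" "0 < fst z" using that by auto
      have "((\<lambda>z. Ppot p (fst z)) has_derivative (\<lambda>h. fst h * P' (fst z))) (at z)"
        by (rule DERIV_compose_FDERIV[where g = fst and x = z, OF Ppot_has_deriv[OF z(2)]]) (intro derivative_intros)
      then have "(\<Phi> has_derivative (\<lambda>h. ((snd z \<bullet> snd h + snd h \<bullet> snd z) * (2 * fst z) - (snd z \<bullet> snd z) * (2 * fst h)) / ((2 * fst z) * (2 * fst z))
            + fst h * P' (fst z))) (at z)"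
        unfolding \<Phi>_def[abs_def] using z by (auto intro!: derivative_eq_intros)
      moreover have "((snd z \<bullet> snd h + snd h \<bullet> snd z) * (2 * fst z) - (snd z \<bullet> snd z) * (2 * fst h)) / ((2 * fst z) * (2 * fst z))
            + fst h * P' (fst z) = G z \<bullet> h" for h
        using z(1) by (simp add: G_def inner_prod_def inner_commute field_simps power2_eq_square)
      ultimately show ?thesis by simp
    qed
    show "continuous_on {z. 0 < fst z} G"
      unfolding G_def[abs_def]
      by (intro continuous_intros continuous_on_compose2[OF P'_cont]) auto
  qed (use t in simp)
  have rate: "AE s in tm T. G (f s) \<bullet> g s = W n (x, s)"
    using aeR aeM
  proof eventually_elim
    case (elim s)
    then have "f s = (Rn n (x, s), \<chi> i. Mn n i (x, s))" by (simp add: f_def)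
    then show ?case
      by (simp add: G_def g_def W_def inner_prod_def inner_vec_def power2_eq_square sum_distrib_left)
  qed
  \<comment> \<open>\<open>G (f s)\<close> is built from the continuous representatives
    \<open>Rt\<close> and \<open>Mt\<close>, \<open>W\<close> from the averages themselves; they
    agree off a null set of times.\<close>
  have spike: "integral {0..t} (\<lambda>s. G (f s) \<bullet> g s) = (LINT s|tm t. W n (x, s))" if t: "0 < t" "t < T" for t
  proof -
    from rate[unfolded AE_tm] obtain N where N: "N \<in> null_sets lborel"
      "\<And>s. s \<notin> N \<Longrightarrow> s \<in> {0<..<T} \<Longrightarrow> G (f s) \<bullet> g s = W n (x, s)"
      unfolding eventually_ae_filter by auto
    have "negligible N" using N(1) by (simp add: negligible_iff_null_sets null_sets_completionI)
    then have "negligible (insert 0 N)" by simp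
    then have "integral {0..t} (\<lambda>s. G (f s) \<bullet> g s) = integral {0..t} (\<lambda>s. W n (x, s))"
      by (rule integral_spike) (use t N(2) in auto)
    also have "\<dots> = (LINT s|tm t. W n (x, s))"
      using tm_absolutely_integrable(2)[OF W_int(2), of t] t by simp
    finally show ?thesis .
  qed
  have "AE t in tm T. t \<in> {0<..<T}" by (simp add: AE_tm)
  then show ?thesis using aeR aeM
  proof eventually_elim
    case (elim t)
    have "\<Phi> (f t) = En n (x, t)"
      unfolding \<Phi>_def f_def elim(2,3)[symmetric] by (simp add: En_def inner_vec_def power2_eq_square)
    moreover have "\<Phi> f0 = E0 n x" by (simp add: \<Phi>_def f0_def E0_def inner_vec_def power2_eq_square)
    ultimately show ?case using chain[of t] spike[of t] elim(1) by simp
  qed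
qed

lemma E0_int: "integrable torus (E0 n)"
proof -
  interpret F: mass_density r0 c1 c2 by (rule r0_density)
  have pR: "pd j (S n r0) (conv (dker n j) r0)" for j by (rule F.pd_S[OF F.r_int])
  have pM: "pd j (S n (\<lambda>z. r0 z * v0 i z)) (conv (dker n j) (\<lambda>z. r0 z * v0 i z))" for i j
    by (rule F.pd_S[OF L2_integrable[OF F.rw_L2[OF v0_L2]]])
  have c: "continuous_on UNIV (\<lambda>x. Ppot p (S n r0 x))"
    by (rule continuous_on_compose2[OF Ppot_cont pd_cont(1)[OF pR]]) (use F.R_pos in auto)
  show ?thesis
  proof (rule integrable_torus_periodic)
    show "continuous_on UNIV (E0 n)"
      unfolding E0_def[abs_def] by (intro continuous_intros c pd_cont(1)[OF pR] pd_cont(1)[OF pM]) (use F.R_pos in auto)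
    show "periodic_sp (E0 n)"
      using pd_periodic[OF pR] pd_periodic[OF pM] by (simp add: periodic_sp_def E0_def)
  qed
qed

definition rate :: "nat \<Rightarrow> real \<Rightarrow> real" where
  "rate n s = (LINT x|torus. W n (x, s))"

text \<open>Integrates \<open>energy_curve\<close> over space. The integral up to \<open>t\<close>
  is written with an indicator over a fixed time measure, so that the right-hand side is jointly
  measurable in \<open>(x, t)\<close> and \<open>AE_st_swap\<close> applies.\<close>

lemma energy_identity_regularized:
  "AE t in tm T. \<forall>n. (LINT x|torus. En n (x, t))
     = integral\<^sup>L torus (E0 n) + (LINT s|tm T. indicator {..<t} s * rate n s)"
proof (subst AE_all_countable, rule allI)
  fix n
  interpret Q: pair_sigma_finite "torus :: (real^'n) measure" "tm T" by (rule pair_st)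
  define Y where "Y t z = indicat_real {..<t} (snd z) * W n z" for t z
  define G :: "(real^'n) \<times> real \<Rightarrow> real" where "G z = E0 n (fst z) + (LINT s|tm T. Y (snd z) (fst z, s))" for z
  have iY: "integrable (st T) (Y t)" for t
    unfolding Y_def[abs_def]
  proof (rule st_mult_bounded[OF W_int(1), where B = 1])
    have "(snd :: (real^'n) \<times> real \<Rightarrow> real) \<in> borel_measurable borel"
      by (intro borel_measurable_continuous_onI continuous_intros)
    then show "(\<lambda>z :: (real^'n) \<times> real. indicat_real {..<t} (snd z)) \<in> borel_measurable borel"
      using measurable_compose[of snd borel borel "indicat_real {..<t}" borel] by simp
  qed (simp add: indicator_def)
  have [measurable]: "E0 n \<in> borel_measurable borel" using borel_measurable_integrable[OF E0_int] by simp
  have fs[measurable]: "fst \<in> borel_measurable (borel :: ((real^'n) \<times> real) measure)"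
      "snd \<in> borel_measurable (borel :: ((real^'n) \<times> real) measure)"
    by (intro borel_measurable_continuous_onI continuous_intros)+
  have G [measurable]: "G \<in> borel_measurable borel"
  proof -
    let ?M = "(borel :: ((real^'n) \<times> real) measure) \<Otimes>\<^sub>M tm T"
    have sn: "snd \<in> ?M \<rightarrow>\<^sub>M borel" using measurable_snd[of "borel :: ((real^'n) \<times> real) measure" "tm T"] by simp
    have f: "(\<lambda>w. snd (fst w)) \<in> ?M \<rightarrow>\<^sub>M borel" "(\<lambda>w. fst (fst w)) \<in> ?M \<rightarrow>\<^sub>M borel"
      by (rule measurable_compose[OF measurable_fst fs(2)], rule measurable_compose[OF measurable_fst fs(1)])
    have m1: "(\<lambda>w. W n (fst (fst w), snd w)) \<in> borel_measurable ?M"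
      by (rule measurable_compose[OF borel_measurable_Pair[OF f(2) sn] W_meas])
    have m2: "(\<lambda>w. indicat_real {..<snd (fst w)} (snd w)) \<in> borel_measurable ?M"
    proof -
      have "Measurable.pred ?M (\<lambda>w. snd w < snd (fst w))" using sn f(1) by measurable
      then have "(\<lambda>w. if snd w < snd (fst w) then 1 else 0 :: real) \<in> borel_measurable ?M" by measurable
      then show ?thesis by (simp add: indicator_def of_bool_def)
    qed
    have "(\<lambda>(z, s). Y (snd z) (fst z, s)) \<in> borel_measurable ?M"
      unfolding Y_def using borel_measurable_times[OF m2 m1] by (simp add: case_prod_beta')
    from sigma_finite_measure.borel_measurable_lebesgue_integral[OF finite_measure.axioms(1)[OF finite_measure_tm] this]
    have [measurable]: "(\<lambda>z. (LINT s|tm T. Y (snd z) (fst z, s))) \<in> borel_measurable (borel :: ((real^'n) \<times> real) measure)" .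
    show ?thesis unfolding G_def[abs_def] by measurable
  qed
  have "AE t in tm T. En n (x, t) = G (x, t)" for x
  proof -
    have "AE t in tm T. t \<in> {0<..<T}" by (simp add: AE_tm)
    then show ?thesis using energy_curve[of n x]
    proof eventually_elim
      case (elim t)
      have m: "(\<lambda>s. W n (x, s)) \<in> borel_measurable borel" using borel_measurable_integrable[OF W_int(2)] by simp
      have "(LINT s|tm t. W n (x, s)) = (LINT s|tm T. indicator {..<t} s * W n (x, s))"
        using elim(1) m by (subst (1 2) integral_tm) (auto intro!: Bochner_Integration.integral_cong simp: indicator_def)
      then show ?case using elim(2) by (simp add: G_def Y_def)
    qed
  qed
  from AE_st_swap[OF En_meas G this]
  show "AE t in tm T. (LINT x|torus. En n (x, t))
     = integral\<^sup>L torus (E0 n) + (LINT s|tm T. indicator {..<t} s * rate n s)"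
  proof eventually_elim
    case (elim t)
    have iY': "integrable (st T) (\<lambda>(x, s). Y t (x, s))" using iY by simp
    have "(LINT x|torus. En n (x, t)) = (LINT x|torus. G (x, t))"
      by (rule integral_cong_AE) (use elim slice_measurable[OF En_meas] slice_measurable[OF G] in auto)
    also have "\<dots> = integral\<^sup>L torus (E0 n) + (LINT x|torus. (LINT s|tm T. Y t (x, s)))"
      unfolding G_def using E0_int Q.integrable_fst[OF iY'] by simp
    also have "(LINT x|torus. (LINT s|tm T. Y t (x, s))) = (LINT s|tm T. (LINT x|torus. Y t (x, s)))"
      using Q.Fubini_integral[OF iY'] by simp
    finally show ?case by (simp add: Y_def rate_def)
  qed
qed

section \<open>Dissipation and the limit of the energy rates\<close>

definition dissipation :: "(real^'n) \<times> real \<Rightarrow> real" where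
  "dissipation z = \<nu> (R z) * (\<Sum>i\<in>UNIV. \<Sum>j\<in>UNIV. ((D i j z + D j i z) / 2)\<^sup>2) + \<mu> (R z) * (\<Sum>k\<in>UNIV. D k k z)\<^sup>2"

text \<open>A symmetric tensor sees only the symmetric part of the gradient: adding the sum to its
  transpose produces the squares. The pressure inside \<open>\<sigma>\<close> cancels the second
  sum.\<close>

lemma stress_power:
  "(\<Sum>i\<in>UNIV. \<Sum>j\<in>UNIV. \<sigma> i j z * D i j z) + (\<Sum>i\<in>UNIV. p (R z) * D i i z) = dissipation z"
proof -
  define s where "s = (\<Sum>i\<in>UNIV. \<Sum>j\<in>UNIV. ((D i j z + D j i z) / 2) * D i j z)"
  have s': "s = (\<Sum>i\<in>UNIV. \<Sum>j\<in>UNIV. ((D i j z + D j i z) / 2) * D j i z)"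
    unfolding s_def by (subst sum.swap) (simp add: add.commute)
  have "s + s = (\<Sum>i\<in>UNIV. \<Sum>j\<in>UNIV. ((D i j z + D j i z) / 2) * D i j z + ((D i j z + D j i z) / 2) * D j i z)"
    by (subst (2) s') (simp only: s_def sum.distrib)
  also have "\<dots> = (\<Sum>i\<in>UNIV. \<Sum>j\<in>UNIV. 2 * ((D i j z + D j i z) / 2)\<^sup>2)"
    by (intro sum.cong refl) (simp add: power2_eq_square field_simps)
  finally have "s + s = (\<Sum>i\<in>UNIV. \<Sum>j\<in>UNIV. 2 * ((D i j z + D j i z) / 2)\<^sup>2)" .
  then have s: "s = (\<Sum>i\<in>UNIV. \<Sum>j\<in>UNIV. ((D i j z + D j i z) / 2)\<^sup>2)"
    by (simp add: sum_distrib_left[symmetric])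
  have "(\<Sum>i\<in>UNIV. \<Sum>j\<in>UNIV. \<sigma> i j z * D i j z) = (\<Sum>i\<in>UNIV. \<Sum>j\<in>UNIV. \<nu> (R z) * (((D i j z + D j i z) / 2) * D i j z)
      + (if i = j then (\<mu> (R z) * (\<Sum>k\<in>UNIV. D k k z) - p (R z)) * D i j z else 0))"
    by (intro sum.cong refl) (simp add: stress_def distrib_right mult.assoc)
  also have "\<dots> = \<nu> (R z) * s + (\<Sum>i\<in>UNIV. (\<mu> (R z) * (\<Sum>k\<in>UNIV. D k k z) - p (R z)) * D i i z)"
    by (simp add: s_def sum.distrib sum_distrib_left)
  also have "(\<Sum>i\<in>UNIV. (\<mu> (R z) * (\<Sum>k\<in>UNIV. D k k z) - p (R z)) * D i i z)
      = (\<mu> (R z) * (\<Sum>k\<in>UNIV. D k k z) - p (R z)) * (\<Sum>i\<in>UNIV. D i i z)" by (simp only: sum_distrib_left)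
  finally show ?thesis
    unfolding dissipation_def s by (simp add: sum_distrib_left[symmetric] algebra_simps power2_eq_square)
qed

lemma dissipation_int: "integrable (st T) dissipation"
  unfolding stress_power[symmetric, abs_def]
  by (intro Bochner_Integration.integrable_add Bochner_Integration.integrable_sum sqint_mult sqint_\<sigma> sqint_D sqint_p)

lemma rate_tendsto: "AE s in tm T. (\<lambda>n. rate n s) \<longlonglongrightarrow> - (LINT x|torus. dissipation (x, s))"
  using AE_slices W_balance
proof eventually_elim
  case (elim s)
  interpret F: flow_slice "\<lambda>x. R (x, s)" c1 c2 "\<lambda>i x. U i (x, s)" "\<lambda>i j x. D i j (x, s)" "\<lambda>i j x. \<sigma> i j (x, s)" pc Lp Pm
    by (rule elim)
  have pc: "pc (R z) = p (R z)" for z unfolding pc_def using clamp_id[OF R_lower R_upper] by simp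
  have i1: "integrable torus (\<lambda>x. \<sigma> i j (x, s) * D i j (x, s))" for i j by (rule L2_mult(1)[OF F.sg_L2 F.g_L2])
  have i2: "integrable torus (\<lambda>x. pc (R (x, s)) * D i i (x, s))" for i by (rule L2_mult(1)[OF F.compose_R(2)[OF Lp] F.g_L2])
  have "- (\<Sum>i\<in>UNIV. \<Sum>j\<in>UNIV. (LINT x|torus. \<sigma> i j (x, s) * D i j (x, s))) - (\<Sum>i\<in>UNIV. (LINT x|torus. pc (R (x, s)) * D i i (x, s)))
     = - (LINT x|torus. (\<Sum>i\<in>UNIV. \<Sum>j\<in>UNIV. \<sigma> i j (x, s) * D i j (x, s)) + (\<Sum>i\<in>UNIV. pc (R (x, s)) * D i i (x, s)))"
    using i1 i2 by simp
  also have "\<dots> = - (LINT x|torus. dissipation (x, s))"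
    unfolding pc stress_power ..
  finally show ?case
    using F.balance_tendsto elim(2) by (simp add: rate_def)
qed

text \<open>\<open>balance_bound\<close> on each slice. Its variable terms are squared
  \<open>L2\<close> norms of slices of fields that are square integrable in space-time; for the
  squared speed \<open>Q\<close> this is the \<open>L4\<close> bound on the velocity.\<close>

lemma rate_dominated: "\<exists>w. integrable (tm T) w \<and> (AE s in tm T. \<forall>n. \<bar>rate n s\<bar> \<le> w s)"
proof -
  define KB where "KB = (c2 / c1)\<^sup>2 * (pi\<^sup>2 * real CARD('n))"
  define sq where "sq f s = (LINT x|torus. (f (x, s))\<^sup>2)" for f :: "(real^'n) \<times> real \<Rightarrow> real" and s
  define Q where "Q z = (\<Sum>i\<in>UNIV. (U i z)\<^sup>2)" for z
  define w where "w s = (\<Sum>i\<in>UNIV. \<Sum>j\<in>UNIV. sq (\<sigma> i j) s + 4 * c2\<^sup>2 * sq Q s + KB * (\<Sum>k\<in>UNIV. sq (D i k) s))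
     + (\<Sum>i\<in>UNIV. Pm\<^sup>2 + KB * (\<Sum>k\<in>UNIV. sq (D i k) s))" for s
  have "sqint Q" unfolding sqint_def Q_def[abs_def] using q_int by simp
  moreover have "integrable (tm T) (sq f)" if "sqint f" for f
    using st_slices(2)[of T "\<lambda>z. (f z)\<^sup>2"] that unfolding sq_def[abs_def] by (simp add: sqint_def)
  ultimately have i: "integrable (tm T) (sq Q)" "integrable (tm T) (sq (\<sigma> i j))" "integrable (tm T) (sq (D i j))" for i j
    using sqint_\<sigma> sqint_D by auto
  have "integrable (tm T) w"
    unfolding w_def[abs_def]
    by (intro Bochner_Integration.integrable_add Bochner_Integration.integrable_sum integrable_mult_right i
        finite_measure.integrable_const[OF finite_measure_tm])
  moreover have "AE s in tm T. \<forall>n. \<bar>rate n s\<bar> \<le> w s"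
    using AE_slices W_balance
  proof eventually_elim
    case (elim s)
    interpret F: flow_slice "\<lambda>x. R (x, s)" c1 c2 "\<lambda>i x. U i (x, s)" "\<lambda>i j x. D i j (x, s)" "\<lambda>i j x. \<sigma> i j (x, s)" pc Lp Pm
      by (rule elim)
    show ?case
      using F.balance_bound elim(2) unfolding rate_def w_def sq_def Q_def KB_def F.CB_def l2_sq F.q_def by simp
  qed
  ultimately show ?thesis by blast
qed

lemma rate_integral_tendsto:
  "(\<lambda>n. (LINT s|tm T. indicator {..<t} s * rate n s))
     \<longlonglongrightarrow> - (LINT z|st T. indicator {..<t} (snd z) * dissipation z)"
proof -
  obtain w where w: "integrable (tm T) w" "AE s in tm T. \<forall>n. \<bar>rate n s\<bar> \<le> w s" using rate_dominated by blast
  have m [measurable]: "rate n \<in> borel_measurable borel" for n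
    using borel_measurable_integrable[OF st_slices(2)[OF W_int(1), of n]] by (simp add: rate_def[abs_def])
  have [measurable]: "(\<lambda>s. (LINT x|torus. dissipation (x, s))) \<in> borel_measurable borel"
    using borel_measurable_integrable[OF st_slices(2)[OF dissipation_int]] by simp
  have "(\<lambda>n. (LINT s|tm T. indicator {..<t} s * rate n s))
     \<longlonglongrightarrow> (LINT s|tm T. indicator {..<t} s * - (LINT x|torus. dissipation (x, s)))"
  proof (rule integral_dominated_convergence[where w = w])
    show "AE s in tm T. (\<lambda>n. indicator {..<t} s * rate n s) \<longlonglongrightarrow> indicator {..<t} s * - (LINT x|torus. dissipation (x, s))"
      using rate_tendsto by eventually_elim (intro tendsto_intros)
    show "AE s in tm T. norm (indicator {..<t} s * rate n s) \<le> w s" for n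
      using w(2) by eventually_elim (auto simp: indicator_def intro: order_trans[OF abs_ge_zero])
  qed (use w in measurable)
  moreover have "(LINT z|st T. indicator {..<t} (snd z) * dissipation z)
    = (LINT s|tm T. indicator {..<t} s * (LINT x|torus. dissipation (x, s)))"
  proof -
    have "(snd :: (real^'n) \<times> real \<Rightarrow> real) \<in> borel_measurable borel"
      by (intro borel_measurable_continuous_onI continuous_intros)
    then have "(\<lambda>z :: (real^'n) \<times> real. indicat_real {..<t} (snd z)) \<in> borel_measurable borel"
      using measurable_compose[of snd borel borel "indicat_real {..<t}" borel] by simp
    from st_slices(3)[OF st_mult_bounded[OF dissipation_int this, of 1]] show ?thesis
      by (simp add: indicator_def)
  qed
  ultimately show ?thesis by simp
qed

text \<open>\<open>energy_tendsto\<close> serves both at time \<open>t\<close> and for the initial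
  data, and the rates converge under the time integral; uniqueness of limits compares the
  outcomes.\<close>

theorem energy_equality:
  "AE t in tm T. (LINT x|torus. (\<Sum>i\<in>UNIV. U i (x, t) * (R (x, t) * U i (x, t))) / 2 + Ppot p (R (x, t)))
     + (LINT z|st T. indicator {..<t} (snd z) * dissipation z)
   = (LINT x|torus. (\<Sum>i\<in>UNIV. v0 i x * (r0 x * v0 i x)) / 2 + Ppot p (r0 x))"
proof -
  \<comment> \<open>\<open>energy_tendsto\<close> wants a globally Lipschitz potential; the clamped
    one agrees with \<open>Ppot p\<close> at all densities that occur.\<close>
  define Pc where "Pc z = Ppot p (max c1 (min c2 z))" for z
  obtain L where L: "\<And>a b. \<bar>Pc a - Pc b\<bar> \<le> L * \<bar>a - b\<bar>"
    using Lipschitz_clamp[OF c1_pos c12 Ppot_has_deriv P'_cont] unfolding Pc_def by metis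
  have lim: "(\<lambda>n. (LINT x|torus. (\<Sum>i\<in>UNIV. (S n (\<lambda>z. r z * v i z) x)\<^sup>2) / (2 * S n r x) + Ppot p (S n r x)))
      \<longlonglongrightarrow> (LINT x|torus. (\<Sum>i\<in>UNIV. v i x * (r x * v i x)) / 2 + Ppot p (r x))"
    if "mass_density r c1 c2" and v: "\<And>i. L2 (v i)" for r :: "real^'n \<Rightarrow> real" and v :: "'n \<Rightarrow> real^'n \<Rightarrow> real"
  proof -
    interpret F: mass_density r c1 c2 by (rule that(1))
    have 1: "Pc (r x) = Ppot p (r x)" "Pc (S n r x) = Ppot p (S n r x)" for x n
      unfolding Pc_def using clamp_id[OF F.r_lower F.r_upper] clamp_id[OF F.R_bounds] by simp_all
    have 2: "(\<Sum>i\<in>UNIV. F.V n (v i) x * S n (\<lambda>x. r x * v i x) x) / 2 = (\<Sum>i\<in>UNIV. (S n (\<lambda>z. r z * v i z) x)\<^sup>2) / (2 * S n r x)" for n x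
      by (simp add: F.V_def sum_divide_distrib power2_eq_square mult.commute[of _ 2])
    show ?thesis using F.energy_tendsto[of v, OF v L] unfolding 1 2 .
  qed
  have lim0: "(\<lambda>n. integral\<^sup>L torus (E0 n)) \<longlonglongrightarrow> (LINT x|torus. (\<Sum>i\<in>UNIV. v0 i x * (r0 x * v0 i x)) / 2 + Ppot p (r0 x))"
    using lim[of r0 v0, OF r0_density v0_L2] unfolding E0_def .
  show ?thesis using AE_slices energy_identity_regularized
  proof eventually_elim
    case (elim t)
    interpret F: flow_slice "\<lambda>x. R (x, t)" c1 c2 "\<lambda>i x. U i (x, t)" "\<lambda>i j x. D i j (x, t)" "\<lambda>i j x. \<sigma> i j (x, t)" pc Lp Pm
      by (rule elim)
    have "(\<lambda>n. (LINT x|torus. En n (x, t))) \<longlonglongrightarrow> (LINT x|torus. (\<Sum>i\<in>UNIV. U i (x, t) * (R (x, t) * U i (x, t))) / 2 + Ppot p (R (x, t)))"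
      using lim[of _ "\<lambda>i x. U i (x, t)", OF F.mass_density_axioms F.u_L2] unfolding En_def Mn_def Rn_def by simp
    moreover have "(\<lambda>n. (LINT x|torus. En n (x, t))) \<longlonglongrightarrow> (LINT x|torus. (\<Sum>i\<in>UNIV. v0 i x * (r0 x * v0 i x)) / 2 + Ppot p (r0 x))
        + - (LINT z|st T. indicator {..<t} (snd z) * dissipation z)"
      using tendsto_add[OF lim0 rate_integral_tendsto] elim(2) by simp
    ultimately show ?case using LIMSEQ_unique by fastforce
  qed
qed

end

section \<open>Borel versions and test functions\<close>

abbreviation lb :: "'a::euclidean_space set \<Rightarrow> 'a measure" where
  "lb E \<equiv> density lborel (indicator E)"

lemma AE_lb: "E \<in> sets borel \<Longrightarrow> (AE x in lb E. P x) \<longleftrightarrow> (AE x in lborel. x \<in> E \<longrightarrow> P x)"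
  by (subst AE_density) (auto simp: indicator_def)

lemma AE_lebesgue_on: "E \<in> sets borel \<Longrightarrow> (AE x in lebesgue_on E. P x) \<longleftrightarrow> (AE x in lb E. P x)"
  by (simp add: AE_restrict_space_iff AE_completion_iff AE_lb)

text \<open>Lebesgue measure is complete, so agreement almost everywhere with the Borel function
  \<open>g\<close> already makes \<open>f\<close> measurable.\<close>

lemma lebesgue_on_transfer:
  fixes f g :: "'a::euclidean_space \<Rightarrow> real"
  assumes E: "E \<in> sets borel" and g: "g \<in> borel_measurable borel" and ae: "AE x in lb E. f x = g x"
  shows "integral\<^sup>L (lebesgue_on E) f = integral\<^sup>L (lb E) g"
    and "integrable (lebesgue_on E) f \<longleftrightarrow> integrable (lb E) g"
proof -
  define h k where "h x = indicat_real E x * f x" and "k x = indicat_real E x * g x" for x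
  have k: "k \<in> borel_measurable borel" unfolding k_def[abs_def] using E g by measurable
  then have kl: "k \<in> borel_measurable lborel" by simp
  have kL: "k \<in> borel_measurable lebesgue" using measurable_completion[OF kl] .
  have hk: "AE x in lborel. h x = k x"
    using ae unfolding AE_lb[OF E] by eventually_elim (auto simp: h_def k_def indicator_def)
  have hkL: "AE x in lebesgue. h x = k x" using hk by (rule AE_completion)
  have hL: "h \<in> borel_measurable lebesgue"
  proof (rule measurableI)
    fix A :: "real set" assume A: "A \<in> sets borel"
    have "AE x in lebesgue. x \<in> k -` A \<inter> space lebesgue \<longleftrightarrow> x \<in> h -` A \<inter> space lebesgue"
      using hkL by eventually_elim simp
    then show "h -` A \<inter> space lebesgue \<in> sets lebesgue"
      by (rule completion.in_sets_AE) (use measurable_sets[OF kL A] in auto)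
  qed simp
  have EL: "E \<inter> space lebesgue \<in> sets lebesgue" using E by auto
  have "integral\<^sup>L (lebesgue_on E) f = integral\<^sup>L lebesgue h"
    using integral_restrict_space[OF EL, of f] by (simp add: h_def[abs_def])
  also have "\<dots> = integral\<^sup>L lebesgue k" by (rule integral_cong_AE[OF hL kL hkL])
  also have "\<dots> = integral\<^sup>L lborel k" by (rule integral_completion[OF kl])
  also have "\<dots> = integral\<^sup>L (lb E) g"
    using integral_density[of g lborel "indicat_real E"] E g by (simp add: k_def[abs_def] ennreal_indicator)
  finally show "integral\<^sup>L (lebesgue_on E) f = integral\<^sup>L (lb E) g" .
  have "integrable (lebesgue_on E) f \<longleftrightarrow> integrable lebesgue h"
    using integrable_restrict_space[OF EL, of f] by (simp add: h_def[abs_def])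
  also have "\<dots> \<longleftrightarrow> integrable lebesgue k" by (rule integrable_cong_AE[OF hL kL hkL])
  also have "\<dots> \<longleftrightarrow> integrable lborel k" by (rule integrable_completion[OF kl])
  also have "\<dots> \<longleftrightarrow> integrable (lb E) g"
    using integrable_density[of g lborel "indicat_real E"] E g by (simp add: k_def[abs_def] ennreal_indicator)
  finally show "integrable (lebesgue_on E) f \<longleftrightarrow> integrable (lb E) g" .
qed

lemma nn_integral_lebesgue_on:
  fixes f g :: "'a::euclidean_space \<Rightarrow> ennreal"
  assumes E: "E \<in> sets borel" and g: "g \<in> borel_measurable borel" and ae: "AE x in lb E. f x = g x"
  shows "(\<integral>\<^sup>+x. f x \<partial>lebesgue_on E) = (\<integral>\<^sup>+x. g x \<partial>lb E)"
proof -
  have EL: "E \<inter> space lebesgue \<in> sets lebesgue" using E by auto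
  have "(\<integral>\<^sup>+x. f x \<partial>lebesgue_on E) = (\<integral>\<^sup>+x. f x * indicator E x \<partial>lborel)"
    by (subst nn_integral_restrict_space[OF EL]) (simp add: nn_integral_completion)
  also have "\<dots> = (\<integral>\<^sup>+x. indicator E x * g x \<partial>lborel)"
    using ae unfolding AE_lb[OF E] by (intro nn_integral_cong_AE, eventually_elim) (auto simp: indicator_def)
  also have "\<dots> = (\<integral>\<^sup>+x. g x \<partial>lb E)" using E g by (simp add: nn_integral_density)
  finally show ?thesis .
qed

lemma borel_version:
  fixes f :: "'a::euclidean_space \<Rightarrow> real"
  assumes E: "E \<in> sets borel" and f: "f \<in> borel_measurable (lebesgue_on E)"
  obtains g where "g \<in> borel_measurable borel" "AE x in lb E. f x = g x"
proof -
  have "(\<lambda>x. indicat_real E x * f x) \<in> borel_measurable lebesgue"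
    using f E borel_measurable_restrict_space_iff[of E lebesgue f] by simp
  from completion_ex_borel_measurable_real[OF this] obtain g where
    "g \<in> borel_measurable lborel" "AE x in lborel. indicat_real E x * f x = g x" by blast
  then show ?thesis
    by (intro that[of g]) (auto simp: AE_lb[OF E] elim!: eventually_mono)
qed

lemma borel_version_vec:
  fixes f :: "'a::euclidean_space \<Rightarrow> real^'n"
  assumes E: "E \<in> sets borel" and f: "f \<in> borel_measurable (lebesgue_on E)"
  obtains g where "\<And>i. g i \<in> borel_measurable borel" "AE x in lb E. \<forall>i. f x $ i = g i x"
proof -
  have "\<exists>g. g \<in> borel_measurable borel \<and> (AE x in lb E. f x $ i = g x)" for i
  proof -
    have "(\<lambda>x. f x \<bullet> axis i 1) \<in> borel_measurable (lebesgue_on E)" using f by measurable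
    then have m: "(\<lambda>x. f x $ i) \<in> borel_measurable (lebesgue_on E)" by (simp add: inner_axis)
    obtain g where "g \<in> borel_measurable borel" "AE x in lb E. f x $ i = g x"
      by (rule borel_version[OF E m])
    then show ?thesis by (intro exI[of _ g] conjI)
  qed
  then have "\<exists>g. \<forall>i. g i \<in> borel_measurable borel \<and> (AE x in lb E. f x $ i = g i x)"
    by (intro choice allI)
  then obtain g where g: "\<And>i. g i \<in> borel_measurable borel" "\<And>i. AE x in lb E. f x $ i = g i x" by blast
  have "AE x in lb E. \<forall>i\<in>UNIV. f x $ i = g i x" by (rule AE_finite_allI) (use g in auto)
  then show ?thesis by (intro that[of g] g) simp
qed

lemma borel_version_mat:
  fixes f :: "'a::euclidean_space \<Rightarrow> real^'n^'m"
  assumes E: "E \<in> sets borel" and f: "f \<in> borel_measurable (lebesgue_on E)"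
  obtains g where "\<And>i j. g i j \<in> borel_measurable borel" "AE x in lb E. \<forall>i j. f x $ i $ j = g i j x"
proof -
  have "\<exists>g. (\<forall>j. g j \<in> borel_measurable borel) \<and> (AE x in lb E. \<forall>j. f x $ i $ j = g j x)" for i
  proof -
    have m: "(\<lambda>x. f x $ i) \<in> borel_measurable (lebesgue_on E)"
      by (rule measurable_compose[OF f]) (intro borel_measurable_continuous_onI continuous_intros)
    obtain g where "\<And>j. g j \<in> borel_measurable borel" "AE x in lb E. \<forall>j. f x $ i $ j = g j x"
      by (rule borel_version_vec[OF E m]) (rule that, auto)
    then show ?thesis by (intro exI[of _ g] conjI allI)
  qed
  then have "\<exists>g. \<forall>i. (\<forall>j. g i j \<in> borel_measurable borel) \<and> (AE x in lb E. \<forall>j. f x $ i $ j = g i j x)"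
    by (intro choice allI)
  then obtain g where g: "\<And>i j. g i j \<in> borel_measurable borel" "\<And>i. AE x in lb E. \<forall>j. f x $ i $ j = g i j x" by blast
  have "AE x in lb E. \<forall>i\<in>UNIV. \<forall>j. f x $ i $ j = g i j x" by (rule AE_finite_allI) (use g in auto)
  then show ?thesis by (intro that[of g] g) simp
qed

lemma cyl_borel: "(cyl a b :: ((real^'n) \<times> real) set) \<in> sets borel"
proof -
  have "(cyl a b :: ((real^'n) \<times> real) set) \<in> sets (borel \<Otimes>\<^sub>M borel)"
    unfolding cyl_def by (rule pair_measureI) auto
  then show ?thesis unfolding borel_prod .
qed

lemma st_density: "(st T :: ((real^'n::finite) \<times> real) measure) = lb (cyl 0 T)"
proof -
  have "(st T :: ((real^'n) \<times> real) measure) = density (lborel \<Otimes>\<^sub>M lborel) (\<lambda>(x, y). indicator cell x * indicator {0<..<T} y)"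
    unfolding torus_def tm_def
    by (rule pair_measure_density)
       (auto simp: sigma_finite_lborel finite_measure.axioms(1)[OF finite_measure_tm[unfolded tm_def]])
  also have "\<dots> = lb (cyl 0 T)"
  proof -
    have "(\<lambda>(x, y). indicator cell x * indicator {0<..<T} y) = (indicator (cyl 0 T) :: (real^'n) \<times> real \<Rightarrow> ennreal)"
      by (auto simp: cyl_def indicator_def fun_eq_iff)
    then show ?thesis unfolding lborel_prod by (rule arg_cong)
  qed
  finally show ?thesis .
qed

text \<open>The predicate \<open>P\<close> may fail to be measurable, so the quantifiers are
  exchanged for a measurable null set that contains its exceptions.\<close>

lemma st_AE_slices:
  fixes P :: "(real^'n::finite) \<times> real \<Rightarrow> bool"
  assumes "AE z in st T. P z"
  shows "AE t in tm T. AE x in torus. P (x, t)"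
proof -
  interpret Q: pair_sigma_finite "torus :: (real^'n) measure" "tm T" by (rule pair_st)
  obtain N where N: "N \<in> null_sets (st T)" "\<And>z. z \<notin> N \<Longrightarrow> P z"
    using assms unfolding eventually_ae_filter by (auto simp: space_pair_measure)
  have "AE z in st T. z \<notin> N" using N(1) by (rule AE_not_in)
  then have "AE x in torus. AE t in tm T. (x, t) \<notin> N"
    by (rule Q.AE_pair)
  moreover have "{z \<in> space (st T). (fst z, snd z) \<notin> N} \<in> sets (st T)"
  proof -
    have "space (st T) - N \<in> sets (st T)" using N(1) by (intro sets.compl_sets) auto
    moreover have "{z \<in> space (st T). (fst z, snd z) \<notin> N} = space (st T) - N" by auto
    ultimately show ?thesis by simp
  qed
  ultimately have "AE t in tm T. AE x in torus. (x, t) \<notin> N"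
    using Q.AE_commute[of "\<lambda>x t. (x, t) \<notin> N"] by blast
  then show ?thesis
    by eventually_elim (use N(2) in \<open>auto elim!: eventually_mono\<close>)
qed

section \<open>The kernel as a test function\<close>

lemma smooth_ker:
  fixes l :: "'a::euclidean_space \<Rightarrow> real^'n::finite"
  assumes l: "bounded_linear l"
  shows "smooth (\<lambda>w. ker n (x - l w))"
proof -
  have s: "smooth (\<lambda>w. csq (- (l w $ i) + x $ i))" for i
    by (rule smooth_compose[OF smooth_csq]) (intro bounded_linear_minus bounded_linear_compose[OF bounded_linear_vec_nth l])
  have "smooth (\<lambda>w. (\<Prod>i\<in>UNIV. csq (- (l w $ i) + x $ i) ^ Suc n) * (1 / kmass TYPE('n) n))"
    by (intro smooth_intros(1,3) smooth_prod smooth_power s)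
  then show ?thesis by (simp add: ker_def ker0_def)
qed

lemma int_vec_minus: "int_vec v \<Longrightarrow> int_vec (- v)"
  by (simp add: int_vec_def)

lemma ker_sp_test: "sp_test_fun (\<lambda>y. ker n ((x::real^'n::finite) - y))"
  unfolding sp_test_fun_def
proof
  show "smooth_fun (\<lambda>y. ker n (x - y))"
    by (intro smooth_fun_smooth smooth_ker bounded_linear_ident)
  show "periodic_sp (\<lambda>y. ker n (x - y))"
    unfolding periodic_sp_def
  proof (intro allI impI)
    fix y v :: "real^'n" assume "int_vec v"
    then have "ker n ((x - y) + (- v)) = ker n (x - y)"
      using ker_periodic[of n] int_vec_minus[of v] unfolding periodic_sp_def by blast
    then show "ker n (x - (y + v)) = ker n (x - y)" by (simp add: algebra_simps)
  qed
qed

text \<open>Inserted into the weak formulation, this product evaluates averages at the point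
  \<open>x\<close> and so turns an equation tested in space-time into one for functions of
  time.\<close>

definition ktest :: "nat \<Rightarrow> real^'n::finite \<Rightarrow> (real \<Rightarrow> real) \<Rightarrow> (real^'n) \<times> real \<Rightarrow> real" where
  "ktest n x \<theta> w = ker n (x - fst w) * \<theta> (snd w)"

lemma ktest_test:
  assumes \<theta>: "tfun T \<theta>"
  shows "test_fun T (ktest n x \<theta>)"
  unfolding test_fun_def
proof (intro conjI)
  have "smooth (\<lambda>w. \<theta> (snd w + 0))"
    using \<theta> by (intro smooth_compose bounded_linear_snd) (simp add: tfun_def)
  then have "smooth (\<lambda>w. ker n (x - fst w) * \<theta> (snd w))"
    by (intro smooth_intros(3) smooth_ker bounded_linear_fst) simp
  then show "smooth_fun (ktest n x \<theta>)" unfolding ktest_def[abs_def] by (rule smooth_fun_smooth)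
  show "periodic_st (ktest n x \<theta>)"
    using ker_sp_test[of n x] by (auto simp: sp_test_fun_def periodic_sp_def periodic_st_def ktest_def)
  show "\<exists>a b. 0 < a \<and> a < b \<and> b < T \<and> (\<forall>y t. t \<notin> {a..b} \<longrightarrow> ktest n x \<theta> (y, t) = 0)"
    using \<theta> unfolding tfun_def ktest_def by fastforce
qed

lemma ktest_dt:
  assumes "\<And>t. (\<theta> has_real_derivative \<theta>' t) (at t)"
  shows "dt (ktest n x \<theta>) z = ker n (x - fst z) * \<theta>' (snd z)"
  unfolding dt_def ktest_def by (rule DERIV_imp_deriv) (auto intro!: derivative_eq_intros assms)

lemma ktest_dx: "dx j (ktest n x \<theta>) z = - dker n j (x - fst z) * \<theta> (snd z)"
proof -
  \<comment> \<open>Written at \<open>- 0\<close> to match the inner function \<open>uminus\<close>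
    in the chain rule, which produces the minus sign of the result.\<close>
  have d: "((\<lambda>s. ker n ((x - fst z) + s *\<^sub>R axis j 1)) has_real_derivative dker n j (x - fst z)) (at (- 0))"
    using pd_ker[of j n] by (simp add: pd_def)
  have "((\<lambda>r. ker n ((x - fst z) + (- r) *\<^sub>R axis j 1)) has_real_derivative dker n j (x - fst z) * - 1) (at 0)"
    by (rule DERIV_chain2[where g = uminus, OF d]) (auto intro!: derivative_eq_intros)
  then have "((\<lambda>r. ker n (x - (fst z + r *\<^sub>R axis j 1))) has_real_derivative - dker n j (x - fst z)) (at 0)"
    by (simp add: algebra_simps)
  from DERIV_cmult_right[OF this, of "\<theta> (snd z)"]
  show ?thesis unfolding dx_def ktest_def by (simp add: DERIV_imp_deriv)
qed

text \<open>Tests one component at a time, so that each component of the momentum equation takes the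
  same scalar form as the mass equation.\<close>

definition vtest :: "'n \<Rightarrow> ((real^'n::finite) \<times> real \<Rightarrow> real) \<Rightarrow> (real^'n) \<times> real \<Rightarrow> real^'n" where
  "vtest i \<phi> z = axis i (\<phi> z)"

lemma vtest_nth: "vtest i \<phi> z $ k = (if k = i then \<phi> z else 0)"
  by (simp add: vtest_def axis_def)

lemma vtest_comp: "(\<lambda>w. vtest i \<phi> w $ k) = (if k = i then \<phi> else (\<lambda>w. 0))"
  by (auto simp: vtest_nth)

lemma test_fun_zero: "0 < T \<Longrightarrow> test_fun T (\<lambda>w :: (real^'n::finite) \<times> real. 0)"
  unfolding test_fun_def by (intro conjI smooth_fun_smooth smooth_intros(1) exI[of _ "T/3"] exI[of _ "T/2"]) (simp_all add: periodic_st_def)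

lemma vtest_test: "0 < T \<Longrightarrow> test_fun T \<phi> \<Longrightarrow> vtest_fun T (vtest i \<phi>)"
  unfolding vtest_fun_def vtest_comp using test_fun_zero by auto

lemma dt_dx_zero [simp]: "dt (\<lambda>w. 0) z = 0" "dx j (\<lambda>w. 0) z = 0"
  by (auto simp: dt_def dx_def intro!: DERIV_imp_deriv)

lemma vtest_derivs:
  "v \<bullet> vdt (vtest i \<phi>) z = v $ i * dt \<phi> z"
  "frob A (jac (vtest i \<phi>) z) = (\<Sum>j\<in>UNIV. A $ i $ j * dx j \<phi> z)"
  "dvg (vtest i \<phi>) z = dx i \<phi> z"
proof -
  have a: "vdt (vtest i \<phi>) z $ k = (if k = i then dt \<phi> z else 0)" for k
    unfolding vdt_def vtest_comp by simp
  have b: "jac (vtest i \<phi>) z $ k $ j = (if k = i then dx j \<phi> z else 0)" for k j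
    unfolding jac_def vtest_comp by simp
  show "v \<bullet> vdt (vtest i \<phi>) z = v $ i * dt \<phi> z" by (simp add: inner_vec_def a if_distrib cong: if_cong)
  have "frob A (jac (vtest i \<phi>) z) = (\<Sum>k\<in>UNIV. if k = i then (\<Sum>j\<in>UNIV. A $ k $ j * dx j \<phi> z) else 0)"
    unfolding frob_def b by (intro sum.cong) auto
  then show "frob A (jac (vtest i \<phi>) z) = (\<Sum>j\<in>UNIV. A $ i $ j * dx j \<phi> z)" by simp
  have "dvg (vtest i \<phi>) z = (\<Sum>k\<in>UNIV. if k = i then dx i \<phi> z else 0)"
    unfolding dvg_def vtest_comp by (intro sum.cong) auto
  then show "dvg (vtest i \<phi>) z = dx i \<phi> z" by simp
qed

section \<open>From weak solutions to the energy equality\<close>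

text \<open>Supplies times tending to 0 at which an almost everywhere statement holds; used for the
  initial momentum.\<close>

lemma AE_tm_small:
  assumes T: "0 < T" and P: "AE t in tm T. P t" and e: "0 < e"
  shows "\<exists>t. 0 < t \<and> t < T \<and> t < e \<and> P t"
proof (rule ccontr)
  assume n: "\<not> ?thesis"
  have "AE t in lborel. t \<notin> {0<..<min T e}"
    using P unfolding AE_tm by eventually_elim (use n in auto)
  then have "{0<..<min T e} \<in> null_sets lborel" by (subst AE_iff_null_sets) auto
  then show False using T e by (auto simp: null_sets_def)
qed

text \<open>Phrased with nonnegative integrals because square integrability of the limit is the
  outcome sought.\<close>

lemma Fatou_squares:
  fixes f :: "real^'n::finite \<Rightarrow> real"
  assumes [measurable]: "\<And>k. F k \<in> borel_measurable borel" "f \<in> borel_measurable borel"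
    and lim: "AE x in torus. (\<lambda>k. F k x) \<longlonglongrightarrow> f x"
    and le: "\<And>k. (\<integral>\<^sup>+x. ennreal ((F k x)\<^sup>2) \<partial>torus) \<le> C"
  shows "(\<integral>\<^sup>+x. ennreal ((f x)\<^sup>2) \<partial>torus) \<le> C"
proof -
  have "(\<integral>\<^sup>+x. ennreal ((f x)\<^sup>2) \<partial>torus) = (\<integral>\<^sup>+x. liminf (\<lambda>k. ennreal ((F k x)\<^sup>2)) \<partial>torus)"
  proof (rule nn_integral_cong_AE)
    show "AE x in torus. ennreal ((f x)\<^sup>2) = liminf (\<lambda>k. ennreal ((F k x)\<^sup>2))"
      using lim
    proof eventually_elim
      case (elim x)
      have "(\<lambda>k. ennreal ((F k x)\<^sup>2)) \<longlonglongrightarrow> ennreal ((f x)\<^sup>2)"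
        by (intro tendsto_ennrealI tendsto_power elim)
      then show ?case using lim_imp_Liminf[OF sequentially_bot] by metis
    qed
  qed
  also have "\<dots> \<le> liminf (\<lambda>k. \<integral>\<^sup>+x. ennreal ((F k x)\<^sup>2) \<partial>torus)"
    by (rule nn_integral_liminf) simp
  also have "\<dots> \<le> C"
    by (rule order_trans[OF Liminf_le_Limsup[OF sequentially_bot]]) (rule Limsup_bounded, simp add: le)
  finally show ?thesis .
qed

lemma L2_nn: "L2 f \<Longrightarrow> (\<integral>\<^sup>+x. ennreal ((f x)\<^sup>2) \<partial>torus) = ennreal ((l2 f)\<^sup>2)"
  using nn_integral_eq_integral[OF L2_sq[of f]] by (simp add: l2_sq)

lemma continuous_eq_dense:
  fixes f g :: "'a::{second_countable_topology, t2_space} \<Rightarrow> real"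
  assumes X: "\<And>V. open V \<Longrightarrow> V \<noteq> {} \<Longrightarrow> \<exists>d\<in>X. d \<in> V"
    and c: "continuous_on UNIV f" "continuous_on UNIV g" and eq: "\<And>x. x \<in> X \<Longrightarrow> f x = g x"
  shows "f = g"
proof (rule ccontr)
  assume "f \<noteq> g"
  then have "{x. f x \<noteq> g x} \<noteq> {}" by auto
  moreover have "open {x. f x \<noteq> g x}" by (intro open_Collect_neq c)
  ultimately show False using X eq by blast
qed

lemma kernel_slices:
  fixes h :: "(real^'n::finite) \<times> real \<Rightarrow> real"
  assumes h: "integrable (st T) h" and k: "continuous_on UNIV k" "periodic_sp k" and \<theta>: "tfun T \<theta>"
  shows "integrable (st T) (\<lambda>z. h z * (k (x - fst z) * \<theta> (snd z)))"
    and "(LINT z|st T. h z * (k (x - fst z) * \<theta> (snd z))) = (LINT t|tm T. conv k (\<lambda>y. h (y, t)) x * \<theta> t)"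
    and "integrable (tm T) (\<lambda>t. conv k (\<lambda>y. h (y, t)) x * \<theta> t)"
proof -
  obtain B where B: "0 \<le> B" "\<And>x. \<bar>k x\<bar> \<le> B" using periodic_bounded[OF k] by blast
  obtain C where C: "0 \<le> C" "\<And>t. \<bar>\<theta> t\<bar> \<le> C" using tfun_bounded[OF \<theta>] by blast
  have km: "k \<in> borel_measurable borel" using k by (auto intro: borel_cont)
  have fs: "(\<lambda>z. x - fst z) \<in> (borel :: ((real^'n) \<times> real) measure) \<rightarrow>\<^sub>M borel"
      "snd \<in> borel_measurable (borel :: ((real^'n) \<times> real) measure)"
    by (intro borel_measurable_continuous_onI continuous_intros)+
  have m: "(\<lambda>z :: (real^'n) \<times> real. k (x - fst z) * \<theta> (snd z)) \<in> borel_measurable borel"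
    by (intro borel_measurable_times measurable_compose[OF fs(1) km] measurable_compose[OF fs(2) tfun_measurable[OF \<theta>]])
  have b: "\<bar>k (x - fst z) * \<theta> (snd z)\<bar> \<le> B * C" for z :: "(real^'n) \<times> real"
    unfolding abs_mult using B C by (intro mult_mono) auto
  show i: "integrable (st T) (\<lambda>z. h z * (k (x - fst z) * \<theta> (snd z)))"
    using st_mult_bounded[OF h m b] by (simp add: mult.commute)
  have eq: "(LINT y|torus. h (y, t) * (k (x - y) * \<theta> t)) = conv k (\<lambda>y. h (y, t)) x * \<theta> t" for t
  proof -
    have "(LINT y|torus. h (y, t) * (k (x - y) * \<theta> t)) = (LINT y|torus. (k (x - y) * h (y, t)) * \<theta> t)"
      by (simp add: mult_ac)
    then show ?thesis by (simp add: conv_def)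
  qed
  show "(LINT z|st T. h z * (k (x - fst z) * \<theta> (snd z))) = (LINT t|tm T. conv k (\<lambda>y. h (y, t)) x * \<theta> t)"
    using st_slices(3)[OF i] by (simp add: eq)
  show "integrable (tm T) (\<lambda>t. conv k (\<lambda>y. h (y, t)) x * \<theta> t)"
    using st_slices(2)[OF i] by (simp add: eq)
qed

text \<open>One statement for the mass and for each momentum component. \<open>A\<close> stands for
  the original slice integrals, whose limit at 0 runs over all times; the representative
  \<open>h\<close> reproduces them for almost every time, which is what \<open>initial_value\<close>
  asks.\<close>

lemma weak_ode:
  fixes h :: "(real^'n::finite) \<times> real \<Rightarrow> real" and G :: "'n \<Rightarrow> (real^'n) \<times> real \<Rightarrow> real" and r :: "real^'n \<Rightarrow> real"
  assumes T: "0 < T" and h: "integrable (st T) h" and G: "\<And>j. integrable (st T) (G j)" and r: "integrable torus r"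
    and weak: "\<And>\<phi>. test_fun T \<phi> \<Longrightarrow> (LINT z|st T. h z * dt \<phi> z + (\<Sum>j\<in>UNIV. G j z * dx j \<phi> z)) = 0"
    and A: "AE t in tm T. \<forall>\<phi>. sp_test_fun \<phi> \<longrightarrow> A \<phi> t = (LINT x|torus. h (x, t) * \<phi> x)"
    and lim: "\<And>\<phi>. sp_test_fun \<phi> \<Longrightarrow> (A \<phi> \<longlongrightarrow> (LINT x|torus. r x * \<phi> x)) (at_right 0)"
  shows "AE t in tm T. S n (\<lambda>y. h (y, t)) x = S n r x + integral {0..t} (\<lambda>s. - (\<Sum>j\<in>UNIV. conv (dker n j) (\<lambda>y. G j (y, s)) x))"
    and "integrable (tm T) (\<lambda>s. - (\<Sum>j\<in>UNIV. conv (dker n j) (\<lambda>y. G j (y, s)) x))"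
proof -
  let ?A = "\<lambda>t. S n (\<lambda>y. h (y, t)) x" and ?B = "\<lambda>s. - (\<Sum>j\<in>UNIV. conv (dker n j) (\<lambda>y. G j (y, s)) x)"
  have iA: "integrable (tm T) ?A" by (rule conv_slices[OF ker_cont ker_periodic h])
  have iBj: "integrable (tm T) (\<lambda>s. conv (dker n j) (\<lambda>y. G j (y, s)) x)" for j by (rule conv_slices[OF dker_facts G])
  show iB: "integrable (tm T) ?B" using iBj by simp
  have "\<exists>c. AE t in tm T. ?A t = c + integral {0..t} ?B"
  proof (rule du_Bois_Reymond[OF T iA iB])
    fix \<theta> \<theta>' assume \<theta>: "tfun T \<theta>" and d: "\<And>t. (\<theta> has_real_derivative \<theta>' t) (at t)"
    note \<theta>' = tfun_deriv[OF \<theta> d]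
    note kA = kernel_slices[OF h ker_cont[of n] ker_periodic \<theta>', of x]
    have kB: "integrable (st T) (\<lambda>z. G j z * (dker n j (x - fst z) * \<theta> (snd z)))"
      "(LINT z|st T. G j z * (dker n j (x - fst z) * \<theta> (snd z))) = (LINT t|tm T. conv (dker n j) (\<lambda>y. G j (y, t)) x * \<theta> t)"
      "integrable (tm T) (\<lambda>t. conv (dker n j) (\<lambda>y. G j (y, t)) x * \<theta> t)" for j
      by (rule kernel_slices[OF G dker_facts \<theta>])+
    have "0 = (LINT z|st T. h z * (ker n (x - fst z) * \<theta>' (snd z)) - (\<Sum>j\<in>UNIV. G j z * (dker n j (x - fst z) * \<theta> (snd z))))"
      using weak[OF ktest_test[OF \<theta>, of n x]] unfolding ktest_dt[OF d] ktest_dx by (simp add: sum_negf)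
    also have "\<dots> = (LINT t|tm T. ?A t * \<theta>' t) - (\<Sum>j\<in>UNIV. (LINT t|tm T. conv (dker n j) (\<lambda>y. G j (y, t)) x * \<theta> t))"
      using kA kB by simp
    also have "\<dots> = (LINT t|tm T. ?A t * \<theta>' t + ?B t * \<theta> t)"
      using kA(3) kB(3) by (simp add: sum_distrib_right)
    finally show "(LINT t|tm T. ?A t * \<theta>' t + ?B t * \<theta> t) = 0" by simp
  qed
  then obtain c where c: "AE t in tm T. ?A t = c + integral {0..t} ?B" by blast
  let ?\<phi> = "\<lambda>y. ker n (x - y)"
  have "c = (LINT y|torus. r y * ?\<phi> y)"
  proof (rule initial_value[OF T iB])
    show "AE t in tm T. A ?\<phi> t = c + integral {0..t} ?B"
      using c A
    proof eventually_elim
      case (elim t)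
      have "A ?\<phi> t = (LINT y|torus. h (y, t) * ?\<phi> y)" using elim(2) ker_sp_test by blast
      then show ?case using elim(1) by (simp add: conv_def mult.commute)
    qed
    show "(A ?\<phi> \<longlongrightarrow> (LINT y|torus. r y * ?\<phi> y)) (at_right 0)" by (rule lim[OF ker_sp_test])
  qed
  then have "c = S n r x" by (simp add: conv_def mult.commute)
  with c show "AE t in tm T. ?A t = S n r x + integral {0..t} ?B" by simp
qed

text \<open>The weak formulation transferred to Borel representatives. \<open>A\<close> and
  \<open>Am\<close> keep the original slice integrals and \<open>m\<close> is the initial momentum.
  The bounds for \<open>r\<close> and the square integrability of \<open>m\<close> are derived from
  the equations below.\<close>

locale borel_solution = flow_data T c1 c2 C0 p p1 \<nu> \<mu> R U D
  for T c1 c2 C0 p p1 \<nu> \<mu> and R :: "(real^'n::finite) \<times> real \<Rightarrow> real" and U D +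
  fixes r :: "real^'n \<Rightarrow> real" and m :: "'n \<Rightarrow> real^'n \<Rightarrow> real"
    and A :: "(real^'n \<Rightarrow> real) \<Rightarrow> real \<Rightarrow> real" and Am :: "'n \<Rightarrow> (real^'n \<Rightarrow> real) \<Rightarrow> real \<Rightarrow> real"
  assumes r_int: "integrable torus r" and m_int: "\<And>i. integrable torus (m i)"
    and dim: "CARD('n) = 2 \<or> integrable (st T) (\<lambda>z. (\<Sum>i\<in>UNIV. (U i z)\<^sup>2)\<^sup>2)"
    and weak_D: "\<And>\<phi> i j. test_fun T \<phi> \<Longrightarrow> (LINT z|st T. U i z * dx j \<phi> z) = - (LINT z|st T. D i j z * \<phi> z)"
    and weak_mass: "\<And>\<phi>. test_fun T \<phi> \<Longrightarrow> (LINT z|st T. R z * dt \<phi> z + (\<Sum>j\<in>UNIV. (R z * U j z) * dx j \<phi> z)) = 0"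
    and weak_momentum: "\<And>\<phi> i. test_fun T \<phi> \<Longrightarrow> (LINT z|st T. (R z * U i z) * dt \<phi> z
        + (\<Sum>j\<in>UNIV. (R z * (U i z * U j z) - stress \<nu> \<mu> p R D i j z) * dx j \<phi> z)) = 0"
    and A_eq: "AE t in tm T. \<forall>\<phi>. sp_test_fun \<phi> \<longrightarrow> A \<phi> t = (LINT x|torus. R (x, t) * \<phi> x)"
    and A_lim: "\<And>\<phi>. sp_test_fun \<phi> \<Longrightarrow> (A \<phi> \<longlongrightarrow> (LINT x|torus. r x * \<phi> x)) (at_right 0)"
    and Am_eq: "\<And>i. AE t in tm T. \<forall>\<phi>. sp_test_fun \<phi> \<longrightarrow> Am i \<phi> t = (LINT x|torus. (R (x, t) * U i (x, t)) * \<phi> x)"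
    and Am_lim: "\<And>i \<phi>. sp_test_fun \<phi> \<Longrightarrow> (Am i \<phi> \<longlongrightarrow> (LINT x|torus. m i x * \<phi> x)) (at_right 0)"
begin

lemma R_int: "integrable (st T) R"
  by (rule sqint_integrable[OF sqint_bounded[OF R_meas R_abs]])

lemma RUU_int: "integrable (st T) (\<lambda>z. R z * (U i z * U j z))"
  by (rule st_mult_bounded[OF sqint_mult[OF sqint_U sqint_U] R_meas R_abs])

lemma mass_ode:
  "AE t in tm T. S n (\<lambda>y. R (y, t)) x = S n r x + integral {0..t} (\<lambda>s. - (\<Sum>j\<in>UNIV. conv (dker n j) (\<lambda>y. R (y, s) * U j (y, s)) x))"
  "integrable (tm T) (\<lambda>s. - (\<Sum>j\<in>UNIV. conv (dker n j) (\<lambda>y. R (y, s) * U j (y, s)) x))"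
  using weak_ode[OF T_pos R_int sqint_integrable[OF sqint_RU] r_int weak_mass A_eq A_lim, of n x] by auto

lemma momentum_ode:
  "AE t in tm T. S n (\<lambda>y. R (y, t) * U i (y, t)) x = S n (m i) x
     + integral {0..t} (\<lambda>s. \<Sum>j\<in>UNIV. conv (dker n j) (\<lambda>y. \<tau> i j (y, s)) x)"
proof -
  have G: "integrable (st T) (\<lambda>z. R z * (U i z * U j z) - \<sigma> i j z)" for j
    by (intro Bochner_Integration.integrable_diff RUU_int sqint_integrable[OF sqint_\<sigma>])
  have neg: "conv (dker n j) (\<lambda>y. \<tau> i j (y, s)) x = - conv (dker n j) (\<lambda>y. R (y, s) * (U i (y, s) * U j (y, s)) - \<sigma> i j (y, s)) x" for j s
    unfolding conv_def Bochner_Integration.integral_minus[symmetric]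
    by (intro Bochner_Integration.integral_cong refl) (simp add: algebra_simps)
  show ?thesis
    using weak_ode(1)[OF T_pos sqint_integrable[OF sqint_RU] G m_int weak_momentum Am_eq Am_lim, of n x]
    unfolding neg sum_negf by simp
qed

text \<open>At fixed \<open>n\<close> and \<open>x\<close> the bounds hold along a continuous curve
  and so at its value for \<open>t = 0\<close>, which is \<open>S n r x\<close>; then
  \<open>n\<close> tends to infinity along a subsequence.\<close>

lemma r_bounds: "AE x in torus. c1 \<le> r x \<and> r x \<le> c2"
proof -
  have b: "c1 \<le> S n r x \<and> S n r x \<le> c2" for n x
  proof -
    let ?B = "\<lambda>s. - (\<Sum>j\<in>UNIV. conv (dker n j) (\<lambda>y. R (y, s) * U j (y, s)) x)"
    let ?f = "\<lambda>t. S n r x + integral {0..t} ?B"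
    have c: "continuous_on {0..T} ?f"
      by (intro continuous_intros indefinite_integral_continuous_1
          set_lebesgue_integral_eq_integral(1)[OF tm_absolutely_integrable(1)[OF mass_ode(2) order_refl]])
    have "AE t in tm T. c1 \<le> ?f t \<and> ?f t \<le> c2"
      using mass_ode(1)[of n x]
    proof eventually_elim
      case (elim t)
      interpret F: mass_density "\<lambda>y. R (y, t)" c1 c2
        by unfold_locales (use slice_measurable[OF R_meas] R_lower R_upper c1_pos in auto)
      show ?case using F.R_bounds[of n x] elim by simp
    qed
    from AE_ge_continuous[OF T_pos c this, of 0] T_pos show ?thesis by simp
  qed
  obtain q where "AE x in torus. (\<lambda>n. S (q n) r x) \<longlonglongrightarrow> r x" using S_AE_subseq[OF r_int] by blast
  then show ?thesis
    by eventually_elim (use b in \<open>auto intro: LIMSEQ_le_const LIMSEQ_le_const2\<close>)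
qed

text \<open>Fatou twice. At fixed \<open>n\<close> the averages of \<open>R U\<close> at the times
  \<open>X k\<close> tend to \<open>S n (m i)\<close> at every point and are bounded in
  \<open>L2\<close> through \<open>c2\<close> and \<open>C0\<close>; then \<open>n\<close> tends to
  infinity along a subsequence that converges almost everywhere.\<close>

lemma m_L2: "L2 (m i)"
proof -
  have [measurable]: "m i \<in> borel_measurable borel" using borel_measurable_integrable[OF m_int] by simp
  let ?C = "ennreal (c2\<^sup>2 * C0)"
  have c2: "0 \<le> c2" using c1_pos c12 by linarith
  \<comment> \<open>Collects what holds at almost every time, so that a single sequence of times can
    be chosen for all of it.\<close>
  define P where "P t \<longleftrightarrow> (\<forall>\<phi>. sp_test_fun \<phi> \<longrightarrow> Am i \<phi> t = (LINT x|torus. (R (x, t) * U i (x, t)) * \<phi> x))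
     \<and> L2 (\<lambda>x. R (x, t) * U i (x, t)) \<and> (l2 (\<lambda>x. R (x, t) * U i (x, t)))\<^sup>2 \<le> c2\<^sup>2 * C0" for t
  have Us: "AE s in tm T. \<forall>j\<in>UNIV. L2 (\<lambda>x. U j (x, s))"
    by (rule AE_finite_allI) (auto intro: sqint_slice[OF sqint_U])
  have "AE t in tm T. P t"
    using Am_eq[of i] Us U_Linf sqint_slice[OF sqint_RU, of i]
  proof eventually_elim
    case (elim t)
    have iU: "integrable torus (\<lambda>x. (U j (x, t))\<^sup>2)" for j using elim(2) L2_sq by blast
    have "(l2 (\<lambda>x. R (x, t) * U i (x, t)))\<^sup>2 \<le> (LINT x|torus. c2\<^sup>2 * (\<Sum>j\<in>UNIV. (U j (x, t))\<^sup>2))"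
      unfolding l2_sq
    proof (rule integral_mono[OF L2_sq[OF elim(4)]])
      show "integrable torus (\<lambda>x. c2\<^sup>2 * (\<Sum>j\<in>UNIV. (U j (x, t))\<^sup>2))" using iU by simp
      fix x
      have "(U i (x, t))\<^sup>2 \<le> (\<Sum>j\<in>UNIV. (U j (x, t))\<^sup>2)" by (rule member_le_sum) auto
      moreover have "(R (x, t))\<^sup>2 \<le> c2\<^sup>2" using power_mono[OF R_abs[of "(x, t)"] abs_ge_zero, of 2] by simp
      ultimately show "(R (x, t) * U i (x, t))\<^sup>2 \<le> c2\<^sup>2 * (\<Sum>j\<in>UNIV. (U j (x, t))\<^sup>2)"
        unfolding power_mult_distrib by (intro mult_mono) auto
    qed
    also have "\<dots> \<le> c2\<^sup>2 * C0" using elim(3) by (simp add: mult_left_mono)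
    finally show ?case unfolding P_def using elim by blast
  qed
  then have "\<forall>k. \<exists>t. 0 < t \<and> t < T \<and> t < 1 / Suc k \<and> P t" by (intro allI AE_tm_small[OF T_pos]) auto
  then obtain X where X: "\<And>k. 0 < X k" "\<And>k. X k < 1 / Suc k" "\<And>k. P (X k)" by metis
  have "X \<longlonglongrightarrow> 0"
    by (rule tendsto_sandwich[OF _ _ tendsto_const LIMSEQ_inverse_real_of_nat])
       (use X in \<open>auto intro!: always_eventually less_imp_le simp: inverse_eq_divide\<close>)
  moreover have "X k \<noteq> 0" for k using X(1)[of k] by simp
  ultimately have X0: "filterlim X (at_right 0) sequentially"
    using X(1) by (simp add: filterlim_at)
  have mS: "S n (\<lambda>x. R (x, X k) * U i (x, X k)) \<in> borel_measurable borel" "S n (m i) \<in> borel_measurable borel" for n k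
    using pd_cont(1)[OF pd_conv[OF pd_ker L2_integrable]] X(3)[of k] pd_cont(1)[OF pd_conv[OF pd_ker m_int]]
    by (auto simp: P_def intro!: borel_cont)
  have FS: "(\<integral>\<^sup>+x. ennreal ((S n (m i) x)\<^sup>2) \<partial>torus) \<le> ?C" for n
  proof (rule Fatou_squares[where F = "\<lambda>k. S n (\<lambda>x. R (x, X k) * U i (x, X k))"])
    show "AE x in torus. (\<lambda>k. S n (\<lambda>x. R (x, X k) * U i (x, X k)) x) \<longlonglongrightarrow> S n (m i) x"
    proof (rule AE_I2)
      fix x
      have "Am i (\<lambda>y. ker n (x - y)) (X k) = S n (\<lambda>x. R (x, X k) * U i (x, X k)) x" for k
        using X(3)[of k] ker_sp_test[of n x] by (simp add: P_def conv_def mult.commute)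
      moreover have "(LINT y|torus. m i y * ker n (x - y)) = S n (m i) x" by (simp add: conv_def mult.commute)
      ultimately show "(\<lambda>k. S n (\<lambda>x. R (x, X k) * U i (x, X k)) x) \<longlonglongrightarrow> S n (m i) x"
        using filterlim_compose[OF Am_lim[OF ker_sp_test, of i n x] X0] by simp
    qed
    fix k
    have L: "L2 (\<lambda>x. R (x, X k) * U i (x, X k))" using X(3) by (simp add: P_def)
    have "(l2 (S n (\<lambda>x. R (x, X k) * U i (x, X k))))\<^sup>2 \<le> (l2 (\<lambda>x. R (x, X k) * U i (x, X k)))\<^sup>2"
      by (intro power_mono S_L2(2) L l2_nonneg)
    then show "(\<integral>\<^sup>+x. ennreal ((S n (\<lambda>x. R (x, X k) * U i (x, X k)) x)\<^sup>2) \<partial>torus) \<le> ?C"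
      unfolding L2_nn[OF S_L2(1)[OF L]] using X(3)[of k] by (intro ennreal_leI) (simp add: P_def)
  qed (use mS in auto)
  obtain q where q: "AE x in torus. (\<lambda>n. S (q n) (m i) x) \<longlonglongrightarrow> m i x" using S_AE_subseq[OF m_int] by blast
  have "(\<integral>\<^sup>+x. ennreal ((m i x)\<^sup>2) \<partial>torus) \<le> ?C"
    by (rule Fatou_squares[OF mS(2) _ q FS]) measurable
  then have "(\<integral>\<^sup>+x. ennreal ((m i x)\<^sup>2) \<partial>torus) < \<infinity>" by (rule order_le_less_trans) simp
  then have "integrable torus (\<lambda>x. (m i x)\<^sup>2)" by (intro integrableI_bounded) simp_all
  then show ?thesis unfolding L2_def by simp
qed

text \<open>For each single \<open>x\<close> the two averages agree for almost all times, by testing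
  with the kernel. A countable dense set of points shares one null set, and continuity in
  \<open>x\<close> extends the identity to all points.\<close>

lemma pd_slices: "AE t in tm T. \<forall>k i j. pd j (S k (\<lambda>x. U i (x, t))) (S k (\<lambda>x. D i j (x, t)))"
proof -
  obtain X :: "(real^'n) set" where X: "countable X" "\<And>V. open V \<Longrightarrow> V \<noteq> {} \<Longrightarrow> \<exists>d\<in>X. d \<in> V"
    using countable_dense_setE by blast
  have pt: "AE t in tm T. conv (dker k j) (\<lambda>x. U i (x, t)) x = S k (\<lambda>x. D i j (x, t)) x" for k i j x
  proof -
    let ?h = "\<lambda>t. conv (dker k j) (\<lambda>x. U i (x, t)) x - S k (\<lambda>x. D i j (x, t)) x"
    note iU = sqint_integrable[OF sqint_U] and iD = sqint_integrable[OF sqint_D]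
    have "AE t in tm T. ?h t = 0"
    proof (rule fundamental_lemma)
      show "integrable (tm T) ?h"
        by (intro Bochner_Integration.integrable_diff conv_slices[OF dker_facts iU] conv_slices[OF ker_cont ker_periodic iD])
      fix \<theta> assume \<theta>: "tfun T \<theta>"
      note kU = kernel_slices[OF iU[of i] dker_facts[of k j] \<theta>, of x] and kD = kernel_slices[OF iD[of i j] ker_cont[of k] ker_periodic \<theta>, of x]
      have "(LINT z|st T. U i z * (dker k j (x - fst z) * \<theta> (snd z))) = (LINT z|st T. D i j z * (ker k (x - fst z) * \<theta> (snd z)))"
        using weak_D[OF ktest_test[OF \<theta>, of k x], of i j] unfolding ktest_dx by (simp add: ktest_def)
      then show "(LINT t|tm T. ?h t * \<theta> t) = 0"
        using kU kD by (simp add: left_diff_distrib)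
    qed
    then show ?thesis by simp
  qed
  have "AE t in tm T. \<forall>k. \<forall>i\<in>UNIV. \<forall>j\<in>UNIV. \<forall>x\<in>X. conv (dker k j) (\<lambda>x. U i (x, t)) x = S k (\<lambda>x. D i j (x, t)) x"
    unfolding AE_all_countable
  proof (intro allI AE_finite_allI[OF finite])
    show "AE t in tm T. \<forall>x\<in>X. conv (dker k j) (\<lambda>x. U i (x, t)) x = S k (\<lambda>x. D i j (x, t)) x" for k i j
      by (simp add: AE_ball_countable[OF X(1)] pt)
  qed
  moreover have "AE t in tm T. \<forall>i\<in>UNIV. L2 (\<lambda>x. U i (x, t))"
    by (rule AE_finite_allI) (auto intro: sqint_slice sqint_U)
  moreover have "AE t in tm T. \<forall>i\<in>UNIV. \<forall>j\<in>UNIV. L2 (\<lambda>x. D i j (x, t))"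
    by (intro AE_finite_allI) (auto intro: sqint_slice sqint_D)
  ultimately show ?thesis
  proof eventually_elim
    case (elim t)
    show ?case
    proof (intro allI)
      fix k i j
      have pU: "pd j (S k (\<lambda>x. U i (x, t))) (conv (dker k j) (\<lambda>x. U i (x, t)))"
        by (rule pd_conv[OF pd_ker L2_integrable]) (use elim in blast)
      have pD: "pd j (S k (\<lambda>x. D i j (x, t))) (conv (dker k j) (\<lambda>x. D i j (x, t)))"
        by (rule pd_conv[OF pd_ker L2_integrable]) (use elim in blast)
      have "conv (dker k j) (\<lambda>x. U i (x, t)) = S k (\<lambda>x. D i j (x, t))"
        by (rule continuous_eq_dense[OF X(2) pd_cont(2)[OF pU] pd_cont(1)[OF pD]]) (use elim in auto)
      with pU show "pd j (S k (\<lambda>x. U i (x, t))) (S k (\<lambda>x. D i j (x, t)))" by simp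
    qed
  qed
qed

text \<open>In dimension two \<open>Ladyzhenskaya\<close> bounds the slices by an expression that is
  affine in the squared gradient norms, with coefficients controlled by \<open>C0\<close>, hence
  integrable in time. Otherwise the claim is the other alternative in \<open>dim\<close>.\<close>

lemma q_int: "integrable (st T) (\<lambda>z. (\<Sum>i\<in>UNIV. (U i z)\<^sup>2)\<^sup>2)"
proof (cases "CARD('n) = 2")
  case False then show ?thesis using dim by simp
next
  case True
  interpret Q: pair_sigma_finite "torus :: (real^'n) measure" "tm T" by (rule pair_st)
  have "integrable (st T) (\<lambda>z. (U i z) ^ 4)" for i
  proof -
    define w where "w t = 3 * C0 * (C0 + 2 * (\<Sum>j\<in>UNIV. (LINT x|torus. (D i j (x, t))\<^sup>2)))" for t
    have iw: "integrable (tm T) w"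
      unfolding w_def[abs_def] using st_slices(2)[OF D_int]
      by (intro integrable_mult_right Bochner_Integration.integrable_add Bochner_Integration.integrable_sum
          finite_measure.integrable_const[OF finite_measure_tm])
    have "AE t in tm T. \<forall>j\<in>UNIV. L2 (\<lambda>x. D i j (x, t))"
      by (intro AE_finite_allI) (auto intro: sqint_slice sqint_D)
    moreover have "AE t in tm T. \<forall>i\<in>UNIV. L2 (\<lambda>x. U i (x, t))"
      by (rule AE_finite_allI) (auto intro: sqint_slice sqint_U)
    ultimately have le: "AE t in tm T. (\<integral>\<^sup>+x. ennreal ((U i (x, t)) ^ 4) \<partial>torus) \<le> ennreal (w t)"
      using pd_slices U_Linf
    proof eventually_elim
      case (elim t)
      have iU: "integrable torus (\<lambda>x. (U j (x, t))\<^sup>2)" for j using elim(2) L2_sq by blast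
      have "(l2 (\<lambda>x. U i (x, t)))\<^sup>2 \<le> integral\<^sup>L torus (\<lambda>x. \<Sum>i\<in>UNIV. (U i (x, t))\<^sup>2)"
        unfolding l2_sq by (rule integral_mono) (use iU in \<open>auto intro: member_le_sum\<close>)
      then have l: "(l2 (\<lambda>x. U i (x, t)))\<^sup>2 \<le> C0" using elim(4) by simp
      have "(\<integral>\<^sup>+x. ennreal ((U i (x, t)) ^ 4) \<partial>torus) \<le> ennreal (3 * (l2 (\<lambda>x. U i (x, t)))\<^sup>2 * ((l2 (\<lambda>x. U i (x, t)))\<^sup>2 + 2 * (\<Sum>j\<in>UNIV. (l2 (\<lambda>x. D i j (x, t)))\<^sup>2)))"
        by (rule Ladyzhenskaya[OF True]) (use elim in blast)+
      also have "\<dots> \<le> ennreal (w t)"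
      proof (rule ennreal_leI)
        define a b where "a = (l2 (\<lambda>x. U i (x, t)))\<^sup>2" and "b = (\<Sum>j\<in>UNIV. (l2 (\<lambda>x. D i j (x, t)))\<^sup>2)"
        have ab: "0 \<le> a" "a \<le> C0" "0 \<le> b" using l by (auto simp: a_def b_def intro: sum_nonneg)
        have "w t = 3 * C0 * (C0 + 2 * b)" unfolding w_def b_def l2_sq ..
        moreover have "3 * a * (a + 2 * b) \<le> 3 * C0 * (C0 + 2 * b)" using ab by (intro mult_mono) auto
        ultimately show "3 * a * (a + 2 * b) \<le> w t" by simp
      qed
      finally show ?case .
    qed
    have m: "(\<lambda>z. ennreal ((U i z) ^ 4)) \<in> borel_measurable (st T)" using st_meas[OF U_meas[of i]] by measurable
    have "(\<integral>\<^sup>+z. ennreal ((U i z) ^ 4) \<partial>st T) = (\<integral>\<^sup>+t. \<integral>\<^sup>+x. ennreal ((U i (x, t)) ^ 4) \<partial>torus \<partial>tm T)"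
      using Q.nn_integral_snd[of "\<lambda>z. ennreal ((U i z) ^ 4)"] m by (simp add: case_prod_beta')
    also have "\<dots> \<le> (\<integral>\<^sup>+t. ennreal (w t) \<partial>tm T)" by (rule nn_integral_mono_AE[OF le])
    also have "\<dots> \<le> (\<integral>\<^sup>+t. ennreal (norm (w t)) \<partial>tm T)" by (intro nn_integral_mono ennreal_leI) simp
    also have "\<dots> < \<infinity>" using iw unfolding integrable_iff_bounded by blast
    finally have fin: "(\<integral>\<^sup>+z. ennreal ((U i z) ^ 4) \<partial>st T) < \<infinity>" .
    have "norm ((U i z) ^ 4) = (U i z) ^ 4" for z by simp
    then show ?thesis using fin by (intro integrableI_bounded st_meas) simp_all
  qed
  then have i: "integrable (st T) (\<lambda>z. real CARD('n) * (\<Sum>i\<in>UNIV. (U i z) ^ 4))" by simp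
  show ?thesis
  proof (rule Bochner_Integration.integrable_bound[OF i])
    show "(\<lambda>z. (\<Sum>i\<in>UNIV. (U i z)\<^sup>2)\<^sup>2) \<in> borel_measurable (st T)" by (rule st_meas) measurable
    have "(\<Sum>i\<in>UNIV. (U i z)\<^sup>2)\<^sup>2 \<le> (\<Sum>i\<in>UNIV. (U i z) ^ 4) * real CARD('n)" for z
      using sum_squared_le_sum_of_squares[of "\<lambda>i. (U i z)\<^sup>2" "UNIV :: 'n set"] by (simp add: power_mult[symmetric])
    then show "AE z in st T. norm ((\<Sum>i\<in>UNIV. (U i z)\<^sup>2)\<^sup>2) \<le> norm (real CARD('n) * (\<Sum>i\<in>UNIV. (U i z) ^ 4))"
      using sum_nonneg[of UNIV "\<lambda>i. (U i _) ^ 4"] by (intro AE_I2) (simp add: mult.commute)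
  qed
qed

text \<open>Since \<open>r\<close> obeys the bounds almost everywhere only, the initial density is
  clamped, and the initial velocity is recovered as momentum divided by the clamped density.\<close>

theorem energy_equality:
  "AE t in tm T. (LINT x|torus. (\<Sum>i\<in>UNIV. U i (x, t) * (R (x, t) * U i (x, t))) / 2 + Ppot p (R (x, t)))
     + (LINT z|st T. indicator {..<t} (snd z) * (\<nu> (R z) * (\<Sum>i\<in>UNIV. \<Sum>j\<in>UNIV. ((D i j z + D j i z) / 2)\<^sup>2) + \<mu> (R z) * (\<Sum>k\<in>UNIV. D k k z)\<^sup>2))
   = (LINT x|torus. (\<Sum>i\<in>UNIV. (m i x / max c1 (min c2 (r x))) * m i x) / 2 + Ppot p (max c1 (min c2 (r x))))"
proof -
  define r0 where "r0 x = max c1 (min c2 (r x))" for x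
  define v0 where "v0 i x = m i x / r0 x" for i x
  have [measurable]: "m i \<in> borel_measurable borel" "r \<in> borel_measurable borel" for i
    using borel_measurable_integrable[OF m_int] borel_measurable_integrable[OF r_int] by auto
  have [measurable]: "r0 \<in> borel_measurable borel" unfolding r0_def[abs_def] by measurable
  have rb: "c1 \<le> r0 x" "r0 x \<le> c2" "r0 x \<noteq> 0" for x using c1_pos c12 by (auto simp: r0_def)
  \<comment> \<open>Averages do not see the null set on which clamping changes
    \<open>r\<close>.\<close>
  have Sr: "S n r x = S n r0 x" for n x
    unfolding conv_def
  proof (rule integral_cong_AE)
    show "AE z in torus. ker n (x - z) * r z = ker n (x - z) * r0 z"
      using r_bounds by eventually_elim (simp add: r0_def)
  qed (use borel_cont[OF ker_cont] in measurable)
  have mv: "r0 z * v0 i z = m i z" for z i using rb(3) by (simp add: v0_def)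
  interpret F: flow T c1 c2 C0 p p1 \<nu> \<mu> R U D r0 v0
  proof unfold_locales
    show "integrable (st T) (\<lambda>z. (\<Sum>i\<in>UNIV. (U i z)\<^sup>2)\<^sup>2)" by (rule q_int)
    show "L2 (v0 i)" for i
    proof (rule L2_dominated[OF L2_cmult(1)[OF m_L2[of i], of "1 / c1"]])
      show "v0 i \<in> borel_measurable borel" unfolding v0_def[abs_def] by measurable
      show "\<bar>v0 i x\<bar> \<le> \<bar>1 / c1 * m i x\<bar>" for x
        using rb(1)[of x] c1_pos by (simp add: v0_def abs_mult frac_le)
    qed
    show "AE t in tm T. \<forall>m i j. pd j (S m (\<lambda>x. U i (x, t))) (S m (\<lambda>x. D i j (x, t)))" by (rule pd_slices)
    show "AE t in tm T. S n (\<lambda>z. R (z, t)) x = S n r0 x + integral {0..t} (\<lambda>s. - (\<Sum>j\<in>UNIV. conv (dker n j) (\<lambda>z. R (z, s) * U j (z, s)) x))" for n x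
      using mass_ode(1)[of n x] unfolding Sr .
    show "AE t in tm T. S n (\<lambda>z. R (z, t) * U i (z, t)) x = S n (\<lambda>z. r0 z * v0 i z) x
      + integral {0..t} (\<lambda>s. \<Sum>j\<in>UNIV. conv (dker n j) (\<lambda>z. stress \<nu> \<mu> p R D i j (z, s) - R (z, s) * (U i (z, s) * U j (z, s))) x)" for n x i
      using momentum_ode[of n i x] unfolding mv .
  qed (use rb c1_pos in auto)
  show ?thesis
    using F.energy_equality unfolding F.dissipation_def mv unfolding v0_def r0_def .
qed

end

section \<open>Passage from the stated hypotheses to Borel representatives\<close>

lemma smooth_fun_cont: "smooth_fun f \<Longrightarrow> continuous_on UNIV f"
  by (auto elim!: smooth_fun.cases intro!: continuous_at_imp_continuous_on has_derivative_continuous)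

text \<open>\<open>dt\<close> and \<open>dx\<close> are one-variable derivatives; they are values of
  the total derivative in a fixed direction, which is again a \<open>smooth_fun\<close>, hence
  continuous.\<close>

lemma smooth_fun_partials:
  fixes \<phi> :: "(real^'n::finite) \<times> real \<Rightarrow> real"
  assumes "smooth_fun \<phi>"
  shows "continuous_on UNIV (dt \<phi>)" "continuous_on UNIV (dx j \<phi>)"
proof -
  from assms obtain f' where d: "\<And>z. (\<phi> has_derivative f' z) (at z)" and s: "\<And>v. smooth_fun (\<lambda>z. f' z v)"
    by (cases rule: smooth_fun.cases) blast
  have lin: "((\<lambda>s. \<phi> (z + s *\<^sub>R v)) has_real_derivative f' z v) (at 0)" for z v
  proof -
    have g: "((\<lambda>s. z + s *\<^sub>R v) has_derivative (\<lambda>s. s *\<^sub>R v)) (at 0)" by (auto intro!: derivative_eq_intros)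
    have "(\<phi> has_derivative f' z) (at (z + 0 *\<^sub>R v))" using d by simp
    from has_derivative_compose[OF g this] have "((\<lambda>s. \<phi> (z + s *\<^sub>R v)) has_derivative (\<lambda>s. f' z (s *\<^sub>R v))) (at 0)" .
    moreover have "f' z (s *\<^sub>R v) = f' z v * s" for s
      using linear_scale[OF has_derivative_linear[OF d]] by simp
    ultimately show ?thesis by (simp add: has_field_derivative_def)
  qed
  have "dt \<phi> z = f' z (0, 1)" for z
  proof -
    have "((\<lambda>s. \<phi> (fst z, snd z + s)) has_real_derivative f' z (0, 1)) (at 0)"
      using lin[of z "(0, 1)"] by (simp add: plus_prod_def)
    then have "((\<lambda>s. \<phi> (fst z, s)) has_real_derivative f' z (0, 1)) (at (snd z))"
      using DERIV_shift[of "\<lambda>s. \<phi> (fst z, s)" "f' z (0, 1)" 0 "snd z"] by (simp add: add.commute)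
    then show ?thesis unfolding dt_def by (rule DERIV_imp_deriv)
  qed
  then show "continuous_on UNIV (dt \<phi>)" using smooth_fun_cont[OF s[of "(0, 1)"]] by (simp add: fun_eq_iff[symmetric])
  have "dx j \<phi> z = f' z (axis j 1, 0)" for z
    unfolding dx_def using lin[of z "(axis j 1, 0)"] by (intro DERIV_imp_deriv) (simp add: plus_prod_def)
  then show "continuous_on UNIV (dx j \<phi>)" using smooth_fun_cont[OF s[of "(axis j 1, 0)"]] by (simp add: fun_eq_iff[symmetric])
qed

lemma norm_vec_sq: "(norm (v :: real^'n::finite))\<^sup>2 = (\<Sum>i\<in>UNIV. (v $ i)\<^sup>2)"
  by (simp only: power2_norm_eq_inner) (simp add: inner_vec_def power2_eq_square)

lemma norm_mat_sq: "(norm (A :: real^'n::finite^'m::finite))\<^sup>2 = (\<Sum>i\<in>UNIV. \<Sum>j\<in>UNIV. (A $ i $ j)\<^sup>2)"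
  by (simp only: power2_norm_eq_inner) (simp add: inner_vec_def power2_eq_square)

lemma integral_lb_subset:
  fixes f :: "(real^'n::finite) \<times> real \<Rightarrow> real"
  assumes [measurable]: "f \<in> borel_measurable borel" and t: "t < T"
  shows "integral\<^sup>L (lb (cyl 0 t)) f = integral\<^sup>L (lb (cyl 0 T)) (\<lambda>z. indicator {..<t} (snd z) * f z)"
proof -
  have [measurable]: "cyl 0 s \<in> sets (borel :: ((real^'n) \<times> real) measure)" for s by (rule cyl_borel)
  have "(snd :: (real^'n) \<times> real \<Rightarrow> real) \<in> borel_measurable borel"
    by (intro borel_measurable_continuous_onI continuous_intros)
  then have [measurable]: "(\<lambda>z :: (real^'n) \<times> real. indicat_real {..<t} (snd z)) \<in> borel_measurable borel"
    using measurable_compose[of snd borel borel "indicat_real {..<t}" borel] by simp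
  have d: "integral\<^sup>L (lb (cyl 0 s)) g = (LINT z|lborel. indicat_real (cyl 0 s) z * g z)"
    if [measurable]: "g \<in> borel_measurable borel" for s and g :: "(real^'n) \<times> real \<Rightarrow> real"
    using integral_density[of g lborel "indicat_real (cyl 0 s)"] by (simp add: ennreal_indicator)
  have m: "(\<lambda>z. indicat_real {..<t} (snd z) * f z) \<in> borel_measurable borel" by measurable
  show ?thesis
    unfolding d[OF assms(1)] d[OF m]
    using t by (intro Bochner_Integration.integral_cong) (auto simp: indicator_def cyl_def)
qed

theorem theorem1:
  fixes p \<nu> \<mu> :: "real \<Rightarrow> real" and T c1 c2 :: real
    and \<rho>0 :: "real^'n \<Rightarrow> real" and u0 :: "real^'n \<Rightarrow> real^'n"
    and \<rho> :: "(real^'n) \<times> real \<Rightarrow> real" and u :: "(real^'n) \<times> real \<Rightarrow> real^'n"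
    and Du :: "(real^'n) \<times> real \<Rightarrow> real^'n^'n"
  assumes dim: "CARD('n) = 2 \<or> CARD('n) = 3"
    and nu_cont: "continuous_on {0<..} \<nu>" and nu_nonneg: "\<forall>z>0. \<nu> z \<ge> 0"
    and mu_cont: "continuous_on {0<..} \<mu>" and mu_nonneg: "\<forall>z>0. \<mu> z \<ge> 0"
    and p_C2: "C2_on {0<..} p"
    and T_pos: "T > 0"
    and weak: "weak_solution p \<nu> \<mu> T \<rho>0 u0 \<rho> u Du"
    and c12: "0 < c1" "c1 \<le> c2"
    and bounds: "AE z in lebesgue_on (cyl 0 T). c1 \<le> \<rho> z \<and> \<rho> z \<le> c2"
    and u_Linf_L2: "Linf_L2 T u"
    and u_L2_H1: "L2_st T u \<and> L2_st T Du"
    and d2: "CARD('n) = 2 \<longrightarrow> half_holder 2 T \<rho>"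
    and d3: "CARD('n) = 3 \<longrightarrow>
               integrable (lebesgue_on (cyl 0 T)) (\<lambda>z. norm (u z) ^ 4) \<and> half_holder (12/5) T \<rho>"
  shows "AE t in lebesgue_on {0<..<T}.
           integral\<^sup>L (lebesgue_on cell)
              (\<lambda>x. (1/2) * \<rho> (x, t) * (norm (u (x, t)))^2 + Ppot p (\<rho> (x, t)))
         + integral\<^sup>L (lebesgue_on (cyl 0 t)) (\<lambda>z. \<nu> (\<rho> z) * frob (sym_part (Du z)) (sym_part (Du z)))
         + integral\<^sup>L (lebesgue_on (cyl 0 t)) (\<lambda>z. \<mu> (\<rho> z) * (trace_m (Du z))^2)
         = integral\<^sup>L (lebesgue_on cell) (\<lambda>x. (1/2) * \<rho>0 x * (norm (u0 x))^2 + Ppot p (\<rho>0 x))"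
proof -
  let ?C = "cyl 0 T :: ((real^'n) \<times> real) set"
  note w = weak[unfolded weak_solution_def]
  have Cb: "?C \<in> sets borel" by (rule cyl_borel)
  have tor: "torus = (lb cell :: (real^'n) measure)" and tmT: "tm T = lb {0<..<T}"
    by (simp_all add: torus_def tm_def)
  have "\<rho> \<in> borel_measurable (lebesgue_on ?C)" using w by blast
  then obtain R' where R': "R' \<in> borel_measurable borel" "AE z in lb ?C. \<rho> z = R' z" by (rule borel_version[OF Cb])
  have "u \<in> borel_measurable (lebesgue_on ?C)" using w by blast
  then obtain U where U: "\<And>i. U i \<in> borel_measurable borel" "AE z in lb ?C. \<forall>i. u z $ i = U i z"
    by (rule borel_version_vec[OF Cb]) (rule that, auto)
  have "Du \<in> borel_measurable (lebesgue_on ?C)" using u_L2_H1 by (simp add: L2_st_def)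
  then obtain D where D: "\<And>i j. D i j \<in> borel_measurable borel" "AE z in lb ?C. \<forall>i j. Du z $ i $ j = D i j z"
    by (rule borel_version_mat[OF Cb]) (rule that, auto)
  \<comment> \<open>Clamping turns the almost everywhere bounds into bounds at every point.\<close>
  define R where "R z = max c1 (min c2 (R' z))" for z
  have Rm: "R \<in> borel_measurable borel" unfolding R_def[abs_def] using R'(1) by measurable
  have ae: "AE z in st T. \<rho> z = R z \<and> (\<forall>i. u z $ i = U i z) \<and> (\<forall>i j. Du z $ i $ j = D i j z)"
    using R'(2) U(2) D(2) bounds[unfolded AE_lebesgue_on[OF Cb]] unfolding st_density
    by eventually_elim (simp add: R_def)
  note sl = st_AE_slices[OF ae]
  note [measurable] = Rm U(1) D(1)
  have transfer: "integral\<^sup>L (lebesgue_on ?C) f = integral\<^sup>L (st T) g" "integrable (lebesgue_on ?C) f \<longleftrightarrow> integrable (st T) g"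
    if "g \<in> borel_measurable borel"
      and "\<And>z. \<rho> z = R z \<Longrightarrow> (\<And>i. u z $ i = U i z) \<Longrightarrow> (\<And>i j. Du z $ i $ j = D i j z) \<Longrightarrow> f z = g z" for f g :: "(real^'n) \<times> real \<Rightarrow> real"
  proof -
    have "AE z in lb ?C. f z = g z" using ae unfolding st_density by eventually_elim (use that(2) in auto)
    from lebesgue_on_transfer[OF Cb that(1) this]
    show "integral\<^sup>L (lebesgue_on ?C) f = integral\<^sup>L (st T) g" "integrable (lebesgue_on ?C) f \<longleftrightarrow> integrable (st T) g"
      unfolding st_density .
  qed
  \<comment> \<open>The quantifiers over \<open>f\<close> and \<open>g\<close> stand inside
    \<open>AE\<close>: one null set of times must serve all spatial test functions at once.\<close>
  have transfer_slice: "AE t in tm T. \<forall>(f :: real^'n \<Rightarrow> real) g. g \<in> borel_measurable borel \<longrightarrow>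
      (\<forall>x. \<rho> (x, t) = R (x, t) \<longrightarrow> (\<forall>i. u (x, t) $ i = U i (x, t)) \<longrightarrow> f x = g x) \<longrightarrow>
      integral\<^sup>L (lebesgue_on cell) f = integral\<^sup>L torus g"
    using sl
  proof eventually_elim
    case (elim t)
    show ?case
    proof (intro allI impI)
      fix f g :: "real^'n \<Rightarrow> real"
      assume g: "g \<in> borel_measurable borel" and fg: "\<forall>x. \<rho> (x, t) = R (x, t) \<longrightarrow> (\<forall>i. u (x, t) $ i = U i (x, t)) \<longrightarrow> f x = g x"
      have "AE x in lb cell. f x = g x" using elim unfolding tor by eventually_elim (use fg in blast)
      then show "integral\<^sup>L (lebesgue_on cell) f = integral\<^sup>L torus g"
        unfolding tor by (rule lebesgue_on_transfer(1)[OF cell_borel g])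
    qed
  qed
  have U2: "integrable (st T) (\<lambda>z. \<Sum>i\<in>UNIV. (U i z)\<^sup>2)"
    by (subst transfer(2)[symmetric, where f = "\<lambda>z. norm (u z) ^ 2"])
       (use u_L2_H1 in \<open>auto simp: L2_st_def norm_vec_sq\<close>)
  have D2: "integrable (st T) (\<lambda>z. \<Sum>i\<in>UNIV. \<Sum>j\<in>UNIV. (D i j z)\<^sup>2)"
    by (subst transfer(2)[symmetric, where f = "\<lambda>z. norm (Du z) ^ 2"])
       (use u_L2_H1 in \<open>auto simp: L2_st_def norm_mat_sq\<close>)
  have stm: "f \<in> borel_measurable borel \<Longrightarrow> f \<in> borel_measurable (st T)" for f :: "(real^'n) \<times> real \<Rightarrow> real"
    by (simp add: measurable_cong_sets[OF sets_st refl])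
  have U_int: "integrable (st T) (\<lambda>z. (U i z)\<^sup>2)" for i
  proof (rule Bochner_Integration.integrable_bound[OF U2 stm])
    have "(U i z)\<^sup>2 \<le> (\<Sum>i\<in>UNIV. (U i z)\<^sup>2)" for z by (rule member_le_sum) auto
    then show "AE z in st T. norm ((U i z)\<^sup>2) \<le> norm (\<Sum>i\<in>UNIV. (U i z)\<^sup>2)"
      by (intro AE_I2) (simp add: order_trans[OF _ abs_ge_self])
  qed measurable
  have D_int: "integrable (st T) (\<lambda>z. (D i j z)\<^sup>2)" for i j
  proof (rule Bochner_Integration.integrable_bound[OF D2 stm])
    have "(D i j z)\<^sup>2 \<le> (\<Sum>j\<in>UNIV. (D i j z)\<^sup>2)" for z by (rule member_le_sum) auto
    also have "(\<Sum>j\<in>UNIV. (D i j z)\<^sup>2) \<le> (\<Sum>i\<in>UNIV. \<Sum>j\<in>UNIV. (D i j z)\<^sup>2)" for z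
      by (rule member_le_sum) (auto intro: sum_nonneg)
    finally show "AE z in st T. norm ((D i j z)\<^sup>2) \<le> norm (\<Sum>i\<in>UNIV. \<Sum>j\<in>UNIV. (D i j z)\<^sup>2)"
      by (intro AE_I2) (simp add: order_trans[OF _ abs_ge_self])
  qed measurable
  obtain C where C: "AE t in lebesgue_on {0<..<T}. (\<integral>\<^sup>+x. ennreal (norm (u (x, t)) ^ 2) \<partial>lebesgue_on cell) \<le> ennreal C"
    using u_Linf_L2 unfolding Linf_L2_def by blast
  have U_Linf: "AE t in tm T. integral\<^sup>L torus (\<lambda>x. \<Sum>i\<in>UNIV. (U i (x, t))\<^sup>2) \<le> max C 0"
    using C[unfolded AE_lebesgue_on[OF borel_open[OF open_greaterThanLessThan]] tmT[symmetric]] sl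
  proof eventually_elim
    case (elim t)
    note [measurable] = slice_measurable[OF U(1)]
    have "(\<integral>\<^sup>+x. ennreal (norm (u (x, t)) ^ 2) \<partial>lebesgue_on cell) = (\<integral>\<^sup>+x. ennreal (\<Sum>i\<in>UNIV. (U i (x, t))\<^sup>2) \<partial>lb cell)"
    proof (rule nn_integral_lebesgue_on[OF cell_borel])
      show "AE x in lb cell. ennreal (norm (u (x, t)) ^ 2) = ennreal (\<Sum>i\<in>UNIV. (U i (x, t))\<^sup>2)"
        using elim(2) unfolding tor by eventually_elim (simp add: norm_vec_sq)
    qed measurable
    then have "(\<integral>\<^sup>+x. ennreal (\<Sum>i\<in>UNIV. (U i (x, t))\<^sup>2) \<partial>torus) \<le> ennreal (max C 0)"
      using elim(1) unfolding tor by (simp add: order_trans[OF _ ennreal_leI])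
    then show ?case by (intro integral_real_bounded) auto
  qed
  obtain p1 p2 where pd: "\<And>z. 0 < z \<Longrightarrow> (p has_real_derivative p1 z) (at z)"
    "\<And>z. 0 < z \<Longrightarrow> (p1 has_real_derivative p2 z) (at z)"
    using p_C2 unfolding C2_on_def by auto
  have p1_cont: "continuous_on {0<..} p1"
    using pd(2) by (auto intro!: continuous_at_imp_continuous_on DERIV_isCont)
  interpret F: flow_data T c1 c2 "max C 0" p p1 \<nu> \<mu> R U D
    by unfold_locales (use T_pos c12 pd p1_cont nu_cont mu_cont Rm U(1) D(1) U_int D_int U_Linf in \<open>auto simp: R_def\<close>)
  have test_meas: "\<phi> \<in> borel_measurable borel" "dt \<phi> \<in> borel_measurable borel" "dx j \<phi> \<in> borel_measurable borel"
    if "test_fun T \<phi>" for \<phi> :: "(real^'n) \<times> real \<Rightarrow> real" and j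
    using that smooth_fun_cont[of \<phi>] smooth_fun_partials[of \<phi>]
    by (auto simp: test_fun_def intro!: borel_measurable_continuous_onI)
  have sp_meas: "\<phi> \<in> borel_measurable borel" if "sp_test_fun \<phi>" for \<phi> :: "real^'n \<Rightarrow> real"
    using that smooth_fun_cont[of \<phi>] by (auto simp: sp_test_fun_def intro!: borel_measurable_continuous_onI)
  have sp_axis: "sp_vtest_fun (\<lambda>x. axis i (\<phi> x))" if "sp_test_fun \<phi>" for \<phi> :: "real^'n \<Rightarrow> real" and i
  proof -
    have "sp_test_fun (\<lambda>x. axis i (\<phi> x) $ k)" for k
    proof (cases "k = i")
      case False
      then have "(\<lambda>x. axis i (\<phi> x) $ k) = (\<lambda>x. 0)" by (auto simp: axis_def)
      moreover have "sp_test_fun (\<lambda>x :: real^'n. 0)"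
        unfolding sp_test_fun_def periodic_sp_def by (auto intro: smooth_fun_smooth smooth_intros(1))
      ultimately show ?thesis by simp
    qed (use that in \<open>simp add: axis_def\<close>)
    then show ?thesis unfolding sp_vtest_fun_def by blast
  qed
  have inner_axis': "v \<bullet> axis i a = v $ i * a" for v :: "real^'n" and i a
    by (simp add: inner_axis)
  have i0: "integrable (lebesgue_on cell) \<rho>0" "integrable (lebesgue_on cell) (\<lambda>x. \<rho>0 x *\<^sub>R u0 x)" using w by blast+
  obtain r where r: "r \<in> borel_measurable borel" "AE x in lb cell. \<rho>0 x = r x"
    by (rule borel_version[OF cell_borel borel_measurable_integrable[OF i0(1)]])
  obtain m where m: "\<And>i. m i \<in> borel_measurable borel" "AE x in lb cell. \<forall>i. (\<rho>0 x *\<^sub>R u0 x) $ i = m i x"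
    by (rule borel_version_vec[OF cell_borel borel_measurable_integrable[OF i0(2)]]) (rule that, auto)
  note [measurable] = r(1) m(1)
  have r_int: "integrable torus r" using lebesgue_on_transfer(2)[OF cell_borel r] i0(1) unfolding tor by simp
  have m_int: "integrable torus (m i)" for i
  proof -
    have i: "integrable (lebesgue_on cell) (\<lambda>x. (\<rho>0 x *\<^sub>R u0 x) $ i)"
      using integrable_bounded_linear[OF bounded_linear_vec_nth i0(2)] .
    have "AE x in lb cell. (\<rho>0 x *\<^sub>R u0 x) $ i = m i x" using m(2) by eventually_elim (rule spec)
    from lebesgue_on_transfer(2)[OF cell_borel m(1) this] i show ?thesis unfolding tor by (rule iffD1)
  qed
  \<comment> \<open>Kept in terms of the original \<open>\<rho>\<close>, since the initial condition
    is a limit over all times and not over almost all of them.\<close>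
  define A where "A \<phi> t = (LINT x|lebesgue_on cell. \<rho> (x, t) * \<phi> x)" for \<phi> t
  define Am where "Am i \<phi> t = (LINT x|lebesgue_on cell. \<rho> (x, t) * (u (x, t) \<bullet> axis i (\<phi> x)))" for i \<phi> t
  interpret B: borel_solution T c1 c2 "max C 0" p p1 \<nu> \<mu> R U D r m A Am
  proof unfold_locales
    show "integrable torus r" "integrable torus (m i)" for i by (fact r_int m_int)+
    show "CARD('n) = 2 \<or> integrable (st T) (\<lambda>z. (\<Sum>i\<in>UNIV. (U i z)\<^sup>2)\<^sup>2)"
    proof (cases "CARD('n) = 2")
      case False
      then have "integrable (lebesgue_on ?C) (\<lambda>z. norm (u z) ^ 4)" using dim d3 by blast
      moreover have "norm v ^ 4 = ((norm v)\<^sup>2)\<^sup>2" for v :: "real^'n" by (simp add: power_mult[symmetric])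
      ultimately show ?thesis
        using transfer(2)[of "\<lambda>z. (\<Sum>i\<in>UNIV. (U i z)\<^sup>2)\<^sup>2" "\<lambda>z. norm (u z) ^ 4"] by (simp add: norm_vec_sq)
    qed simp
    fix \<phi> :: "(real^'n) \<times> real \<Rightarrow> real" and i j assume \<phi>: "test_fun T \<phi>"
    note [measurable] = test_meas[OF \<phi>]
    have "(LINT z|lebesgue_on ?C. u z $ i * dx j \<phi> z) = - (LINT z|lebesgue_on ?C. Du z $ i $ j * \<phi> z)"
      using w \<phi> unfolding weak_grad_def by blast
    then show "(LINT z|st T. U i z * dx j \<phi> z) = - (LINT z|st T. D i j z * \<phi> z)"
      using transfer(1)[of "\<lambda>z. U i z * dx j \<phi> z" "\<lambda>z. u z $ i * dx j \<phi> z"]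
        transfer(1)[of "\<lambda>z. D i j z * \<phi> z" "\<lambda>z. Du z $ i $ j * \<phi> z"] by simp
    have "(LINT z|lebesgue_on ?C. \<rho> z * dt \<phi> z + \<rho> z * (u z \<bullet> grad \<phi> z)) = 0" using w \<phi> by blast
    moreover have "(LINT z|lebesgue_on ?C. \<rho> z * dt \<phi> z + \<rho> z * (u z \<bullet> grad \<phi> z))
      = (LINT z|st T. R z * dt \<phi> z + (\<Sum>j\<in>UNIV. (R z * U j z) * dx j \<phi> z))"
      by (rule transfer(1)) (measurable, simp add: inner_vec_def grad_def sum_distrib_left mult.assoc)
    ultimately show "(LINT z|st T. R z * dt \<phi> z + (\<Sum>j\<in>UNIV. (R z * U j z) * dx j \<phi> z)) = 0" by simp
    have v: "vtest_fun T (vtest i \<phi>)" by (rule vtest_test[OF T_pos \<phi>])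
    let ?f = "\<lambda>z. \<rho> z * (u z \<bullet> vdt (vtest i \<phi>) z) + \<rho> z * frob (tensor (u z) (u z)) (jac (vtest i \<phi>) z)
             + p (\<rho> z) * dvg (vtest i \<phi>) z - \<nu> (\<rho> z) * frob (sym_part (Du z)) (jac (vtest i \<phi>) z)
             - \<mu> (\<rho> z) * trace_m (Du z) * dvg (vtest i \<phi>) z"
    let ?g = "\<lambda>z. (R z * U i z) * dt \<phi> z + (\<Sum>j\<in>UNIV. (R z * (U i z * U j z) - stress \<nu> \<mu> p R D i j z) * dx j \<phi> z)"
    have "integral\<^sup>L (lebesgue_on ?C) ?f = 0" using w v by blast
    moreover have "integral\<^sup>L (lebesgue_on ?C) ?f = integral\<^sup>L (st T) ?g"
    \<comment> \<open>With a test field along axis \<open>i\<close> the integrand collapses to row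
      \<open>i\<close> of the tensors; divergence and pressure survive only for
      \<open>j = i\<close>.\<close>
    proof (rule transfer(1))
      fix z assume e: "\<rho> z = R z" "\<And>i. u z $ i = U i z" "\<And>i j. Du z $ i $ j = D i j z"
      have "(\<Sum>j\<in>UNIV. stress \<nu> \<mu> p R D i j z * dx j \<phi> z) = (\<Sum>j\<in>UNIV. \<nu> (R z) * ((D i j z + D j i z) / 2) * dx j \<phi> z
          + (if i = j then (\<mu> (R z) * (\<Sum>k\<in>UNIV. D k k z) - p (R z)) * dx j \<phi> z else 0))"
        by (intro sum.cong refl) (simp add: stress_def distrib_right)
      also have "\<dots> = \<nu> (R z) * (\<Sum>j\<in>UNIV. (D i j z + D j i z) / 2 * dx j \<phi> z) + (\<mu> (R z) * (\<Sum>k\<in>UNIV. D k k z) - p (R z)) * dx i \<phi> z"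
        by (simp add: sum.distrib sum_distrib_left mult.assoc)
      finally have s: "(\<Sum>j\<in>UNIV. stress \<nu> \<mu> p R D i j z * dx j \<phi> z) = \<dots>" .
      have "?g z = R z * U i z * dt \<phi> z + R z * (\<Sum>j\<in>UNIV. U i z * U j z * dx j \<phi> z)
          - (\<Sum>j\<in>UNIV. stress \<nu> \<mu> p R D i j z * dx j \<phi> z)"
        by (simp add: left_diff_distrib sum_subtractf sum_distrib_left mult.assoc)
      moreover have "?f z = R z * U i z * dt \<phi> z + R z * (\<Sum>j\<in>UNIV. U i z * U j z * dx j \<phi> z) + p (R z) * dx i \<phi> z
          - \<nu> (R z) * (\<Sum>j\<in>UNIV. (D i j z + D j i z) / 2 * dx j \<phi> z) - \<mu> (R z) * (\<Sum>k\<in>UNIV. D k k z) * dx i \<phi> z"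
        unfolding vtest_derivs by (simp add: e tensor_def sym_part_def transpose_def trace_m_def)
      ultimately show "?f z = ?g z" unfolding s by (simp add: left_diff_distrib)
    qed measurable
    ultimately show "integral\<^sup>L (st T) ?g = 0" by simp
  next
    show "AE t in tm T. \<forall>\<phi>. sp_test_fun \<phi> \<longrightarrow> A \<phi> t = (LINT x|torus. R (x, t) * \<phi> x)"
      using transfer_slice
    proof eventually_elim
      case (elim t)
      show ?case
      proof (intro allI impI)
        fix \<phi> :: "real^'n \<Rightarrow> real" assume \<phi>: "sp_test_fun \<phi>"
        show "A \<phi> t = (LINT x|torus. R (x, t) * \<phi> x)"
          unfolding A_def by (rule elim[rule_format, OF borel_measurable_times[OF slice_measurable[OF Rm] sp_meas[OF \<phi>]]]) simp
      qed
    qed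
    show "AE t in tm T. \<forall>\<phi>. sp_test_fun \<phi> \<longrightarrow> Am i \<phi> t = (LINT x|torus. (R (x, t) * U i (x, t)) * \<phi> x)" for i
      using transfer_slice
    proof eventually_elim
      case (elim t)
      show ?case
      proof (intro allI impI)
        fix \<phi> :: "real^'n \<Rightarrow> real" assume \<phi>: "sp_test_fun \<phi>"
        note meas = borel_measurable_times[OF slice_measurable[OF Rm] slice_measurable[OF U(1)]]
        show "Am i \<phi> t = (LINT x|torus. (R (x, t) * U i (x, t)) * \<phi> x)"
          unfolding Am_def inner_axis' by (rule elim[rule_format, OF borel_measurable_times[OF meas sp_meas[OF \<phi>]]]) simp
      qed
    qed
    fix \<phi> :: "real^'n \<Rightarrow> real" assume \<phi>: "sp_test_fun \<phi>"
    note [measurable] = sp_meas[OF \<phi>]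
    have "(LINT x|lebesgue_on cell. \<rho>0 x * \<phi> x) = (LINT x|torus. r x * \<phi> x)"
      unfolding tor
    proof (rule lebesgue_on_transfer(1)[OF cell_borel])
      show "AE x in lb cell. \<rho>0 x * \<phi> x = r x * \<phi> x" using r(2) by eventually_elim simp
    qed measurable
    moreover have "(A \<phi> \<longlongrightarrow> (LINT x|lebesgue_on cell. \<rho>0 x * \<phi> x)) (at_right 0)"
      unfolding A_def[abs_def] using w \<phi> by blast
    ultimately show "(A \<phi> \<longlongrightarrow> (LINT x|torus. r x * \<phi> x)) (at_right 0)" by simp
    fix i
    have "(LINT x|lebesgue_on cell. \<rho>0 x * (u0 x \<bullet> axis i (\<phi> x))) = (LINT x|torus. m i x * \<phi> x)"
      unfolding tor inner_axis'
    proof (rule lebesgue_on_transfer(1)[OF cell_borel])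
      show "AE x in lb cell. \<rho>0 x * (u0 x $ i * \<phi> x) = m i x * \<phi> x"
        using m(2) by eventually_elim (metis mult.assoc vector_scaleR_component real_scaleR_def)
    qed measurable
    moreover have "(Am i \<phi> \<longlongrightarrow> (LINT x|lebesgue_on cell. \<rho>0 x * (u0 x \<bullet> axis i (\<phi> x)))) (at_right 0)"
      unfolding Am_def[abs_def] using w sp_axis[OF \<phi>, of i] by blast
    ultimately show "(Am i \<phi> \<longlongrightarrow> (LINT x|torus. m i x * \<phi> x)) (at_right 0)" by simp
  qed
  have Pc: "continuous_on {0<..} (Ppot p)"
    using Ppot_deriv[OF F.p_cont] by (auto intro!: continuous_at_imp_continuous_on DERIV_isCont)
  \<comment> \<open>Almost everywhere the clamp is inactive and
    \<open>m i x = r x * u0 x $ i\<close> with \<open>r x\<close> nonzero, so the quotient form of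
    the kinetic energy is the usual one.\<close>
  have initial: "(LINT x|lebesgue_on cell. (1/2) * \<rho>0 x * (norm (u0 x))^2 + Ppot p (\<rho>0 x))
     = (LINT x|torus. (\<Sum>i\<in>UNIV. (m i x / max c1 (min c2 (r x))) * m i x) / 2 + Ppot p (max c1 (min c2 (r x))))"
    unfolding tor
  proof (rule lebesgue_on_transfer(1)[OF cell_borel])
    have [measurable]: "(\<lambda>x. Ppot p (max c1 (min c2 (r x)))) \<in> borel_measurable borel"
      by (rule measurable_compose[OF r(1) borel_measurable_continuous_onI[OF continuous_clamp[OF Pc c12(1)]]])
    show "(\<lambda>x. (\<Sum>i\<in>UNIV. (m i x / max c1 (min c2 (r x))) * m i x) / 2 + Ppot p (max c1 (min c2 (r x)))) \<in> borel_measurable borel"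
      by measurable
    show "AE x in lb cell. (1/2) * \<rho>0 x * (norm (u0 x))^2 + Ppot p (\<rho>0 x)
      = (\<Sum>i\<in>UNIV. (m i x / max c1 (min c2 (r x))) * m i x) / 2 + Ppot p (max c1 (min c2 (r x)))"
      using r(2) m(2) B.r_bounds[unfolded tor]
    proof eventually_elim
      case (elim x)
      then have "m i x = r x * u0 x $ i" for i by (metis vector_scaleR_component real_scaleR_def)
      moreover have "max c1 (min c2 (r x)) = r x" "r x \<noteq> 0" using elim c12 by auto
      ultimately show ?case using elim(1) unfolding norm_vec_sq
        by (simp add: sum_distrib_left power2_eq_square mult_ac)
    qed
  qed
  let ?g1 = "\<lambda>z. \<nu> (R z) * (\<Sum>i\<in>UNIV. \<Sum>j\<in>UNIV. ((D i j z + D j i z) / 2)\<^sup>2)"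
  let ?g2 = "\<lambda>z. \<mu> (R z) * (\<Sum>k\<in>UNIV. D k k z)\<^sup>2"
  have gm: "?g1 \<in> borel_measurable borel" "?g2 \<in> borel_measurable borel"
    using F.coeff_R(1)[OF nu_cont] F.coeff_R(1)[OF mu_cont] by measurable
  have gi: "integrable (st T) ?g1" "integrable (st T) ?g2"
  proof -
    obtain B1 where B1: "\<And>z. \<bar>\<nu> (R z)\<bar> \<le> B1" using F.coeff_R(2)[OF nu_cont] by blast
    obtain B2 where B2: "\<And>z. \<bar>\<mu> (R z)\<bar> \<le> B2" using F.coeff_R(2)[OF mu_cont] by blast
    have s: "F.sqint (\<lambda>z. (1/2) * (D i j z + D j i z))" for i j
      by (rule F.sqint_bounded_mult[OF F.sqint_add[OF F.sqint_D F.sqint_D], where B = "1/2"]) auto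
    have "integrable (st T) (\<lambda>z. \<Sum>i\<in>UNIV. \<Sum>j\<in>UNIV. ((D i j z + D j i z) / 2)\<^sup>2)"
      using s by (intro Bochner_Integration.integrable_sum) (simp add: F.sqint_def)
    then show "integrable (st T) ?g1" by (rule st_mult_bounded[OF _ F.coeff_R(1)[OF nu_cont] B1])
    have "integrable (st T) (\<lambda>z. (\<Sum>k\<in>UNIV. D k k z)\<^sup>2)"
      using F.sqint_sum[of UNIV "\<lambda>k. D k k"] F.sqint_D by (simp add: F.sqint_def)
    then show "integrable (st T) ?g2" by (rule st_mult_bounded[OF _ F.coeff_R(1)[OF mu_cont] B2])
  qed
  have "AE t in tm T. t \<in> {0<..<T}" by (simp add: AE_tm)
  then have "AE t in tm T.
           integral\<^sup>L (lebesgue_on cell)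
              (\<lambda>x. (1/2) * \<rho> (x, t) * (norm (u (x, t)))^2 + Ppot p (\<rho> (x, t)))
         + integral\<^sup>L (lebesgue_on (cyl 0 t)) (\<lambda>z. \<nu> (\<rho> z) * frob (sym_part (Du z)) (sym_part (Du z)))
         + integral\<^sup>L (lebesgue_on (cyl 0 t)) (\<lambda>z. \<mu> (\<rho> z) * (trace_m (Du z))^2)
         = (LINT x|lebesgue_on cell. (1/2) * \<rho>0 x * (norm (u0 x))^2 + Ppot p (\<rho>0 x))"
    using transfer_slice B.energy_equality
  proof eventually_elim
    case (elim t)
    let ?I = "\<lambda>z :: (real^'n) \<times> real. indicat_real {..<t} (snd z)"
    have E: "(LINT x|lebesgue_on cell. (1/2) * \<rho> (x, t) * (norm (u (x, t)))^2 + Ppot p (\<rho> (x, t)))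
       = (LINT x|torus. (\<Sum>i\<in>UNIV. U i (x, t) * (R (x, t) * U i (x, t))) / 2 + Ppot p (R (x, t)))"
    proof (rule elim(2)[rule_format])
      show "(\<lambda>x. (\<Sum>i\<in>UNIV. U i (x, t) * (R (x, t) * U i (x, t))) / 2 + Ppot p (R (x, t))) \<in> borel_measurable borel"
        by (intro borel_measurable_add borel_measurable_divide borel_measurable_sum borel_measurable_times borel_measurable_const
            slice_measurable[OF Rm] slice_measurable[OF U(1)] slice_measurable[OF F.coeff_R(1)[OF Pc]])
      fix x assume "\<rho> (x, t) = R (x, t)" "\<And>i. u (x, t) $ i = U i (x, t)"
      then show "(1/2) * \<rho> (x, t) * (norm (u (x, t)))^2 + Ppot p (\<rho> (x, t))
        = (\<Sum>i\<in>UNIV. U i (x, t) * (R (x, t) * U i (x, t))) / 2 + Ppot p (R (x, t))"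
        unfolding norm_vec_sq by (simp add: sum_distrib_left power2_eq_square mult_ac)
    qed
    \<comment> \<open>The cylinder up to \<open>t\<close> is expressed through an indicator on the
      full one, the form in which the time integrals were carried to the limit.\<close>
    have tr: "integral\<^sup>L (lebesgue_on (cyl 0 t)) f = (LINT z|st T. ?I z * g z)"
      if g: "g \<in> borel_measurable borel"
        and fg: "\<And>z. \<rho> z = R z \<Longrightarrow> (\<And>i j. Du z $ i $ j = D i j z) \<Longrightarrow> f z = g z" for f g :: "(real^'n) \<times> real \<Rightarrow> real"
    proof -
      have sub: "cyl 0 t \<subseteq> ?C" using elim(1) by (auto simp: cyl_def)
      have "AE z in lb (cyl 0 t). f z = g z"
        using ae unfolding st_density AE_lb[OF cyl_borel]
        by eventually_elim (use sub fg in blast)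
      from lebesgue_on_transfer(1)[OF cyl_borel g this] show ?thesis
        unfolding st_density using integral_lb_subset[OF g, of t T] elim(1) by simp
    qed
    have 1: "integral\<^sup>L (lebesgue_on (cyl 0 t)) (\<lambda>z. \<nu> (\<rho> z) * frob (sym_part (Du z)) (sym_part (Du z)))
      = (LINT z|st T. ?I z * ?g1 z)"
      by (rule tr[OF gm(1)]) (simp add: frob_def sym_part_def transpose_def power2_eq_square)
    have 2: "integral\<^sup>L (lebesgue_on (cyl 0 t)) (\<lambda>z. \<mu> (\<rho> z) * (trace_m (Du z))^2) = (LINT z|st T. ?I z * ?g2 z)"
      by (rule tr[OF gm(2)]) (simp add: trace_m_def)
    have Im: "?I \<in> borel_measurable borel"
    proof -
      have "(snd :: (real^'n) \<times> real \<Rightarrow> real) \<in> borel_measurable borel"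
        by (intro borel_measurable_continuous_onI continuous_intros)
      then show ?thesis using measurable_compose[of snd borel borel "indicat_real {..<t}" borel] by simp
    qed
    have "(LINT z|st T. ?I z * (?g1 z + ?g2 z)) = (LINT z|st T. ?I z * ?g1 z + ?I z * ?g2 z)"
      by (simp add: distrib_left)
    also have "\<dots> = (LINT z|st T. ?I z * ?g1 z) + (LINT z|st T. ?I z * ?g2 z)"
      by (intro Bochner_Integration.integral_add st_mult_bounded[OF gi(1) Im, where B = 1] st_mult_bounded[OF gi(2) Im, where B = 1])
         (auto simp: indicator_def)
    finally show ?case using elim(3) unfolding E 1 2 initial by simp
  qed
  then show ?thesis unfolding AE_lebesgue_on[OF borel_open[OF open_greaterThanLessThan]] tmT .
qed

end
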